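(* Let $D\subset\mathbb R^d$ be a bounded open set, $0<\alpha\le\beta$, and let $A_k$, $B^j_k$ ($j,k\in\mathbb N$) be in $\mathcal M^{\rm sym}_{\alpha,\beta}(D)$. Assume that for almost all $x\in D$ $$\lim_{j\to+\infty}\limsup_{\rho\to0}\limsup_{k\to+\infty}\frac1{\rho^d}\int_{B_\rho(x)}|A_k(y)-B^j_k(y)|\,dy=0.$$ If for every $j$ the sequence $B^j_k$ $G$-converges (as $k\to+\infty$) to $B^j_\infty$, then the pointwise limit $B_\infty$ of $B^j_\infty$ as $j\to+\infty$ exists and $A_k$ $G$-converges to $B_\infty$.
   Context: $\mathcal M^{\rm sym}_{\alpha,\beta}(D)$ is the family of measurable $A:D\to\mathbb M^{d\times d}_{\rm sym}$ (symmetric $d\times d$ matrices) with $\alpha|\xi|^2\le\langle A(x)\xi,\xi\rangle\le\beta|\xi|^2$ for a.e. $x\in D$ and all $\xi\in\mathbb R^d$. For $A_k,A\in\mathcal M^{\rm sym}_{\alpha,\beta}(D)$, $A_k$ $G$-converges to $A$ if for every $\phi\in H^{-1}(D)$ the solutions $u_k\in H^1_0(D)$ of $-{\rm div}(A_k\nabla u_k)=\phi$ converge weakly in $H^1_0(D)$ to the solution $u\in H^1_0(D)$ of $-{\rm div}(A\nabla u)=\phi$. $|\cdot|$ is a norm on matrices; $B_\rho(x)$ is the open ball of radius $\rho$ centred at $x$. *)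

theory Defs
  imports "HOL-Analysis.Analysis" "HOL-Library.Liminf_Limsup"
begin

definition Msym :: "real \<Rightarrow> real \<Rightarrow> (real^'n) set \<Rightarrow> (real^'n \<Rightarrow> real^'n^'n) set" where
  "Msym \<alpha> \<beta> D = {A. set_borel_measurable lebesgue D A
      \<and> (\<forall>x\<in>D. transpose (A x) = A x)
      \<and> (AE x\<in>D in lebesgue. \<forall>\<xi>::real^'n.
            \<alpha> * (norm \<xi>)\<^sup>2 \<le> (A x *v \<xi>) \<bullet> \<xi> \<and> (A x *v \<xi>) \<bullet> \<xi> \<le> \<beta> * (norm \<xi>)\<^sup>2)}"

coinductive smooth_fun :: "(real^'n \<Rightarrow> real) \<Rightarrow> bool" where
  "f differentiable_on UNIV \<Longrightarrow>
   (\<forall>i. smooth_fun (\<lambda>x. frechet_derivative f (at x) (axis i 1))) \<Longrightarrow> smooth_fun f"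

definition grad :: "(real^'n \<Rightarrow> real) \<Rightarrow> real^'n \<Rightarrow> real^'n" where
  "grad f x = (\<chi> i. frechet_derivative f (at x) (axis i 1))"

definition Cc_inf :: "(real^'n) set \<Rightarrow> (real^'n \<Rightarrow> real) \<Rightarrow> bool" where
  "Cc_inf D f \<longleftrightarrow> smooth_fun f \<and> compact (closure {x. f x \<noteq> 0})
      \<and> closure {x. f x \<noteq> 0} \<subseteq> D"

text \<open>u belongs to H^1_0(D) (closure of C_c^infinity(D) in the H^1(D) norm),
  with (weak) gradient g.\<close>
definition H10_grad :: "(real^'n) set \<Rightarrow> (real^'n \<Rightarrow> real) \<Rightarrow> (real^'n \<Rightarrow> real^'n) \<Rightarrow> bool" where
  "H10_grad D u g \<longleftrightarrow> set_borel_measurable lebesgue D u \<and> set_borel_measurable lebesgue D g \<and>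
     (\<exists>\<phi>. (\<forall>k. Cc_inf D (\<phi> k))
        \<and> (\<lambda>k. \<integral>\<^sup>+x\<in>D. ennreal ((\<phi> k x - u x)\<^sup>2) \<partial>lebesgue) \<longlonglongrightarrow> 0
        \<and> (\<lambda>k. \<integral>\<^sup>+x\<in>D. ennreal ((norm (grad (\<phi> k) x - g x))\<^sup>2) \<partial>lebesgue) \<longlonglongrightarrow> 0)"

definition H10 :: "(real^'n) set \<Rightarrow> (real^'n \<Rightarrow> real) set" where
  "H10 D = {u. \<exists>g. H10_grad D u g}"

definition Hminus1 :: "(real^'n) set \<Rightarrow> ((real^'n \<Rightarrow> real) \<Rightarrow> real) set" where
  "Hminus1 D = {F.
     (\<forall>v w a b. v \<in> H10 D \<longrightarrow> w \<in> H10 D \<longrightarrow>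
         F (\<lambda>x. a * v x + b * w x) = a * F v + b * F w)
     \<and> (\<exists>C. \<forall>v g. H10_grad D v g \<longrightarrow>
         \<bar>F v\<bar> \<le> C * sqrt ((\<integral>x\<in>D. (v x)\<^sup>2 \<partial>lebesgue) + (\<integral>x\<in>D. (norm (g x))\<^sup>2 \<partial>lebesgue)))}"

text \<open>u in H^1_0(D) is the (variational) solution of -div(A grad u) = F.\<close>
definition is_sol :: "(real^'n) set \<Rightarrow> (real^'n \<Rightarrow> real^'n^'n) \<Rightarrow> ((real^'n \<Rightarrow> real) \<Rightarrow> real)
    \<Rightarrow> (real^'n \<Rightarrow> real) \<Rightarrow> bool" where
  "is_sol D A F u \<longleftrightarrow> (\<exists>g. H10_grad D u g \<and>
     (\<forall>v h. H10_grad D v h \<longrightarrow> (\<integral>x\<in>D. (A x *v g x) \<bullet> h x \<partial>lebesgue) = F v))"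

definition weak_conv_H10 :: "(real^'n) set \<Rightarrow> (nat \<Rightarrow> real^'n \<Rightarrow> real) \<Rightarrow> (real^'n \<Rightarrow> real) \<Rightarrow> bool" where
  "weak_conv_H10 D us u \<longleftrightarrow> (\<forall>k. us k \<in> H10 D) \<and> u \<in> H10 D \<and>
     (\<forall>F\<in>Hminus1 D. (\<lambda>k. F (us k)) \<longlonglongrightarrow> F u)"

definition G_conv :: "real \<Rightarrow> real \<Rightarrow> (real^'n) set \<Rightarrow> (nat \<Rightarrow> real^'n \<Rightarrow> real^'n^'n)
    \<Rightarrow> (real^'n \<Rightarrow> real^'n^'n) \<Rightarrow> bool" where
  "G_conv \<alpha> \<beta> D A A0 \<longleftrightarrow> (\<forall>k. A k \<in> Msym \<alpha> \<beta> D) \<and> A0 \<in> Msym \<alpha> \<beta> D \<and>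
     (\<forall>F\<in>Hminus1 D. \<forall>us u. (\<forall>k. is_sol D (A k) F (us k)) \<longrightarrow> is_sol D A0 F u \<longrightarrow>
        weak_conv_H10 D us u)"

end

theory Submission
  imports Defs
begin

text \<open>The coefficients are compared through Tartar's correctors: solutions of the equation for \<open>B k\<close> that converge weakly
  to a given smooth function. By the div-curl argument, if \<open>g k\<close> and \<open>g' k\<close> are corrector gradients for \<open>B k\<close> and \<open>B' k\<close>
  with limits equal to the constants a and b on a ball, then the integrals of \<open>\<psi> (B' k - B k) g k \<bullet> g' k\<close> converge to
  the integral of \<open>\<psi> (B0' - B0) a \<bullet> b\<close>. The inequalities of Caccioppoli and Poincare and Gehring's lemma make \<open>\<bar>g k\<bar>\<^sup>2\<close>
  equiintegrable, uniformly in the coefficients. As these are bounded, smallness of \<open>B' k - B k\<close> in mean on small balls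
  bounds the averages of \<open>B0' - B0\<close>, and differentiation of integrals shows that the G-limits form a Cauchy sequence
  almost everywhere. Averaging the hypothesis over the centre of the ball and applying Fatou's lemma, one
  gets smallness of \<open>A k - B j k\<close> in mean on compact sets; testing the equation for \<open>A k\<close> with the correctors of
  \<open>B j k\<close> and using equiintegrability once more identifies the limit of the solutions.\<close>

text \<open>The obstacle is a mismatch of norms: the hypothesis measures \<open>A k - B j k\<close>
  in L1, but in the energies this difference multiplies a product of two gradients that are bounded
  only in L2 and could concentrate exactly where the difference is large. A modulus of
  equiintegrability depending only on \<alpha>, \<beta> and the dimension resolves this. It is an
  interior estimate, so the strip near the boundary is treated by convergence of energies. A second
  gap is that G-convergence as defined speaks of solutions and not of fluxes; the convergence of
  fluxes is recovered from the symmetry of the matrices, which also gives existence by minimisation.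
  Thirdly, the radius from which the hypothesis takes effect depends on the point and on j, so it
  can be integrated only after passing to upper limits pointwise; averaging over centres keeps the
  integral of a nonnegative function, which makes this possible. The limit of the solutions is
  identified by duality, through a problem for the limit coefficient, without extracting
  subsequences.\<close>

abbreviation ind :: "'a set \<Rightarrow> 'a \<Rightarrow> 'b::zero_neq_one" where
  "ind \<equiv> indicator"

abbreviation res :: "'a set \<Rightarrow> ('a \<Rightarrow> 'b::real_vector) \<Rightarrow> 'a \<Rightarrow> 'b" where
  "res S f \<equiv> \<lambda>x. ind S x *\<^sub>R f x"

abbreviation LM :: "('a::euclidean_space \<Rightarrow> 'b::topological_space) set" where
  "LM \<equiv> borel_measurable lebesgue"

section \<open>Square-integrable fields\<close>

definition L2 :: "('a::euclidean_space \<Rightarrow> 'b::euclidean_space) \<Rightarrow> bool" where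
  "L2 f \<longleftrightarrow> f \<in> LM \<and> integrable lebesgue (\<lambda>x. (norm (f x))\<^sup>2)"

definition nrm2 :: "('a::euclidean_space \<Rightarrow> 'b::euclidean_space) \<Rightarrow> real" where
  "nrm2 f = sqrt (LINT x|lebesgue. (norm (f x))\<^sup>2)"

lemma L2_meas[measurable_dest]: "L2 f \<Longrightarrow> f \<in> LM"
  by (simp add: L2_def)

lemma L2_int: "L2 f \<Longrightarrow> integrable lebesgue (\<lambda>x. (norm (f x))\<^sup>2)"
  by (simp add: L2_def)

lemma nrm2_nonneg[simp]: "0 \<le> nrm2 f"
  by (simp add: nrm2_def)

lemma nrm2_sq: "(nrm2 f)\<^sup>2 = (LINT x|lebesgue. (norm (f x))\<^sup>2)"
  by (simp add: nrm2_def)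

lemma L2_bound:
  assumes "f \<in> LM" "integrable lebesgue w" "AE x in lebesgue. (norm (f x))\<^sup>2 \<le> w x"
  shows "L2 f"
  unfolding L2_def
proof
  show "integrable lebesgue (\<lambda>x. (norm (f x))\<^sup>2)"
  proof (rule Bochner_Integration.integrable_bound[OF assms(2)])
    show "AE x in lebesgue. norm ((norm (f x))\<^sup>2) \<le> norm (w x)"
      using assms(3) by eventually_elim auto
  qed (use assms(1) in measurable)
qed fact

lemma L2_zero[simp]: "L2 (\<lambda>x. 0)"
  by (simp add: L2_def)

lemma nrm2_zero[simp]: "nrm2 (\<lambda>x. 0) = 0"
  by (simp add: nrm2_def)

lemma norm_add_sq_le: "(norm (a + b :: 'a::real_normed_vector))\<^sup>2 \<le> 2 * (norm a)\<^sup>2 + 2 * (norm b)\<^sup>2"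
proof -
  have "(norm (a + b))\<^sup>2 \<le> (norm a + norm b)\<^sup>2"
    by (intro power_mono norm_triangle_ineq) auto
  also have "\<dots> \<le> 2 * (norm a)\<^sup>2 + 2 * (norm b)\<^sup>2"
    using sum_squares_bound[of "norm a" "norm b"] by (simp add: power2_sum)
  finally show ?thesis .
qed

lemma L2_add: assumes "L2 f" "L2 g" shows "L2 (\<lambda>x. f x + g x)"
proof (rule L2_bound)
  show "integrable lebesgue (\<lambda>x. 2 * (norm (f x))\<^sup>2 + 2 * (norm (g x))\<^sup>2)"
    using assms by (auto simp: L2_def)
  show "(\<lambda>x. f x + g x) \<in> LM"
    using assms by (auto simp: L2_def)
qed (auto intro!: AE_I2 norm_add_sq_le)

lemma nrm2_cong_AE:
  assumes "f \<in> LM" "g \<in> LM" "AE x in lebesgue. f x = g x"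
  shows "nrm2 f = nrm2 g"
  unfolding nrm2_def
proof (intro arg_cong[where f=sqrt] integral_cong_AE)
  show "AE x in lebesgue. (norm (f x))\<^sup>2 = (norm (g x))\<^sup>2"
    using assms(3) by eventually_elim auto
qed (use assms(1,2) in measurable)

lemma L2_mono:
  assumes "f \<in> LM" "L2 g" "0 \<le> c" "AE x in lebesgue. norm (f x) \<le> c * norm (g x)"
  shows "L2 f" "nrm2 f \<le> c * nrm2 g"
proof -
  have 1: "AE x in lebesgue. (norm (f x))\<^sup>2 \<le> c\<^sup>2 * (norm (g x))\<^sup>2"
    using assms(4) by eventually_elim (metis norm_ge_zero power_mono power_mult_distrib)
  show f: "L2 f"
    by (rule L2_bound[OF assms(1) _ 1]) (use assms in \<open>auto simp: L2_def\<close>)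
  have "(LINT x|lebesgue. (norm (f x))\<^sup>2) \<le> (LINT x|lebesgue. c\<^sup>2 * (norm (g x))\<^sup>2)"
    by (intro integral_mono_AE 1) (use f assms in \<open>auto simp: L2_def\<close>)
  then have "nrm2 f \<le> sqrt (c\<^sup>2 * (LINT x|lebesgue. (norm (g x))\<^sup>2))"
    unfolding nrm2_def by (intro real_sqrt_le_mono) simp
  then show "nrm2 f \<le> c * nrm2 g"
    using assms(3) by (simp add: nrm2_def real_sqrt_mult)
qed

lemma L2_scaleR: assumes "L2 f" shows "L2 (\<lambda>x. c *\<^sub>R f x)"
  by (rule L2_mono(1)[of _ f "\<bar>c\<bar>"]) (use assms in \<open>auto simp: L2_def\<close>)

lemma nrm2_scaleR: "nrm2 (\<lambda>x. c *\<^sub>R f x) = \<bar>c\<bar> * nrm2 f"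
  by (simp add: nrm2_def power_mult_distrib real_sqrt_mult)

lemma L2_minus: "L2 f \<Longrightarrow> L2 (\<lambda>x. - f x)"
  using L2_scaleR[of f "-1"] by simp

lemma L2_diff: assumes "L2 f" "L2 g" shows "L2 (\<lambda>x. f x - g x)"
  using L2_add[OF assms(1) L2_minus[OF assms(2)]] by simp

lemma L2_mult: assumes "L2 f" shows "L2 (\<lambda>x. c * f x :: real)"
  using L2_scaleR[OF assms, of c] by simp

lemma nrm2_minus: "nrm2 (\<lambda>x. - f x) = nrm2 f"
  by (simp add: nrm2_def)

lemma nrm2_commute: "nrm2 (\<lambda>x. f x - g x) = nrm2 (\<lambda>x. g x - f x)"
  by (simp add: nrm2_def norm_minus_commute)

lemma L2_norm: "L2 f \<Longrightarrow> L2 (\<lambda>x. norm (f x))"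
  by (auto simp: L2_def)

lemma L2_mult_integrable: assumes "L2 f" "L2 g" shows "integrable lebesgue (\<lambda>x. norm (f x) * norm (g x))"
proof (rule Bochner_Integration.integrable_bound)
  show "integrable lebesgue (\<lambda>x. (norm (f x))\<^sup>2 + (norm (g x))\<^sup>2)"
    using assms by (auto simp: L2_def)
  have "norm (f x) * norm (g x) \<le> (norm (f x))\<^sup>2 + (norm (g x))\<^sup>2" for x
    using sum_squares_bound[of "norm (f x)" "norm (g x)"] mult_nonneg_nonneg[OF norm_ge_zero norm_ge_zero, of "f x" "g x"]
    by linarith
  then show "AE x in lebesgue. norm (norm (f x) * norm (g x)) \<le> norm ((norm (f x))\<^sup>2 + (norm (g x))\<^sup>2)"
    by (auto intro!: AE_I2 simp: abs_mult)
  show "(\<lambda>x. norm (f x) * norm (g x)) \<in> LM"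
    using assms by (auto simp: L2_def)
qed

text \<open>Young's inequality with weights \<open>A\<close> and \<open>B\<close> strictly above the
  two norms, which are then lowered to the norms; this avoids dividing by a norm that may
  vanish.\<close>

lemma CS_norm: assumes "L2 f" "L2 g"
  shows "(LINT x|lebesgue. norm (f x) * norm (g x)) \<le> nrm2 f * nrm2 g"
proof -
  let ?c = "LINT x|lebesgue. norm (f x) * norm (g x)"
  have key: "?c \<le> A * B" if A: "A > nrm2 f" and B: "B > nrm2 g" for A B
  proof -
    have A0: "A > 0" and B0: "B > 0" using A B nrm2_nonneg[of f] nrm2_nonneg[of g] by linarith+
    have pt: "norm (f x) * norm (g x) \<le> (B / A * (norm (f x))\<^sup>2 + A / B * (norm (g x))\<^sup>2) / 2" for x
    proof -
      have "0 \<le> (B * norm (f x) - A * norm (g x))\<^sup>2 / (A * B)" using A0 B0 by simp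
      also have "\<dots> = B / A * (norm (f x))\<^sup>2 + A / B * (norm (g x))\<^sup>2 - 2 * (norm (f x) * norm (g x))"
        using A0 B0 by (simp add: field_simps power2_eq_square)
      finally show ?thesis by simp
    qed
    have "?c \<le> (LINT x|lebesgue. (B / A * (norm (f x))\<^sup>2 + A / B * (norm (g x))\<^sup>2) / 2)"
      by (intro integral_mono pt L2_mult_integrable) (use assms in \<open>auto simp: L2_def\<close>)
    also have "\<dots> = (B / A * (nrm2 f)\<^sup>2 + A / B * (nrm2 g)\<^sup>2) / 2"
      using assms by (simp add: nrm2_sq L2_def)
    also have "\<dots> \<le> (B / A * A\<^sup>2 + A / B * B\<^sup>2) / 2"
      using A B A0 B0 by (intro divide_right_mono add_mono mult_left_mono power_mono) auto
    also have "\<dots> = A * B" using A0 B0 by (simp add: field_simps power2_eq_square)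
    finally show ?thesis .
  qed
  have lim: "((\<lambda>e. (nrm2 f + e) * (nrm2 g + e)) \<longlongrightarrow> (nrm2 f + 0) * (nrm2 g + 0)) (at_right 0)"
    by (intro tendsto_intros)
  have "?c \<le> (nrm2 f + 0) * (nrm2 g + 0)"
    by (rule tendsto_lowerbound[OF lim]) (auto intro!: eventually_at_right_less[THEN eventually_mono] key)
  then show ?thesis by simp
qed

lemma L2_inner_integrable: assumes "L2 f" "L2 g" shows "integrable lebesgue (\<lambda>x. f x \<bullet> g x)"
  by (rule Bochner_Integration.integrable_bound[OF L2_mult_integrable[OF assms]])
    (use assms in \<open>auto simp: L2_def abs_mult Cauchy_Schwarz_ineq2\<close>)

lemma L2_mult_integrable_real: assumes "L2 f" "L2 g" shows "integrable lebesgue (\<lambda>x. f x * g x :: real)"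
  using L2_inner_integrable[OF assms] by (simp add: mult.commute)

lemma CS_inner: assumes "L2 f" "L2 g" shows "\<bar>LINT x|lebesgue. f x \<bullet> g x\<bar> \<le> nrm2 f * nrm2 g"
proof -
  have "\<bar>LINT x|lebesgue. f x \<bullet> g x\<bar> \<le> (LINT x|lebesgue. \<bar>f x \<bullet> g x\<bar>)"
    by (rule integral_abs_bound)
  also have "\<dots> \<le> (LINT x|lebesgue. norm (f x) * norm (g x))"
    by (intro integral_mono L2_mult_integrable integrable_abs L2_inner_integrable assms Cauchy_Schwarz_ineq2)
  finally show ?thesis using CS_norm[OF assms] by linarith
qed

lemma nrm2_triangle: assumes "L2 f" "L2 g" shows "nrm2 (\<lambda>x. f x + g x) \<le> nrm2 f + nrm2 g"
proof -
  have "(nrm2 (\<lambda>x. f x + g x))\<^sup>2 = (LINT x|lebesgue. (norm (f x))\<^sup>2 + (norm (g x))\<^sup>2 + 2 * (f x \<bullet> g x))"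
    unfolding nrm2_sq by (intro Bochner_Integration.integral_cong refl)
      (simp add: power2_norm_eq_inner inner_add inner_commute)
  also have "\<dots> = (nrm2 f)\<^sup>2 + (nrm2 g)\<^sup>2 + 2 * (LINT x|lebesgue. f x \<bullet> g x)"
    using L2_inner_integrable[OF assms] L2_int[OF assms(1)] L2_int[OF assms(2)] by (simp add: nrm2_sq)
  also have "\<dots> \<le> (nrm2 f + nrm2 g)\<^sup>2"
    using CS_inner[OF assms] by (simp add: power2_sum)
  finally show ?thesis by (rule power2_le_imp_le) simp
qed

lemma nrm2_triangle_diff: assumes "L2 f" "L2 g" "L2 h"
  shows "nrm2 (\<lambda>x. f x - h x) \<le> nrm2 (\<lambda>x. f x - g x) + nrm2 (\<lambda>x. g x - h x)"
  using nrm2_triangle[OF L2_diff[OF assms(1,2)] L2_diff[OF assms(2,3)]] by simp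

lemma nrm2_diff_abs: assumes "L2 f" "L2 g" shows "\<bar>nrm2 f - nrm2 g\<bar> \<le> nrm2 (\<lambda>x. f x - g x)"
  using nrm2_triangle[OF L2_diff[OF assms] assms(2)]
    nrm2_triangle[OF L2_diff[OF assms(2,1)] assms(1)] nrm2_commute[of f g] by simp

lemma nrm2_tendsto:
  assumes "\<And>k. L2 (f k)" "L2 g" "(\<lambda>k. nrm2 (\<lambda>x. f k x - g x)) \<longlonglongrightarrow> 0"
  shows "(\<lambda>k. nrm2 (f k)) \<longlonglongrightarrow> nrm2 g"
proof -
  have "(\<lambda>k. nrm2 (f k) - nrm2 g) \<longlonglongrightarrow> 0"
    by (rule Lim_null_comparison[OF _ assms(3)]) (use nrm2_diff_abs[OF assms(1,2)] in auto)
  then show ?thesis by (simp add: LIM_zero_iff)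
qed

lemma L2_inner_tendsto:
  assumes "\<And>k. L2 (f k)" "L2 g" "(\<lambda>k. nrm2 (\<lambda>x. f k x - g x)) \<longlonglongrightarrow> 0" "L2 h"
  shows "(\<lambda>k. LINT x|lebesgue. f k x \<bullet> h x) \<longlonglongrightarrow> (LINT x|lebesgue. g x \<bullet> h x)"
proof -
  have "(\<lambda>k. (LINT x|lebesgue. f k x \<bullet> h x) - (LINT x|lebesgue. g x \<bullet> h x)) \<longlonglongrightarrow> 0"
  proof (rule Lim_null_comparison)
    show "(\<lambda>k. nrm2 (\<lambda>x. f k x - g x) * nrm2 h) \<longlonglongrightarrow> 0"
      using tendsto_mult_right[OF assms(3), of "nrm2 h"] by simp
    have "\<bar>(LINT x|lebesgue. f k x \<bullet> h x) - (LINT x|lebesgue. g x \<bullet> h x)\<bar> \<le> nrm2 (\<lambda>x. f k x - g x) * nrm2 h" for k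
    proof -
      have "(LINT x|lebesgue. f k x \<bullet> h x) - (LINT x|lebesgue. g x \<bullet> h x) = (LINT x|lebesgue. (f k x - g x) \<bullet> h x)"
        using L2_inner_integrable[OF assms(1) assms(4)] L2_inner_integrable[OF assms(2) assms(4)]
        by (simp add: inner_diff_left)
      then show ?thesis using CS_inner[OF L2_diff[OF assms(1,2)] assms(4)] by simp
    qed
    then show "\<forall>\<^sub>F k in sequentially. norm ((LINT x|lebesgue. f k x \<bullet> h x) - (LINT x|lebesgue. g x \<bullet> h x)) \<le> nrm2 (\<lambda>x. f k x - g x) * nrm2 h"
      by simp
  qed
  then show ?thesis by (simp add: LIM_zero_iff)
qed

lemma nrm2_eq_0: assumes "L2 f" "nrm2 f = 0" shows "AE x in lebesgue. f x = 0"
proof -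
  have "(LINT x|lebesgue. (norm (f x))\<^sup>2) = 0" using assms(2) by (simp add: nrm2_def)
  then have "AE x in lebesgue. (norm (f x))\<^sup>2 = 0"
    using integral_nonneg_eq_0_iff_AE[OF L2_int[OF assms(1)]] by simp
  then show ?thesis by simp
qed

lemma nn_integral_nrm2: "L2 f \<Longrightarrow> (\<integral>\<^sup>+x. ennreal ((norm (f x))\<^sup>2) \<partial>lebesgue) = ennreal ((nrm2 f)\<^sup>2)"
  by (simp add: nrm2_sq nn_integral_eq_integral L2_def)

text \<open>Riesz-Fischer: a subsequence whose consecutive differences are at most 2^-n in norm
  converges almost everywhere, and Fatou's lemma carries the Cauchy estimate over to its
  limit.\<close>

theorem L2_complete:
  fixes f :: "nat \<Rightarrow> 'a::euclidean_space \<Rightarrow> 'b::euclidean_space"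
  assumes L: "\<And>k. L2 (f k)" and C: "\<And>e. e > 0 \<Longrightarrow> \<exists>N. \<forall>k\<ge>N. \<forall>l\<ge>N. nrm2 (\<lambda>x. f k x - f l x) < e"
  shows "\<exists>g. L2 g \<and> (\<lambda>k. nrm2 (\<lambda>x. f k x - g x)) \<longlonglongrightarrow> 0"
proof -
  have [measurable]: "f k \<in> LM" for k using L by (simp add: L2_def)
  obtain N where N: "\<And>n k l. k \<ge> N n \<Longrightarrow> l \<ge> N n \<Longrightarrow> nrm2 (\<lambda>x. f k x - f l x) < (1/2)^n"
    using C[of "(1/2)^n" for n] by (metis half_gt_zero_iff zero_less_one zero_less_power)
  \<comment> \<open>A partial sum is at least each of its terms, so \<open>r m\<close> passes all
    thresholds \<open>N n\<close> with n up to m at once.\<close>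
  define r where "r n = (\<Sum>i\<le>n. N i)" for n
  have rN: "r m \<ge> N n" if "m \<ge> n" for m n
    unfolding r_def using that by (intro member_le_sum) auto
  define d where "d n x = f (r (Suc n)) x - f (r n) x" for n x
  have dL: "L2 (d n)" for n unfolding d_def by (intro L2_diff L)
  have [measurable]: "d n \<in> LM" for n using dL by (simp add: L2_def)
  \<comment> \<open>The weights 2^n below are affordable because the squared norms are at most 4^-n.
    Pointwise, finiteness of the weighted sum gives a geometric bound for
    \<open>norm (d n x)\<close>, hence absolute convergence.\<close>
  have dn: "nrm2 (d n) \<le> (1/2)^n" for n
    unfolding d_def using N[of n "r (Suc n)" "r n"] rN by (simp add: less_imp_le)
  have "(\<integral>\<^sup>+x. (\<Sum>n. ennreal (2^n * (norm (d n x))\<^sup>2)) \<partial>lebesgue) = (\<Sum>n. \<integral>\<^sup>+x. ennreal (2^n * (norm (d n x))\<^sup>2) \<partial>lebesgue)"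
    by (intro nn_integral_suminf) measurable
  also have "\<dots> = (\<Sum>n. ennreal (2^n * (nrm2 (d n))\<^sup>2))"
    using nn_integral_nrm2[OF dL] by (simp add: ennreal_mult nn_integral_cmult)
  also have "\<dots> \<le> (\<Sum>n. ennreal ((1/2)^n))"
  proof (intro suminf_le allI summableI ennreal_leI)
    fix n
    have "2^n * (nrm2 (d n))\<^sup>2 \<le> 2^n * ((1/2)^n)\<^sup>2"
      using dn by (intro mult_left_mono power_mono) auto
    also have "\<dots> = (1/2)^n" by (simp add: power2_eq_square power_one_over field_simps)
    finally show "2^n * (nrm2 (d n))\<^sup>2 \<le> (1/2)^n" .
  qed
  also have "\<dots> < \<infinity>"
    by (subst suminf_ennreal2) (auto intro: summable_geometric)
  finally have fin: "(\<integral>\<^sup>+x. (\<Sum>n. ennreal (2^n * (norm (d n x))\<^sup>2)) \<partial>lebesgue) < \<infinity>" .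
  have "AE x in lebesgue. (\<Sum>n. ennreal (2^n * (norm (d n x))\<^sup>2)) \<noteq> \<infinity>"
    by (rule nn_integral_noteq_infinite) (use fin in auto)
  then have conv: "AE x in lebesgue. convergent (\<lambda>n. f (r n) x)"
  proof eventually_elim
    case (elim x)
    define S where "S = enn2real (\<Sum>n. ennreal (2^n * (norm (d n x))\<^sup>2))"
    have S: "(\<Sum>n. ennreal (2^n * (norm (d n x))\<^sup>2)) = ennreal S" "S \<ge> 0"
      using elim by (auto simp: S_def less_top)
    have "norm (d n x) \<le> sqrt S * (1 / sqrt 2)^n" for n
    proof -
      have "sum (\<lambda>n. ennreal (2^n * (norm (d n x))\<^sup>2)) {n} \<le> (\<Sum>n. ennreal (2^n * (norm (d n x))\<^sup>2))"
        by (rule sum_le_suminf[OF summableI]) simp_all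
      then have "2^n * (norm (d n x))\<^sup>2 \<le> S" using S by simp
      then have "sqrt ((norm (d n x))\<^sup>2) \<le> sqrt (S / 2^n)"
        by (intro real_sqrt_le_mono) (simp add: field_simps)
      then show ?thesis by (simp add: real_sqrt_divide real_sqrt_power power_one_over)
    qed
    moreover have "summable (\<lambda>n. sqrt S * (1 / sqrt 2)^n)"
      by (intro summable_mult summable_geometric) auto
    ultimately have "summable (\<lambda>n. d n x)"
      by (rule summable_comparison_test'[where N=0, rotated])
    then have "convergent (\<lambda>n. (\<Sum>i<n. d i x) + f (r 0) x)"
      by (intro convergent_add convergent_const) (simp add: summable_iff_convergent)
    moreover have "(\<Sum>i<n. d i x) + f (r 0) x = f (r n) x" for n
      unfolding d_def using sum_lessThan_telescope[of "\<lambda>n. f (r n) x" n] by simp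
    ultimately show ?case by simp
  qed
  define g where "g x = lim (\<lambda>n. f (r n) x)" for x
  have gm[measurable]: "g \<in> LM" unfolding g_def by measurable
  have gbound: "(\<integral>\<^sup>+x. ennreal ((norm (f k x - g x))\<^sup>2) \<partial>lebesgue) \<le> ennreal (((1/2)^m)\<^sup>2)" if k: "k \<ge> N m" for k m
  proof -
    have "(\<integral>\<^sup>+x. ennreal ((norm (f k x - g x))\<^sup>2) \<partial>lebesgue) = (\<integral>\<^sup>+x. liminf (\<lambda>n. ennreal ((norm (f k x - f (r n) x))\<^sup>2)) \<partial>lebesgue)"
    proof (intro nn_integral_cong_AE)
      show "AE x in lebesgue. ennreal ((norm (f k x - g x))\<^sup>2) = liminf (\<lambda>n. ennreal ((norm (f k x - f (r n) x))\<^sup>2))"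
        using conv
      proof eventually_elim
        case (elim x)
        then have "(\<lambda>n. f (r n) x) \<longlonglongrightarrow> g x" by (simp add: g_def convergent_LIMSEQ_iff)
        then have "(\<lambda>n. ennreal ((norm (f k x - f (r n) x))\<^sup>2)) \<longlonglongrightarrow> ennreal ((norm (f k x - g x))\<^sup>2)"
          by (intro tendsto_intros)
        from lim_imp_Liminf[OF trivial_limit_sequentially this] show ?case by simp
      qed
    qed
    also have "\<dots> \<le> liminf (\<lambda>n. \<integral>\<^sup>+x. ennreal ((norm (f k x - f (r n) x))\<^sup>2) \<partial>lebesgue)"
      by (rule nn_integral_liminf) measurable
    also have "\<dots> \<le> liminf (\<lambda>n. ennreal (((1/2)^m)\<^sup>2))"
    proof (intro Liminf_mono eventually_sequentiallyI[of m])
      fix n assume "m \<le> n"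
      have "nrm2 (\<lambda>x. f k x - f (r n) x) \<le> (1/2)^m"
        using N[of m k "r n"] k rN[OF \<open>m \<le> n\<close>] by simp
      then show "(\<integral>\<^sup>+x. ennreal ((norm (f k x - f (r n) x))\<^sup>2) \<partial>lebesgue) \<le> ennreal (((1/2)^m)\<^sup>2)"
        by (subst nn_integral_nrm2[OF L2_diff[OF L L]]) (auto intro!: ennreal_leI power_mono)
    qed
    also have "\<dots> = ennreal (((1/2)^m)\<^sup>2)" by (simp add: Liminf_const)
    finally show ?thesis .
  qed
  have diffL: "L2 (\<lambda>x. f k x - g x)" if "k \<ge> N m" for k m
  proof -
    have "(\<integral>\<^sup>+x. ennreal ((norm (f k x - g x))\<^sup>2) \<partial>lebesgue) < \<infinity>"
      by (rule le_less_trans[OF gbound[OF that]]) simp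
    then show ?thesis unfolding L2_def by (simp add: integrable_iff_bounded)
  qed
  have gL: "L2 g"
    using L2_diff[OF L[of "N 0"] diffL[of 0 "N 0"]] by simp
  have nb: "nrm2 (\<lambda>x. f k x - g x) \<le> (1/2)^m" if "k \<ge> N m" for k m
  proof -
    have "ennreal ((nrm2 (\<lambda>x. f k x - g x))\<^sup>2) \<le> ennreal (((1/2)^m)\<^sup>2)"
      using gbound[OF that] nn_integral_nrm2[OF diffL[OF that]] by simp
    then have "(nrm2 (\<lambda>x. f k x - g x))\<^sup>2 \<le> ((1/2)^m)\<^sup>2"
      by (subst (asm) ennreal_le_iff) auto
    then show ?thesis by (rule power2_le_imp_le) simp
  qed
  have "(\<lambda>k. nrm2 (\<lambda>x. f k x - g x)) \<longlonglongrightarrow> 0"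
  proof (rule LIMSEQ_I)
    fix e :: real assume "e > 0"
    then obtain m where "(1/2)^m < e" using real_arch_pow_inv[of e "1/2"] by auto
    then show "\<exists>no. \<forall>k\<ge>no. norm (nrm2 (\<lambda>x. f k x - g x) - 0) < e"
      using nb[of m] by (intro exI[of _ "N m"]) force
  qed
  then show ?thesis using gL by blast
qed

section \<open>Smooth functions of compact support\<close>

text \<open>The index m makes the family closed under differentiation up to linear combinations, see
  \<open>hm_deriv\<close>; a coinductive proof of smoothness needs such a closed class around
  exp(-1/t).\<close>

definition hm :: "nat \<Rightarrow> real \<Rightarrow> real" where
  "hm m t = (if t > 0 then (1 / t) ^ m * exp (- (1 / t)) else 0)"

lemma hm_tendsto_0: "(hm m \<longlongrightarrow> 0) (at 0)"
proof -
  have "((\<lambda>x. inverse x ^ m / exp (inverse x) :: real) \<longlongrightarrow> 0) (at_right 0)"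
    by (rule filterlim_compose[OF tendsto_power_div_exp_0 filterlim_inverse_at_top_right])
  then have r: "(hm m \<longlongrightarrow> 0) (at_right 0)"
    by (rule Lim_transform_eventually)
      (unfold eventually_at_filter, rule always_eventually, auto simp: hm_def exp_minus divide_inverse)
  have "((\<lambda>x. 0 :: real) \<longlongrightarrow> 0) (at_left 0)" by simp
  then have "(hm m \<longlongrightarrow> 0) (at_left 0)"
    by (rule Lim_transform_eventually) (unfold eventually_at_filter, rule always_eventually, auto simp: hm_def)
  with r show ?thesis by (simp add: filterlim_split_at)
qed

lemma hm_deriv: "(hm m has_real_derivative (hm (m + 2) t - real m * hm (m + 1) t)) (at t)"
proof -
  consider "t > 0" | "t < 0" | "t = 0" by linarith
  then show ?thesis
  proof cases
    case 1
    have "((\<lambda>t. (1 / t) ^ m * exp (- (1 / t))) has_real_derivative (hm (m + 2) t - real m * hm (m + 1) t)) (at t)"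
    proof (cases m)
      case 0
      then show ?thesis using 1
        by (auto intro!: derivative_eq_intros simp: hm_def power2_eq_square)
    next
      case (Suc k)
      show ?thesis unfolding Suc using 1
        by (auto intro!: derivative_eq_intros simp: hm_def field_simps power2_eq_square) (cases k; simp)
    qed
    then show ?thesis
      by (rule has_field_derivative_transform_within_open[where S="{0<..}"]) (use 1 in \<open>auto simp: hm_def\<close>)
  next
    case 2
    have "((\<lambda>t. 0) has_real_derivative (hm (m + 2) t - real m * hm (m + 1) t)) (at t)"
      using 2 by (auto simp: hm_def)
    then show ?thesis
      by (rule has_field_derivative_transform_within_open[where S="{..<0}"]) (use 2 in \<open>auto simp: hm_def\<close>)
  next
    case 3
    \<comment> \<open>At 0 the difference quotient of \<open>hm m\<close> is
      \<open>hm (m + 1)\<close>, whose limit is already known to be 0.\<close>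
    have "((\<lambda>h. (hm m h - hm m 0) / h) \<longlongrightarrow> 0) (at 0)"
      by (rule Lim_transform_eventually[OF hm_tendsto_0[of "m + 1"]])
        (unfold eventually_at_filter, rule always_eventually, auto simp: hm_def)
    then show ?thesis using 3 by (simp add: has_field_derivative_iff hm_def)
  qed
qed

text \<open>The class for coinduction up to closure under the algebraic operations.\<close>

inductive smooth_cl :: "(real^'n \<Rightarrow> real) \<Rightarrow> bool" where
  base: "smooth_fun f \<Longrightarrow> smooth_cl f"
| const: "smooth_cl (\<lambda>x. c)"
| coord: "smooth_cl (\<lambda>x. x $ i)"
| add: "smooth_cl f \<Longrightarrow> smooth_cl g \<Longrightarrow> smooth_cl (\<lambda>x. f x + g x)"
| mult: "smooth_cl f \<Longrightarrow> smooth_cl g \<Longrightarrow> smooth_cl (\<lambda>x. f x * g x)"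
| hm: "smooth_cl f \<Longrightarrow> smooth_cl (\<lambda>x. hm m (f x))"
| inverse: "smooth_cl f \<Longrightarrow> (\<And>x. f x \<noteq> 0) \<Longrightarrow> smooth_cl (\<lambda>x. inverse (f x))"

lemma smooth_fun_D: assumes "smooth_fun f"
  shows "f differentiable_on UNIV" "smooth_fun (\<lambda>x. frechet_derivative f (at x) (axis i 1))"
  using assms by (auto elim: smooth_fun.cases)

lemma smooth_has_derivative:
  assumes "smooth_fun f"
  shows "(f has_derivative (\<lambda>h. grad f x \<bullet> h)) (at x)"
proof -
  have d: "(f has_derivative frechet_derivative f (at x)) (at x)"
    using smooth_fun_D(1)[OF assms] by (simp add: differentiable_on_def frechet_derivative_works)
  then have lin: "linear (frechet_derivative f (at x))" by (rule has_derivative_linear)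
  have "frechet_derivative f (at x) h = grad f x \<bullet> h" for h
  proof -
    have "frechet_derivative f (at x) h = frechet_derivative f (at x) (\<Sum>i\<in>UNIV. h $ i *\<^sub>R axis i 1)"
      by (simp add: basis_expansion scalar_mult_eq_scaleR[symmetric])
    also have "\<dots> = (\<Sum>i\<in>UNIV. h $ i * frechet_derivative f (at x) (axis i 1))"
      by (simp add: linear_sum[OF lin] linear_cmul[OF lin])
    finally show ?thesis by (simp add: grad_def inner_vec_def mult.commute)
  qed
  then have "frechet_derivative f (at x) = (\<lambda>h. grad f x \<bullet> h)" by auto
  with d show ?thesis by simp
qed

text \<open>The invariant of the coinduction: partial derivatives stay in the class. As
  \<open>base\<close> admits arbitrary smooth functions, a single coinduction yields all closure
  properties of \<open>smooth_fun\<close>.\<close>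

lemma smooth_cl_deriv:
  assumes "smooth_cl f"
  shows "\<exists>g. (\<forall>x. (f has_derivative (\<lambda>h. \<Sum>i\<in>UNIV. g i x * h $ i)) (at x)) \<and> (\<forall>i. smooth_cl (g i))"
  using assms
proof induction
  case (base f)
  show ?case
    using smooth_has_derivative[OF base] smooth_fun_D(2)[OF base]
    by (intro exI[of _ "\<lambda>i x. frechet_derivative f (at x) (axis i 1)"])
      (auto simp: grad_def inner_vec_def intro: smooth_cl.base)
next
  case (const c)
  show ?case by (intro exI[of _ "\<lambda>i x. 0"]) (auto intro: smooth_cl.const)
next
  case (coord j)
  have "((\<lambda>x. x $ j) has_derivative (\<lambda>h. \<Sum>i\<in>UNIV. (if i = j then 1 else 0) * h $ i)) (at x)" for x :: "real^_"
    using bounded_linear_imp_has_derivative[OF bounded_linear_vec_nth[of j]] by (simp add: mult_if_delta)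
  then show ?case
    by (intro exI[of _ "\<lambda>i x. if i = j then 1 else 0"]) (auto intro: smooth_cl.const)
next
  case (add f1 f2)
  then obtain g1 g2 where g: "\<And>x. (f1 has_derivative (\<lambda>h. \<Sum>i\<in>UNIV. g1 i x * h $ i)) (at x)" "\<And>i. smooth_cl (g1 i)"
    "\<And>x. (f2 has_derivative (\<lambda>h. \<Sum>i\<in>UNIV. g2 i x * h $ i)) (at x)" "\<And>i. smooth_cl (g2 i)" by blast
  have "((\<lambda>x. f1 x + f2 x) has_derivative (\<lambda>h. \<Sum>i\<in>UNIV. (g1 i x + g2 i x) * h $ i)) (at x)" for x
    using has_derivative_add[OF g(1,3)] by (simp add: distrib_right sum.distrib)
  then show ?case using g by (intro exI[of _ "\<lambda>i x. g1 i x + g2 i x"]) (auto intro: smooth_cl.add)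
next
  case (mult f1 f2)
  then obtain g1 g2 where g: "\<And>x. (f1 has_derivative (\<lambda>h. \<Sum>i\<in>UNIV. g1 i x * h $ i)) (at x)" "\<And>i. smooth_cl (g1 i)"
    "\<And>x. (f2 has_derivative (\<lambda>h. \<Sum>i\<in>UNIV. g2 i x * h $ i)) (at x)" "\<And>i. smooth_cl (g2 i)" by blast
  have h: "((\<lambda>x. f1 x * f2 x) has_derivative (\<lambda>h. \<Sum>i\<in>UNIV. (f1 x * g2 i x + g1 i x * f2 x) * h $ i)) (at x)" for x
    using has_derivative_mult[OF g(1,3)]
    by (simp add: distrib_right sum.distrib sum_distrib_left sum_distrib_right algebra_simps)
  show ?case
    by (intro exI[of _ "\<lambda>i x. f1 x * g2 i x + g1 i x * f2 x"] conjI allI h smooth_cl.add smooth_cl.mult g mult.hyps)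
next
  case (hm f m)
  then obtain g where g: "\<And>x. (f has_derivative (\<lambda>h. \<Sum>i\<in>UNIV. g i x * h $ i)) (at x)" "\<And>i. smooth_cl (g i)" by blast
  let ?d = "\<lambda>x. hm (m + 2) (f x) + (- real m) * hm (m + 1) (f x)"
  have "((\<lambda>x. hm m (f x)) has_derivative (\<lambda>h. \<Sum>i\<in>UNIV. (?d x * g i x) * h $ i)) (at x)" for x
    using has_derivative_compose[OF g(1) hm_deriv[unfolded has_field_derivative_def]]
    by (simp add: sum_distrib_left mult.assoc)
  moreover have "smooth_cl (\<lambda>x. ?d x * g i x)" for i
    using hm g by (intro smooth_cl.add smooth_cl.mult smooth_cl.hm smooth_cl.const)
  ultimately show ?case by (intro exI[of _ "\<lambda>i x. ?d x * g i x"]) auto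
next
  case (inverse f)
  then obtain g where g: "\<And>x. (f has_derivative (\<lambda>h. \<Sum>i\<in>UNIV. g i x * h $ i)) (at x)" "\<And>i. smooth_cl (g i)" by blast
  let ?d = "\<lambda>x. (-1) * (inverse (f x) * inverse (f x))"
  have "((\<lambda>x. inverse (f x)) has_derivative (\<lambda>h. \<Sum>i\<in>UNIV. (?d x * g i x) * h $ i)) (at x)" for x
    using Deriv.has_derivative_inverse[OF inverse(2) g(1), of x]
    by (simp add: sum_distrib_left sum_negf mult.assoc mult.left_commute mult.commute)
  moreover have "smooth_cl (\<lambda>x. ?d x * g i x)" for i
    using inverse g by (intro smooth_cl.mult smooth_cl.inverse smooth_cl.const)
  ultimately show ?case by (intro exI[of _ "\<lambda>i x. ?d x * g i x"]) auto
qed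

lemma smooth_cl_smooth: assumes "smooth_cl f" shows "smooth_fun f"
  using assms
proof (coinduction arbitrary: f)
  case smooth_fun
  obtain g where g: "\<And>x. (f has_derivative (\<lambda>h. \<Sum>i\<in>UNIV. g i x * h $ i)) (at x)" "\<And>i. smooth_cl (g i)"
    using smooth_cl_deriv[OF smooth_fun] by blast
  have fd: "frechet_derivative f (at x) = (\<lambda>h. \<Sum>i\<in>UNIV. g i x * h $ i)" for x
    using frechet_derivative_at[OF g(1)] by simp
  have "f differentiable_on UNIV"
    using g(1) by (auto simp: differentiable_on_def differentiable_def)
  moreover have "(\<lambda>x. frechet_derivative f (at x) (axis i 1)) = g i" for i
    by (auto simp: fd axis_def if_distrib[of "\<lambda>t. _ * t"] cong: if_cong)
  ultimately show ?case using g(2) by auto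
qed

lemma smooth_const[simp]: "smooth_fun (\<lambda>x. c)"
  and smooth_coord[simp]: "smooth_fun (\<lambda>x. x $ i)"
  and smooth_add: "smooth_fun f \<Longrightarrow> smooth_fun g \<Longrightarrow> smooth_fun (\<lambda>x. f x + g x)"
  and smooth_mult: "smooth_fun f \<Longrightarrow> smooth_fun g \<Longrightarrow> smooth_fun (\<lambda>x. f x * g x)"
  and smooth_hm: "smooth_fun f \<Longrightarrow> smooth_fun (\<lambda>x. hm m (f x))"
  and smooth_inverse: "smooth_fun f \<Longrightarrow> (\<And>x. f x \<noteq> 0) \<Longrightarrow> smooth_fun (\<lambda>x. inverse (f x))"
  by (auto intro!: smooth_cl_smooth intro: smooth_cl.intros)

lemma smooth_diff: "smooth_fun f \<Longrightarrow> smooth_fun g \<Longrightarrow> smooth_fun (\<lambda>x. f x - g x)"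
  using smooth_add[OF _ smooth_mult[OF smooth_const[of "-1"]], of f g] by simp

lemma smooth_sum: "(\<And>i. i \<in> I \<Longrightarrow> smooth_fun (f i)) \<Longrightarrow> smooth_fun (\<lambda>x. \<Sum>i\<in>I. f i x)"
  by (induction I rule: infinite_finite_induct) (simp_all add: smooth_add)

lemma smooth_grad: "smooth_fun f \<Longrightarrow> smooth_fun (\<lambda>x. grad f x $ i)"
  using smooth_fun_D(2) by (simp add: grad_def)

lemma smooth_continuous: "smooth_fun f \<Longrightarrow> continuous_on S f"
  by (meson continuous_at_imp_continuous_on has_derivative_continuous smooth_has_derivative)

lemma smooth_continuous_grad: "smooth_fun f \<Longrightarrow> continuous_on S (grad f)"
proof -
  assume "smooth_fun f"
  then have "continuous_on S (\<lambda>x. \<chi> i. grad f x $ i)"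
    by (intro continuous_on_vec_lambda smooth_continuous smooth_grad)
  then show "continuous_on S (grad f)" by simp
qed

lemma gradI: assumes "(f has_derivative (\<lambda>h. v \<bullet> h)) (at x)" shows "grad f x = v"
  using frechet_derivative_at[OF assms, symmetric] by (simp add: grad_def vec_eq_iff inner_axis)

lemma grad_add: "smooth_fun f \<Longrightarrow> smooth_fun g \<Longrightarrow> grad (\<lambda>x. f x + g x) x = grad f x + grad g x"
  using has_derivative_add[OF smooth_has_derivative smooth_has_derivative, of f g x]
  by (intro gradI) (simp add: inner_add_left)

lemma grad_mult: "smooth_fun f \<Longrightarrow> smooth_fun g \<Longrightarrow> grad (\<lambda>x. f x * g x) x = f x *\<^sub>R grad g x + g x *\<^sub>R grad f x"
  using has_derivative_mult[OF smooth_has_derivative smooth_has_derivative, of f g x]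
  by (intro gradI) (simp add: inner_add_left mult.commute)

lemma grad_const: "grad (\<lambda>x. c) x = 0"
  by (intro gradI) simp

lemma grad_coord: "grad (\<lambda>x. x $ i) x = axis i 1"
  using bounded_linear_imp_has_derivative[OF bounded_linear_vec_nth[of i]]
  by (intro gradI) (simp add: inner_axis inner_commute[of "axis i 1"])

lemma grad_cmult: "smooth_fun f \<Longrightarrow> grad (\<lambda>x. c * f x) x = c *\<^sub>R grad f x"
  using grad_mult[OF smooth_const[of c]] by (simp add: grad_const)

lemma grad_diff: assumes "smooth_fun f" "smooth_fun g" shows "grad (\<lambda>x. f x - g x) x = grad f x - grad g x"
  using has_derivative_diff[OF smooth_has_derivative smooth_has_derivative, OF assms, of x]
  by (intro gradI) (simp add: inner_diff_left)

lemma Cc_infD: assumes "Cc_inf D f"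
  shows "smooth_fun f" "compact (closure {x. f x \<noteq> 0})" "closure {x. f x \<noteq> 0} \<subseteq> D"
  using assms by (auto simp: Cc_inf_def)

lemma Cc_inf_sub:
  assumes "smooth_fun f" "compact K" "K \<subseteq> D" "\<And>x. x \<notin> K \<Longrightarrow> f x = 0"
  shows "Cc_inf D f"
proof -
  have "closure {x. f x \<noteq> 0} \<subseteq> K"
    using assms by (intro closure_minimal) (auto intro: compact_imp_closed)
  then have "closure {x. f x \<noteq> 0} = K \<inter> closure {x. f x \<noteq> 0}" by auto
  then have "compact (closure {x. f x \<noteq> 0})"
    using compact_Int_closed[OF assms(2) closed_closure] by metis
  then show ?thesis using assms(1,3) \<open>closure {x. f x \<noteq> 0} \<subseteq> K\<close> by (auto simp: Cc_inf_def)
qed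

lemma Cc_inf_mono: "Cc_inf D f \<Longrightarrow> D \<subseteq> D' \<Longrightarrow> Cc_inf D' f"
  by (auto simp: Cc_inf_def)

lemma Cc_inf_zero_outside: "x \<notin> closure {x. f x \<noteq> 0} \<Longrightarrow> f x = 0"
  using closure_subset[of "{x. f x \<noteq> 0}"] by auto

lemma grad_zero_open: assumes "open U" "x \<in> U" "\<And>y. y \<in> U \<Longrightarrow> f y = 0" shows "grad f x = 0"
proof (rule gradI)
  have "((\<lambda>x. 0) has_derivative (\<lambda>h. 0)) (at x)" by simp
  then have "(f has_derivative (\<lambda>h. 0)) (at x)"
    by (rule has_derivative_transform_within_open) (use assms in auto)
  then show "(f has_derivative (\<lambda>h. 0 \<bullet> h)) (at x)" by simp
qed

lemma Cc_inf_support: assumes "Cc_inf D f"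
  shows "\<exists>K. compact K \<and> K \<subseteq> D \<and> (\<forall>x. x \<notin> K \<longrightarrow> f x = 0) \<and> (\<forall>x. x \<notin> K \<longrightarrow> grad f x = 0)"
proof -
  define K where "K = closure {x. f x \<noteq> 0}"
  have K: "compact K" "K \<subseteq> D" using Cc_infD(2,3)[OF assms] unfolding K_def by this+
  have f0: "f x = 0" if "x \<notin> K" for x using that unfolding K_def by (rule Cc_inf_zero_outside)
  have g0: "grad f x = 0" if "x \<notin> K" for x
    by (rule grad_zero_open[of "- K"]) (use that f0 K(1) compact_imp_closed in auto)
  show ?thesis using K f0 g0 by (intro exI[of _ K] conjI allI impI)
qed

lemma Cc_inf_mult: assumes "Cc_inf D f" "smooth_fun g"
  shows "Cc_inf D (\<lambda>x. f x * g x)" "Cc_inf D (\<lambda>x. g x * f x)"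
proof -
  obtain K where K: "compact K" "K \<subseteq> D" "\<And>x. x \<notin> K \<Longrightarrow> f x = 0" "\<And>x. x \<notin> K \<Longrightarrow> grad f x = 0"
    using Cc_inf_support[OF assms(1)] by metis
  show "Cc_inf D (\<lambda>x. f x * g x)" "Cc_inf D (\<lambda>x. g x * f x)"
    by (rule Cc_inf_sub[OF _ K(1,2)]; simp add: smooth_mult Cc_infD(1)[OF assms(1)] assms(2) K(3))+
qed

lemma Cc_inf_add: assumes "Cc_inf D f" "Cc_inf D g" shows "Cc_inf D (\<lambda>x. f x + g x)"
proof -
  obtain K where K: "compact K" "K \<subseteq> D" "\<And>x. x \<notin> K \<Longrightarrow> f x = 0" "\<And>x. x \<notin> K \<Longrightarrow> grad f x = 0"
    using Cc_inf_support[OF assms(1)] by metis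
  obtain L where L: "compact L" "L \<subseteq> D" "\<And>x. x \<notin> L \<Longrightarrow> g x = 0" "\<And>x. x \<notin> L \<Longrightarrow> grad g x = 0"
    using Cc_inf_support[OF assms(2)] by metis
  show ?thesis
    by (rule Cc_inf_sub[where K="K \<union> L"])
      (use K L Cc_infD(1)[OF assms(1)] Cc_infD(1)[OF assms(2)] in \<open>auto simp: smooth_add\<close>)
qed

lemma Cc_inf_cmult: "Cc_inf D f \<Longrightarrow> Cc_inf D (\<lambda>x. c * f x)"
  using Cc_inf_mult(2)[OF _ smooth_const] by blast

lemma Cc_inf_zero[simp]: "Cc_inf D (\<lambda>x. 0)"
  by (rule Cc_inf_sub[where K="{}"]) auto

lemma Cc_inf_bounded: assumes "Cc_inf D f"
  shows "\<exists>C\<ge>0. \<forall>x. \<bar>f x\<bar> \<le> C \<and> norm (grad f x) \<le> C"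
proof -
  obtain K where K: "compact K" "K \<subseteq> D" "\<And>x. x \<notin> K \<Longrightarrow> f x = 0" "\<And>x. x \<notin> K \<Longrightarrow> grad f x = 0"
    using Cc_inf_support[OF assms] by metis
  have "bounded (f ` K)" "bounded (grad f ` K)"
    using K(1) Cc_infD(1)[OF assms]
    by (auto intro!: compact_imp_bounded compact_continuous_image smooth_continuous smooth_continuous_grad)
  then obtain C1 C2 where C: "\<And>x. x \<in> K \<Longrightarrow> norm (f x) \<le> C1" "\<And>x. x \<in> K \<Longrightarrow> norm (grad f x) \<le> C2"
    unfolding bounded_iff by blast
  show ?thesis
  proof (intro exI[of _ "\<bar>C1\<bar> + \<bar>C2\<bar>"] conjI allI)
    show "\<bar>f x\<bar> \<le> \<bar>C1\<bar> + \<bar>C2\<bar>" for x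
      using C(1)[of x] K(3)[of x] by (cases "x \<in> K") auto
    show "norm (grad f x) \<le> \<bar>C1\<bar> + \<bar>C2\<bar>" for x
      using C(2)[of x] K(4)[of x] by (cases "x \<in> K") auto
  qed simp
qed

section \<open>Cutoff functions\<close>

definition step_fun :: "real \<Rightarrow> real" where
  "step_fun t = hm 0 t * inverse (hm 0 t + hm 0 (1 - t))"

lemma hm0_nonneg: "0 \<le> hm 0 t" and hm0_den: "hm 0 t + hm 0 (1 - t) > 0"
  by (auto simp: hm_def add_pos_pos)

lemma step_fun_props:
  "t \<le> 0 \<Longrightarrow> step_fun t = 0" "t \<ge> 1 \<Longrightarrow> step_fun t = 1" "0 \<le> step_fun t" "step_fun t \<le> 1"
proof -
  show "t \<le> 0 \<Longrightarrow> step_fun t = 0" by (simp add: step_fun_def hm_def)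
  show "t \<ge> 1 \<Longrightarrow> step_fun t = 1" by (simp add: step_fun_def hm_def)
  show "0 \<le> step_fun t" using hm0_nonneg[of t] hm0_den[of t] by (simp add: step_fun_def)
  show "step_fun t \<le> 1" using hm0_nonneg[of t] hm0_nonneg[of "1-t"] hm0_den[of t] by (simp add: step_fun_def field_simps)
qed

text \<open>With the squared norm the argument is a polynomial. It is at least 1 for distances up to
  r and at most 0 from sqrt 2 times r on; 3/2 r is the rational threshold used later, which leaves
  room inside the ball of radius 2 r.\<close>

definition bump :: "real^'n \<Rightarrow> real \<Rightarrow> real^'n \<Rightarrow> real" where
  "bump x r y = step_fun (2 - (norm ((1 / r) *\<^sub>R (y - x)))\<^sup>2)"

lemma smooth_bump: fixes x :: "real^'n" shows "smooth_fun (bump x r)"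
proof -
  have e: "(norm ((1 / r) *\<^sub>R (y - x)))\<^sup>2 = (\<Sum>i\<in>UNIV. (1 / r * (y $ i - x $ i)) * (1 / r * (y $ i - x $ i)))" for y :: "real^'n"
    unfolding power2_norm_eq_inner inner_vec_def by simp
  have *: "smooth_fun (\<lambda>y. 2 - (\<Sum>i\<in>UNIV. (1 / r * (y $ i - x $ i)) * (1 / r * (y $ i - x $ i))))"
    by (intro smooth_diff smooth_const smooth_sum smooth_mult smooth_coord)
  show ?thesis
    unfolding bump_def step_fun_def e
    by (intro smooth_mult smooth_inverse smooth_add smooth_hm smooth_diff[OF smooth_const *] *)
      (rule less_imp_neq[OF hm0_den, symmetric])
qed

lemma bump_props:
  assumes "r > 0"
  shows "0 \<le> bump x r y" "bump x r y \<le> 1" "norm (y - x) \<le> r \<Longrightarrow> bump x r y = 1" "norm (y - x) \<ge> 3 / 2 * r \<Longrightarrow> bump x r y = 0"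
proof -
  show "0 \<le> bump x r y" "bump x r y \<le> 1" by (auto simp: bump_def step_fun_props)
  show "bump x r y = 1" if "norm (y - x) \<le> r"
  proof -
    have "norm ((1 / r) *\<^sub>R (y - x)) = norm (y - x) / r" using assms by (simp del: scaleR_diff_right)
    also have "\<dots> \<le> 1" using that assms by simp
    finally have "(norm ((1 / r) *\<^sub>R (y - x)))\<^sup>2 \<le> 1\<^sup>2" by (intro power_mono) auto
    then show ?thesis by (simp add: bump_def step_fun_props)
  qed
  show "bump x r y = 0" if "norm (y - x) \<ge> 3 / 2 * r"
  proof -
    have "norm ((1 / r) *\<^sub>R (y - x)) = norm (y - x) / r" using assms by (simp del: scaleR_diff_right)
    also have "\<dots> \<ge> 3 / 2" using that assms by (simp add: field_simps)
    finally have "(norm ((1 / r) *\<^sub>R (y - x)))\<^sup>2 \<ge> (3 / 2)\<^sup>2" by (intro power_mono) auto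
    moreover have "(2::real) \<le> (3 / 2)\<^sup>2" by (simp add: power2_eq_square)
    ultimately have "2 - (norm ((1 / r) *\<^sub>R (y - x)))\<^sup>2 \<le> 0" by linarith
    then show ?thesis unfolding bump_def by (rule step_fun_props(1))
  qed
qed

lemma Cc_inf_bump: assumes "r > 0" "ball x (2 * r) \<subseteq> D" shows "Cc_inf D (bump x r)"
proof (rule Cc_inf_sub[OF smooth_bump])
  show "cball x (3 / 2 * r) \<subseteq> D" using assms by (auto simp: subset_iff)
  show "bump x r y = 0" if "y \<notin> cball x (3 / 2 * r)" for y
    using that assms by (intro bump_props) (auto simp: dist_norm norm_minus_commute)
qed simp

text \<open>\<open>bump x r\<close> is \<open>bump 0 1\<close> after an affine map, so one constant
  serves all centres and radii. This uniformity is what makes the constants in the later estimates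
  scale invariant.\<close>

lemma grad_bump_bound: "\<exists>C>0. \<forall>(x::real^'n) r y. r > 0 \<longrightarrow> norm (grad (bump x r) y) \<le> C / r"
proof -
  obtain C where C: "C \<ge> 0" "\<And>y::real^'n. norm (grad (bump 0 1) y) \<le> C"
    using Cc_inf_bounded[OF Cc_inf_bump[of 1 0 "UNIV"]] by auto
  have "norm (grad (bump x r) y) \<le> (C + 1) / r" if "r > 0" for x y :: "real^'n" and r
  proof -
    let ?T = "\<lambda>y::real^'n. (1 / r) *\<^sub>R (y - x)"
    have "((\<lambda>y. bump 0 1 (?T y)) has_derivative (\<lambda>h. grad (bump 0 1) (?T y) \<bullet> ((1 / r) *\<^sub>R h))) (at y)"
      by (rule has_derivative_compose[OF _ smooth_has_derivative[OF smooth_bump]]) (auto intro!: derivative_eq_intros)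
    moreover have "(\<lambda>y. bump 0 1 (?T y)) = bump x r" by (auto simp: bump_def)
    ultimately have "grad (bump x r) y = (1 / r) *\<^sub>R grad (bump 0 1) (?T y)"
      by (intro gradI) simp
    then have "norm (grad (bump x r) y) = 1 / r * norm (grad (bump 0 1) (?T y))" using that by simp
    also have "\<dots> \<le> 1 / r * (C + 1)" using C(2)[of "?T y"] that by (intro mult_left_mono) auto
    finally show ?thesis by simp
  qed
  then show ?thesis using C by (intro exI[of _ "C + 1"]) auto
qed

text \<open>Finitely many balls carrying bumps cover K by compactness; the bumps are joined one at a
  time, so that no partition of unity is required.\<close>

lemma smooth_urysohn:
  fixes K D :: "(real^'n) set"
  assumes "compact K" "open D" "K \<subseteq> D"
  shows "\<exists>\<psi>. Cc_inf D \<psi> \<and> (\<forall>x. 0 \<le> \<psi> x \<and> \<psi> x \<le> 1) \<and> (\<forall>x\<in>K. \<psi> x = 1)"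
proof -
  have "\<forall>x\<in>K. \<exists>r>0. ball x (2 * r) \<subseteq> D"
  proof
    fix x assume "x \<in> K"
    then obtain e where "e > 0" "ball x e \<subseteq> D" using assms by (meson openE subsetD)
    then show "\<exists>r>0. ball x (2 * r) \<subseteq> D" by (intro exI[of _ "e / 2"]) auto
  qed
  then obtain r where r: "\<And>x. x \<in> K \<Longrightarrow> r x > 0 \<and> ball x (2 * r x) \<subseteq> D" by metis
  have "K \<subseteq> (\<Union>x\<in>K. ball x (r x))" using r by force
  then obtain F where F: "F \<subseteq> K" "finite F" "K \<subseteq> (\<Union>x\<in>F. ball x (r x))"
    using compactE_image[OF assms(1), of K "\<lambda>x. ball x (r x)"] by auto
  have "\<exists>\<psi>. Cc_inf D \<psi> \<and> (\<forall>x. 0 \<le> \<psi> x \<and> \<psi> x \<le> 1) \<and> (\<forall>x\<in>(\<Union>x\<in>F. ball x (r x)). \<psi> x = 1)"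
    using F(2,1)
  proof induction
    case empty
    show ?case by (intro exI[of _ "\<lambda>x. 0"]) auto
  next
    case (insert z F)
    then have "\<exists>\<psi>. Cc_inf D \<psi> \<and> (\<forall>x. 0 \<le> \<psi> x \<and> \<psi> x \<le> 1) \<and> (\<forall>x\<in>(\<Union>x\<in>F. ball x (r x)). \<psi> x = 1)"
      by blast
    then obtain \<psi> where p: "Cc_inf D \<psi>" "\<forall>x. 0 \<le> \<psi> x \<and> \<psi> x \<le> 1" "\<forall>x\<in>(\<Union>x\<in>F. ball x (r x)). \<psi> x = 1"
      by (elim exE conjE)
    let ?b = "bump z (r z)"
    have z: "r z > 0" "ball z (2 * r z) \<subseteq> D" using insert r by auto
    note b = bump_props[OF z(1), of z]
    \<comment> \<open>This is 1 - (1 - \<psi>)(1 - b): it stays between 0 and 1 and equals 1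
      wherever one of the two functions does.\<close>
    let ?q = "\<lambda>x. \<psi> x + (1 - \<psi> x) * ?b x"
    have "Cc_inf D ?q"
      by (intro Cc_inf_add p Cc_inf_mult(2) Cc_inf_bump z smooth_diff smooth_const Cc_infD(1)[OF p(1)])
    moreover have "0 \<le> ?q x \<and> ?q x \<le> 1" for x
    proof
      show "0 \<le> ?q x" using p(2)[rule_format, of x] b(1)[of x] by auto
      have "(1 - \<psi> x) * ?b x \<le> (1 - \<psi> x) * 1" using p(2)[rule_format, of x] b(2)[of x] by (intro mult_left_mono) auto
      then show "?q x \<le> 1" by simp
    qed
    moreover have "?q x = 1" if "x \<in> (\<Union>x\<in>insert z F. ball x (r x))" for x
    proof (cases "x \<in> (\<Union>x\<in>F. ball x (r x))")
      case True
      then have "\<psi> x = 1" using p(3) by (rule bspec[rotated])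
      then show ?thesis by simp
    next
      case False
      then have "norm (x - z) \<le> r z" using that by (auto simp: dist_norm norm_minus_commute)
      then show ?thesis using bump_props(3)[OF z(1), of x z] by simp
    qed
    ultimately show ?case by blast
  qed
  then show ?thesis using F(3) by blast
qed

section \<open>Measurability, integrability and integration by parts\<close>

lemma smooth_borel[measurable_dest]: "smooth_fun f \<Longrightarrow> f \<in> borel_measurable borel"
  by (intro borel_measurable_continuous_onI smooth_continuous)

lemma smooth_grad_borel: "smooth_fun f \<Longrightarrow> grad f \<in> borel_measurable borel"
  by (intro borel_measurable_continuous_onI smooth_continuous_grad)

lemma smooth_lebesgue: assumes "smooth_fun f"
  shows "f \<in> LM" "grad f \<in> LM"
  using smooth_borel[OF assms] smooth_grad_borel[OF assms] by (auto intro: measurable_completion)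

lemma finite_measure_support_integrable:
  fixes f :: "'a::euclidean_space \<Rightarrow> 'b::euclidean_space"
  assumes "f \<in> LM" "\<And>x. norm (f x) \<le> C" "bounded S" "\<And>x. x \<notin> S \<Longrightarrow> f x = 0"
  shows "integrable lebesgue f"
proof -
  obtain R where "\<forall>x\<in>S. norm x \<le> R" using assms(3) unfolding bounded_iff by metis
  then have R: "S \<subseteq> cball 0 R" by auto
  show ?thesis
  proof (rule Bochner_Integration.integrable_bound)
    show "integrable lebesgue (\<lambda>x::'a. C * ind (cball 0 R) x :: real)"
      by (intro integrable_mult_right integrable_real_indicator) (use emeasure_lborel_cball_finite[of "0::'a" R] in simp_all)
    show "AE x in lebesgue. norm (f x) \<le> norm (C * ind (cball 0 R) x :: real)"
    proof (rule AE_I2)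
      fix x
      show "norm (f x) \<le> norm (C * ind (cball 0 R) x :: real)"
      proof (cases "x \<in> S")
        case True
        then have "x \<in> cball 0 R" using R by blast
        then show ?thesis using assms(2)[of x] by (simp add: indicator_def)
      qed (simp add: assms(4))
    qed
  qed fact
qed

lemma L2_bounded_support:
  fixes f :: "'a::euclidean_space \<Rightarrow> 'b::euclidean_space"
  assumes "f \<in> LM" "\<And>x. norm (f x) \<le> C" "bounded S" "\<And>x. x \<notin> S \<Longrightarrow> f x = 0"
  shows "L2 f"
  unfolding L2_def
proof
  show "integrable lebesgue (\<lambda>x. (norm (f x))\<^sup>2)"
    by (rule finite_measure_support_integrable[where C="C\<^sup>2" and S=S]) (use assms in \<open>auto intro!: power_mono\<close>)
qed fact

lemma Cc_inf_L2: assumes "Cc_inf D f" shows "L2 f" "L2 (grad f)"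
proof -
  obtain C where C: "\<And>x. \<bar>f x\<bar> \<le> C" "\<And>x. norm (grad f x) \<le> C" using Cc_inf_bounded[OF assms] by blast
  obtain K where K: "compact K" "K \<subseteq> D" "\<And>x. x \<notin> K \<Longrightarrow> f x = 0" "\<And>x. x \<notin> K \<Longrightarrow> grad f x = 0"
    using Cc_inf_support[OF assms] by metis
  note b = compact_imp_bounded[OF K(1)] and m = smooth_lebesgue[OF Cc_infD(1)[OF assms]]
  show "L2 f" by (rule L2_bounded_support[OF m(1) _ b K(3), where C=C]) (use C in auto)
  show "L2 (grad f)" by (rule L2_bounded_support[OF m(2) _ b K(4), where C=C]) (use C in auto)
qed

lemma Cc_inf_integrable: assumes "Cc_inf D f" shows "integrable lebesgue f" "integrable lebesgue (\<lambda>x. grad f x $ i)"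
proof -
  obtain C where C: "\<And>x. \<bar>f x\<bar> \<le> C" "\<And>x. norm (grad f x) \<le> C" using Cc_inf_bounded[OF assms] by blast
  obtain K where K: "compact K" "K \<subseteq> D" "\<And>x. x \<notin> K \<Longrightarrow> f x = 0" "\<And>x. x \<notin> K \<Longrightarrow> grad f x = 0"
    using Cc_inf_support[OF assms] by metis
  note b = compact_imp_bounded[OF K(1)] and sm = Cc_infD(1)[OF assms]
  show "integrable lebesgue f"
    by (rule finite_measure_support_integrable[OF smooth_lebesgue(1)[OF sm] _ b K(3), where C=C]) (use C in auto)
  show "integrable lebesgue (\<lambda>x. grad f x $ i)"
    by (rule finite_measure_support_integrable[OF smooth_lebesgue(1)[OF smooth_grad[OF sm]] _ b, where C=C])
      (use order_trans[OF component_le_norm_cart C(2)] K(4) in auto)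
qed

lemma onorm_inner_bound:
  fixes v :: "'a::euclidean_space" and C :: real
  shows "norm v \<le> C \<Longrightarrow> 0 \<le> C \<Longrightarrow> onorm (\<lambda>h. v \<bullet> h) \<le> C"
proof (rule onorm_bound)
  fix h assume "norm v \<le> C"
  then show "norm (v \<bullet> h) \<le> C * norm h"
    by (metis Cauchy_Schwarz_ineq2 mult_right_mono norm_ge_zero order_trans real_norm_def)
qed

text \<open>Lebesgue measure is translation invariant, so every difference quotient has integral 0;
  dominated convergence passes this to the derivative.\<close>

lemma integral_grad_0: fixes f :: "real^'n \<Rightarrow> real" assumes "Cc_inf D f" shows "(LINT x|lebesgue. grad f x $ i) = 0"
proof -
  obtain K where K: "compact K" "K \<subseteq> D" "\<And>x. x \<notin> K \<Longrightarrow> f x = 0" "\<And>x. x \<notin> K \<Longrightarrow> grad f x = 0"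
    using Cc_inf_support[OF assms] by metis
  let ?e = "axis i 1 :: real^'n"
  obtain C where C0: "C \<ge> 0" and C: "\<And>x. \<bar>f x\<bar> \<le> C" "\<And>x. norm (grad f x) \<le> C" using Cc_inf_bounded[OF assms] by blast
  note sm = Cc_infD(1)[OF assms]
  have [measurable]: "f \<in> borel_measurable borel" using sm by (rule smooth_borel)
  have intf: "integrable lborel f"
    using Cc_inf_integrable(1)[OF assms] by (simp add: integrable_completion)
  obtain R where R: "\<And>x. x \<in> K \<Longrightarrow> norm x \<le> R"
    using compact_imp_bounded[OF K(1)] unfolding bounded_iff by blast
  have fR: "f x = 0" if "norm x > R" for x using R[of x] that K(3)[of x] by linarith
  define q where "q k x = (f (x + (1 / real (Suc k)) *\<^sub>R ?e) - f x) * real (Suc k)" for k x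
  have [measurable]: "q k \<in> borel_measurable borel" for k unfolding q_def by measurable
  have q0: "(LINT x|lborel. q k x) = 0" for k
  proof -
    let ?t = "(1 / real (Suc k)) *\<^sub>R ?e"
    have i: "integrable lborel (\<lambda>x. f (?t + x))"
      using intf integrable_distr_eq[of "(+) ?t" lborel borel f] by (simp add: lborel_distr_plus)
    have "(LINT x|lborel. f (?t + x)) = (LINT x|lborel. f x)"
      using integral_distr[of "(+) ?t" lborel borel f] by (simp add: lborel_distr_plus)
    then show ?thesis unfolding q_def using i intf by (simp add: add.commute)
  qed
  have lim: "(\<lambda>k. q k x) \<longlonglongrightarrow> grad f x $ i" for x
  proof -
    have "((\<lambda>t. f (x + t *\<^sub>R ?e)) has_derivative (\<lambda>t. grad f x \<bullet> (t *\<^sub>R ?e))) (at 0)"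
      by (rule has_derivative_compose[of "\<lambda>t. x + t *\<^sub>R ?e" "\<lambda>t. t *\<^sub>R ?e" 0 UNIV f])
        (auto intro!: derivative_eq_intros smooth_has_derivative[OF sm])
    then have "((\<lambda>t. f (x + t *\<^sub>R ?e)) has_real_derivative grad f x $ i) (at 0)"
      by (simp add: has_field_derivative_def inner_axis mult.commute[of _ "grad f x $ i"])
    then have l: "((\<lambda>h. (f (x + h *\<^sub>R ?e) - f x) / h) \<longlongrightarrow> grad f x $ i) (at 0)"
      by (simp add: has_field_derivative_iff)
    have "filterlim (\<lambda>k. 1 / real (Suc k)) (at 0) sequentially"
      using LIMSEQ_inverse_real_of_nat by (auto simp: filterlim_at inverse_eq_divide)
    from filterlim_compose[OF l this] show ?thesis by (simp add: q_def)
  qed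
  \<comment> \<open>The steps have length at most 1, so all quotients vanish off one ball, and the
    mean value inequality bounds them there by \<open>C\<close>.\<close>
  have bound: "norm (q k x) \<le> C * ind (cball 0 (\<bar>R\<bar> + 1)) x" for k x
  proof (cases "x \<in> cball 0 (\<bar>R\<bar> + 1)")
    case True
    let ?t = "(1 / real (Suc k)) *\<^sub>R ?e"
    have "norm (f (x + ?t) - f x) \<le> C * norm (x + ?t - x)"
      by (rule differentiable_bound[where S=UNIV and f'="\<lambda>x h. grad f x \<bullet> h"])
        (simp_all add: smooth_has_derivative[OF sm] onorm_inner_bound[OF C(2) C0])
    also have "\<dots> = C / real (Suc k)" by simp
    finally have "norm (f (x + ?t) - f x) * real (Suc k) \<le> C" by (simp add: field_simps)
    then show ?thesis using True by (simp add: q_def abs_mult)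
  next
    case False
    let ?t = "(1 / real (Suc k)) *\<^sub>R ?e"
    have "norm ?t \<le> 1" by simp
    moreover have "norm x > \<bar>R\<bar> + 1" using False by (simp only: mem_cball_0 not_le)
    ultimately have "norm (x + ?t) > R" "norm x > R"
      using norm_diff_ineq[of x ?t] by linarith+
    then show ?thesis using False fR by (simp add: q_def)
  qed
  have "(\<lambda>k. LINT x|lborel. q k x) \<longlonglongrightarrow> (LINT x|lborel. grad f x $ i)"
  proof (rule integral_dominated_convergence)
    show "integrable lborel (\<lambda>x::real^'n. C * ind (cball 0 (\<bar>R\<bar> + 1)) x)"
      by (intro integrable_mult_right integrable_real_indicator) (use emeasure_lborel_cball_finite[of "0::real^'n" "\<bar>R\<bar> + 1"] in simp_all)
    show "(\<lambda>x. grad f x $ i) \<in> borel_measurable lborel"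
      using smooth_borel[OF smooth_grad[OF sm]] by simp
  qed (use lim bound in auto)
  then have "(LINT x|lborel. grad f x $ i) = 0" using q0 by (simp add: LIMSEQ_const_iff)
  moreover have "(LINT x|lebesgue. grad f x $ i) = (LINT x|lborel. grad f x $ i)"
    using smooth_borel[OF smooth_grad[OF sm]] by (intro integral_completion) simp
  ultimately show ?thesis by simp
qed

lemma integration_by_parts:
  assumes "Cc_inf D f" "smooth_fun g"
  shows "(LINT x|lebesgue. grad f x $ i * g x) = - (LINT x|lebesgue. f x * grad g x $ i)"
proof -
  note f = Cc_infD(1)[OF assms(1)]
  have fg: "Cc_inf D (\<lambda>x. f x * g x)" using Cc_inf_mult assms by blast
  have i1: "integrable lebesgue (\<lambda>x. f x * grad g x $ i)"
    by (rule Cc_inf_integrable(1)[OF Cc_inf_mult(1)[OF assms(1) smooth_grad[OF assms(2)]]])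
  have "integrable lebesgue (\<lambda>x. grad (\<lambda>x. f x * g x) x $ i - f x * grad g x $ i)"
    by (intro Bochner_Integration.integrable_diff Cc_inf_integrable(2)[OF fg] i1)
  then have i2: "integrable lebesgue (\<lambda>x. grad f x $ i * g x)"
    by (simp add: grad_mult[OF f assms(2)] mult.commute)
  have "0 = (LINT x|lebesgue. f x * grad g x $ i + grad f x $ i * g x)"
    using integral_grad_0[OF fg, of i] by (simp add: grad_mult[OF f assms(2)] mult.commute)
  then show ?thesis using i1 i2 by simp
qed

lemma Cc_inf_zero_off: assumes "Cc_inf D f" "x \<notin> D" shows "f x = 0 \<and> grad f x = 0"
proof -
  obtain K where "compact K" "K \<subseteq> D" "\<forall>x. x \<notin> K \<longrightarrow> f x = 0" "\<forall>x. x \<notin> K \<longrightarrow> grad f x = 0"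
    using Cc_inf_support[OF assms(1)] by (elim exE conjE)
  then show ?thesis using assms(2) by auto
qed

section \<open>The Sobolev space\<close>

text \<open>The Sobolev space with integrals over the whole space: for open D its elements vanish
  almost everywhere off D, see \<open>W_zero_outside\<close>. \<open>H10_grad_iff\<close> translates
  between the two descriptions by restriction to D.\<close>

definition W :: "(real^'n) set \<Rightarrow> (real^'n \<Rightarrow> real) \<Rightarrow> (real^'n \<Rightarrow> real^'n) \<Rightarrow> bool" where
  "W D u g \<longleftrightarrow> L2 u \<and> L2 g \<and> (\<exists>\<phi>. (\<forall>k. Cc_inf D (\<phi> k))
     \<and> (\<lambda>k. nrm2 (\<lambda>x. \<phi> k x - u x)) \<longlonglongrightarrow> 0 \<and> (\<lambda>k. nrm2 (\<lambda>x. grad (\<phi> k) x - g x)) \<longlonglongrightarrow> 0)"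

lemma WI:
  assumes "L2 u" "L2 g" "\<And>k. Cc_inf D (\<phi> k)" "(\<lambda>k. nrm2 (\<lambda>x. \<phi> k x - u x)) \<longlonglongrightarrow> 0"
    "(\<lambda>k. nrm2 (\<lambda>x. grad (\<phi> k) x - g x)) \<longlonglongrightarrow> 0"
  shows "W D u g"
  unfolding W_def using assms by (intro conjI exI[of _ \<phi>] allI)

lemma WE:
  assumes "W D u g"
  obtains \<phi> where "\<forall>k. Cc_inf D (\<phi> k)" "(\<lambda>k. nrm2 (\<lambda>x. \<phi> k x - u x)) \<longlonglongrightarrow> 0"
    "(\<lambda>k. nrm2 (\<lambda>x. grad (\<phi> k) x - g x)) \<longlonglongrightarrow> 0"
  using assms unfolding W_def by (elim exE conjE)

lemma W_L2: "W D u g \<Longrightarrow> L2 u" "W D u g \<Longrightarrow> L2 g"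
  by (simp_all add: W_def)

lemma W_Cc: "Cc_inf D \<phi> \<Longrightarrow> W D \<phi> (grad \<phi>)"
  by (rule WI[where \<phi>="\<lambda>k. \<phi>"]) (simp_all add: Cc_inf_L2)

lemma tendsto_0_le:
  assumes "f \<longlonglongrightarrow> (0::real)" "\<And>k. 0 \<le> g k" "\<And>k. g k \<le> f k" shows "g \<longlonglongrightarrow> 0"
  by (rule tendsto_sandwich[OF _ _ tendsto_const assms(1)]) (use assms in auto)

lemma W_add: assumes "W D u g" "W D v h" shows "W D (\<lambda>x. u x + v x) (\<lambda>x. g x + h x)"
proof -
  obtain \<phi> where f0: "\<forall>k. Cc_inf D (\<phi> k)" "(\<lambda>k. nrm2 (\<lambda>x. \<phi> k x - u x)) \<longlonglongrightarrow> 0"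
    "(\<lambda>k. nrm2 (\<lambda>x. grad (\<phi> k) x - g x)) \<longlonglongrightarrow> 0"
    by (rule WE[OF assms(1)])
  note f = f0(1)[rule_format] f0(2,3)
  obtain \<psi> where p0: "\<forall>k. Cc_inf D (\<psi> k)" "(\<lambda>k. nrm2 (\<lambda>x. \<psi> k x - v x)) \<longlonglongrightarrow> 0"
    "(\<lambda>k. nrm2 (\<lambda>x. grad (\<psi> k) x - h x)) \<longlonglongrightarrow> 0"
    by (rule WE[OF assms(2)])
  note p = p0(1)[rule_format] p0(2,3)
  note L = W_L2[OF assms(1)] W_L2[OF assms(2)] Cc_inf_L2[OF f(1)] Cc_inf_L2[OF p(1)]
  show ?thesis
  proof (rule WI[where \<phi>="\<lambda>k x. \<phi> k x + \<psi> k x"])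
    show "(\<lambda>k. nrm2 (\<lambda>x. \<phi> k x + \<psi> k x - (u x + v x))) \<longlonglongrightarrow> 0"
    proof (rule tendsto_0_le)
      show "(\<lambda>k. nrm2 (\<lambda>x. \<phi> k x - u x) + nrm2 (\<lambda>x. \<psi> k x - v x)) \<longlonglongrightarrow> 0"
        using tendsto_add[OF f(2) p(2)] by simp
      show "nrm2 (\<lambda>x. \<phi> k x + \<psi> k x - (u x + v x)) \<le> nrm2 (\<lambda>x. \<phi> k x - u x) + nrm2 (\<lambda>x. \<psi> k x - v x)" for k
        using nrm2_triangle[OF L2_diff[OF L(5) L(1)] L2_diff[OF L(7) L(3)], of k k] by (simp add: algebra_simps)
    qed simp
    show "(\<lambda>k. nrm2 (\<lambda>x. grad (\<lambda>x. \<phi> k x + \<psi> k x) x - (g x + h x))) \<longlonglongrightarrow> 0"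
    proof (rule tendsto_0_le)
      show "(\<lambda>k. nrm2 (\<lambda>x. grad (\<phi> k) x - g x) + nrm2 (\<lambda>x. grad (\<psi> k) x - h x)) \<longlonglongrightarrow> 0"
        using tendsto_add[OF f(3) p(3)] by simp
      show "nrm2 (\<lambda>x. grad (\<lambda>x. \<phi> k x + \<psi> k x) x - (g x + h x)) \<le> nrm2 (\<lambda>x. grad (\<phi> k) x - g x) + nrm2 (\<lambda>x. grad (\<psi> k) x - h x)" for k
        using nrm2_triangle[OF L2_diff[OF L(6) L(2)] L2_diff[OF L(8) L(4)], of k k]
        by (simp add: algebra_simps grad_add[OF Cc_infD(1)[OF f(1)] Cc_infD(1)[OF p(1)]])
    qed simp
  qed (simp_all add: L2_add L Cc_inf_add f p)
qed

lemma W_scale: assumes "W D u g" shows "W D (\<lambda>x. c * u x) (\<lambda>x. c *\<^sub>R g x)"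
proof -
  obtain \<phi> where f0: "\<forall>k. Cc_inf D (\<phi> k)" "(\<lambda>k. nrm2 (\<lambda>x. \<phi> k x - u x)) \<longlonglongrightarrow> 0"
    "(\<lambda>k. nrm2 (\<lambda>x. grad (\<phi> k) x - g x)) \<longlonglongrightarrow> 0"
    by (rule WE[OF assms(1)])
  note f = f0(1)[rule_format] f0(2,3)
  show ?thesis
  proof (rule WI[where \<phi>="\<lambda>k x. c * \<phi> k x"])
    show "(\<lambda>k. nrm2 (\<lambda>x. c * \<phi> k x - c * u x)) \<longlonglongrightarrow> 0"
      using tendsto_mult_right[OF f(2), of "\<bar>c\<bar>"] nrm2_scaleR[of c "\<lambda>x. \<phi> _ x - u x"]
      by (simp add: algebra_simps)
    show "(\<lambda>k. nrm2 (\<lambda>x. grad (\<lambda>x. c * \<phi> k x) x - c *\<^sub>R g x)) \<longlonglongrightarrow> 0"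
      using tendsto_mult_right[OF f(3), of "\<bar>c\<bar>"] nrm2_scaleR[of c "\<lambda>x. grad (\<phi> _) x - g x"]
      by (simp add: algebra_simps grad_cmult[OF Cc_infD(1)[OF f(1)]])
  qed (simp_all add: L2_mult L2_scaleR W_L2[OF assms] Cc_inf_cmult f)
qed

lemma W_diff: assumes "W D u g" "W D v h" shows "W D (\<lambda>x. u x - v x) (\<lambda>x. g x - h x)"
  using W_add[OF assms(1) W_scale[OF assms(2), of "-1"]] by simp

lemma W_lin: assumes "W D u g" "W D v h" shows "W D (\<lambda>x. a * u x + b * v x) (\<lambda>x. a *\<^sub>R g x + b *\<^sub>R h x)"
  by (intro W_add W_scale assms)

lemma W_zero: "W D (\<lambda>x. 0) (\<lambda>x. 0)"
  by (rule WI[where \<phi>="\<lambda>k x. 0"]) (simp_all add: grad_const)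

lemma W_approx:
  assumes "W D u g" "e > 0"
  shows "\<exists>\<phi>. Cc_inf D \<phi> \<and> nrm2 (\<lambda>x. \<phi> x - u x) < e \<and> nrm2 (\<lambda>x. grad \<phi> x - g x) < e"
proof -
  obtain \<phi> where f0: "\<forall>k. Cc_inf D (\<phi> k)" "(\<lambda>k. nrm2 (\<lambda>x. \<phi> k x - u x)) \<longlonglongrightarrow> 0"
    "(\<lambda>k. nrm2 (\<lambda>x. grad (\<phi> k) x - g x)) \<longlonglongrightarrow> 0"
    by (rule WE[OF assms(1)])
  note f = f0(1)[rule_format] f0(2,3)
  have "eventually (\<lambda>k. nrm2 (\<lambda>x. \<phi> k x - u x) < e \<and> nrm2 (\<lambda>x. grad (\<phi> k) x - g x) < e) sequentially"
    using order_tendstoD(2)[OF f(2) assms(2)] order_tendstoD(2)[OF f(3) assms(2)] by (rule eventually_conj)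
  from eventually_happens'[OF sequentially_bot this]
  obtain k where "nrm2 (\<lambda>x. \<phi> k x - u x) < e \<and> nrm2 (\<lambda>x. grad (\<phi> k) x - g x) < e" by (elim exE)
  then show ?thesis using f(1) by (intro exI[of _ "\<phi> k"] conjI) simp_all
qed

lemma W_closed:
  assumes "\<And>k. W D (u k) (g k)" "L2 v" "L2 h" "(\<lambda>k. nrm2 (\<lambda>x. u k x - v x)) \<longlonglongrightarrow> 0"
    "(\<lambda>k. nrm2 (\<lambda>x. g k x - h x)) \<longlonglongrightarrow> 0"
  shows "W D v h"
proof -
  have "\<forall>k. \<exists>\<phi>. Cc_inf D \<phi> \<and> nrm2 (\<lambda>x. \<phi> x - u k x) < 1 / real (Suc k) \<and> nrm2 (\<lambda>x. grad \<phi> x - g k x) < 1 / real (Suc k)"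
    by (intro allI W_approx[OF assms(1)]) simp
  then obtain \<phi> where f: "\<And>k. Cc_inf D (\<phi> k)" "\<And>k. nrm2 (\<lambda>x. \<phi> k x - u k x) < 1 / real (Suc k)"
    "\<And>k. nrm2 (\<lambda>x. grad (\<phi> k) x - g k x) < 1 / real (Suc k)" by metis
  have lim: "(\<lambda>k. 1 / real (Suc k)) \<longlonglongrightarrow> 0"
    using LIMSEQ_inverse_real_of_nat by (simp add: inverse_eq_divide)
  note L = Cc_inf_L2[OF f(1)] W_L2[OF assms(1)] assms(2,3)
  show ?thesis
  proof (rule WI[where \<phi>=\<phi>])
    show "(\<lambda>k. nrm2 (\<lambda>x. \<phi> k x - v x)) \<longlonglongrightarrow> 0"
    proof (rule tendsto_0_le)
      show "(\<lambda>k. 1 / real (Suc k) + nrm2 (\<lambda>x. u k x - v x)) \<longlonglongrightarrow> 0"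
        using tendsto_add[OF lim assms(4)] by simp
      show "nrm2 (\<lambda>x. \<phi> k x - v x) \<le> 1 / real (Suc k) + nrm2 (\<lambda>x. u k x - v x)" for k
        using nrm2_triangle_diff[OF L(1) L(3) L(5), of k k] f(2)[of k] by simp
    qed simp
    show "(\<lambda>k. nrm2 (\<lambda>x. grad (\<phi> k) x - h x)) \<longlonglongrightarrow> 0"
    proof (rule tendsto_0_le)
      show "(\<lambda>k. 1 / real (Suc k) + nrm2 (\<lambda>x. g k x - h x)) \<longlonglongrightarrow> 0"
        using tendsto_add[OF lim assms(5)] by simp
      show "nrm2 (\<lambda>x. grad (\<phi> k) x - h x) \<le> 1 / real (Suc k) + nrm2 (\<lambda>x. g k x - h x)" for k
        using nrm2_triangle_diff[OF L(2) L(4) L(6), of k k] f(3)[of k] by simp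
    qed simp
  qed (use assms f in auto)
qed

lemma L2_bdd_mult:
  fixes f :: "'a::euclidean_space \<Rightarrow> 'b::euclidean_space"
  assumes "L2 f" "\<psi> \<in> LM" "\<And>x. \<bar>\<psi> x\<bar> \<le> C"
  shows "L2 (\<lambda>x. \<psi> x *\<^sub>R f x)" "nrm2 (\<lambda>x. \<psi> x *\<^sub>R f x) \<le> C * nrm2 f"
proof -
  have m: "(\<lambda>x. \<psi> x *\<^sub>R f x) \<in> LM" by (intro borel_measurable_scaleR L2_meas assms)
  have "0 \<le> C" using order_trans[OF abs_ge_zero assms(3)[of undefined]] .
  moreover have "AE x in lebesgue. norm (\<psi> x *\<^sub>R f x) \<le> C * norm (f x)"
    using assms(3) by (simp add: mult_right_mono)
  ultimately show "L2 (\<lambda>x. \<psi> x *\<^sub>R f x)" "nrm2 (\<lambda>x. \<psi> x *\<^sub>R f x) \<le> C * nrm2 f"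
    using L2_mono[OF m assms(1)] by auto
qed

lemma L2_bdd_mult_vec:
  fixes u :: "'a::euclidean_space \<Rightarrow> real" and G :: "'a \<Rightarrow> 'b::euclidean_space"
  assumes "L2 u" "G \<in> LM" "\<And>x. norm (G x) \<le> C"
  shows "L2 (\<lambda>x. u x *\<^sub>R G x)" "nrm2 (\<lambda>x. u x *\<^sub>R G x) \<le> C * nrm2 u"
proof -
  have m: "(\<lambda>x. u x *\<^sub>R G x) \<in> LM" by (intro borel_measurable_scaleR L2_meas assms)
  have "0 \<le> C" using order_trans[OF norm_ge_zero assms(3)[of undefined]] .
  moreover have "AE x in lebesgue. norm (u x *\<^sub>R G x) \<le> C * norm (u x)"
    using mult_left_mono[OF assms(3) abs_ge_zero] by (intro AE_I2) (simp add: mult.commute)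
  ultimately show "L2 (\<lambda>x. u x *\<^sub>R G x)" "nrm2 (\<lambda>x. u x *\<^sub>R G x) \<le> C * nrm2 u"
    using L2_mono[OF m assms(1)] by auto
qed

lemma W_mult:
  assumes "W D u g" and s: "smooth_fun \<psi>" and C: "\<And>x. \<bar>\<psi> x\<bar> \<le> C" "\<And>x. norm (grad \<psi> x) \<le> C"
  shows "W D (\<lambda>x. \<psi> x * u x) (\<lambda>x. \<psi> x *\<^sub>R g x + u x *\<^sub>R grad \<psi> x)"
proof -
  obtain \<phi> where f0: "\<forall>k. Cc_inf D (\<phi> k)" "(\<lambda>k. nrm2 (\<lambda>x. \<phi> k x - u x)) \<longlonglongrightarrow> 0"
    "(\<lambda>k. nrm2 (\<lambda>x. grad (\<phi> k) x - g x)) \<longlonglongrightarrow> 0"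
    by (rule WE[OF assms(1)])
  note f = f0(1)[rule_format] f0(2,3)
  note m = smooth_lebesgue[OF s]
  note L = Cc_inf_L2[OF f(1)] W_L2[OF assms(1)]
  have d1: "L2 (\<lambda>x. \<phi> k x - u x)" and d2: "L2 (\<lambda>x. grad (\<phi> k) x - g x)" for k
    using L by (auto intro: L2_diff)
  show ?thesis
  proof (rule WI[where \<phi>="\<lambda>k x. \<psi> x * \<phi> k x"])
    show "L2 (\<lambda>x. \<psi> x * u x)" using L2_bdd_mult(1)[OF L(3) m(1) C(1)] by simp
    show "L2 (\<lambda>x. \<psi> x *\<^sub>R g x + u x *\<^sub>R grad \<psi> x)"
      by (intro L2_add L2_bdd_mult(1)[OF L(4) m(1) C(1)] L2_bdd_mult_vec(1)[OF L(3) m(2) C(2)])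
    show "(\<lambda>k. nrm2 (\<lambda>x. \<psi> x * \<phi> k x - \<psi> x * u x)) \<longlonglongrightarrow> 0"
    proof (rule tendsto_0_le)
      show "(\<lambda>k. C * nrm2 (\<lambda>x. \<phi> k x - u x)) \<longlonglongrightarrow> 0"
        using tendsto_mult_right_zero[OF f(2)] by simp
      show "nrm2 (\<lambda>x. \<psi> x * \<phi> k x - \<psi> x * u x) \<le> C * nrm2 (\<lambda>x. \<phi> k x - u x)" for k
        using L2_bdd_mult(2)[OF d1 m(1) C(1), of k] by (simp add: right_diff_distrib)
    qed simp
    show "(\<lambda>k. nrm2 (\<lambda>x. grad (\<lambda>x. \<psi> x * \<phi> k x) x - (\<psi> x *\<^sub>R g x + u x *\<^sub>R grad \<psi> x))) \<longlonglongrightarrow> 0"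
    proof (rule tendsto_0_le)
      show "(\<lambda>k. C * nrm2 (\<lambda>x. grad (\<phi> k) x - g x) + C * nrm2 (\<lambda>x. \<phi> k x - u x)) \<longlonglongrightarrow> 0"
        using tendsto_add[OF tendsto_mult_right_zero[OF f(3), of C] tendsto_mult_right_zero[OF f(2), of C]] by simp
      fix k
      have "nrm2 (\<lambda>x. grad (\<lambda>x. \<psi> x * \<phi> k x) x - (\<psi> x *\<^sub>R g x + u x *\<^sub>R grad \<psi> x))
        = nrm2 (\<lambda>x. \<psi> x *\<^sub>R (grad (\<phi> k) x - g x) + (\<phi> k x - u x) *\<^sub>R grad \<psi> x)"
        by (simp add: grad_mult[OF s Cc_infD(1)[OF f(1)]] algebra_simps)
      also have "\<dots> \<le> C * nrm2 (\<lambda>x. grad (\<phi> k) x - g x) + C * nrm2 (\<lambda>x. \<phi> k x - u x)"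
        using nrm2_triangle[OF L2_bdd_mult(1)[OF d2 m(1) C(1)] L2_bdd_mult_vec(1)[OF d1 m(2) C(2)], of k k]
          L2_bdd_mult(2)[OF d2 m(1) C(1), of k] L2_bdd_mult_vec(2)[OF d1 m(2) C(2), of k] by simp
      finally show "nrm2 (\<lambda>x. grad (\<lambda>x. \<psi> x * \<phi> k x) x - (\<psi> x *\<^sub>R g x + u x *\<^sub>R grad \<psi> x))
        \<le> C * nrm2 (\<lambda>x. grad (\<phi> k) x - g x) + C * nrm2 (\<lambda>x. \<phi> k x - u x)" .
    qed simp
  qed (simp add: Cc_inf_mult(2) f s)
qed

lemma W_mult_Cc:
  assumes "W D u g" "Cc_inf D' \<psi>"
  shows "W D (\<lambda>x. \<psi> x * u x) (\<lambda>x. \<psi> x *\<^sub>R g x + u x *\<^sub>R grad \<psi> x)"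
proof -
  obtain C where "\<forall>x. \<bar>\<psi> x\<bar> \<le> C \<and> norm (grad \<psi> x) \<le> C" using Cc_inf_bounded[OF assms(2)] by metis
  then show ?thesis using W_mult[OF assms(1) Cc_infD(1)[OF assms(2)], of C] by simp
qed

lemma nrm2_restrict_le: "L2 f \<Longrightarrow> S \<in> sets lebesgue \<Longrightarrow> L2 (res S f)"
  "L2 f \<Longrightarrow> S \<in> sets lebesgue \<Longrightarrow> nrm2 (res S f) \<le> nrm2 f"
  using L2_bdd_mult[of f "ind S" 1] by (auto simp: indicator_def)

text \<open>The approximating functions vanish off D, so the norm of u there is at most the
  approximation error; likewise for g.\<close>

lemma W_zero_outside:
  assumes "W D u g" "open D"
  shows "AE x in lebesgue. x \<notin> D \<longrightarrow> u x = 0 \<and> g x = 0"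
proof -
  obtain \<phi> where f0: "\<forall>k. Cc_inf D (\<phi> k)" "(\<lambda>k. nrm2 (\<lambda>x. \<phi> k x - u x)) \<longlonglongrightarrow> 0"
    "(\<lambda>k. nrm2 (\<lambda>x. grad (\<phi> k) x - g x)) \<longlonglongrightarrow> 0"
    by (rule WE[OF assms(1)])
  note f = f0(1)[rule_format] f0(2,3)
  note L = Cc_inf_L2[OF f(1)] W_L2[OF assms(1)]
  have S: "- D \<in> sets lebesgue" using assms(2) by (auto simp: Compl_in_sets_lebesgue)
  have z: "\<phi> k x = 0" "grad (\<phi> k) x = 0" if "x \<notin> D" for k x
    using Cc_inf_zero_off[OF f(1) that] by auto
  have "nrm2 (res (-D) u) \<le> nrm2 (\<lambda>x. \<phi> k x - u x)" for k
  proof -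
    have "(res (-D) (\<lambda>x. \<phi> k x - u x)) = (\<lambda>x. - (ind (-D) x *\<^sub>R u x))"
      using z(1) by (auto simp: indicator_def)
    then show ?thesis using nrm2_restrict_le(2)[OF L2_diff[OF L(1) L(3)] S, of k] nrm2_minus[of "res (-D) u"]
      by metis
  qed
  then have 1: "nrm2 (res (-D) u) = 0"
    using LIMSEQ_le_const[OF f(2)] nrm2_nonneg by (meson order_antisym)
  have "nrm2 (res (-D) g) \<le> nrm2 (\<lambda>x. grad (\<phi> k) x - g x)" for k
  proof -
    have "(res (-D) (\<lambda>x. grad (\<phi> k) x - g x)) = (\<lambda>x. - (ind (-D) x *\<^sub>R g x))"
      using z(2) by (auto simp: indicator_def)
    then show ?thesis using nrm2_restrict_le(2)[OF L2_diff[OF L(2) L(4)] S, of k] nrm2_minus[of "res (-D) g"]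
      by metis
  qed
  then have 2: "nrm2 (res (-D) g) = 0"
    using LIMSEQ_le_const[OF f(3)] nrm2_nonneg by (meson order_antisym)
  have "AE x in lebesgue. ind (-D) x *\<^sub>R u x = 0" "AE x in lebesgue. ind (-D) x *\<^sub>R g x = 0"
    by (rule nrm2_eq_0[OF nrm2_restrict_le(1)[OF L(3) S] 1], rule nrm2_eq_0[OF nrm2_restrict_le(1)[OF L(4) S] 2])
  then show ?thesis by eventually_elim (auto simp: indicator_def split: if_splits)
qed

text \<open>The integral of the i-th derivative of \<open>x $ i * (\<phi> x * \<phi> x)\<close> is
  0. This expresses the integral of the square of \<phi> by a product of \<phi> and one of its
  derivatives with weight \<open>x $ i\<close>, and after Cauchy-Schwarz one factor
  \<open>nrm2 \<phi>\<close> cancels.\<close>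

lemma poincare_Cc:
  assumes "Cc_inf D \<phi>" "\<And>x. x \<in> D \<Longrightarrow> norm x \<le> R" "0 \<le> R"
  shows "nrm2 \<phi> \<le> 2 * R * nrm2 (grad \<phi>)"
proof -
  fix i :: 'a
  note sm = Cc_infD(1)[OF assms(1)]
  let ?p = "\<lambda>x. x $ i * (\<phi> x * \<phi> x)"
  have c1: "Cc_inf D (\<lambda>x. \<phi> x * \<phi> x)" by (rule Cc_inf_mult(1)[OF assms(1) sm])
  have c: "Cc_inf D ?p" by (rule Cc_inf_mult(2)[OF c1 smooth_coord])
  have z: "\<phi> x = 0" if "x \<notin> D" for x
    using Cc_inf_zero_off[OF assms(1) that] by auto
  have g: "grad ?p x $ i = (\<phi> x)\<^sup>2 + 2 * (x $ i * (\<phi> x * grad \<phi> x $ i))" for x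
    unfolding grad_mult[OF smooth_coord Cc_infD(1)[OF c1]] grad_mult[OF sm sm] grad_coord
    by (simp add: power2_eq_square algebra_simps)
  have i0: "integrable lebesgue (\<lambda>x. (\<phi> x)\<^sup>2)" using L2_int[OF Cc_inf_L2(1)[OF assms(1)]] by simp
  have "integrable lebesgue (\<lambda>x. grad ?p x $ i - (\<phi> x)\<^sup>2)"
    by (intro Bochner_Integration.integrable_diff i0 Cc_inf_integrable(2)[OF c])
  then have i1: "integrable lebesgue (\<lambda>x. 2 * (x $ i * (\<phi> x * grad \<phi> x $ i)))" by (simp add: g)
  have i2: "integrable lebesgue (\<lambda>x. norm (\<phi> x) * norm (grad \<phi> x))"
    by (intro L2_mult_integrable Cc_inf_L2[OF assms(1)])
  have "(nrm2 \<phi>)\<^sup>2 = (LINT x|lebesgue. (\<phi> x)\<^sup>2)" by (simp add: nrm2_sq)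
  also have "\<dots> = (LINT x|lebesgue. - (2 * (x $ i * (\<phi> x * grad \<phi> x $ i))))"
    using integral_grad_0[OF c, of i] i0 i1 by (simp add: g)
  also have "\<dots> \<le> (LINT x|lebesgue. 2 * R * (norm (\<phi> x) * norm (grad \<phi> x)))"
  proof (intro integral_mono)
    fix x
    show "- (2 * (x $ i * (\<phi> x * grad \<phi> x $ i))) \<le> 2 * R * (norm (\<phi> x) * norm (grad \<phi> x))"
    proof (cases "x \<in> D")
      case True
      have "\<bar>x $ i\<bar> * (\<bar>\<phi> x\<bar> * \<bar>grad \<phi> x $ i\<bar>) \<le> R * (\<bar>\<phi> x\<bar> * norm (grad \<phi> x))"
        using assms(2)[OF True] component_le_norm_cart[of x i] component_le_norm_cart[of "grad \<phi> x" i] assms(3)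
        by (intro mult_mono mult_left_mono) auto
      then have "\<bar>x $ i * (\<phi> x * grad \<phi> x $ i)\<bar> \<le> R * (norm (\<phi> x) * norm (grad \<phi> x))"
        by (simp add: abs_mult)
      then show ?thesis by linarith
    qed (simp add: z)
  qed (use i1 i2 in auto)
  also have "\<dots> = 2 * R * (LINT x|lebesgue. norm (\<phi> x) * norm (grad \<phi> x))" by simp
  also have "\<dots> \<le> 2 * R * (nrm2 \<phi> * nrm2 (grad \<phi>))"
    using CS_norm[OF Cc_inf_L2[OF assms(1)]] assms(3) by (intro mult_left_mono) auto
  finally have "nrm2 \<phi> * nrm2 \<phi> \<le> nrm2 \<phi> * (2 * R * nrm2 (grad \<phi>))"
    by (simp add: power2_eq_square mult.assoc mult.left_commute)
  then show ?thesis
    using nrm2_nonneg[of \<phi>] nrm2_nonneg[of "grad \<phi>"] assms(3)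
    by (cases "nrm2 \<phi> = 0") (auto simp: mult_le_cancel_left)
qed

lemma poincare_W:
  assumes "bounded D"
  shows "\<exists>C\<ge>0. \<forall>u g. W D u g \<longrightarrow> nrm2 u \<le> C * nrm2 g"
proof -
  obtain R where R: "\<forall>x\<in>D. norm x \<le> R" using assms unfolding bounded_iff by metis
  show ?thesis
  proof (intro exI[of _ "2 * \<bar>R\<bar>"] conjI allI impI)
    fix u g assume w: "W D u g"
    obtain \<phi> where f0: "\<forall>k. Cc_inf D (\<phi> k)" "(\<lambda>k. nrm2 (\<lambda>x. \<phi> k x - u x)) \<longlonglongrightarrow> 0"
      "(\<lambda>k. nrm2 (\<lambda>x. grad (\<phi> k) x - g x)) \<longlonglongrightarrow> 0"
    by (rule WE[OF w])
  note f = f0(1)[rule_format] f0(2,3)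
    note L = Cc_inf_L2[OF f(1)] W_L2[OF w]
    have "nrm2 (\<phi> k) \<le> 2 * \<bar>R\<bar> * nrm2 (grad (\<phi> k))" for k
      by (rule poincare_Cc[OF f(1)]) (use R in \<open>auto intro: order_trans[OF _ abs_ge_self]\<close>)
    then show "nrm2 u \<le> 2 * \<bar>R\<bar> * nrm2 g"
      by (intro LIMSEQ_le[OF nrm2_tendsto[OF L(1) L(3) f(2)] tendsto_mult_left[OF nrm2_tendsto[OF L(2) L(4) f(3)]]]) auto
  qed simp
qed

lemma L2_component: fixes g :: "real^'n \<Rightarrow> real^'n" assumes "L2 g" shows "L2 (\<lambda>x. g x $ i)"
proof (rule L2_mono(1)[OF _ assms, of _ 1])
  have "(\<lambda>x. g x \<bullet> axis i 1) \<in> LM"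
    by (intro borel_measurable_inner L2_meas[OF assms]) simp
  then show "(\<lambda>x. g x $ i) \<in> LM" by (simp add: inner_axis)
  show "AE x in lebesgue. norm (g x $ i) \<le> 1 * norm (g x)" by (simp add: component_le_norm_cart)
qed simp

text \<open>The Laplacian of \<psi> takes over all derivatives, so the right-hand side depends
  continuously on \<phi> in L2 alone.\<close>

lemma grad_inner_by_parts:
  assumes "Cc_inf D \<phi>" "Cc_inf D' \<psi>"
  shows "(LINT x|lebesgue. grad \<phi> x \<bullet> grad \<psi> x) = - (LINT x|lebesgue. \<phi> x * (\<Sum>i\<in>UNIV. grad (\<lambda>x. grad \<psi> x $ i) x $ i))"
proof -
  note s = Cc_infD(1)[OF assms(1)] Cc_infD(1)[OF assms(2)]
  have i1: "integrable lebesgue (\<lambda>x. grad \<phi> x $ i * grad \<psi> x $ i)" for i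
    by (intro L2_mult_integrable_real L2_component Cc_inf_L2(2)[OF assms(1)] Cc_inf_L2(2)[OF assms(2)])
  have i2: "integrable lebesgue (\<lambda>x. \<phi> x * grad (\<lambda>x. grad \<psi> x $ i) x $ i)" for i
    by (rule Cc_inf_integrable(1)[OF Cc_inf_mult(1)[OF assms(1) smooth_grad[OF smooth_grad[OF s(2)]]]])
  have "(LINT x|lebesgue. grad \<phi> x \<bullet> grad \<psi> x) = (LINT x|lebesgue. (\<Sum>i\<in>UNIV. grad \<phi> x $ i * grad \<psi> x $ i))"
    by (simp add: inner_vec_def)
  also have "\<dots> = (\<Sum>i\<in>UNIV. (LINT x|lebesgue. grad \<phi> x $ i * grad \<psi> x $ i))"
    by (rule Bochner_Integration.integral_sum) (rule i1)
  also have "\<dots> = (\<Sum>i\<in>UNIV. - (LINT x|lebesgue. \<phi> x * grad (\<lambda>x. grad \<psi> x $ i) x $ i))"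
    by (intro sum.cong refl integration_by_parts[OF assms(1) smooth_grad[OF s(2)]])
  also have "\<dots> = - (LINT x|lebesgue. (\<Sum>i\<in>UNIV. \<phi> x * grad (\<lambda>x. grad \<psi> x $ i) x $ i))"
    by (subst Bochner_Integration.integral_sum) (simp_all add: i2 sum_negf)
  finally show ?thesis by (simp add: sum_distrib_left)
qed

text \<open>Pair the gradients of two approximants and integrate by parts. Letting the first
  approximant tend to u = 0 shows that g is orthogonal to the gradient of the second; letting the
  second vary gives that g is orthogonal to itself. Uniqueness is what lets a functional of the
  gradient be a functional of the function.\<close>

lemma W_grad_unique_0:
  assumes "W D u g" "AE x in lebesgue. u x = 0"
  shows "AE x in lebesgue. g x = 0"
proof -
  obtain \<phi> where f0: "\<forall>k. Cc_inf D (\<phi> k)" "(\<lambda>k. nrm2 (\<lambda>x. \<phi> k x - u x)) \<longlonglongrightarrow> 0"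
    "(\<lambda>k. nrm2 (\<lambda>x. grad (\<phi> k) x - g x)) \<longlonglongrightarrow> 0"
    by (rule WE[OF assms(1)])
  note f = f0(1)[rule_format] f0(2,3)
  note L = Cc_inf_L2[OF f(1)] W_L2[OF assms(1)]
  have "(LINT x|lebesgue. grad (\<phi> k) x \<bullet> g x) = 0" for k
  proof -
    let ?l = "\<lambda>x. \<Sum>i\<in>UNIV. grad (\<lambda>x. grad (\<phi> k) x $ i) x $ i"
    note s = Cc_infD(1)[OF f(1)[of k]]
    obtain K where K: "compact K" "K \<subseteq> D" "\<forall>x. x \<notin> K \<longrightarrow> \<phi> k x = 0" "\<forall>x. x \<notin> K \<longrightarrow> grad (\<phi> k) x = 0"
      using Cc_inf_support[OF f(1)[of k]] by metis
    have "Cc_inf D (\<lambda>x. grad (\<phi> k) x $ i)" for i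
      by (rule Cc_inf_sub[OF smooth_grad[OF s] K(1,2)]) (use K(4) in auto)
    then have li: "L2 (\<lambda>x. grad (\<lambda>x. grad (\<phi> k) x $ i) x $ i)" for i
      by (intro L2_component Cc_inf_L2(2))
    have "L2 (\<lambda>x. \<Sum>i\<in>I. grad (\<lambda>x. grad (\<phi> k) x $ i) x $ i)" for I
      by (induction I rule: infinite_finite_induct) (simp_all add: L2_add li)
    then have l: "L2 ?l" .
    have "(\<lambda>m. LINT x|lebesgue. grad (\<phi> m) x \<bullet> grad (\<phi> k) x) \<longlonglongrightarrow> (LINT x|lebesgue. g x \<bullet> grad (\<phi> k) x)"
      by (rule L2_inner_tendsto[OF L(2) L(4) f(3) L(2)])
    moreover have "(\<lambda>m. LINT x|lebesgue. \<phi> m x \<bullet> ?l x) \<longlonglongrightarrow> (LINT x|lebesgue. u x \<bullet> ?l x)"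
      by (rule L2_inner_tendsto[OF L(1) L(3) f(2) l])
    then have "(\<lambda>m. LINT x|lebesgue. grad (\<phi> m) x \<bullet> grad (\<phi> k) x) \<longlonglongrightarrow> - (LINT x|lebesgue. u x \<bullet> ?l x)"
      by (subst grad_inner_by_parts[OF f(1) f(1)]) (rule tendsto_minus, simp)
    moreover have "AE x in lebesgue. u x \<bullet> ?l x = 0" using assms(2) by eventually_elim simp
    then have "(LINT x|lebesgue. u x \<bullet> ?l x) = 0" by (rule integral_eq_zero_AE)
    ultimately have "(LINT x|lebesgue. g x \<bullet> grad (\<phi> k) x) = 0"
      using LIMSEQ_unique by fastforce
    then show ?thesis by (simp add: inner_commute)
  qed
  then have "(LINT x|lebesgue. g x \<bullet> g x) = 0"
    using L2_inner_tendsto[OF L(2) L(4) f(3) L(4)] by (simp add: LIMSEQ_const_iff)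
  then have "nrm2 g = 0" by (simp add: nrm2_def power2_norm_eq_inner)
  then show ?thesis by (rule nrm2_eq_0[OF L(4)])
qed

lemma W_grad_unique:
  assumes "W D u g" "W D v h" "AE x in lebesgue. u x = v x"
  shows "AE x in lebesgue. g x = h x"
proof -
  have "AE x in lebesgue. g x - h x = 0"
    by (rule W_grad_unique_0[OF W_diff[OF assms(1,2)]]) (use assms(3) in auto)
  then show ?thesis by simp
qed

lemma L2_of_nn_integral:
  fixes f :: "'a::euclidean_space \<Rightarrow> 'b::euclidean_space"
  assumes "f \<in> LM" "(\<integral>\<^sup>+x. ennreal ((norm (f x))\<^sup>2) \<partial>lebesgue) < \<infinity>"
  shows "L2 f"
  using assms unfolding L2_def by (simp add: integrable_iff_bounded)

lemma L2_approx_nn: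
  fixes v :: "'a::euclidean_space \<Rightarrow> 'b::euclidean_space"
  assumes p: "\<And>k. L2 (p k)" and z: "\<And>k x. x \<notin> D \<Longrightarrow> p k x = 0" and D: "D \<in> sets lebesgue"
    and v: "set_borel_measurable lebesgue D v"
    and lim: "(\<lambda>k. \<integral>\<^sup>+x\<in>D. ennreal ((norm (p k x - v x))\<^sup>2) \<partial>lebesgue) \<longlonglongrightarrow> 0"
  shows "L2 (res D v)" "(\<lambda>k. nrm2 (\<lambda>x. p k x - ind D x *\<^sub>R v x)) \<longlonglongrightarrow> 0"
proof -
  let ?v = "res D v"
  have vm: "?v \<in> LM" using v by (simp add: set_borel_measurable_def)
  have e: "(\<integral>\<^sup>+x\<in>D. ennreal ((norm (p k x - v x))\<^sup>2) \<partial>lebesgue) = (\<integral>\<^sup>+x. ennreal ((norm (p k x - ?v x))\<^sup>2) \<partial>lebesgue)" for k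
    by (intro nn_integral_cong) (auto simp: indicator_def z)
  have "eventually (\<lambda>k. (\<integral>\<^sup>+x. ennreal ((norm (p k x - ?v x))\<^sup>2) \<partial>lebesgue) < 1) sequentially"
    using order_tendstoD(2)[OF lim, of 1] by (simp add: e)
  from eventually_happens'[OF sequentially_bot this]
  obtain k where k: "(\<integral>\<^sup>+x. ennreal ((norm (p k x - ?v x))\<^sup>2) \<partial>lebesgue) < 1" by (elim exE)
  have "L2 (\<lambda>x. p k x - ?v x)"
    by (rule L2_of_nn_integral) (use vm L2_meas[OF p] order.strict_trans[OF k] in auto)
  from L2_diff[OF p[of k] this] show L: "L2 ?v" by simp
  have "(\<lambda>k. ennreal ((nrm2 (\<lambda>x. p k x - ?v x))\<^sup>2)) \<longlonglongrightarrow> ennreal 0"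
    using lim nn_integral_nrm2[OF L2_diff[OF p L]] by (simp add: e)
  then have "(\<lambda>k. (nrm2 (\<lambda>x. p k x - ?v x))\<^sup>2) \<longlonglongrightarrow> 0"
    by (subst (asm) tendsto_ennreal_iff) auto
  then have "(\<lambda>k. sqrt ((nrm2 (\<lambda>x. p k x - ?v x))\<^sup>2)) \<longlonglongrightarrow> sqrt 0"
    by (rule tendsto_real_sqrt)
  then show "(\<lambda>k. nrm2 (\<lambda>x. p k x - ?v x)) \<longlonglongrightarrow> 0" by simp
qed

lemma H10_grad_W:
  assumes "H10_grad D u g" "open D"
  shows "W D (res D u) (res D g)"
proof -
  from assms(1) have m: "set_borel_measurable lebesgue D u" "set_borel_measurable lebesgue D g"
    and "\<exists>\<phi>. (\<forall>k. Cc_inf D (\<phi> k))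
        \<and> (\<lambda>k. \<integral>\<^sup>+x\<in>D. ennreal ((\<phi> k x - u x)\<^sup>2) \<partial>lebesgue) \<longlonglongrightarrow> 0
        \<and> (\<lambda>k. \<integral>\<^sup>+x\<in>D. ennreal ((norm (grad (\<phi> k) x - g x))\<^sup>2) \<partial>lebesgue) \<longlonglongrightarrow> 0"
    unfolding H10_grad_def by simp_all
  then obtain \<phi> where f0: "\<forall>k. Cc_inf D (\<phi> k)"
      "(\<lambda>k. \<integral>\<^sup>+x\<in>D. ennreal ((\<phi> k x - u x)\<^sup>2) \<partial>lebesgue) \<longlonglongrightarrow> 0"
      "(\<lambda>k. \<integral>\<^sup>+x\<in>D. ennreal ((norm (grad (\<phi> k) x - g x))\<^sup>2) \<partial>lebesgue) \<longlonglongrightarrow> 0"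
    by (elim exE conjE)
  have f: "\<And>k. Cc_inf D (\<phi> k)"
      "(\<lambda>k. \<integral>\<^sup>+x\<in>D. ennreal ((norm (\<phi> k x - u x))\<^sup>2) \<partial>lebesgue) \<longlonglongrightarrow> 0"
      "(\<lambda>k. \<integral>\<^sup>+x\<in>D. ennreal ((norm (grad (\<phi> k) x - g x))\<^sup>2) \<partial>lebesgue) \<longlonglongrightarrow> 0"
    using f0 by simp_all
  have z: "\<phi> k x = 0" "grad (\<phi> k) x = 0" if "x \<notin> D" for k x
    using Cc_inf_zero_off[OF f(1) that] by auto
  have D: "D \<in> sets lebesgue" using assms(2) by auto
  show ?thesis
    by (rule WI[OF _ _ f(1)])
      (use L2_approx_nn[OF Cc_inf_L2(1)[OF f(1)] z(1) D m(1) f(2)] L2_approx_nn[OF Cc_inf_L2(2)[OF f(1)] z(2) D m(2) f(3)] in auto)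
qed

lemma W_H10_grad:
  assumes "W D u g" "open D"
  shows "H10_grad D u g"
proof -
  obtain \<phi> where f0: "\<forall>k. Cc_inf D (\<phi> k)" "(\<lambda>k. nrm2 (\<lambda>x. \<phi> k x - u x)) \<longlonglongrightarrow> 0"
    "(\<lambda>k. nrm2 (\<lambda>x. grad (\<phi> k) x - g x)) \<longlonglongrightarrow> 0"
    by (rule WE[OF assms(1)])
  note f = f0(1)[rule_format] f0(2,3)
  note L = Cc_inf_L2[OF f(1)] W_L2[OF assms(1)]
  have D: "D \<in> sets lebesgue" using assms(2) by auto
  have le: "(\<lambda>k. \<integral>\<^sup>+x\<in>D. ennreal ((norm (p k x - v x))\<^sup>2) \<partial>lebesgue) \<longlonglongrightarrow> 0"
    if "\<And>k. L2 (p k)" "L2 v" "(\<lambda>k. nrm2 (\<lambda>x. p k x - v x)) \<longlonglongrightarrow> 0" for p and v :: "real^'a \<Rightarrow> 'c::euclidean_space"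
  proof (rule tendsto_sandwich[OF _ _ tendsto_const])
    show "\<forall>\<^sub>F k in sequentially. (\<integral>\<^sup>+x\<in>D. ennreal ((norm (p k x - v x))\<^sup>2) \<partial>lebesgue) \<le> ennreal ((nrm2 (\<lambda>x. p k x - v x))\<^sup>2)"
    proof (intro always_eventually allI)
      fix k
      have "(\<integral>\<^sup>+x\<in>D. ennreal ((norm (p k x - v x))\<^sup>2) \<partial>lebesgue) \<le> (\<integral>\<^sup>+x. ennreal ((norm (p k x - v x))\<^sup>2) \<partial>lebesgue)"
        by (intro nn_integral_mono) (auto simp: indicator_def)
      then show "(\<integral>\<^sup>+x\<in>D. ennreal ((norm (p k x - v x))\<^sup>2) \<partial>lebesgue) \<le> ennreal ((nrm2 (\<lambda>x. p k x - v x))\<^sup>2)"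
        using nn_integral_nrm2[OF L2_diff[OF that(1,2)]] by simp
    qed
    have "(\<lambda>k. ennreal ((nrm2 (\<lambda>x. p k x - v x))\<^sup>2)) \<longlonglongrightarrow> ennreal (0\<^sup>2)"
      by (intro tendsto_ennrealI tendsto_power that(3))
    then show "(\<lambda>k. ennreal ((nrm2 (\<lambda>x. p k x - v x))\<^sup>2)) \<longlonglongrightarrow> 0" by simp
  qed simp
  have m: "set_borel_measurable lebesgue D u" "set_borel_measurable lebesgue D g"
    using L2_meas[OF nrm2_restrict_le(1)[OF L(3) D]] L2_meas[OF nrm2_restrict_le(1)[OF L(4) D]]
    by (simp_all only: set_borel_measurable_def)
  show ?thesis
    unfolding H10_grad_def
    using m f(1) le[OF L(1) L(3) f(2)] le[OF L(2) L(4) f(3)]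
    by (intro conjI exI[of _ \<phi>]) simp_all
qed

section \<open>Poincare inequalities\<close>

text \<open>Change of variables: the Jacobian contributes the power -n of t, at most 2^n when t is
  at least 1/2.\<close>

lemma nn_integral_affine_le:
  fixes F :: "'a::euclidean_space \<Rightarrow> ennreal" and t :: real
  assumes F[measurable]: "F \<in> borel_measurable borel" and t: "1/2 \<le> t"
  shows "(\<integral>\<^sup>+x. F (c + t *\<^sub>R x) \<partial>lborel) \<le> ennreal (2 ^ DIM('a)) * (\<integral>\<^sup>+x. F x \<partial>lborel)"
proof -
  have t0: "t \<noteq> 0" using t by auto
  have [measurable]: "(\<lambda>x. c + t *\<^sub>R x) \<in> borel \<rightarrow>\<^sub>M borel" by measurable
  have "(\<integral>\<^sup>+x. F x \<partial>lborel) = (\<integral>\<^sup>+x. F x \<partial>(density (distr lborel borel (\<lambda>x. c + t *\<^sub>R x)) (\<lambda>_. \<bar>t\<bar> ^ DIM('a))))"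
    using lborel_affine[OF t0, of c] by simp
  also have "\<dots> = (\<integral>\<^sup>+x. ennreal (\<bar>t\<bar> ^ DIM('a)) * F (c + t *\<^sub>R x) \<partial>lborel)"
    by (simp add: nn_integral_density nn_integral_distr)
  also have "\<dots> = ennreal (\<bar>t\<bar> ^ DIM('a)) * (\<integral>\<^sup>+x. F (c + t *\<^sub>R x) \<partial>lborel)"
    by (rule nn_integral_cmult) measurable
  finally have e: "(\<integral>\<^sup>+x. F x \<partial>lborel) = ennreal (\<bar>t\<bar> ^ DIM('a)) * (\<integral>\<^sup>+x. F (c + t *\<^sub>R x) \<partial>lborel)" .
  have "1 \<le> (2 * \<bar>t\<bar>) ^ DIM('a)" using t by (intro one_le_power) auto
  then have "(\<integral>\<^sup>+x. F (c + t *\<^sub>R x) \<partial>lborel) \<le> ennreal ((2 * \<bar>t\<bar>) ^ DIM('a)) * (\<integral>\<^sup>+x. F (c + t *\<^sub>R x) \<partial>lborel)"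
    using mult_right_mono[of 1 "ennreal ((2 * \<bar>t\<bar>) ^ DIM('a))" "\<integral>\<^sup>+x. F (c + t *\<^sub>R x) \<partial>lborel"] by simp
  also have "\<dots> = ennreal (2 ^ DIM('a)) * (\<integral>\<^sup>+x. F x \<partial>lborel)"
    unfolding e by (simp add: power_mult_distrib ennreal_mult mult.assoc)
  finally show ?thesis .
qed

lemma segment_integral_le:
  fixes F :: "'a::euclidean_space \<Rightarrow> ennreal" and t :: real
  assumes F[measurable]: "F \<in> borel_measurable borel" and t: "1/2 \<le> t" "t \<le> 1"
    and K[measurable]: "K \<in> sets borel" and cv: "convex K" and y: "y \<in> K"
  shows "(\<integral>\<^sup>+x. ind K x * F (y + t *\<^sub>R (x - y)) \<partial>lborel) \<le> ennreal (2 ^ DIM('a)) * (\<integral>\<^sup>+x. ind K x * F x \<partial>lborel)"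
proof -
  have [measurable]: "(\<lambda>x. ind K x * F x) \<in> borel_measurable borel" by measurable
  have "(\<integral>\<^sup>+x. ind K x * F (y + t *\<^sub>R (x - y)) \<partial>lborel) \<le> (\<integral>\<^sup>+x. (\<lambda>x. ind K x * F x) ((1 - t) *\<^sub>R y + t *\<^sub>R x) \<partial>lborel)"
  proof (intro nn_integral_mono)
    fix x
    have e: "y + t *\<^sub>R (x - y) = (1 - t) *\<^sub>R y + t *\<^sub>R x" by (simp add: algebra_simps)
    show "ind K x * F (y + t *\<^sub>R (x - y)) \<le> (\<lambda>x. ind K x * F x) ((1 - t) *\<^sub>R y + t *\<^sub>R x)"
    proof (cases "x \<in> K")
      case True
      then have "(1 - t) *\<^sub>R y + t *\<^sub>R x \<in> K" using convexD[OF cv y True, of "1 - t" t] t by simp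
      then show ?thesis using True by (simp add: e)
    qed simp
  qed
  also have "\<dots> \<le> ennreal (2 ^ DIM('a)) * (\<integral>\<^sup>+x. ind K x * F x \<partial>lborel)"
    by (rule nn_integral_affine_le[OF _ t(1)]) measurable
  finally show ?thesis .
qed

text \<open>For t at least 1/2, integrating in x first gives a Jacobian that stays bounded. For
  smaller t the roles of x and y are exchanged, which turns t into 1 - t.\<close>

lemma double_segment_le:
  fixes F :: "'a::euclidean_space \<Rightarrow> ennreal" and t :: real
  assumes F[measurable]: "F \<in> borel_measurable borel" and t: "0 \<le> t" "t \<le> 1"
    and K[measurable]: "K \<in> sets borel" and cv: "convex K"
  shows "(\<integral>\<^sup>+y. \<integral>\<^sup>+x. ind K y * (ind K x * F (y + t *\<^sub>R (x - y))) \<partial>lborel \<partial>lborel)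
    \<le> ennreal (2 ^ DIM('a)) * emeasure lborel K * (\<integral>\<^sup>+x. ind K x * F x \<partial>lborel)" (is "?L \<le> ?R")
proof -
  let ?c = "ennreal (2 ^ DIM('a)) * (\<integral>\<^sup>+x. ind K x * F x \<partial>lborel)"
  have main: "(\<integral>\<^sup>+y. \<integral>\<^sup>+x. ind K y * (ind K x * F (y + s *\<^sub>R (x - y))) \<partial>lborel \<partial>lborel) \<le> ?R"
    if s: "1/2 \<le> s" "s \<le> 1" for s :: real
  proof -
    have "(\<integral>\<^sup>+y. \<integral>\<^sup>+x. ind K y * (ind K x * F (y + s *\<^sub>R (x - y))) \<partial>lborel \<partial>lborel)
      \<le> (\<integral>\<^sup>+y. ?c * ind K y \<partial>lborel)"
    proof (intro nn_integral_mono)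
      fix y
      show "(\<integral>\<^sup>+x. ind K y * (ind K x * F (y + s *\<^sub>R (x - y))) \<partial>lborel) \<le> ?c * ind K y"
        using segment_integral_le[OF F s K cv, of y] by (cases "y \<in> K") auto
    qed
    also have "\<dots> = ?R" by (subst nn_integral_cmult_indicator) (simp_all add: mult_ac)
    finally show ?thesis .
  qed
  show ?thesis
  proof (cases "1/2 \<le> t")
    case True
    then show ?thesis using main t by auto
  next
    case False
    have "?L = (\<integral>\<^sup>+x. \<integral>\<^sup>+y. ind K y * (ind K x * F (y + t *\<^sub>R (x - y))) \<partial>lborel \<partial>lborel)"
      by (rule lborel_pair.Fubini'[symmetric]) measurable
    also have "\<dots> = (\<integral>\<^sup>+y. \<integral>\<^sup>+x. ind K y * (ind K x * F (y + (1 - t) *\<^sub>R (x - y))) \<partial>lborel \<partial>lborel)"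
      by (intro nn_integral_cong) (simp add: algebra_simps)
    also have "\<dots> \<le> ?R" by (rule main) (use False t in auto)
    finally show ?thesis .
  qed
qed

text \<open>Fubini moves the segment parameter t outermost, where \<open>double_segment_le\<close>
  applies for each fixed t. Stated for an abstract q so that first powers and squares of differences
  are covered together.\<close>

lemma poincare_pairs:
  fixes F :: "'a::euclidean_space \<Rightarrow> ennreal" and q :: "'a \<Rightarrow> 'a \<Rightarrow> ennreal"
  assumes F[measurable]: "F \<in> borel_measurable borel"
    and K[measurable]: "K \<in> sets borel" and cv: "convex K"
    and q: "\<And>x y. x \<in> K \<Longrightarrow> y \<in> K \<Longrightarrow> q x y \<le> c * (\<integral>\<^sup>+t. ind {0..1::real} t * F (y + t *\<^sub>R (x - y)) \<partial>lborel)"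
  shows "(\<integral>\<^sup>+y. \<integral>\<^sup>+x. ind K y * (ind K x * q x y) \<partial>lborel \<partial>lborel)
    \<le> c * (ennreal (2 ^ DIM('a)) * emeasure lborel K * (\<integral>\<^sup>+x. ind K x * F x \<partial>lborel))" (is "?L \<le> c * ?R")
proof -
  let ?G = "\<lambda>y x t. ind {0..1} t * (ind K y * (ind K x * F (y + t *\<^sub>R (x - y)))) :: ennreal"
  have "?L \<le> (\<integral>\<^sup>+y. \<integral>\<^sup>+x. c * (\<integral>\<^sup>+t. ?G y x t \<partial>lborel) \<partial>lborel \<partial>lborel)"
  proof (intro nn_integral_mono)
    fix x y
    show "ind K y * (ind K x * q x y) \<le> c * (\<integral>\<^sup>+t. ?G y x t \<partial>lborel)"
      using q[of x y] by (auto simp: indicator_def split: if_splits)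
  qed
  also have "\<dots> = c * (\<integral>\<^sup>+y. \<integral>\<^sup>+x. (\<integral>\<^sup>+t. ?G y x t \<partial>lborel) \<partial>lborel \<partial>lborel)"
    by (simp add: nn_integral_cmult)
  also have "(\<integral>\<^sup>+y. \<integral>\<^sup>+x. (\<integral>\<^sup>+t. ?G y x t \<partial>lborel) \<partial>lborel \<partial>lborel) = (\<integral>\<^sup>+y. \<integral>\<^sup>+t. \<integral>\<^sup>+x. ?G y x t \<partial>lborel \<partial>lborel \<partial>lborel)"
    by (intro nn_integral_cong lborel_pair.Fubini') measurable
  also have "\<dots> = (\<integral>\<^sup>+t. \<integral>\<^sup>+y. \<integral>\<^sup>+x. ?G y x t \<partial>lborel \<partial>lborel \<partial>lborel)"
    by (intro lborel_pair.Fubini') measurable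
  also have "\<dots> \<le> (\<integral>\<^sup>+t. ?R * ind {0..1::real} t \<partial>lborel)"
  proof (intro nn_integral_mono)
    fix t :: real
    show "(\<integral>\<^sup>+y. \<integral>\<^sup>+x. ?G y x t \<partial>lborel \<partial>lborel) \<le> ?R * ind {0..1::real} t"
      using double_segment_le[OF F _ _ K cv, of t] by (cases "t \<in> {0..1}") auto
  qed
  also have "\<dots> = ?R" by (simp add: nn_integral_cmult)
  finally show ?thesis by (simp add: mult_left_mono)
qed

text \<open>The fundamental theorem of calculus along the segment from y to x, in the shape that
  \<open>poincare_pairs\<close> asks for.\<close>

lemma smooth_line_bound:
  fixes \<phi> :: "real^'n \<Rightarrow> real"
  assumes s: "smooth_fun \<phi>" and d: "norm (x - y) \<le> d"
  shows "ennreal \<bar>\<phi> x - \<phi> y\<bar> \<le> ennreal d * (\<integral>\<^sup>+t. ind {0..1::real} t * ennreal (norm (grad \<phi> (y + t *\<^sub>R (x - y)))) \<partial>lborel)"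
    "ennreal ((\<phi> x - \<phi> y)\<^sup>2) \<le> ennreal (d\<^sup>2) * (\<integral>\<^sup>+t. ind {0..1::real} t * ennreal ((norm (grad \<phi> (y + t *\<^sub>R (x - y))))\<^sup>2) \<partial>lborel)"
proof -
  let ?l = "\<lambda>t::real. y + t *\<^sub>R (x - y)"
  let ?f = "\<lambda>t. grad \<phi> (?l t) \<bullet> (x - y)"
  let ?h = "\<lambda>t. norm (grad \<phi> (?l t))"
  have d0: "0 \<le> d" using d norm_ge_zero order_trans by blast
  have cg: "isCont (\<lambda>t. grad \<phi> (?l t)) t" for t
  proof -
    have "continuous_on UNIV (\<lambda>t. grad \<phi> (?l t))"
      by (intro continuous_on_compose2[OF smooth_continuous_grad[OF s, of UNIV]] continuous_intros) auto
    then show ?thesis by (simp add: continuous_on_eq_continuous_at)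
  qed
  have der: "((\<lambda>t. \<phi> (?l t)) has_real_derivative ?f t) (at t)" for t
  proof -
    have "((\<lambda>t. \<phi> (?l t)) has_derivative (\<lambda>h. grad \<phi> (?l t) \<bullet> (h *\<^sub>R (x - y)))) (at t)"
      by (rule has_derivative_compose[OF _ smooth_has_derivative[OF s]]) (auto intro!: derivative_eq_intros)
    then show ?thesis unfolding has_field_derivative_def by (rule has_derivative_eq_rhs) (auto simp: mult.commute)
  qed
  have cf: "isCont ?f t" for t by (intro continuous_intros cg)
  have ch: "isCont ?h t" for t by (intro continuous_intros cg)
  have ch2: "isCont (\<lambda>t. (?h t)\<^sup>2) t" for t by (intro continuous_intros cg)
  have ih: "integrable lborel (\<lambda>t. ?h t * ind {0..1} t)" by (intro borel_integrable_atLeastAtMost ch)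
  have ih2: "integrable lborel (\<lambda>t. (?h t)\<^sup>2 * ind {0..1} t)" by (intro borel_integrable_atLeastAtMost ch2)
  have if': "integrable lborel (\<lambda>t. ?f t * ind {0..1} t)" by (intro borel_integrable_atLeastAtMost cf)
  have "\<phi> x - \<phi> y = (LINT t|lborel. ?f t * ind {0..1} t)"
    using integral_FTC_Icc_real[of 0 1 "\<lambda>t. \<phi> (?l t)" ?f] der cf by simp
  also have "\<bar>\<dots>\<bar> \<le> (LINT t|lborel. \<bar>?f t * ind {0..1} t\<bar>)" by (rule integral_abs_bound)
  also have "\<dots> \<le> (LINT t|lborel. d * (?h t * ind {0..1} t))"
  proof (intro integral_mono)
    fix t :: real
    have "\<bar>?f t\<bar> \<le> ?h t * norm (x - y)" by (rule Cauchy_Schwarz_ineq2)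
    also have "\<dots> \<le> ?h t * d" using d by (intro mult_left_mono) auto
    finally show "\<bar>?f t * ind {0..1} t\<bar> \<le> d * (?h t * ind {0..1} t)"
      by (simp add: indicator_def mult.commute)
  qed (use if' ih in auto)
  also have "\<dots> = d * (LINT t|lborel. ?h t * ind {0..1} t)" by simp
  finally have 1: "\<bar>\<phi> x - \<phi> y\<bar> \<le> d * (LINT t|lborel. ?h t * ind {0..1} t)" .
  let ?M = "LINT t|lborel. ?h t * ind {0..1} t"
  have M0: "0 \<le> ?M" by (intro integral_nonneg_AE) (auto simp: indicator_def)
  \<comment> \<open>Jensen's inequality on the unit interval: the variance of \<open>?h\<close> is
    nonnegative.\<close>
  have "0 \<le> (LINT t|lborel. (?h t - ?M)\<^sup>2 * ind {0..1} t)"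
    by (intro integral_nonneg_AE) (auto simp: indicator_def)
  also have "\<dots> = (LINT t|lborel. (?h t)\<^sup>2 * ind {0..1} t - 2 * ?M * (?h t * ind {0..1} t) + ?M\<^sup>2 * ind {0..1} t)"
    by (intro Bochner_Integration.integral_cong refl) (simp add: power2_diff algebra_simps)
  also have "\<dots> = (LINT t|lborel. (?h t)\<^sup>2 * ind {0..1} t) - 2 * ?M * ?M + ?M\<^sup>2"
    using ih ih2 by simp
  finally have 2: "?M\<^sup>2 \<le> (LINT t|lborel. (?h t)\<^sup>2 * ind {0..1} t)" by (simp add: power2_eq_square)
  have n1: "(\<integral>\<^sup>+t. ind {0..1::real} t * ennreal (?h t) \<partial>lborel) = ennreal ?M"
  proof -
    have "(\<integral>\<^sup>+t. ind {0..1::real} t * ennreal (?h t) \<partial>lborel) = (\<integral>\<^sup>+t. ennreal (?h t * ind {0..1} t) \<partial>lborel)"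
      by (intro nn_integral_cong) (auto simp: indicator_def)
    then show ?thesis using nn_integral_eq_integral[OF ih] by (simp add: indicator_def)
  qed
  have n2: "(\<integral>\<^sup>+t. ind {0..1::real} t * ennreal ((?h t)\<^sup>2) \<partial>lborel) = ennreal (LINT t|lborel. (?h t)\<^sup>2 * ind {0..1} t)"
  proof -
    have "(\<integral>\<^sup>+t. ind {0..1::real} t * ennreal ((?h t)\<^sup>2) \<partial>lborel) = (\<integral>\<^sup>+t. ennreal ((?h t)\<^sup>2 * ind {0..1} t) \<partial>lborel)"
      by (intro nn_integral_cong) (auto simp: indicator_def)
    then show ?thesis using nn_integral_eq_integral[OF ih2] by (simp add: indicator_def)
  qed
  show "ennreal \<bar>\<phi> x - \<phi> y\<bar> \<le> ennreal d * (\<integral>\<^sup>+t. ind {0..1::real} t * ennreal (?h t) \<partial>lborel)"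
    unfolding n1 using 1 d0 M0 by (simp add: ennreal_mult[symmetric])
  have "(\<phi> x - \<phi> y)\<^sup>2 \<le> (d * ?M)\<^sup>2" using power_mono[OF 1 abs_ge_zero, of 2] by (simp only: power2_abs)
  also have "\<dots> \<le> d\<^sup>2 * (LINT t|lborel. (?h t)\<^sup>2 * ind {0..1} t)"
    using 2 by (simp add: power_mult_distrib mult_left_mono)
  finally show "ennreal ((\<phi> x - \<phi> y)\<^sup>2) \<le> ennreal (d\<^sup>2) * (\<integral>\<^sup>+t. ind {0..1::real} t * ennreal ((?h t)\<^sup>2) \<partial>lborel)"
    unfolding n2 using order_trans[OF zero_le_power2 2] by (simp add: ennreal_mult[symmetric])
qed

lemma poincare_pairs_smooth:
  fixes \<phi> :: "real^'n \<Rightarrow> real"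
  assumes s: "smooth_fun \<phi>" and K: "K \<in> sets borel" "convex K" and d: "\<And>x y. x \<in> K \<Longrightarrow> y \<in> K \<Longrightarrow> norm (x - y) \<le> d"
  shows "(\<integral>\<^sup>+y. \<integral>\<^sup>+x. ind K y * (ind K x * ennreal \<bar>\<phi> x - \<phi> y\<bar>) \<partial>lborel \<partial>lborel)
    \<le> ennreal d * (ennreal (2 ^ CARD('n)) * emeasure lborel K * (\<integral>\<^sup>+x. ind K x * ennreal (norm (grad \<phi> x)) \<partial>lborel))"
    "(\<integral>\<^sup>+y. \<integral>\<^sup>+x. ind K y * (ind K x * ennreal ((\<phi> x - \<phi> y)\<^sup>2)) \<partial>lborel \<partial>lborel)
    \<le> ennreal (d\<^sup>2) * (ennreal (2 ^ CARD('n)) * emeasure lborel K * (\<integral>\<^sup>+x. ind K x * ennreal ((norm (grad \<phi> x))\<^sup>2) \<partial>lborel))"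
proof -
  have [measurable]: "grad \<phi> \<in> borel_measurable borel" by (rule smooth_grad_borel[OF s])
  show "(\<integral>\<^sup>+y. \<integral>\<^sup>+x. ind K y * (ind K x * ennreal \<bar>\<phi> x - \<phi> y\<bar>) \<partial>lborel \<partial>lborel)
    \<le> ennreal d * (ennreal (2 ^ CARD('n)) * emeasure lborel K * (\<integral>\<^sup>+x. ind K x * ennreal (norm (grad \<phi> x)) \<partial>lborel))"
    using poincare_pairs[where q="\<lambda>x y. ennreal \<bar>\<phi> x - \<phi> y\<bar>" and F="\<lambda>x. ennreal (norm (grad \<phi> x))" and c="ennreal d", OF _ K smooth_line_bound(1)[OF s d]]
    by simp
  show "(\<integral>\<^sup>+y. \<integral>\<^sup>+x. ind K y * (ind K x * ennreal ((\<phi> x - \<phi> y)\<^sup>2)) \<partial>lborel \<partial>lborel)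
    \<le> ennreal (d\<^sup>2) * (ennreal (2 ^ CARD('n)) * emeasure lborel K * (\<integral>\<^sup>+x. ind K x * ennreal ((norm (grad \<phi> x))\<^sup>2) \<partial>lborel))"
    using poincare_pairs[where q="\<lambda>x y. ennreal ((\<phi> x - \<phi> y)\<^sup>2)" and F="\<lambda>x. ennreal ((norm (grad \<phi> x))\<^sup>2)" and c="ennreal (d\<^sup>2)", OF _ K smooth_line_bound(2)[OF s d]]
    by simp
qed

lemma integrable_indicator_continuous:
  fixes f :: "'a::euclidean_space \<Rightarrow> real"
  assumes "continuous_on UNIV f" "K \<in> sets borel" "bounded K"
  shows "integrable lborel (\<lambda>x. ind K x * f x)"
proof -
  obtain R where R: "\<forall>x\<in>K. norm x \<le> R" using assms(3) unfolding bounded_iff by metis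
  have "compact (cball (0::'a) R)" by simp
  then have "bounded (f ` cball 0 R)" by (intro compact_imp_bounded compact_continuous_image continuous_on_subset[OF assms(1)]) auto
  then obtain C where C: "\<forall>x\<in>cball 0 R. \<bar>f x\<bar> \<le> C" unfolding bounded_iff by (metis imageI real_norm_def)
  have m: "f \<in> borel_measurable borel" by (rule borel_measurable_continuous_onI[OF assms(1)])
  have "integrable lborel (\<lambda>x::'a. C * ind (cball 0 R) x)"
    by (intro integrable_mult_right integrable_real_indicator) (use emeasure_lborel_cball_finite[of "0::'a" R] in simp_all)
  then show ?thesis
  proof (rule Bochner_Integration.integrable_bound)
    show "(\<lambda>x. ind K x * f x) \<in> borel_measurable lborel" using m assms(2) by simp
    show "AE x in lborel. norm (ind K x * f x) \<le> norm (C * ind (cball 0 R) x)"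
    proof (rule AE_I2)
      fix x show "norm (ind K x * f x) \<le> norm (C * ind (cball 0 R) x)"
      proof (cases "x \<in> K")
        case True
        then have "x \<in> cball 0 R" using R by simp
        then have "\<bar>f x\<bar> \<le> C" using C by blast
        then show ?thesis using True \<open>x \<in> cball 0 R\<close> by simp
      qed simp
    qed
  qed
qed

text \<open>Both parts come from double integrals over pairs of points of K. In the first, the term
  with the mean is kept instead of being removed by a choice of c: weak convergence makes it vanish
  in \<open>rellich\<close>, and an L1 bound controls it in \<open>local_poincare\<close>. In the
  second, averaging the difference of two values over one of the points gives the distance to the
  mean.\<close>

lemma cell_poincare_smooth:
  fixes \<phi> :: "real^'n \<Rightarrow> real"
  assumes s: "smooth_fun \<phi>" and K: "K \<in> sets borel" "convex K" "bounded K" and d: "\<And>x y. x \<in> K \<Longrightarrow> y \<in> K \<Longrightarrow> norm (x - y) \<le> d"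
    and m: "0 < measure lborel K"
  shows "(LINT x|lborel. ind K x * (\<phi> x - c)\<^sup>2)
     \<le> d\<^sup>2 * 2 ^ CARD('n) * (LINT x|lborel. ind K x * (norm (grad \<phi> x))\<^sup>2) + (LINT x|lborel. ind K x * (\<phi> x - c))\<^sup>2 / measure lborel K"
    "(LINT y|lborel. ind K y * \<bar>\<phi> y - (LINT x|lborel. ind K x * \<phi> x) / measure lborel K\<bar>)
      \<le> 2 ^ CARD('n) * d * (LINT x|lborel. ind K x * norm (grad \<phi> x))"
proof -
  define f where "f x = \<phi> x - c" for x
  define S where "S = (LINT x|lborel. ind K x * (f x)\<^sup>2)"
  define T where "T = (LINT x|lborel. ind K x * f x)"
  define M where "M = measure lborel K"
  define G2 where "G2 = (LINT x|lborel. ind K x * (norm (grad \<phi> x))\<^sup>2)"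
  define G1 where "G1 = (LINT x|lborel. ind K x * norm (grad \<phi> x))"
  have cp: "continuous_on UNIV \<phi>" and cg: "continuous_on UNIV (grad \<phi>)"
    by (rule smooth_continuous[OF s], rule smooth_continuous_grad[OF s])
  have cf: "continuous_on UNIV f" unfolding f_def by (intro continuous_intros cp)
  have fin: "emeasure lborel K < \<infinity>" using emeasure_bounded_finite[OF K(3)] .
  have eM: "emeasure lborel K = ennreal M" unfolding M_def using fin by (simp add: emeasure_eq_ennreal_measure)
  have i1: "integrable lborel (\<lambda>x. ind K x * f x)"
    and i2: "integrable lborel (\<lambda>x. ind K x * (f x)\<^sup>2)"
    and ig2: "integrable lborel (\<lambda>x. ind K x * (norm (grad \<phi> x))\<^sup>2)"
    and ig1: "integrable lborel (\<lambda>x. ind K x * norm (grad \<phi> x))"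
    and ip: "integrable lborel (\<lambda>x. ind K x * \<phi> x)"
    by (intro integrable_indicator_continuous K continuous_intros cf cg cp)+
  have i0: "integrable lborel (ind K :: _ \<Rightarrow> real)" using K fin by (intro integrable_real_indicator) auto
  have l0: "(LINT x|lborel. ind K x) = M" unfolding M_def using K by simp
  obtain z where z: "z \<in> K" using m by (cases "K = {}") auto
  have d0: "0 \<le> d" using d[OF z z] by simp
  have g1: "(\<integral>\<^sup>+x. ind K x * ennreal (norm (grad \<phi> x)) \<partial>lborel) = ennreal G1"
  proof -
    have "(\<integral>\<^sup>+x. ind K x * ennreal (norm (grad \<phi> x)) \<partial>lborel) = (\<integral>\<^sup>+x. ennreal (ind K x * norm (grad \<phi> x)) \<partial>lborel)"
      by (intro nn_integral_cong) (auto simp: indicator_def)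
    then show ?thesis unfolding G1_def using nn_integral_eq_integral[OF ig1] by simp
  qed
  have g2: "(\<integral>\<^sup>+x. ind K x * ennreal ((norm (grad \<phi> x))\<^sup>2) \<partial>lborel) = ennreal G2"
  proof -
    have "(\<integral>\<^sup>+x. ind K x * ennreal ((norm (grad \<phi> x))\<^sup>2) \<partial>lborel) = (\<integral>\<^sup>+x. ennreal (ind K x * (norm (grad \<phi> x))\<^sup>2) \<partial>lborel)"
      by (intro nn_integral_cong) (auto simp: indicator_def)
    then show ?thesis unfolding G2_def using nn_integral_eq_integral[OF ig2] by simp
  qed
  have G10: "0 \<le> G1" and G20: "0 \<le> G2" unfolding G1_def G2_def by (auto intro!: integral_nonneg_AE)
  have M0: "0 < M" using m by (simp add: M_def)
  \<comment> \<open>Integrating this in y gives 2 (M S - T^2), the double integral of the squared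
    differences; the pair estimate therefore bounds S up to T^2 / M.\<close>
  have inner2: "(\<integral>\<^sup>+x. ind K y * (ind K x * ennreal ((\<phi> x - \<phi> y)\<^sup>2)) \<partial>lborel)
     = ennreal (ind K y * (S + M * (f y)\<^sup>2 - 2 * f y * T))" for y
  proof -
    have e: "ind K x * (\<phi> x - \<phi> y)\<^sup>2 = ind K x * (f x)\<^sup>2 + (f y)\<^sup>2 * ind K x - (2 * f y) * (ind K x * f x)" for x
      by (simp add: f_def indicator_def power2_eq_square algebra_simps)
    have i: "integrable lborel (\<lambda>x. ind K x * (\<phi> x - \<phi> y)\<^sup>2)"
      unfolding e by (intro Bochner_Integration.integrable_diff Bochner_Integration.integrable_add integrable_mult_right i1 i2 i0)
    have v: "(LINT x|lborel. ind K x * (\<phi> x - \<phi> y)\<^sup>2) = S + M * (f y)\<^sup>2 - 2 * f y * T"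
      unfolding e using i1 i2 i0 l0 by (simp add: S_def T_def)
    have "(\<integral>\<^sup>+x. ind K x * ennreal ((\<phi> x - \<phi> y)\<^sup>2) \<partial>lborel) = (\<integral>\<^sup>+x. ennreal (ind K x * (\<phi> x - \<phi> y)\<^sup>2) \<partial>lborel)"
      by (intro nn_integral_cong) (auto simp: indicator_def)
    also have "\<dots> = ennreal (S + M * (f y)\<^sup>2 - 2 * f y * T)"
      using nn_integral_eq_integral[OF i] v by simp
    finally show ?thesis by (cases "y \<in> K") auto
  qed
  let ?H = "\<lambda>y. ind K y * (S + M * (f y)\<^sup>2 - 2 * f y * T)"
  have e2: "?H y = S * ind K y + M * (ind K y * (f y)\<^sup>2) - 2 * T * (ind K y * f y)" for y
    by (simp add: indicator_def)
  have iH: "integrable lborel ?H" unfolding e2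
    by (intro Bochner_Integration.integrable_diff Bochner_Integration.integrable_add integrable_mult_right i1 i2 i0)
  have vH: "(LINT y|lborel. ?H y) = 2 * (M * S - T\<^sup>2)" unfolding e2 using i1 i2 i0 l0
    by (simp add: S_def[symmetric] T_def[symmetric]) (simp add: power2_eq_square)
  have H0: "0 \<le> ?H y" for y
  proof (cases "y \<in> K")
    case True
    have "0 \<le> (LINT x|lborel. ind K x * (\<phi> x - \<phi> y)\<^sup>2)" by (intro integral_nonneg_AE) auto
    also have "\<dots> = (LINT x|lborel. ind K x * (f x)\<^sup>2 + (f y)\<^sup>2 * ind K x - (2 * f y) * (ind K x * f x))"
      by (intro Bochner_Integration.integral_cong refl) (simp add: f_def indicator_def power2_eq_square algebra_simps)
    also have "\<dots> = S + M * (f y)\<^sup>2 - 2 * f y * T" using i1 i2 i0 l0 by (simp add: S_def T_def)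
    finally show ?thesis using True by simp
  qed simp
  have "ennreal (2 * (M * S - T\<^sup>2)) = (\<integral>\<^sup>+y. ennreal (?H y) \<partial>lborel)"
    using nn_integral_eq_integral[OF iH] H0 vH by simp
  also have "\<dots> \<le> ennreal (d\<^sup>2) * (ennreal (2 ^ CARD('n)) * ennreal M * ennreal G2)"
    using poincare_pairs_smooth(2)[OF s K(1,2) d] unfolding inner2 g2 eM by simp
  also have "\<dots> = ennreal (d\<^sup>2 * (2 ^ CARD('n) * M * G2))"
    using M0 G20 by (simp add: ennreal_mult[symmetric])
  finally have "2 * (M * S - T\<^sup>2) \<le> d\<^sup>2 * (2 ^ CARD('n) * M * G2)"
    using M0 G20 by (subst (asm) ennreal_le_iff) auto
  then have "M * S \<le> M * (d\<^sup>2 * 2 ^ CARD('n) * G2) + T\<^sup>2"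
  proof -
    have "0 \<le> d\<^sup>2 * (2 ^ CARD('n) * M * G2)" using M0 G20 by simp
    moreover assume "2 * (M * S - T\<^sup>2) \<le> d\<^sup>2 * (2 ^ CARD('n) * M * G2)"
    moreover have "a \<le> X + b" if "0 \<le> X" "2 * (a - b) \<le> X" for a b X :: real using that by argo
    ultimately have "M * S \<le> d\<^sup>2 * (2 ^ CARD('n) * M * G2) + T\<^sup>2" by blast
    also have "d\<^sup>2 * (2 ^ CARD('n) * M * G2) = M * (d\<^sup>2 * 2 ^ CARD('n) * G2)" by simp
    finally show ?thesis .
  qed
  then have "S \<le> d\<^sup>2 * 2 ^ CARD('n) * G2 + T\<^sup>2 / M"
    using M0 by (simp add: field_simps)
  then show "(LINT x|lborel. ind K x * (\<phi> x - c)\<^sup>2)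
     \<le> d\<^sup>2 * 2 ^ CARD('n) * (LINT x|lborel. ind K x * (norm (grad \<phi> x))\<^sup>2) + (LINT x|lborel. ind K x * (\<phi> x - c))\<^sup>2 / measure lborel K"
    unfolding S_def T_def M_def G2_def f_def .
  define a where "a = (LINT x|lborel. ind K x * \<phi> x) / M"
  have aM: "(LINT x|lborel. ind K x * \<phi> x) = a * M" using M0 by (simp add: a_def)
  have ia: "integrable lborel (\<lambda>y. ind K y * \<bar>\<phi> y - a\<bar>)"
    by (intro integrable_indicator_continuous K continuous_intros cp)
  have "ennreal (M * (ind K y * \<bar>\<phi> y - a\<bar>)) \<le> (\<integral>\<^sup>+x. ind K y * (ind K x * ennreal \<bar>\<phi> x - \<phi> y\<bar>) \<partial>lborel)" for y
  proof (cases "y \<in> K")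
    case True
    have i: "integrable lborel (\<lambda>x. ind K x * \<bar>\<phi> x - \<phi> y\<bar>)"
      by (intro integrable_indicator_continuous K continuous_intros cp)
    have "(LINT x|lborel. ind K x * \<phi> x - \<phi> y * ind K x) = a * M - \<phi> y * M"
      by (subst Bochner_Integration.integral_diff[OF ip integrable_mult_right[OF i0]]) (simp only: aM l0 integral_mult_right_zero)
    also have "\<dots> = - (M * (\<phi> y - a))" by (simp add: algebra_simps)
    finally have "M * \<bar>\<phi> y - a\<bar> = \<bar>LINT x|lborel. ind K x * \<phi> x - \<phi> y * ind K x\<bar>"
      using M0 by (simp only: abs_minus_cancel abs_mult abs_of_pos)
    also have "\<dots> \<le> (LINT x|lborel. \<bar>ind K x * \<phi> x - \<phi> y * ind K x\<bar>)"
      by (rule integral_abs_bound)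
    also have "\<dots> = (LINT x|lborel. ind K x * \<bar>\<phi> x - \<phi> y\<bar>)"
      by (intro Bochner_Integration.integral_cong refl) (simp add: indicator_def)
    finally have "ennreal (M * \<bar>\<phi> y - a\<bar>) \<le> (\<integral>\<^sup>+x. ennreal (ind K x * \<bar>\<phi> x - \<phi> y\<bar>) \<partial>lborel)"
      using nn_integral_eq_integral[OF i] by (simp add: ennreal_leI)
    also have "\<dots> = (\<integral>\<^sup>+x. ind K x * ennreal \<bar>\<phi> x - \<phi> y\<bar> \<partial>lborel)"
      by (intro nn_integral_cong) (auto simp: indicator_def)
    finally show ?thesis using True by simp
  qed simp
  then have "(\<integral>\<^sup>+y. ennreal (M * (ind K y * \<bar>\<phi> y - a\<bar>)) \<partial>lborel) \<le> (\<integral>\<^sup>+y. \<integral>\<^sup>+x. ind K y * (ind K x * ennreal \<bar>\<phi> x - \<phi> y\<bar>) \<partial>lborel \<partial>lborel)"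
    by (rule nn_integral_mono)
  also have "\<dots> \<le> ennreal d * (ennreal (2 ^ CARD('n)) * ennreal M * ennreal G1)"
    using poincare_pairs_smooth(1)[OF s K(1,2) d] unfolding g1 eM by simp
  also have "\<dots> = ennreal (d * (2 ^ CARD('n) * M * G1))"
    using M0 G10 d0 by (simp add: ennreal_mult[symmetric])
  also have "(\<integral>\<^sup>+y. ennreal (M * (ind K y * \<bar>\<phi> y - a\<bar>)) \<partial>lborel) = ennreal (M * (LINT y|lborel. ind K y * \<bar>\<phi> y - a\<bar>))"
    using nn_integral_eq_integral[OF integrable_mult_right[OF ia, of M]] M0 by simp
  finally have "M * (LINT y|lborel. ind K y * \<bar>\<phi> y - a\<bar>) \<le> d * (2 ^ CARD('n) * M * G1)"
    using M0 G10 d0 by (subst (asm) ennreal_le_iff) auto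
  also have "\<dots> = M * (2 ^ CARD('n) * d * G1)" by simp
  finally have "(LINT y|lborel. ind K y * \<bar>\<phi> y - a\<bar>) \<le> 2 ^ CARD('n) * d * G1"
    using M0 by (simp only: mult_le_cancel_left_pos)
  then show "(LINT y|lborel. ind K y * \<bar>\<phi> y - (LINT x|lborel. ind K x * \<phi> x) / measure lborel K\<bar>)
      \<le> 2 ^ CARD('n) * d * (LINT x|lborel. ind K x * norm (grad \<phi> x))"
    unfolding a_def M_def G1_def .
qed

lemma L2_indicator: fixes K :: "'a::euclidean_space set"
  assumes "K \<in> sets borel" "bounded K" shows "L2 (\<lambda>x. ind K x *\<^sub>R (c::'b::euclidean_space))"
proof (rule L2_bounded_support[where C="norm c" and S=K])
  have "K \<in> sets lebesgue" using assms(1) by simp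
  then show "(\<lambda>x. ind K x *\<^sub>R c) \<in> LM"
    by (intro borel_measurable_scaleR borel_measurable_indicator borel_measurable_const)
qed (use assms(2) in \<open>auto simp: indicator_def\<close>)

lemma restrict_tendsto:
  assumes "\<And>k. L2 (f k)" "L2 g" "(\<lambda>k. nrm2 (\<lambda>x. f k x - g x)) \<longlonglongrightarrow> 0" "K \<in> sets lebesgue"
  shows "(\<lambda>k. nrm2 (\<lambda>x. ind K x *\<^sub>R f k x - ind K x *\<^sub>R g x)) \<longlonglongrightarrow> 0"
proof (rule tendsto_0_le[OF assms(3)])
  show "nrm2 (\<lambda>x. ind K x *\<^sub>R f k x - ind K x *\<^sub>R g x) \<le> nrm2 (\<lambda>x. f k x - g x)" for k
    using nrm2_restrict_le(2)[OF L2_diff[OF assms(1,2)] assms(4), of k] by (simp add: scaleR_diff_right)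
qed simp

lemma borel_sets_lebesgue: "K \<in> sets borel \<Longrightarrow> K \<in> sets lebesgue"
  by simp

lemma nrm2_restrict_sq_lborel:
  assumes "f \<in> borel_measurable borel" "K \<in> sets borel"
  shows "(nrm2 (res K f))\<^sup>2 = (LINT x|lborel. ind K x * (norm (f x))\<^sup>2)"
proof -
  have "(nrm2 (res K f))\<^sup>2 = (LINT x|lebesgue. ind K x * (norm (f x))\<^sup>2)"
    unfolding nrm2_sq by (intro Bochner_Integration.integral_cong refl) (simp add: indicator_def)
  also have "\<dots> = (LINT x|lborel. ind K x * (norm (f x))\<^sup>2)"
    by (rule integral_completion) (use assms in measurable)
  finally show ?thesis .
qed

text \<open>By density. The first inequality passes to the limit term by term; the second contains
  an L1 norm around a mean that itself varies, so its errors are tracked explicitly.\<close>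

lemma cell_poincare_W:
  fixes u :: "real^'n \<Rightarrow> real"
  assumes w: "W D u g" and K: "K \<in> sets borel" "convex K" "bounded K" and d: "\<And>x y. x \<in> K \<Longrightarrow> y \<in> K \<Longrightarrow> norm (x - y) \<le> d"
    and m: "0 < measure lborel K"
  shows "(nrm2 (res K (\<lambda>x. u x - c)))\<^sup>2
     \<le> d\<^sup>2 * 2 ^ CARD('n) * (nrm2 (res K g))\<^sup>2 + (LINT x|lebesgue. ind K x * (u x - c))\<^sup>2 / measure lborel K"
    "(LINT y|lebesgue. ind K y * \<bar>u y - (LINT x|lebesgue. ind K x * u x) / measure lborel K\<bar>)
      \<le> 2 ^ CARD('n) * d * (LINT x|lebesgue. ind K x * norm (g x))"
proof -
  obtain \<phi> where f0: "\<forall>k. Cc_inf D (\<phi> k)" "(\<lambda>k. nrm2 (\<lambda>x. \<phi> k x - u x)) \<longlonglongrightarrow> 0"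
    "(\<lambda>k. nrm2 (\<lambda>x. grad (\<phi> k) x - g x)) \<longlonglongrightarrow> 0" by (rule WE[OF w])
  note f = f0(1)[rule_format] f0(2,3)
  note s = Cc_infD(1)[OF f(1)]
  note L = Cc_inf_L2[OF f(1)] W_L2[OF w]
  have KL: "K \<in> sets lebesgue" using K(1) by simp
  note R = nrm2_restrict_le(1)[OF L(1) KL] nrm2_restrict_le(1)[OF L(2) KL] nrm2_restrict_le(1)[OF L(3) KL] nrm2_restrict_le(1)[OF L(4) KL]
  have Lc: "L2 (\<lambda>x. ind K x *\<^sub>R c)" by (rule L2_indicator[OF K(1,3)])
  have L1: "L2 (\<lambda>x. ind K x :: real)" using L2_indicator[OF K(1,3), of "1::real"] by simp
  have Lu: "L2 (res K (\<lambda>x. u x - c))" using L2_diff[OF R(3) Lc] by (simp add: right_diff_distrib)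
  have Lf: "L2 (res K (\<lambda>x. \<phi> k x - c))" for k using L2_diff[OF R(1) Lc] by (simp add: right_diff_distrib)
  have [measurable]: "\<phi> k \<in> borel_measurable borel" "grad (\<phi> k) \<in> borel_measurable borel" for k
    by (rule smooth_borel[OF s], rule smooth_grad_borel[OF s])
  have t1: "(\<lambda>k. nrm2 (\<lambda>x. ind K x *\<^sub>R (\<phi> k x - c) - ind K x *\<^sub>R (u x - c))) \<longlonglongrightarrow> 0"
    using restrict_tendsto[OF L(1) L(3) f(2) KL] by (simp add: right_diff_distrib)
  have t2: "(\<lambda>k. nrm2 (\<lambda>x. ind K x *\<^sub>R grad (\<phi> k) x - ind K x *\<^sub>R g x)) \<longlonglongrightarrow> 0"
    by (rule restrict_tendsto[OF L(2) L(4) f(3) KL])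
  have ind: "ind K x * t * ind K x = ind K x * t" for x and t :: real by (simp add: indicator_def)
  have "(\<lambda>k. LINT x|lebesgue. (ind K x *\<^sub>R (\<phi> k x - c)) \<bullet> ind K x) \<longlonglongrightarrow> (LINT x|lebesgue. (ind K x *\<^sub>R (u x - c)) \<bullet> ind K x)"
    by (rule L2_inner_tendsto[OF Lf Lu t1 L1])
  then have t3: "(\<lambda>k. LINT x|lebesgue. ind K x * (\<phi> k x - c)) \<longlonglongrightarrow> (LINT x|lebesgue. ind K x * (u x - c))"
    by (simp add: ind)
  show "(nrm2 (res K (\<lambda>x. u x - c)))\<^sup>2
     \<le> d\<^sup>2 * 2 ^ CARD('n) * (nrm2 (res K g))\<^sup>2 + (LINT x|lebesgue. ind K x * (u x - c))\<^sup>2 / measure lborel K"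
  proof (rule LIMSEQ_le)
    show "(\<lambda>k. (nrm2 (res K (\<lambda>x. \<phi> k x - c)))\<^sup>2) \<longlonglongrightarrow> (nrm2 (res K (\<lambda>x. u x - c)))\<^sup>2"
      by (intro tendsto_power nrm2_tendsto[OF Lf Lu t1])
    show "(\<lambda>k. d\<^sup>2 * 2 ^ CARD('n) * (nrm2 (res K (grad (\<phi> k))))\<^sup>2 + (LINT x|lebesgue. ind K x * (\<phi> k x - c))\<^sup>2 / measure lborel K)
      \<longlonglongrightarrow> d\<^sup>2 * 2 ^ CARD('n) * (nrm2 (res K g))\<^sup>2 + (LINT x|lebesgue. ind K x * (u x - c))\<^sup>2 / measure lborel K"
      by (intro tendsto_add tendsto_mult_left tendsto_power tendsto_divide tendsto_const t3 nrm2_tendsto[OF R(2) R(4) t2]) (use m in auto)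
    have "(nrm2 (res K (\<lambda>x. \<phi> k x - c)))\<^sup>2
      \<le> d\<^sup>2 * 2 ^ CARD('n) * (nrm2 (res K (grad (\<phi> k))))\<^sup>2 + (LINT x|lebesgue. ind K x * (\<phi> k x - c))\<^sup>2 / measure lborel K" for k
    proof -
      have "(LINT x|lebesgue. ind K x * (\<phi> k x - c)) = (LINT x|lborel. ind K x * (\<phi> k x - c))"
        by (rule integral_completion) (use K in measurable)
      then show ?thesis
        using cell_poincare_smooth(1)[OF s K d m, of k c]
          nrm2_restrict_sq_lborel[of "\<lambda>x. \<phi> k x - c" K] nrm2_restrict_sq_lborel[of "grad (\<phi> k)" K] K(1)
        by simp
    qed
    then show "\<exists>N. \<forall>k\<ge>N. (nrm2 (res K (\<lambda>x. \<phi> k x - c)))\<^sup>2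
      \<le> d\<^sup>2 * 2 ^ CARD('n) * (nrm2 (res K (grad (\<phi> k))))\<^sup>2 + (LINT x|lebesgue. ind K x * (\<phi> k x - c))\<^sup>2 / measure lborel K"
      by simp
  qed
  define M where "M = measure lborel K"
  have M0: "M > 0" using m by (simp add: M_def)
  define a where "a k = (LINT x|lebesgue. ind K x * \<phi> k x) / M" for k
  define b where "b = (LINT x|lebesgue. ind K x * u x) / M"
  have "(\<lambda>k. LINT x|lebesgue. \<phi> k x \<bullet> ind K x) \<longlonglongrightarrow> (LINT x|lebesgue. u x \<bullet> ind K x)"
    by (rule L2_inner_tendsto[OF L(1) L(3) f(2) L1])
  then have ab: "a \<longlonglongrightarrow> b" unfolding a_def b_def using M0 by (intro tendsto_divide tendsto_const) (simp_all add: mult.commute)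
  have iK: "integrable lebesgue (ind K :: _ \<Rightarrow> real)"
    proof -
    have "(\<lambda>x. ind K x * ind K x :: real) = ind K" by (auto simp: indicator_def)
    then show ?thesis using L2_mult_integrable_real[OF L1 L1] by (simp only:)
  qed
  have lK: "(LINT x|lebesgue. ind K x) = M" unfolding M_def using KL K by simp
  have LaK: "L2 (res K (\<lambda>x. u x - b))" using L2_diff[OF R(3) L2_indicator[OF K(1,3), of b]] by (simp add: right_diff_distrib)
  have LaK': "L2 (res K (\<lambda>x. \<phi> k x - a k))" for k using L2_diff[OF R(1) L2_indicator[OF K(1,3), of "a k"]] by (simp add: right_diff_distrib)
  have int1: "integrable lebesgue (\<lambda>x. ind K x * \<bar>u x - b\<bar>)"
    using L2_mult_integrable[OF LaK L1] by (simp add: abs_mult ind)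
  have int2: "integrable lebesgue (\<lambda>x. ind K x * \<bar>\<phi> k x - a k\<bar>)" for k
    using L2_mult_integrable[OF LaK'[of k] L1] by (simp add: abs_mult ind)
  have Ld: "L2 (\<lambda>x. \<phi> k x - u x)" and Ldg: "L2 (\<lambda>x. grad (\<phi> k) x - g x)" for k using L by (auto intro: L2_diff)
  have int3: "integrable lebesgue (\<lambda>x. \<bar>\<phi> k x - u x\<bar> * ind K x)" for k
    using L2_mult_integrable[OF Ld L1] by simp
  have int4: "integrable lebesgue (\<lambda>x. norm (grad (\<phi> k) x) * ind K x)" for k
    using L2_mult_integrable[OF L(2) L1] by simp
  have int5: "integrable lebesgue (\<lambda>x. norm (g x) * ind K x)"
    using L2_mult_integrable[OF L(4) L1] by simp
  have int6: "integrable lebesgue (\<lambda>x. norm (grad (\<phi> k) x - g x) * ind K x)" for k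
    using L2_mult_integrable[OF Ldg L1] by simp
  let ?G = "LINT x|lebesgue. norm (g x) * ind K x"
  \<comment> \<open>\<open>e\<close> is the cost of replacing the approximant and its mean
    \<open>a k\<close> by u and \<open>b\<close>, and \<open>e'\<close> the cost of replacing the
    gradients.\<close>
  define e where "e k = nrm2 (\<lambda>x. \<phi> k x - u x) * nrm2 (\<lambda>x. ind K x :: real) + \<bar>a k - b\<bar> * M" for k
  define e' where "e' k = nrm2 (\<lambda>x. grad (\<phi> k) x - g x) * nrm2 (\<lambda>x. ind K x :: real)" for k
  have "(\<lambda>k. \<bar>a k - b\<bar>) \<longlonglongrightarrow> 0" using tendsto_rabs[OF LIM_zero[OF ab]] by simp
  then have e0: "e \<longlonglongrightarrow> 0" unfolding e_def
    by (intro tendsto_add_zero tendsto_mult_left_zero f(2))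
  have e'0: "e' \<longlonglongrightarrow> 0" unfolding e'_def by (intro tendsto_mult_left_zero f(3))
  obtain z where z: "z \<in> K" using m by (cases "K = {}") auto
  have d0: "0 \<le> d" using d[OF z z] by simp
  have "(LINT y|lebesgue. ind K y * \<bar>u y - b\<bar>) \<le> 2 ^ CARD('n) * d * (?G + e' k) + e k" for k
  proof -
    have "(LINT y|lebesgue. ind K y * \<bar>u y - b\<bar>)
      \<le> (LINT y|lebesgue. ind K y * \<bar>\<phi> k y - a k\<bar> + \<bar>\<phi> k y - u y\<bar> * ind K y + \<bar>a k - b\<bar> * ind K y)"
    proof (rule integral_mono)
      show "ind K y * \<bar>u y - b\<bar> \<le> ind K y * \<bar>\<phi> k y - a k\<bar> + \<bar>\<phi> k y - u y\<bar> * ind K y + \<bar>a k - b\<bar> * ind K y" for y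
      proof -
        have "\<bar>u y - b\<bar> \<le> \<bar>\<phi> k y - a k\<bar> + \<bar>\<phi> k y - u y\<bar> + \<bar>a k - b\<bar>" by argo
        then show ?thesis by (simp add: indicator_def)
      qed
    qed (intro Bochner_Integration.integrable_add int1 int2 int3 integrable_mult_right iK)+
    also have "\<dots> = (LINT y|lebesgue. ind K y * \<bar>\<phi> k y - a k\<bar>) + (LINT y|lebesgue. \<bar>\<phi> k y - u y\<bar> * ind K y) + \<bar>a k - b\<bar> * M"
      using int2 int3 iK lK by simp
    also have "(LINT y|lebesgue. \<bar>\<phi> k y - u y\<bar> * ind K y) \<le> nrm2 (\<lambda>x. \<phi> k x - u x) * nrm2 (\<lambda>x. ind K x :: real)"
      using CS_norm[OF Ld L1, of k] by simp
    also have "(LINT y|lebesgue. ind K y * \<bar>\<phi> k y - a k\<bar>) \<le> 2 ^ CARD('n) * d * (LINT x|lebesgue. norm (grad (\<phi> k) x) * ind K x)"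
    proof -
      have "(LINT y|lebesgue. ind K y * \<bar>\<phi> k y - a k\<bar>) = (LINT y|lborel. ind K y * \<bar>\<phi> k y - a k\<bar>)"
        by (rule integral_completion) (use K in measurable)
      moreover have "a k = (LINT x|lborel. ind K x * \<phi> k x) / M"
        unfolding a_def by (subst integral_completion) (use K in measurable)
      moreover have "(LINT x|lebesgue. norm (grad (\<phi> k) x) * ind K x) = (LINT x|lborel. norm (grad (\<phi> k) x) * ind K x)"
        by (rule integral_completion) (use K in measurable)
      ultimately show ?thesis
        using cell_poincare_smooth(2)[OF s K d m, of k] by (simp add: M_def mult.commute)
    qed
    also have "(LINT x|lebesgue. norm (grad (\<phi> k) x) * ind K x) \<le> ?G + e' k"
    proof -
      have "(LINT x|lebesgue. norm (grad (\<phi> k) x) * ind K x) \<le> (LINT x|lebesgue. norm (g x) * ind K x + norm (grad (\<phi> k) x - g x) * ind K x)"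
      proof (rule integral_mono)
        show "norm (grad (\<phi> k) x) * ind K x \<le> norm (g x) * ind K x + norm (grad (\<phi> k) x - g x) * ind K x" for x
          using norm_triangle_ineq[of "g x" "grad (\<phi> k) x - g x"] by (simp add: indicator_def)
      qed (intro Bochner_Integration.integrable_add int4 int5 int6)+
      also have "\<dots> = ?G + (LINT x|lebesgue. norm (grad (\<phi> k) x - g x) * ind K x)" using int5 int6 by simp
      also have "(LINT x|lebesgue. norm (grad (\<phi> k) x - g x) * ind K x) \<le> e' k"
        unfolding e'_def using CS_norm[OF Ldg L1, of k] by simp
      finally show ?thesis by simp
    qed
    finally show ?thesis using d0 by (simp add: e_def mult_left_mono)
  qed
  moreover have "(\<lambda>k. 2 ^ CARD('n) * d * (?G + e' k) + e k) \<longlonglongrightarrow> 2 ^ CARD('n) * d * (?G + 0) + 0"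
    by (intro tendsto_intros e0 e'0)
  ultimately have "(LINT y|lebesgue. ind K y * \<bar>u y - b\<bar>) \<le> 2 ^ CARD('n) * d * (?G + 0) + 0"
    by (intro LIMSEQ_le_const) auto
  then show "(LINT y|lebesgue. ind K y * \<bar>u y - (LINT x|lebesgue. ind K x * u x) / measure lborel K\<bar>)
      \<le> 2 ^ CARD('n) * d * (LINT x|lebesgue. ind K x * norm (g x))"
    unfolding b_def M_def by (simp add: mult.commute)
qed

section \<open>Grids of cubes and the Poincare inequality at a given scale\<close>

definition cell :: "real \<Rightarrow> ('n \<Rightarrow> int) \<Rightarrow> (real^'n) set" where
  "cell h m = {x. \<forall>i. h * real_of_int (m i) \<le> x $ i \<and> x $ i < h * (real_of_int (m i) + 1)}"

lemma cell_alt: "cell h m = (\<Inter>i\<in>UNIV. {x. axis i 1 \<bullet> x \<ge> h * real_of_int (m i)} \<inter> {x. axis i 1 \<bullet> x < h * (real_of_int (m i) + 1)})"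
  by (auto simp: cell_def inner_axis')

lemma cell_borel: fixes m :: "'n::finite \<Rightarrow> int" shows "cell h m \<in> sets borel"
proof -
  have "{x::real^'n. axis i 1 \<bullet> x \<ge> h * real_of_int (m i)} \<inter> {x. axis i 1 \<bullet> x < h * (real_of_int (m i) + 1)} \<in> sets borel" for i
    by (intro sets.Int borel_closed borel_open closed_halfspace_ge open_halfspace_lt)
  then show ?thesis unfolding cell_alt by (intro sets.finite_INT) auto
qed

lemma convex_cell: fixes m :: "'n::finite \<Rightarrow> int" shows "convex (cell h m)"
  unfolding cell_alt by (intro convex_INT convex_Int convex_halfspace_ge convex_halfspace_lt)

lemma cell_diam: fixes m :: "'n::finite \<Rightarrow> int" assumes "x \<in> cell h m" "y \<in> cell h m" shows "norm (x - y) \<le> real CARD('n) * h"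
proof -
  have "norm (x - y) \<le> (\<Sum>i\<in>UNIV. \<bar>(x - y) $ i\<bar>)" by (rule norm_le_l1_cart)
  also have "\<dots> \<le> (\<Sum>i\<in>(UNIV::'n set). h)"
  proof (rule sum_mono)
    fix i
    have "h * real_of_int (m i) \<le> x $ i" "x $ i < h * real_of_int (m i) + h" "h * real_of_int (m i) \<le> y $ i" "y $ i < h * real_of_int (m i) + h"
      using assms by (auto simp: cell_def distrib_left)
    then show "\<bar>(x - y) $ i\<bar> \<le> h" unfolding vector_minus_component by linarith
  qed
  finally show ?thesis by simp
qed

text \<open>Half-open cubes tile the space: the index of the cell of a point is read off by rounding
  down. Sums over cells therefore count each point at most once, while convexity keeps
  \<open>cell_poincare_W\<close> applicable.\<close>

lemma cell_disjoint: assumes "h > 0" "x \<in> cell h m" shows "m = (\<lambda>i. \<lfloor>x $ i / h\<rfloor>)"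
proof
  fix i
  have "h * real_of_int (m i) \<le> x $ i" "x $ i < h * (real_of_int (m i) + 1)" using assms by (auto simp: cell_def)
  then have "real_of_int (m i) \<le> x $ i / h" "x $ i / h < real_of_int (m i) + 1"
    using assms(1) by (simp_all add: field_simps)
  then show "m i = \<lfloor>x $ i / h\<rfloor>" by linarith
qed

lemma cell_cover: assumes "h > 0" shows "x \<in> cell h (\<lambda>i. \<lfloor>x $ i / h\<rfloor>)"
proof -
  have "h * real_of_int \<lfloor>t / h\<rfloor> \<le> t \<and> t < h * (real_of_int \<lfloor>t / h\<rfloor> + 1)" for t
  proof -
    have "h * real_of_int \<lfloor>t / h\<rfloor> \<le> h * (t / h)" "h * (t / h) < h * (real_of_int \<lfloor>t / h\<rfloor> + 1)"
      using assms by (intro mult_left_mono mult_strict_left_mono; linarith)+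
    then show ?thesis using assms by simp
  qed
  then show ?thesis by (simp add: cell_def)
qed

lemma cell_bounded: fixes m :: "'n::finite \<Rightarrow> int" shows "bounded (cell h m)"
proof (cases "cell h m = {}")
  case False
  then obtain z where "z \<in> cell h m" by blast
  then have "cell h m \<subseteq> cball z (real CARD('n) * h)"
    using cell_diam[of z h m] by (auto simp: dist_norm)
  then show ?thesis by (rule bounded_subset[OF bounded_cball])
qed simp

lemma cell_measure: fixes m :: "'n::finite \<Rightarrow> int" assumes h: "h > 0" shows "measure lborel (cell h m) = h ^ CARD('n)"
proof -
  let ?a = "\<chi> i. h * real_of_int (m i)" and ?b = "\<chi> i. h * (real_of_int (m i) + 1)"
  have le: "?a $ i \<le> ?b $ i" for i using h by simp
  have c: "measure lborel (cbox ?a ?b) = h ^ CARD('n)"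
  proof -
    have "cbox ?a ?b \<noteq> {}" using le by (auto simp: interval_ne_empty_cart)
    then have "measure lborel (cbox ?a ?b) = (\<Prod>i\<in>UNIV. ?b $ i - ?a $ i)" by (rule content_cbox_cart)
    also have "\<dots> = (\<Prod>i\<in>(UNIV::'n set). h)" by (intro prod.cong refl) (simp add: algebra_simps)
    finally show ?thesis by simp
  qed
  have b: "measure lborel (box ?a ?b) = h ^ CARD('n)"
    using c by (simp add: measure_lborel_box_eq measure_lborel_cbox_eq)
  have s1: "box ?a ?b \<subseteq> cell h m" and s2: "cell h m \<subseteq> cbox ?a ?b"
    by (auto simp: cell_def mem_box_cart less_imp_le)
  have fin: "emeasure lborel (cbox ?a ?b) < \<infinity>" by (rule emeasure_lborel_cbox_finite)
  have fcb: "cbox ?a ?b \<in> fmeasurable lborel" using fin by (simp add: fmeasurable_def)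
  have fc: "cell h m \<in> fmeasurable lborel"
    by (rule fmeasurableI2[OF fcb s2]) (simp add: cell_borel)
  have "measure lborel (box ?a ?b) \<le> measure lborel (cell h m)"
    by (rule measure_mono_fmeasurable[OF s1 _ fc]) simp
  moreover have "measure lborel (cell h m) \<le> measure lborel (cbox ?a ?b)"
    by (rule measure_mono_fmeasurable[OF s2]) (simp_all add: cell_borel fcb)
  ultimately show ?thesis using b c by simp
qed

lemma finite_cells: fixes S :: "(real^'n) set" assumes h: "h > 0" and "bounded S" shows "finite {m. cell h m \<inter> S \<noteq> {}}"
proof -
  obtain R where R: "\<forall>x\<in>S. norm x \<le> R" using assms(2) unfolding bounded_iff by metis
  let ?N = "\<lceil>R / h\<rceil> + 1"
  have "{m. cell h m \<inter> S \<noteq> {}} \<subseteq> (PiE UNIV (\<lambda>_. {- ?N .. ?N}))"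
  proof
    fix m assume "m \<in> {m. cell h m \<inter> S \<noteq> {}}"
    then obtain x where x: "x \<in> cell h m" "x \<in> S" by blast
    have "m i \<in> {- ?N .. ?N}" for i
    proof -
      have "\<bar>x $ i\<bar> \<le> R" using R x(2) component_le_norm_cart[of x i] order_trans by blast
      then have "x $ i / h \<le> R / h" "- (R / h) \<le> x $ i / h" using h by (simp_all add: field_simps)
      moreover have "m i = \<lfloor>x $ i / h\<rfloor>" using cell_disjoint[OF h x(1)] by metis
      ultimately show ?thesis by (simp only: atLeastAtMost_iff) linarith
    qed
    then show "m \<in> (PiE UNIV (\<lambda>_. {- ?N .. ?N}))" by (simp add: PiE_UNIV_domain)
  qed
  moreover have "finite (PiE (UNIV :: 'n set) (\<lambda>_. {- ?N .. ?N}))" by (intro finite_PiE) auto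
  ultimately show ?thesis by (rule finite_subset)
qed

lemma cells_sum_le_1: assumes "h > 0" "finite Q" shows "(\<Sum>m\<in>Q. ind (cell h m) x) \<le> (1::real)"
proof -
  let ?m = "\<lambda>i. \<lfloor>x $ i / h\<rfloor>"
  have "(\<Sum>m\<in>Q. ind (cell h m) x) = (\<Sum>m\<in>Q. if m = ?m then 1 else (0::real))"
    using cell_disjoint[OF assms(1)] cell_cover[OF assms(1)] by (intro sum.cong refl) (auto simp: indicator_def)
  also have "\<dots> \<le> 1" using assms(2) by simp
  finally show ?thesis .
qed

text \<open>The cell inequality summed over the finitely many cells that meet S. Oscillation inside
  the cells costs a multiple of h^2 times the gradient; what remains is the finite-dimensional
  information given by the cell integrals. Compactness and the reverse Hoelder inequality both rest
  on this split.\<close>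

lemma grid_poincare:
  fixes u :: "real^'n \<Rightarrow> real"
  assumes w: "W D u g" and S: "bounded S" "S \<in> sets lebesgue" and h: "h > 0" and S': "S' \<in> sets lebesgue"
    and near: "\<And>x y. x \<in> S \<Longrightarrow> norm (x - y) \<le> real CARD('n) * h \<Longrightarrow> y \<in> S'"
  defines "Q \<equiv> {m. cell h m \<inter> S \<noteq> {}}"
  shows "L2 (res S (\<lambda>x. u x - c))"
    "(nrm2 (res S (\<lambda>x. u x - c)))\<^sup>2 \<le> (real CARD('n) * h)\<^sup>2 * 2 ^ CARD('n) * (nrm2 (res S' g))\<^sup>2
       + (\<Sum>m\<in>Q. (LINT x|lebesgue. ind (cell h m) x * (u x - c))\<^sup>2) / h ^ CARD('n)"
proof -
  have fQ: "finite Q" unfolding Q_def by (rule finite_cells[OF h S(1)])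
  note L = W_L2[OF w]
  have cm: "cell h m \<in> sets lebesgue" for m :: "'n \<Rightarrow> int" by (rule borel_sets_lebesgue[OF cell_borel])
  have Lc: "L2 (res (cell h m) (\<lambda>x. u x - c))" for m
    using L2_diff[OF nrm2_restrict_le(1)[OF L(1) cm] L2_indicator[OF cell_borel cell_bounded, of h m c]] by (simp add: right_diff_distrib)
  have Lg: "L2 (res (cell h m) g)" for m by (rule nrm2_restrict_le(1)[OF L(2) cm])
  have Lg': "L2 (res S' g)" by (rule nrm2_restrict_le(1)[OF L(2) S'])
  have sq: "(norm (ind A x *\<^sub>R v))\<^sup>2 = ind A x * (norm v)\<^sup>2" for A :: "(real^'n) set" and x and v :: "'z::real_normed_vector"
    by (simp add: indicator_def)
  have iQ: "integrable lebesgue (\<lambda>x. \<Sum>m\<in>Q. ind (cell h m) x * (norm (u x - c))\<^sup>2)"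
    using L2_int[OF Lc] unfolding sq by (intro Bochner_Integration.integrable_sum)
  have dom: "ind S x * (norm (u x - c))\<^sup>2 \<le> (\<Sum>m\<in>Q. ind (cell h m) x * (norm (u x - c))\<^sup>2)" for x
  proof (cases "x \<in> S")
    case True
    let ?m = "\<lambda>i. \<lfloor>x $ i / h\<rfloor>"
    have "?m \<in> Q" unfolding Q_def using cell_cover[OF h, of x] True by blast
    then have "ind (cell h ?m) x * (norm (u x - c))\<^sup>2 \<le> (\<Sum>m\<in>Q. ind (cell h m) x * (norm (u x - c))\<^sup>2)"
      using fQ by (intro member_le_sum[where f="\<lambda>m. ind (cell h m) x * (norm (u x - c))\<^sup>2"]) auto
    then show ?thesis using True cell_cover[OF h, of x] by simp
  qed (simp add: sum_nonneg)
  show LS: "L2 (res S (\<lambda>x. u x - c))"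
  proof (rule L2_bound[OF _ iQ])
    show "(res S (\<lambda>x. u x - c)) \<in> LM"
      using L2_meas[OF L(1)] S(2) by (intro borel_measurable_scaleR borel_measurable_diff) auto
    show "AE x in lebesgue. (norm (ind S x *\<^sub>R (u x - c)))\<^sup>2 \<le> (\<Sum>m\<in>Q. ind (cell h m) x * (norm (u x - c))\<^sup>2)"
      using dom by (intro AE_I2) (simp only: sq)
  qed
  have "(nrm2 (res S (\<lambda>x. u x - c)))\<^sup>2 \<le> (LINT x|lebesgue. (\<Sum>m\<in>Q. ind (cell h m) x * (norm (u x - c))\<^sup>2))"
    unfolding nrm2_sq sq using L2_int[OF LS] iQ dom by (intro integral_mono) (simp_all only: sq)
  also have "\<dots> = (\<Sum>m\<in>Q. (nrm2 (res (cell h m) (\<lambda>x. u x - c)))\<^sup>2)"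
    unfolding nrm2_sq sq using L2_int[OF Lc] unfolding sq by (intro Bochner_Integration.integral_sum)
  also have "\<dots> \<le> (\<Sum>m\<in>Q. (real CARD('n) * h)\<^sup>2 * 2 ^ CARD('n) * (nrm2 (res (cell h m) g))\<^sup>2 + (LINT x|lebesgue. ind (cell h m) x * (u x - c))\<^sup>2 / h ^ CARD('n))"
  proof (rule sum_mono)
    fix m
    show "(nrm2 (res (cell h m) (\<lambda>x. u x - c)))\<^sup>2 \<le> (real CARD('n) * h)\<^sup>2 * 2 ^ CARD('n) * (nrm2 (res (cell h m) g))\<^sup>2 + (LINT x|lebesgue. ind (cell h m) x * (u x - c))\<^sup>2 / h ^ CARD('n)"
      using cell_poincare_W(1)[OF w cell_borel[of h m] convex_cell[of h m] cell_bounded[of h m] cell_diam[of _ h m], of c] h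
      by (simp add: cell_measure[OF h])
  qed
  also have "\<dots> = (real CARD('n) * h)\<^sup>2 * 2 ^ CARD('n) * (\<Sum>m\<in>Q. (nrm2 (res (cell h m) g))\<^sup>2) + (\<Sum>m\<in>Q. (LINT x|lebesgue. ind (cell h m) x * (u x - c))\<^sup>2) / h ^ CARD('n)"
    by (simp add: sum.distrib sum_distrib_left sum_divide_distrib)
  also have "(\<Sum>m\<in>Q. (nrm2 (res (cell h m) g))\<^sup>2) \<le> (nrm2 (res S' g))\<^sup>2"
  proof -
    have i: "integrable lebesgue (\<lambda>x. ind (cell h m) x * (norm (g x))\<^sup>2)" for m
      using L2_int[OF Lg[of m]] unfolding sq .
    have "(\<Sum>m\<in>Q. (nrm2 (res (cell h m) g))\<^sup>2) = (LINT x|lebesgue. (\<Sum>m\<in>Q. ind (cell h m) x * (norm (g x))\<^sup>2))"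
      unfolding nrm2_sq sq by (intro Bochner_Integration.integral_sum[symmetric] i)
    also have "\<dots> \<le> (LINT x|lebesgue. ind S' x * (norm (g x))\<^sup>2)"
    proof (rule integral_mono)
      show "integrable lebesgue (\<lambda>x. \<Sum>m\<in>Q. ind (cell h m) x * (norm (g x))\<^sup>2)" by (intro Bochner_Integration.integrable_sum i)
      show "integrable lebesgue (\<lambda>x. ind S' x * (norm (g x))\<^sup>2)" using L2_int[OF Lg'] unfolding sq .
      fix x
      show "(\<Sum>m\<in>Q. ind (cell h m) x * (norm (g x))\<^sup>2) \<le> ind S' x * (norm (g x))\<^sup>2"
      proof (cases "x \<in> S'")
        case True
        have "(\<Sum>m\<in>Q. ind (cell h m) x) * (norm (g x))\<^sup>2 \<le> 1 * (norm (g x))\<^sup>2"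
          by (intro mult_right_mono cells_sum_le_1 h fQ) simp
        then show ?thesis using True by (simp add: sum_distrib_right)
      next
        case False
        have "x \<notin> cell h m" if "m \<in> Q" for m
        proof
          assume xm: "x \<in> cell h m"
          from that obtain y where y: "y \<in> cell h m" "y \<in> S" unfolding Q_def by blast
          show False using near[OF y(2) cell_diam[OF y(1) xm]] False by blast
        qed
        then have "(\<Sum>m\<in>Q. ind (cell h m) x * (norm (g x))\<^sup>2) = 0" by (intro sum.neutral) simp
        then show ?thesis using False by simp
      qed
    qed
    also have "\<dots> = (nrm2 (res S' g))\<^sup>2" unfolding nrm2_sq sq ..
    finally show ?thesis .
  qed
  finally show "(nrm2 (res S (\<lambda>x. u x - c)))\<^sup>2 \<le> (real CARD('n) * h)\<^sup>2 * 2 ^ CARD('n) * (nrm2 (res S' g))\<^sup>2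
       + (\<Sum>m\<in>Q. (LINT x|lebesgue. ind (cell h m) x * (u x - c))\<^sup>2) / h ^ CARD('n)"
    by (simp add: mult_left_mono)
qed

section \<open>Compactness and existence\<close>

text \<open>A small h makes the gradient term of \<open>grid_poincare\<close> small uniformly in k.
  For this fixed h, the rest consists of finitely many integrals against indicators of cells, which
  tend to 0 by weak convergence.\<close>

lemma rellich:
  fixes u :: "nat \<Rightarrow> real^'n \<Rightarrow> real"
  assumes D: "bounded D" "open D" and w: "\<And>k. W D (u k) (g k)" and M: "\<And>k. nrm2 (g k) \<le> M"
    and weak: "\<And>f. L2 f \<Longrightarrow> (\<lambda>k. LINT x|lebesgue. u k x * f x) \<longlonglongrightarrow> 0"
  shows "(\<lambda>k. nrm2 (u k)) \<longlonglongrightarrow> 0"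
proof (rule LIMSEQ_I)
  fix e :: real assume e: "0 < e"
  let ?c = "\<lambda>h. (real CARD('n) * h)\<^sup>2 * 2 ^ CARD('n) * M\<^sup>2"
  have "(?c \<longlongrightarrow> (real CARD('n) * 0)\<^sup>2 * 2 ^ CARD('n) * M\<^sup>2) (at_right 0)" by (intro tendsto_intros)
  then have "(?c \<longlongrightarrow> 0) (at_right 0)" by simp
  then have "eventually (\<lambda>h. ?c h < e\<^sup>2 / 2) (at_right 0)" using e by (intro order_tendstoD) auto
  moreover have "eventually (\<lambda>h::real. 0 < h) (at_right 0)" by (rule eventually_at_right_less)
  ultimately have "eventually (\<lambda>h. ?c h < e\<^sup>2 / 2 \<and> 0 < h) (at_right 0)" by (rule eventually_conj)
  from eventually_happens'[OF trivial_limit_at_right_real this]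
  obtain h where h: "?c h < e\<^sup>2 / 2 \<and> 0 < h" by (elim exE)
  define Q where "Q = {m. cell h m \<inter> D \<noteq> {}}"
  define T where "T k = (\<Sum>m\<in>Q. (LINT x|lebesgue. ind (cell h m) x * u k x)\<^sup>2) / h ^ CARD('n)" for k
  have "(\<lambda>k. LINT x|lebesgue. ind (cell h m) x * u k x) \<longlonglongrightarrow> 0" for m
    using weak[of "ind (cell h m)"] L2_indicator[OF cell_borel cell_bounded, of h m "1::real"] by (simp add: mult.commute)
  then have "T \<longlonglongrightarrow> (\<Sum>m\<in>Q. 0\<^sup>2) / h ^ CARD('n)"
    unfolding T_def using h by (intro tendsto_intros) auto
  then have "T \<longlonglongrightarrow> 0" by simp
  then have ev: "eventually (\<lambda>k. T k < e\<^sup>2 / 2) sequentially" using e by (intro order_tendstoD) auto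
  have bound: "(nrm2 (u k))\<^sup>2 \<le> ?c h + T k" for k
  proof -
    have DL: "D \<in> sets lebesgue" using D by auto
    note L = W_L2[OF w[of k]]
    have "nrm2 (u k) = nrm2 (res D (u k))"
    proof (rule nrm2_cong_AE)
      show "AE x in lebesgue. u k x = ind D x *\<^sub>R u k x"
        using W_zero_outside[OF w D(2), of k] by eventually_elim (auto simp: indicator_def)
    qed (use L2_meas[OF L(1)] L2_meas[OF nrm2_restrict_le(1)[OF L(1) DL]] in auto)
    moreover have "(nrm2 (res D (\<lambda>x. u k x - 0)))\<^sup>2 \<le> (real CARD('n) * h)\<^sup>2 * 2 ^ CARD('n) * (nrm2 (res UNIV (g k)))\<^sup>2
       + (\<Sum>m\<in>Q. (LINT x|lebesgue. ind (cell h m) x * (u k x - 0))\<^sup>2) / h ^ CARD('n)"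
      unfolding Q_def by (rule grid_poincare(2)[OF w D(1) DL]) (use h in auto)
    moreover have "(real CARD('n) * h)\<^sup>2 * 2 ^ CARD('n) * (nrm2 (g k))\<^sup>2 \<le> ?c h"
      using M by (intro mult_left_mono power_mono) auto
    ultimately show ?thesis by (simp add: T_def)
  qed
  show "\<exists>no. \<forall>k\<ge>no. norm (nrm2 (u k) - 0) < e"
  proof -
    obtain N where N: "\<forall>k\<ge>N. T k < e\<^sup>2 / 2" using ev unfolding eventually_sequentially by (elim exE)
    have "nrm2 (u k) < e" if "k \<ge> N" for k
    proof -
      have "T k < e\<^sup>2 / 2" using N that by blast
      then have "(nrm2 (u k))\<^sup>2 < e\<^sup>2" using bound[of k] h by argo
      then show ?thesis by (rule power2_less_imp_less[OF _ less_imp_le[OF e]])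
    qed
    then show ?thesis by (intro exI[of _ N]) simp
  qed
qed

lemma sum_squares_le: fixes a :: "'i \<Rightarrow> real" assumes "\<And>i. i \<in> I \<Longrightarrow> 0 \<le> a i" "finite I" shows "(\<Sum>i\<in>I. (a i)\<^sup>2) \<le> (\<Sum>i\<in>I. a i)\<^sup>2"
proof -
  have "(\<Sum>i\<in>I. (a i)\<^sup>2) \<le> (\<Sum>i\<in>I. a i * (\<Sum>i\<in>I. a i))"
    unfolding power2_eq_square using assms by (intro sum_mono mult_left_mono member_le_sum) auto
  also have "\<dots> = (\<Sum>i\<in>I. a i)\<^sup>2" by (simp add: power2_eq_square sum_distrib_right)
  finally show ?thesis .
qed

text \<open>A substitute for the Sobolev-Poincare inequality: the L2 oscillation is bounded by a
  small multiple of the L2 norm of the gradient plus a large multiple of its L1 norm. A grid of mesh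
  proportional to \<delta> r yields the first term. The cell integrals are controlled by the L1
  Poincare inequality on the doubled ball, since a sum of squares of nonnegative numbers is at most
  the square of their sum.\<close>

lemma local_poincare:
  fixes u :: "real^'n \<Rightarrow> real" and x0 :: "real^'n"
  assumes w: "W D u g" and r: "r > 0" and \<delta>: "0 < \<delta>" "\<delta> \<le> 1"
  defines "B2 \<equiv> ball x0 (2 * r)"
  defines "c \<equiv> (LINT x|lebesgue. ind B2 x * u x) / measure lborel B2"
  shows "(nrm2 (res (ball x0 r) (\<lambda>x. u x - c)))\<^sup>2
     \<le> \<delta>\<^sup>2 * r\<^sup>2 * 2 ^ CARD('n) * (nrm2 (res B2 g))\<^sup>2
      + (real CARD('n) / \<delta>) ^ CARD('n) * (2 ^ CARD('n) * 4)\<^sup>2 * (r\<^sup>2 / r ^ CARD('n)) * (LINT x|lebesgue. ind B2 x * norm (g x))\<^sup>2"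
    "L2 (res (ball x0 r) (\<lambda>x. u x - c))"
proof -
  let ?n = "CARD('n)"
  \<comment> \<open>The bound for the diameter of a cell becomes \<delta> r, at most r, so cells
    meeting the ball of radius r lie in the ball of radius 2 r.\<close>
  define h where "h = \<delta> * r / real ?n"
  have n0: "real ?n > 0" by simp
  have h: "h > 0" unfolding h_def using r \<delta> by simp
  have nh: "real ?n * h = \<delta> * r" unfolding h_def by simp
  define Q where "Q = {m. cell h m \<inter> ball x0 r \<noteq> {}}"
  have fQ: "finite Q" unfolding Q_def by (rule finite_cells[OF h]) simp
  note L = W_L2[OF w]
  have B2L: "B2 \<in> sets lebesgue" and B2b: "B2 \<in> sets borel" "convex B2" "bounded B2" by (auto simp: B2_def)
  have near: "y \<in> B2" if "x \<in> ball x0 r" "norm (x - y) \<le> real ?n * h" for x y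
  proof -
    have "norm (x - y) \<le> 1 * r" using that(2) \<delta> r mult_right_mono[of \<delta> 1 r] unfolding nh by linarith
    then have "dist x y \<le> r" by (simp add: dist_norm)
    moreover have "dist x0 x < r" using that by simp
    ultimately show ?thesis unfolding B2_def mem_ball using dist_triangle[of x0 y x] by linarith
  qed
  have gp: "(nrm2 (res (ball x0 r) (\<lambda>x. u x - c)))\<^sup>2 \<le> (real ?n * h)\<^sup>2 * 2 ^ ?n * (nrm2 (res B2 g))\<^sup>2
       + (\<Sum>m\<in>Q. (LINT x|lebesgue. ind (cell h m) x * (u x - c))\<^sup>2) / h ^ ?n"
    unfolding Q_def by (rule grid_poincare(2)[OF w _ _ h B2L near]) auto
  show "L2 (res (ball x0 r) (\<lambda>x. u x - c))"
    by (rule grid_poincare(1)[OF w _ _ h B2L near]) auto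
  have mB: "0 < measure lborel B2" unfolding B2_def using r
    by (simp add: content_ball_pos)
  have LB: "L2 (res B2 (\<lambda>x. u x - c))"
    using L2_diff[OF nrm2_restrict_le(1)[OF L(1) B2L] L2_indicator[OF B2b(1,3), of c]] by (simp add: right_diff_distrib)
  have L1: "L2 (\<lambda>x. ind B2 x :: real)" using L2_indicator[OF B2b(1,3), of "1::real"] by simp
  have iB: "integrable lebesgue (\<lambda>x. ind B2 x * \<bar>u x - c\<bar>)"
  proof -
    have e: "norm (ind B2 x *\<^sub>R (u x - c)) * norm (ind B2 x :: real) = ind B2 x * \<bar>u x - c\<bar>" for x
      by (simp add: indicator_def)
    show ?thesis using L2_mult_integrable[OF LB L1] unfolding e .
  qed
  have cB: "cell h m \<subseteq> B2" if "m \<in> Q" for m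
  proof
    fix y assume y: "y \<in> cell h m"
    from that obtain x where "x \<in> cell h m" "x \<in> ball x0 r" unfolding Q_def by blast
    then show "y \<in> B2" using near[of x y] cell_diam[of x h m y] y by blast
  qed
  have ic: "integrable lebesgue (\<lambda>x. ind (cell h m) x * \<bar>u x - c\<bar>)" if "m \<in> Q" for m
  proof (rule Bochner_Integration.integrable_bound[OF iB])
    show "(\<lambda>x. ind (cell h m) x * \<bar>u x - c\<bar>) \<in> LM"
      using L2_meas[OF L(1)] borel_sets_lebesgue[OF cell_borel]
      by (intro borel_measurable_times borel_measurable_abs borel_measurable_diff borel_measurable_indicator) auto
    show "AE x in lebesgue. norm (ind (cell h m) x * \<bar>u x - c\<bar>) \<le> norm (ind B2 x * \<bar>u x - c\<bar>)"
      using cB[OF that] by (intro AE_I2) (auto simp: indicator_def)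
  qed
  let ?I = "LINT x|lebesgue. ind B2 x * \<bar>u x - c\<bar>"
  have "(\<Sum>m\<in>Q. (LINT x|lebesgue. ind (cell h m) x * (u x - c))\<^sup>2) \<le> (\<Sum>m\<in>Q. (LINT x|lebesgue. ind (cell h m) x * \<bar>u x - c\<bar>)\<^sup>2)"
  proof (intro sum_mono)
    fix m
    have "\<bar>LINT x|lebesgue. ind (cell h m) x * (u x - c)\<bar> \<le> (LINT x|lebesgue. \<bar>ind (cell h m) x * (u x - c)\<bar>)"
      by (rule integral_abs_bound)
    also have "\<dots> = (LINT x|lebesgue. ind (cell h m) x * \<bar>u x - c\<bar>)" by (simp add: abs_mult)
    finally have "\<bar>LINT x|lebesgue. ind (cell h m) x * (u x - c)\<bar>\<^sup>2 \<le> (LINT x|lebesgue. ind (cell h m) x * \<bar>u x - c\<bar>)\<^sup>2"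
      by (intro power_mono) auto
    then show "(LINT x|lebesgue. ind (cell h m) x * (u x - c))\<^sup>2 \<le> (LINT x|lebesgue. ind (cell h m) x * \<bar>u x - c\<bar>)\<^sup>2"
      by (simp only: power2_abs)
  qed
  also have "\<dots> \<le> (\<Sum>m\<in>Q. (LINT x|lebesgue. ind (cell h m) x * \<bar>u x - c\<bar>))\<^sup>2"
    by (rule sum_squares_le[OF _ fQ]) (intro integral_nonneg_AE, simp)
  also have "\<dots> \<le> ?I\<^sup>2"
  proof (intro power_mono sum_nonneg)
    have "(\<Sum>m\<in>Q. (LINT x|lebesgue. ind (cell h m) x * \<bar>u x - c\<bar>)) = (LINT x|lebesgue. (\<Sum>m\<in>Q. ind (cell h m) x * \<bar>u x - c\<bar>))"
      by (rule Bochner_Integration.integral_sum[symmetric]) (rule ic)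
    also have "\<dots> \<le> ?I"
    proof (rule integral_mono)
      show "integrable lebesgue (\<lambda>x. \<Sum>m\<in>Q. ind (cell h m) x * \<bar>u x - c\<bar>)"
        by (rule Bochner_Integration.integrable_sum) (rule ic)
      fix x
      show "(\<Sum>m\<in>Q. ind (cell h m) x * \<bar>u x - c\<bar>) \<le> ind B2 x * \<bar>u x - c\<bar>"
      proof (cases "x \<in> B2")
        case True
        have "(\<Sum>m\<in>Q. ind (cell h m) x) * \<bar>u x - c\<bar> \<le> 1 * \<bar>u x - c\<bar>"
          by (intro mult_right_mono cells_sum_le_1 h fQ) simp
        then show ?thesis using True by (simp add: sum_distrib_right)
      next
        case False
        then have "(\<Sum>m\<in>Q. ind (cell h m) x * \<bar>u x - c\<bar>) = 0" using cB by (intro sum.neutral) (auto simp: indicator_def)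
        then show ?thesis by simp
      qed
    qed (rule iB)
    finally show "(\<Sum>m\<in>Q. (LINT x|lebesgue. ind (cell h m) x * \<bar>u x - c\<bar>)) \<le> ?I" .
  qed (intro integral_nonneg_AE, simp)
  also have "?I\<^sup>2 \<le> (2 ^ ?n * (4 * r) * (LINT x|lebesgue. ind B2 x * norm (g x)))\<^sup>2"
  proof (intro power_mono)
    have "norm (x - y) \<le> 4 * r" if "x \<in> B2" "y \<in> B2" for x y
      using that dist_triangle[of x y x0] unfolding B2_def mem_ball by (simp add: dist_norm norm_minus_commute)
    then show "?I \<le> 2 ^ ?n * (4 * r) * (LINT x|lebesgue. ind B2 x * norm (g x))"
      unfolding c_def by (rule cell_poincare_W(2)[OF w B2b _ mB])
    show "0 \<le> ?I" by (intro integral_nonneg_AE) simp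
  qed
  finally have s: "(\<Sum>m\<in>Q. (LINT x|lebesgue. ind (cell h m) x * (u x - c))\<^sup>2) \<le> (2 ^ ?n * (4 * r) * (LINT x|lebesgue. ind B2 x * norm (g x)))\<^sup>2" .
  have hn: "1 / h ^ ?n = (real ?n / \<delta>) ^ ?n / r ^ ?n"
    unfolding h_def using r \<delta> by (simp add: power_divide power_mult_distrib)
  have "(\<Sum>m\<in>Q. (LINT x|lebesgue. ind (cell h m) x * (u x - c))\<^sup>2) / h ^ ?n
    \<le> (2 ^ ?n * (4 * r) * (LINT x|lebesgue. ind B2 x * norm (g x)))\<^sup>2 * (1 / h ^ ?n)"
    using s h by (simp add: divide_right_mono)
  also have "\<dots> = (real ?n / \<delta>) ^ ?n * (2 ^ ?n * 4)\<^sup>2 * (r\<^sup>2 / r ^ ?n) * (LINT x|lebesgue. ind B2 x * norm (g x))\<^sup>2"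
    unfolding hn by (simp add: power_mult_distrib)
  finally show "(nrm2 (res (ball x0 r) (\<lambda>x. u x - c)))\<^sup>2
     \<le> \<delta>\<^sup>2 * r\<^sup>2 * 2 ^ CARD('n) * (nrm2 (res B2 g))\<^sup>2
      + (real CARD('n) / \<delta>) ^ CARD('n) * (2 ^ CARD('n) * 4)\<^sup>2 * (r\<^sup>2 / r ^ CARD('n)) * (LINT x|lebesgue. ind B2 x * norm (g x))\<^sup>2"
    using gp unfolding nh by (simp add: power_mult_distrib)
qed

text \<open>The upper bound is stated for the operator norm and at every point, so that
  \<open>A\<close> maps L2 fields to L2 fields everywhere. Coercivity is required only almost
  everywhere in D, so that the coefficient may vanish elsewhere.\<close>

definition ell :: "real \<Rightarrow> real \<Rightarrow> (real^'n) set \<Rightarrow> (real^'n \<Rightarrow> real^'n^'n) \<Rightarrow> bool" where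
  "ell \<alpha> \<beta> D A \<longleftrightarrow> A \<in> LM \<and> (\<forall>x. transpose (A x) = A x)
    \<and> (\<forall>x \<xi>. norm (A x *v \<xi>) \<le> \<beta> * norm \<xi>) \<and> (\<forall>x \<xi>. 0 \<le> (A x *v \<xi>) \<bullet> \<xi>)
    \<and> (AE x in lebesgue. x \<in> D \<longrightarrow> (\<forall>\<xi>. \<alpha> * (norm \<xi>)\<^sup>2 \<le> (A x *v \<xi>) \<bullet> \<xi>))"

lemma symmetric_inner: fixes M :: "real^'n^'n" assumes "transpose M = M" shows "(M *v v) \<bullet> w = (M *v w) \<bullet> v"
proof -
  have "(M *v v) \<bullet> w = (transpose M *v v) \<bullet> w" using assms by simp
  also have "\<dots> = v \<bullet> (M *v w)" by (simp add: dot_lmul_matrix)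
  finally show ?thesis by (simp add: inner_commute)
qed

text \<open>Evaluate the nonnegative form at \<open>M *v \<xi> - \<beta> *\<^sub>R \<xi>\<close>:
  the negative middle term -2 \<beta> times the square of the norm of \<open>M *v \<xi>\<close>
  beats the first one, and symmetry preserves the constant \<beta>.\<close>

lemma symmetric_norm_le:
  fixes M :: "real^'n^'n"
  assumes s: "transpose M = M" and b: "0 < \<beta>" and q: "\<And>\<xi>. 0 \<le> (M *v \<xi>) \<bullet> \<xi> \<and> (M *v \<xi>) \<bullet> \<xi> \<le> \<beta> * (norm \<xi>)\<^sup>2"
  shows "norm (M *v \<xi>) \<le> \<beta> * norm \<xi>"
proof -
  let ?e = "M *v \<xi>"
  have sm: "(M *v ?e) \<bullet> \<xi> = ?e \<bullet> ?e" using symmetric_inner[OF s, of ?e \<xi>] by simp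
  have "0 \<le> (M *v (?e - \<beta> *\<^sub>R \<xi>)) \<bullet> (?e - \<beta> *\<^sub>R \<xi>)" using q by blast
  also have "\<dots> = (M *v ?e) \<bullet> ?e - 2 * \<beta> * (?e \<bullet> ?e) + \<beta>\<^sup>2 * (?e \<bullet> \<xi>)"
    using sm by (simp add: matrix_vector_mult_diff_distrib matrix_vector_mult_scaleR inner_diff_left inner_diff_right power2_eq_square algebra_simps)
  also have "(M *v ?e) \<bullet> ?e \<le> \<beta> * (norm ?e)\<^sup>2" using q by blast
  also have "\<beta>\<^sup>2 * (?e \<bullet> \<xi>) \<le> \<beta>\<^sup>2 * (\<beta> * (norm \<xi>)\<^sup>2)" using q by (intro mult_left_mono) auto
  finally have "\<beta> * (norm ?e)\<^sup>2 \<le> \<beta> * (\<beta> * norm \<xi>)\<^sup>2"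
    by (simp add: power2_norm_eq_inner[symmetric] power_mult_distrib) (simp add: power2_eq_square mult.assoc)
  then have "(norm ?e)\<^sup>2 \<le> (\<beta> * norm \<xi>)\<^sup>2" using b by (simp only: mult_le_cancel_left_pos)
  then show ?thesis by (rule power2_le_imp_le) (use b in simp)
qed

lemma ell_D:
  assumes "ell \<alpha> \<beta> D A"
  shows "A \<in> LM" "transpose (A x) = A x" "norm (A x *v \<xi>) \<le> \<beta> * norm \<xi>" "0 \<le> (A x *v \<xi>) \<bullet> \<xi>"
    "AE x in lebesgue. x \<in> D \<longrightarrow> (\<forall>\<xi>. \<alpha> * (norm \<xi>)\<^sup>2 \<le> (A x *v \<xi>) \<bullet> \<xi>)"
  using assms by (simp_all add: ell_def)

lemma ell_beta_nonneg: assumes "ell \<alpha> \<beta> D A" shows "0 \<le> \<beta>"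
proof -
  have "0 \<le> \<beta> * norm (axis undefined 1 :: real^'a)"
    by (rule order_trans[OF norm_ge_zero ell_D(3)[OF assms]])
  then show ?thesis by simp
qed

lemma mult_vec_measurable:
  fixes A :: "'b::euclidean_space \<Rightarrow> real^'n^'n"
  assumes "A \<in> LM" "g \<in> LM"
  shows "(\<lambda>x. A x *v g x) \<in> LM"
proof (rule borel_measurable_continuous_Pair[OF assms])
  show "continuous_on UNIV (\<lambda>x::(real^'n^'n) \<times> (real^'n). fst x *v snd x)"
    unfolding matrix_vector_mult_def by (intro continuous_intros)
qed

lemma ell_L2:
  assumes "ell \<alpha> \<beta> D A" "L2 g"
  shows "L2 (\<lambda>x. A x *v g x)" "nrm2 (\<lambda>x. A x *v g x) \<le> \<beta> * nrm2 g"
  using L2_mono[OF mult_vec_measurable[OF ell_D(1)[OF assms(1)] L2_meas[OF assms(2)]] assms(2) ell_beta_nonneg[OF assms(1)]]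
    ell_D(3)[OF assms(1)] by auto

definition aF :: "(real^'n \<Rightarrow> real^'n^'n) \<Rightarrow> (real^'n \<Rightarrow> real^'n) \<Rightarrow> (real^'n \<Rightarrow> real^'n) \<Rightarrow> real" where
  "aF A g h = (LINT x|lebesgue. (A x *v g x) \<bullet> h x)"

lemma aF_sym: assumes "ell \<alpha> \<beta> D A" shows "aF A g h = aF A h g"
  unfolding aF_def by (intro Bochner_Integration.integral_cong refl symmetric_inner ell_D(2)[OF assms])

lemma aF_lin:
  assumes "ell \<alpha> \<beta> D A" "L2 g" "L2 g'" "L2 h"
  shows "aF A (\<lambda>x. a *\<^sub>R g x + b *\<^sub>R g' x) h = a * aF A g h + b * aF A g' h"
proof -
  have "aF A (\<lambda>x. a *\<^sub>R g x + b *\<^sub>R g' x) h = (LINT x|lebesgue. a * ((A x *v g x) \<bullet> h x) + b * ((A x *v g' x) \<bullet> h x))"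
    unfolding aF_def by (simp add: matrix_vector_right_distrib matrix_vector_mult_scaleR inner_add_left)
  also have "\<dots> = a * aF A g h + b * aF A g' h"
    using L2_inner_integrable[OF ell_L2(1)[OF assms(1,2)] assms(4)] L2_inner_integrable[OF ell_L2(1)[OF assms(1,3)] assms(4)]
    by (simp add: aF_def)
  finally show ?thesis .
qed

lemma aF_lin2:
  assumes "ell \<alpha> \<beta> D A" "L2 g" "L2 g'" "L2 h"
  shows "aF A h (\<lambda>x. a *\<^sub>R g x + b *\<^sub>R g' x) = a * aF A h g + b * aF A h g'"
  using aF_lin[OF assms] aF_sym[OF assms(1)] by metis

lemma aF_diff:
  assumes "ell \<alpha> \<beta> D A" "L2 g" "L2 g'" "L2 h"
  shows "aF A (\<lambda>x. g x - g' x) h = aF A g h - aF A g' h"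
  using aF_lin[OF assms, of 1 "-1"] by simp

lemma aF_diff2:
  assumes "ell \<alpha> \<beta> D A" "L2 g" "L2 g'" "L2 h"
  shows "aF A h (\<lambda>x. g x - g' x) = aF A h g - aF A h g'"
  using aF_lin2[OF assms, of 1 "-1"] by simp

lemma aF_bound: assumes "ell \<alpha> \<beta> D A" "L2 g" "L2 h" shows "\<bar>aF A g h\<bar> \<le> \<beta> * nrm2 g * nrm2 h"
proof -
  have "\<bar>aF A g h\<bar> \<le> nrm2 (\<lambda>x. A x *v g x) * nrm2 h" unfolding aF_def by (rule CS_inner[OF ell_L2(1)[OF assms(1,2)] assms(3)])
  also have "\<dots> \<le> \<beta> * nrm2 g * nrm2 h" by (intro mult_right_mono ell_L2(2)[OF assms(1,2)]) simp
  finally show ?thesis .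
qed

text \<open>The lower bound on A is known in D only, but gradients of elements of \<open>W D\<close>
  vanish almost everywhere outside.\<close>

lemma aF_coercive: assumes "ell \<alpha> \<beta> D A" "W D u g" "open D" shows "\<alpha> * (nrm2 g)\<^sup>2 \<le> aF A g g"
proof -
  note L = W_L2(2)[OF assms(2)]
  have "\<alpha> * (nrm2 g)\<^sup>2 = (LINT x|lebesgue. \<alpha> * (norm (g x))\<^sup>2)" by (simp add: nrm2_sq)
  also have "\<dots> \<le> (LINT x|lebesgue. (A x *v g x) \<bullet> g x)"
  proof (rule integral_mono_AE)
    show "AE x in lebesgue. \<alpha> * (norm (g x))\<^sup>2 \<le> (A x *v g x) \<bullet> g x"
      using ell_D(5)[OF assms(1)] W_zero_outside[OF assms(2,3)] by eventually_elim (metis inner_zero_right mult_zero_right norm_zero order_refl zero_power2)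
  qed (use L2_int[OF L] L2_inner_integrable[OF ell_L2(1)[OF assms(1) L] L] in auto)
  finally show ?thesis by (simp add: aF_def)
qed

text \<open>The form is symmetric, so the solution is found as the minimiser of the energy
  \<open>J\<close>; the parallelogram identity makes minimising sequences Cauchy. F receives the
  gradient besides the function, so that functionals of either kind fit.\<close>

lemma lax_milgram:
  fixes D :: "(real^'n) set" and F :: "(real^'n \<Rightarrow> real) \<Rightarrow> (real^'n \<Rightarrow> real^'n) \<Rightarrow> real"
  assumes D: "bounded D" "open D" and A: "ell \<alpha> \<beta> D A" and \<alpha>: "0 < \<alpha>"
    and lin: "\<And>u g v h a b. W D u g \<Longrightarrow> W D v h \<Longrightarrow> F (\<lambda>x. a * u x + b * v x) (\<lambda>x. a *\<^sub>R g x + b *\<^sub>R h x) = a * F u g + b * F v h"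
    and bd: "\<And>u g. W D u g \<Longrightarrow> \<bar>F u g\<bar> \<le> C * nrm2 g"
  shows "\<exists>u g. W D u g \<and> (\<forall>v h. W D v h \<longrightarrow> aF A g h = F v h)"
proof -
  define J where "J u g = aF A g g - 2 * F u g" for u g
  have Jlow: "- (C\<^sup>2 / \<alpha>) \<le> J u g" if w: "W D u g" for u g
  proof -
    have "0 \<le> (\<alpha> * nrm2 g - C)\<^sup>2 / \<alpha>" using \<alpha> by simp
    also have "\<dots> = \<alpha> * (nrm2 g)\<^sup>2 - 2 * C * nrm2 g + C\<^sup>2 / \<alpha>"
      using \<alpha> by (simp add: field_simps power2_eq_square)
    finally have "- (C\<^sup>2 / \<alpha>) \<le> \<alpha> * (nrm2 g)\<^sup>2 - 2 * (C * nrm2 g)" by simp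
    then show ?thesis using aF_coercive[OF A w D(2)] bd[OF w] unfolding J_def by linarith
  qed
  let ?S = "{J u g | u g. W D u g}"
  define m where "m = Inf ?S"
  have bb: "bdd_below ?S" using Jlow by (intro bdd_belowI[of _ "- (C\<^sup>2 / \<alpha>)"]) auto
  have ne: "?S \<noteq> {}" using W_zero by blast
  have mle: "m \<le> J u g" if "W D u g" for u g unfolding m_def using that by (intro cInf_lower bb) blast
  have "\<forall>k. \<exists>p. W D (fst p) (snd p) \<and> J (fst p) (snd p) < m + 1 / real (Suc k)"
  proof
    fix k
    have "Inf ?S < m + 1 / real (Suc k)" unfolding m_def by simp
    then obtain y where "y \<in> ?S" "y < m + 1 / real (Suc k)" using cInf_lessD[OF ne] by blast
    then obtain u g where "W D u g" "J u g < m + 1 / real (Suc k)" by blast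
    then show "\<exists>p. W D (fst p) (snd p) \<and> J (fst p) (snd p) < m + 1 / real (Suc k)" by (intro exI[of _ "(u, g)"]) simp
  qed
  then obtain p where p: "\<forall>k. W D (fst (p k)) (snd (p k)) \<and> J (fst (p k)) (snd (p k)) < m + 1 / real (Suc k)"
    by (elim choice[elim_format] exE)
  define u where "u k = fst (p k)" for k
  define g where "g k = snd (p k)" for k
  have w: "W D (u k) (g k)" and Jk: "J (u k) (g k) < m + 1 / real (Suc k)" for k using p by (auto simp: u_def g_def)
  note L = W_L2[OF w]
  \<comment> \<open>The midpoint of two almost minimisers cannot lie below the infimum
    \<open>m\<close>, so by the parallelogram identity their difference has small energy.\<close>
  have para: "\<alpha> * (nrm2 (\<lambda>x. g k x - g l x))\<^sup>2 \<le> 2 / real (Suc k) + 2 / real (Suc l)" for k l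
  proof -
    let ?gm = "\<lambda>x. (1/2) *\<^sub>R g k x + (1/2) *\<^sub>R g l x"
    let ?um = "\<lambda>x. (1/2) * u k x + (1/2) * u l x"
    have wm: "W D ?um ?gm" by (rule W_lin[OF w w])
    have Lm: "L2 ?gm" using W_L2[OF wm] by simp
    let ?a = "aF A (g k) (g k)" and ?b = "aF A (g l) (g l)" and ?c = "aF A (g k) (g l)"
    have e1: "aF A ?gm ?gm = (?a + 2 * ?c + ?b) / 4"
    proof -
      have "aF A ?gm ?gm = (1/2) * aF A (g k) ?gm + (1/2) * aF A (g l) ?gm" by (rule aF_lin[OF A L(2) L(2) Lm])
      moreover have "aF A (g k) ?gm = (1/2) * ?a + (1/2) * ?c" by (rule aF_lin2[OF A L(2) L(2) L(2)])
      moreover have "aF A (g l) ?gm = (1/2) * aF A (g l) (g k) + (1/2) * ?b" by (rule aF_lin2[OF A L(2) L(2) L(2)])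
      moreover have "aF A (g l) (g k) = ?c" by (rule aF_sym[OF A])
      ultimately show ?thesis by (simp add: field_simps)
    qed
    have Ld: "L2 (\<lambda>x. g k x - g l x)" by (rule L2_diff[OF L(2) L(2)])
    have e2: "aF A (\<lambda>x. g k x - g l x) (\<lambda>x. g k x - g l x) = ?a - 2 * ?c + ?b"
    proof -
      have "aF A (g l) (g k) = ?c" by (rule aF_sym[OF A])
      have "aF A (\<lambda>x. g k x - g l x) (\<lambda>x. g k x - g l x) = aF A (g k) (\<lambda>x. g k x - g l x) - aF A (g l) (\<lambda>x. g k x - g l x)"
        by (rule aF_diff[OF A L(2) L(2) Ld])
      moreover have "aF A (g k) (\<lambda>x. g k x - g l x) = ?a - aF A (g l) (g k)" using aF_diff2[OF A L(2) L(2) L(2), of k k l] \<open>aF A (g l) (g k) = ?c\<close> by simp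
      moreover have "aF A (g l) (\<lambda>x. g k x - g l x) = ?c - ?b" using aF_diff2[OF A L(2) L(2) L(2), of l k l] \<open>aF A (g l) (g k) = ?c\<close> by simp
      moreover note \<open>aF A (g l) (g k) = ?c\<close>
      ultimately show ?thesis by simp
    qed
    have e3: "F ?um ?gm = (1/2) * F (u k) (g k) + (1/2) * F (u l) (g l)" by (rule lin[OF w w])
    have "m \<le> (?a + 2 * ?c + ?b) / 4 - (F (u k) (g k) + F (u l) (g l))"
      using mle[OF wm] unfolding J_def e1 e3 by argo
    moreover have "?a - 2 * F (u k) (g k) < m + 1 / real (Suc k)" "?b - 2 * F (u l) (g l) < m + 1 / real (Suc l)"
      using Jk[of k] Jk[of l] unfolding J_def by auto
    moreover have t: "X - 2 * Z + Y \<le> 2 * p + 2 * q" if "m \<le> (X + 2 * Z + Y) / 4 - (f + f')" "X - 2 * f < m + p" "Y - 2 * f' < m + q" for X Y Z f f' p q :: real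
      using that by argo
    ultimately have "aF A (\<lambda>x. g k x - g l x) (\<lambda>x. g k x - g l x) \<le> 2 * (1 / real (Suc k)) + 2 * (1 / real (Suc l))"
      unfolding e2 by (intro t)
    moreover have "\<alpha> * (nrm2 (\<lambda>x. g k x - g l x))\<^sup>2 \<le> aF A (\<lambda>x. g k x - g l x) (\<lambda>x. g k x - g l x)"
      by (rule aF_coercive[OF A W_diff[OF w w] D(2)])
    ultimately show ?thesis by simp
  qed
  have cg: "\<exists>N. \<forall>k\<ge>N. \<forall>l\<ge>N. nrm2 (\<lambda>x. g k x - g l x) < e" if e: "e > 0" for e
  proof -
    obtain N where N: "4 / (\<alpha> * e\<^sup>2) < real N" using reals_Archimedean2 by blast
    have ae: "0 < \<alpha> * e\<^sup>2" using \<alpha> e by simp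
    have N0: "real N > 0" using N ae by (meson divide_pos_pos less_trans zero_less_numeral)
    have "nrm2 (\<lambda>x. g k x - g l x) < e" if "k \<ge> N" "l \<ge> N" for k l
    proof -
      have "2 / real (Suc k) \<le> 2 / real N" "2 / real (Suc l) \<le> 2 / real N" using that N0 by (auto intro!: divide_left_mono)
      then have "\<alpha> * (nrm2 (\<lambda>x. g k x - g l x))\<^sup>2 \<le> 4 / real N" using para[of k l] by linarith
      also have "\<dots> < \<alpha> * e\<^sup>2" using N N0 ae by (simp add: field_simps)
      finally have "(nrm2 (\<lambda>x. g k x - g l x))\<^sup>2 < e\<^sup>2" using \<alpha> by simp
      then show ?thesis by (rule power2_less_imp_less[OF _ less_imp_le[OF e]])
    qed
    then show ?thesis by blast
  qed
  obtain P where P: "P \<ge> 0 \<and> (\<forall>u g. W D u g \<longrightarrow> nrm2 u \<le> P * nrm2 g)" using poincare_W[OF D(1)] by (elim exE)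
  have cu: "\<exists>N. \<forall>k\<ge>N. \<forall>l\<ge>N. nrm2 (\<lambda>x. u k x - u l x) < e" if e: "e > 0" for e
  proof -
    have "e / (P + 1) > 0" using e P by simp
    from cg[OF this] obtain N where N: "\<forall>k\<ge>N. \<forall>l\<ge>N. nrm2 (\<lambda>x. g k x - g l x) < e / (P + 1)" by (elim exE)
    have "nrm2 (\<lambda>x. u k x - u l x) < e" if "k \<ge> N" "l \<ge> N" for k l
    proof -
      have "nrm2 (\<lambda>x. u k x - u l x) \<le> P * nrm2 (\<lambda>x. g k x - g l x)" using P W_diff[OF w w] by blast
      also have "\<dots> \<le> (P + 1) * nrm2 (\<lambda>x. g k x - g l x)" by (intro mult_right_mono) auto
      also have "\<dots> < (P + 1) * (e / (P + 1))" using N that P by (intro mult_strict_left_mono) auto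
      also have "\<dots> = e" using P by simp
      finally show ?thesis .
    qed
    then show ?thesis by blast
  qed
  have "\<exists>g0. L2 g0 \<and> (\<lambda>k. nrm2 (\<lambda>x. g k x - g0 x)) \<longlonglongrightarrow> 0" by (rule L2_complete[OF L(2)]) (rule cg)
  then obtain g0 where g0: "L2 g0 \<and> (\<lambda>k. nrm2 (\<lambda>x. g k x - g0 x)) \<longlonglongrightarrow> 0" by (elim exE)
  have "\<exists>u0. L2 u0 \<and> (\<lambda>k. nrm2 (\<lambda>x. u k x - u0 x)) \<longlonglongrightarrow> 0" by (rule L2_complete[OF L(1)]) (rule cu)
  then obtain u0 where u0: "L2 u0 \<and> (\<lambda>k. nrm2 (\<lambda>x. u k x - u0 x)) \<longlonglongrightarrow> 0" by (elim exE)
  have w0: "W D u0 g0" by (rule W_closed[OF w]) (use g0 u0 in auto)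
  have "aF A g0 h = F v h" if wv: "W D v h" for v h
  proof -
    note Lh = W_L2(2)[OF wv] and Lg0 = W_L2(2)[OF w0]
    define q where "q = aF A g0 h - F v h"
    define s where "s = aF A h h"
    have "(\<lambda>k. LINT x|lebesgue. g k x \<bullet> (A x *v h x)) \<longlonglongrightarrow> (LINT x|lebesgue. g0 x \<bullet> (A x *v h x))"
      by (rule L2_inner_tendsto[OF L(2) Lg0 _ ell_L2(1)[OF A Lh]]) (use g0 in simp)
    then have al: "(\<lambda>k. aF A (g k) h) \<longlonglongrightarrow> aF A g0 h" unfolding aF_sym[OF A, of _ h] unfolding aF_def by (simp add: inner_commute)
    \<comment> \<open>Moving the k-th almost minimiser by t times v can lower \<open>J\<close> by at
      most 1 / (k + 1). In the limit a quadratic polynomial in t without constant term is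
      nonnegative, which forces its linear coefficient to vanish.\<close>
    have key: "0 \<le> 2 * t * q + t\<^sup>2 * s" for t
    proof (rule LIMSEQ_le_const)
      show "(\<lambda>k. inverse (real (Suc k)) + (2 * t * (aF A (g k) h - F v h) + t\<^sup>2 * s)) \<longlonglongrightarrow> 2 * t * q + t\<^sup>2 * s"
        using tendsto_add[OF LIMSEQ_inverse_real_of_nat, of "\<lambda>k. 2 * t * (aF A (g k) h - F v h) + t\<^sup>2 * s" "2 * t * q + t\<^sup>2 * s"]
        unfolding q_def by (simp add: tendsto_intros al)
      have "0 \<le> inverse (real (Suc k)) + (2 * t * (aF A (g k) h - F v h) + t\<^sup>2 * s)" for k
      proof -
        let ?g = "\<lambda>x. 1 *\<^sub>R g k x + t *\<^sub>R h x"
        have wt: "W D (\<lambda>x. 1 * u k x + t * v x) ?g" by (rule W_lin[OF w wv])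
        have "J (u k) (g k) \<le> J (\<lambda>x. 1 * u k x + t * v x) ?g + inverse (real (Suc k))" using Jk[of k] mle[OF wt] by (simp add: inverse_eq_divide)
        moreover have "aF A ?g ?g = 1 * aF A (g k) ?g + t * aF A h ?g" by (rule aF_lin[OF A L(2) Lh W_L2(2)[OF wt]])
        moreover have "aF A (g k) ?g = 1 * aF A (g k) (g k) + t * aF A (g k) h" by (rule aF_lin2[OF A L(2) Lh L(2)])
        moreover have "aF A h ?g = 1 * aF A h (g k) + t * s" unfolding s_def by (rule aF_lin2[OF A L(2) Lh Lh])
        moreover have "aF A h (g k) = aF A (g k) h" by (rule aF_sym[OF A])
        moreover have "F (\<lambda>x. 1 * u k x + t * v x) ?g = 1 * F (u k) (g k) + t * F v h" by (rule lin[OF w wv])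
        ultimately show ?thesis unfolding J_def by (simp add: algebra_simps power2_eq_square)
      qed
      then show "\<exists>N. \<forall>k\<ge>N. 0 \<le> inverse (real (Suc k)) + (2 * t * (aF A (g k) h - F v h) + t\<^sup>2 * s)" by blast
    qed
    have s0: "0 \<le> s" unfolding s_def using aF_coercive[OF A wv D(2)] \<alpha> by (meson mult_nonneg_nonneg less_imp_le order_trans zero_le_power2)
    have "q = 0"
    proof (rule ccontr)
      assume "q \<noteq> 0"
      \<comment> \<open>At t = -\<tau> q the polynomial equals \<tau> q^2 (\<tau> s - 2), which is
        negative because \<tau> s is at most 1; the summand 1 covers s = 0.\<close>
      define \<tau> where "\<tau> = 1 / (s + 1)"
      have t: "0 < \<tau>" "\<tau> * s \<le> 1" using s0 by (simp_all add: \<tau>_def)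
      have "0 \<le> 2 * (- \<tau> * q) * q + (- \<tau> * q)\<^sup>2 * s" by (rule key)
      also have "\<dots> = (\<tau> * q\<^sup>2) * (\<tau> * s - 2)"
        by (simp add: power2_eq_square algebra_simps)
      also have "\<dots> < 0" using t \<open>q \<noteq> 0\<close> by (intro mult_pos_neg) auto
      finally show False by simp
    qed
    then show ?thesis by (simp add: q_def)
  qed
  then show ?thesis using w0 by blast
qed

section \<open>Coefficients and functionals\<close>

text \<open>Setting the coefficient to 0 on the exceptional null set and off the domain makes the upper bound and
  nonnegativity hold everywhere, and makes the integrals over D integrals over the whole space.\<close>

definition cut_coef :: "real \<Rightarrow> real \<Rightarrow> (real^'n) set \<Rightarrow> (real^'n \<Rightarrow> real^'n^'n) \<Rightarrow> real^'n \<Rightarrow> real^'n^'n" where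
  "cut_coef \<alpha> \<beta> D A x = (if x \<in> D \<and> (\<forall>\<xi>. \<alpha> * (norm \<xi>)\<^sup>2 \<le> (A x *v \<xi>) \<bullet> \<xi> \<and> (A x *v \<xi>) \<bullet> \<xi> \<le> \<beta> * (norm \<xi>)\<^sup>2) then A x else 0)"

lemma cut_coef_AE:
  assumes "A \<in> Msym \<alpha> \<beta> D"
  shows "AE x in lebesgue. x \<in> D \<longrightarrow> cut_coef \<alpha> \<beta> D A x = A x"
  using assms unfolding Msym_def by (auto simp: cut_coef_def)

text \<open>Completeness of Lebesgue measure: a set with null complement is measurable even when its
  definition quantifies over uncountably many vectors.\<close>

lemma AE_lebesgue_set: assumes "AE x in lebesgue. P x" shows "{x. P x} \<in> sets lebesgue"
proof -
  obtain N where N: "N \<in> null_sets lebesgue" "{x \<in> space lebesgue. \<not> P x} \<subseteq> N"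
    using assms unfolding eventually_ae_filter by blast
  then have "{x. \<not> P x} \<subseteq> N" by simp
  then have "{x. \<not> P x} \<in> null_sets lebesgue" by (rule completion.complete2[OF _ N(1)])
  then have "- {x. \<not> P x} \<in> sets lebesgue" by (intro Compl_in_sets_lebesgue[THEN iffD2]) auto
  then show ?thesis by (simp add: Collect_neg_eq[symmetric])
qed

lemma cut_coef_ell:
  assumes A: "A \<in> Msym \<alpha> \<beta> D" and D: "open D" and ab: "0 < \<alpha>" "\<alpha> \<le> \<beta>"
  shows "ell \<alpha> \<beta> D (cut_coef \<alpha> \<beta> D A)"
proof -
  let ?P = "\<lambda>x. \<forall>\<xi>. \<alpha> * (norm \<xi>)\<^sup>2 \<le> (A x *v \<xi>) \<bullet> \<xi> \<and> (A x *v \<xi>) \<bullet> \<xi> \<le> \<beta> * (norm \<xi>)\<^sup>2"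
  let ?G = "{x. x \<in> D \<longrightarrow> ?P x}"
  have m: "set_borel_measurable lebesgue D A" and sy: "\<forall>x\<in>D. transpose (A x) = A x" and ae: "AE x in lebesgue. x \<in> D \<longrightarrow> ?P x"
    using A unfolding Msym_def by simp_all
  have G: "?G \<in> sets lebesgue" by (rule AE_lebesgue_set[OF ae])
  have e: "cut_coef \<alpha> \<beta> D A = (\<lambda>x. ind ?G x *\<^sub>R (ind D x *\<^sub>R A x))"
    by (rule ext) (simp add: cut_coef_def indicator_def)
  have "(res D A) \<in> LM" using m by (simp only: set_borel_measurable_def)
  then have 1: "cut_coef \<alpha> \<beta> D A \<in> LM"
    unfolding e by (rule borel_measurable_scaleR[OF borel_measurable_indicator[OF G]])
  have 2: "transpose (cut_coef \<alpha> \<beta> D A x) = cut_coef \<alpha> \<beta> D A x" for x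
    using sy by (auto simp: cut_coef_def transpose_def vec_eq_iff)
  have q: "0 \<le> (cut_coef \<alpha> \<beta> D A x *v \<xi>) \<bullet> \<xi> \<and> (cut_coef \<alpha> \<beta> D A x *v \<xi>) \<bullet> \<xi> \<le> \<beta> * (norm \<xi>)\<^sup>2" for x \<xi>
  proof (cases "x \<in> D \<and> ?P x")
    case True
    then have "\<alpha> * (norm \<xi>)\<^sup>2 \<le> (A x *v \<xi>) \<bullet> \<xi> \<and> (A x *v \<xi>) \<bullet> \<xi> \<le> \<beta> * (norm \<xi>)\<^sup>2" by blast
    moreover have "0 \<le> \<alpha> * (norm \<xi>)\<^sup>2" using ab by simp
    moreover have "cut_coef \<alpha> \<beta> D A x = A x" using True by (simp only: cut_coef_def if_True simp_thms)
    ultimately show ?thesis by auto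
  next
    case False
    then have "cut_coef \<alpha> \<beta> D A x = 0" by (auto simp: cut_coef_def)
    then show ?thesis using ab by (simp add: matrix_vector_mult_0)
  qed
  have 3: "norm (cut_coef \<alpha> \<beta> D A x *v \<xi>) \<le> \<beta> * norm \<xi>" for x \<xi>
    by (rule symmetric_norm_le[OF 2 _ q]) (use ab in simp)
  have 4: "AE x in lebesgue. x \<in> D \<longrightarrow> (\<forall>\<xi>. \<alpha> * (norm \<xi>)\<^sup>2 \<le> (cut_coef \<alpha> \<beta> D A x *v \<xi>) \<bullet> \<xi>)"
    using ae by eventually_elim (auto simp: cut_coef_def)
  show ?thesis unfolding ell_def using 1 2 3 4 q by blast
qed

section \<open>Functions in \<open>H10\<close> and functionals in \<open>Hminus1\<close>\<close>

lemma set_int_eq: "(LINT x:D|lebesgue. f x) = (LINT x|lebesgue. ind D x *\<^sub>R f x)"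
  by (simp add: set_lebesgue_integral_def)

lemma H10_grad_cong:
  assumes "H10_grad D u g" "\<And>x. x \<in> D \<Longrightarrow> u' x = u x" "\<And>x. x \<in> D \<Longrightarrow> g' x = g x"
  shows "H10_grad D u' g'"
proof -
  have e: "(res D u') = (res D u)" "(res D g') = (res D g)"
    using assms(2,3) by (rule_tac [!] ext, case_tac [!] "x \<in> D", simp_all)
  have i1: "(\<integral>\<^sup>+x\<in>D. ennreal ((p x - u' x)\<^sup>2) \<partial>lebesgue) = (\<integral>\<^sup>+x\<in>D. ennreal ((p x - u x)\<^sup>2) \<partial>lebesgue)" for p
    using assms(2) by (intro nn_integral_cong) (simp add: indicator_def)
  have i2: "(\<integral>\<^sup>+x\<in>D. ennreal ((norm (p x - g' x))\<^sup>2) \<partial>lebesgue) = (\<integral>\<^sup>+x\<in>D. ennreal ((norm (p x - g x))\<^sup>2) \<partial>lebesgue)" for p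
    using assms(3) by (intro nn_integral_cong) (simp add: indicator_def)
  show ?thesis using assms(1) unfolding H10_grad_def set_borel_measurable_def e i1 i2 .
qed

lemma H10_grad_iff:
  assumes "open D"
  shows "H10_grad D u g \<longleftrightarrow> W D (res D u) (res D g)"
proof
  assume "W D (res D u) (res D g)"
  from H10_grad_cong[OF W_H10_grad[OF this assms], of u g] show "H10_grad D u g" by simp
qed (rule H10_grad_W[OF _ assms])

lemma H10_grad_lin:
  assumes D: "open D" and "H10_grad D u g" "H10_grad D v h"
  shows "H10_grad D (\<lambda>x. a * u x + b * v x) (\<lambda>x. a *\<^sub>R g x + b *\<^sub>R h x)"
proof -
  have "W D (\<lambda>x. a * (ind D x *\<^sub>R u x) + b * (ind D x *\<^sub>R v x)) (\<lambda>x. a *\<^sub>R (ind D x *\<^sub>R g x) + b *\<^sub>R (ind D x *\<^sub>R h x))"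
    using assms(2,3) unfolding H10_grad_iff[OF D] by (rule W_lin)
  then show ?thesis unfolding H10_grad_iff[OF D] by (simp add: algebra_simps)
qed

lemma W_restrict:
  assumes "W D u g" "open D"
  shows "W D (res D u) (res D g)"
  using W_H10_grad[OF assms] H10_grad_iff[OF assms(2)] by blast

lemma norm_restrict_int:
  fixes g :: "real^'n \<Rightarrow> 'b::euclidean_space"
  shows "(LINT x:D|lebesgue. (norm (g x))\<^sup>2) = (nrm2 (res D g))\<^sup>2"
  unfolding set_int_eq nrm2_sq by (intro Bochner_Integration.integral_cong refl) (simp add: indicator_def)

lemma Hminus1_lin:
  assumes "F \<in> Hminus1 D" "v \<in> H10 D" "w \<in> H10 D"
  shows "F (\<lambda>x. a * v x + b * w x) = a * F v + b * F w"
  using assms unfolding Hminus1_def by blast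

text \<open>Poincare's inequality absorbs the values, leaving the norm of the gradient alone; this
  is the boundedness that \<open>lax_milgram\<close> expects.\<close>

lemma Hminus1_bound:
  assumes "F \<in> Hminus1 D" and D: "bounded D" "open D"
  shows "\<exists>C\<ge>0. \<forall>v g. H10_grad D v g \<longrightarrow> \<bar>F v\<bar> \<le> C * nrm2 (res D g)"
proof -
  obtain C where C: "\<forall>v g. H10_grad D v g \<longrightarrow>
         \<bar>F v\<bar> \<le> C * sqrt ((\<integral>x\<in>D. (v x)\<^sup>2 \<partial>lebesgue) + (\<integral>x\<in>D. (norm (g x))\<^sup>2 \<partial>lebesgue))"
    using assms(1) unfolding Hminus1_def by blast
  obtain P where P: "P \<ge> 0 \<and> (\<forall>u g. W D u g \<longrightarrow> nrm2 u \<le> P * nrm2 g)" using poincare_W[OF D(1)] by (elim exE)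
  show ?thesis
  proof (intro exI[of _ "\<bar>C\<bar> * (P + 1)"] conjI allI impI)
    show "0 \<le> \<bar>C\<bar> * (P + 1)" using P by simp
    fix v g assume h: "H10_grad D v g"
    let ?v = "res D v" and ?g = "res D g"
    have w: "W D ?v ?g" by (rule H10_grad_W[OF h D(2)])
    have pv: "nrm2 ?v \<le> P * nrm2 ?g" using P w by blast
    have "\<bar>F v\<bar> \<le> C * sqrt ((nrm2 ?v)\<^sup>2 + (nrm2 ?g)\<^sup>2)"
      using C[rule_format, OF h] norm_restrict_int[of D v] norm_restrict_int[of D g] by simp
    also have "\<dots> \<le> \<bar>C\<bar> * sqrt ((nrm2 ?v)\<^sup>2 + (nrm2 ?g)\<^sup>2)" by (intro mult_right_mono) auto
    also have "sqrt ((nrm2 ?v)\<^sup>2 + (nrm2 ?g)\<^sup>2) \<le> nrm2 ?v + nrm2 ?g" by (rule sqrt_sum_squares_le_sum) simp_all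
    also have "nrm2 ?v + nrm2 ?g \<le> (P + 1) * nrm2 ?g" using pv by (simp add: distrib_right)
    finally show "\<bar>F v\<bar> \<le> \<bar>C\<bar> * (P + 1) * nrm2 ?g" by (simp add: mult_left_mono mult.assoc)
  qed
qed

text \<open>The difference of the two functions has gradient 0 on D, so by
  \<open>Hminus1_bound\<close> the functional vanishes on it. Values off D are therefore invisible
  to functionals, and restriction to D is harmless.\<close>

lemma Hminus1_cong:
  assumes F: "F \<in> Hminus1 D" and D: "bounded D" "open D" and v: "v \<in> H10 D" and e: "\<And>x. x \<in> D \<Longrightarrow> v x = v' x"
  shows "F v = F v'"
proof -
  obtain g where g: "H10_grad D v g" using v unfolding H10_def by blast
  have g': "H10_grad D v' g" by (rule H10_grad_cong[OF g]) (simp_all add: e)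
  then have v': "v' \<in> H10 D" unfolding H10_def by blast
  obtain C where C: "C \<ge> 0 \<and> (\<forall>v g. H10_grad D v g \<longrightarrow> \<bar>F v\<bar> \<le> C * nrm2 (res D g))"
    using Hminus1_bound[OF F D] by (elim exE)
  have "H10_grad D (\<lambda>x. 1 * v x + (-1) * v' x) (\<lambda>x. 1 *\<^sub>R g x + (-1) *\<^sub>R g x)" by (rule H10_grad_lin[OF D(2) g g'])
  then have "\<bar>F (\<lambda>x. 1 * v x + (-1) * v' x)\<bar> \<le> C * nrm2 (res D (\<lambda>x. 1 *\<^sub>R g x + (-1) *\<^sub>R g x))" using C by blast
  then have "F (\<lambda>x. 1 * v x + (-1) * v' x) = 0" by simp
  moreover have "F (\<lambda>x. 1 * v x + (-1) * v' x) = 1 * F v + (-1) * F v'" by (rule Hminus1_lin[OF F v v'])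
  ultimately show ?thesis by simp
qed

text \<open>Functionals in \<open>Hminus1\<close> see only the function, so a gradient has to be
  chosen; on D the choice is unique almost everywhere by \<open>wgrad_eq\<close>.\<close>

definition wgrad :: "(real^'n) set \<Rightarrow> (real^'n \<Rightarrow> real) \<Rightarrow> real^'n \<Rightarrow> real^'n" where
  "wgrad D v = (SOME h. H10_grad D v h)"

lemma wgrad_eq:
  assumes "H10_grad D v g" "open D"
  shows "AE x in lebesgue. ind D x *\<^sub>R wgrad D v x = ind D x *\<^sub>R g x"
proof -
  have "H10_grad D v (wgrad D v)" unfolding wgrad_def by (rule someI[of "H10_grad D v", OF assms(1)])
  from W_grad_unique[OF H10_grad_W[OF this assms(2)] H10_grad_W[OF assms]] show ?thesis by simp
qed

text \<open>Distributions of the form -div f. Testing weak convergence in \<open>H10\<close> with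
  them gives weak L2 convergence of the gradients.\<close>

definition field_functional :: "(real^'n) set \<Rightarrow> (real^'n \<Rightarrow> real^'n) \<Rightarrow> (real^'n \<Rightarrow> real) \<Rightarrow> real" where
  "field_functional D f v = (LINT x|lebesgue. (ind D x *\<^sub>R wgrad D v x) \<bullet> f x)"

lemma field_functional_eq:
  assumes "H10_grad D v g" "open D" "L2 f"
  shows "field_functional D f v = (LINT x|lebesgue. (ind D x *\<^sub>R g x) \<bullet> f x)"
  unfolding field_functional_def
proof (rule integral_cong_AE)
  have "H10_grad D v (wgrad D v)" unfolding wgrad_def by (rule someI[of "H10_grad D v", OF assms(1)])
  note m = L2_meas[OF W_L2(2)[OF H10_grad_W[OF this assms(2)]]] L2_meas[OF W_L2(2)[OF H10_grad_W[OF assms(1,2)]]] L2_meas[OF assms(3)]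
  show "(\<lambda>x. (ind D x *\<^sub>R wgrad D v x) \<bullet> f x) \<in> LM"
    by (rule borel_measurable_inner[OF m(1) m(3)])
  show "(\<lambda>x. (ind D x *\<^sub>R g x) \<bullet> f x) \<in> LM"
    by (rule borel_measurable_inner[OF m(2) m(3)])
  show "AE x in lebesgue. (ind D x *\<^sub>R wgrad D v x) \<bullet> f x = (ind D x *\<^sub>R g x) \<bullet> f x"
    using wgrad_eq[OF assms(1,2)] by eventually_elim (simp only:)
qed

lemma field_functional_W:
  assumes w: "W D v g" and D: "open D" and f: "L2 f"
  shows "field_functional D f v = (LINT x|lebesgue. g x \<bullet> f x)"
proof -
  note L = W_L2(2)[OF w] W_L2(2)[OF W_restrict[OF w D]]
  have "(LINT x|lebesgue. (ind D x *\<^sub>R g x) \<bullet> f x) = (LINT x|lebesgue. g x \<bullet> f x)"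
  proof (rule integral_cong_AE)
    show "AE x in lebesgue. (ind D x *\<^sub>R g x) \<bullet> f x = g x \<bullet> f x"
      using W_zero_outside[OF w D] by eventually_elim (auto simp: indicator_def)
  qed (intro borel_measurable_inner L2_meas L f)+
  then show ?thesis using field_functional_eq[OF W_H10_grad[OF w D] D f] by simp
qed

lemma field_functional_Hminus1:
  assumes D: "open D" and f: "L2 f"
  shows "field_functional D f \<in> Hminus1 D"
  unfolding Hminus1_def
proof (intro CollectI conjI allI impI exI[of _ "nrm2 f"])
  fix v w a b assume "v \<in> H10 D" "w \<in> H10 D"
  then obtain g h where gh: "H10_grad D v g" "H10_grad D w h" unfolding H10_def by blast
  note i = L2_inner_integrable[OF W_L2(2)[OF H10_grad_W[OF gh(1) D]] f] L2_inner_integrable[OF W_L2(2)[OF H10_grad_W[OF gh(2) D]] f]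
  have "field_functional D f (\<lambda>x. a * v x + b * w x) = (LINT x|lebesgue. (ind D x *\<^sub>R (a *\<^sub>R g x + b *\<^sub>R h x)) \<bullet> f x)"
    by (rule field_functional_eq[OF H10_grad_lin[OF D gh] D f])
  also have "\<dots> = (LINT x|lebesgue. a * ((ind D x *\<^sub>R g x) \<bullet> f x) + b * ((ind D x *\<^sub>R h x) \<bullet> f x))"
    by (simp add: inner_add_left algebra_simps)
  also have "\<dots> = a * field_functional D f v + b * field_functional D f w"
    unfolding field_functional_eq[OF gh(1) D f] field_functional_eq[OF gh(2) D f] using i by simp
  finally show "field_functional D f (\<lambda>x. a * v x + b * w x) = a * field_functional D f v + b * field_functional D f w" .
next
  fix v g assume h: "H10_grad D v g"
  have "\<bar>field_functional D f v\<bar> \<le> nrm2 (res D g) * nrm2 f"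
    unfolding field_functional_eq[OF h D f] by (rule CS_inner[OF W_L2(2)[OF H10_grad_W[OF h D]] f])
  also have "nrm2 (res D g) \<le> sqrt ((LINT x:D|lebesgue. (v x)\<^sup>2) + (LINT x:D|lebesgue. (norm (g x))\<^sup>2))"
  proof -
    have "0 \<le> (LINT x:D|lebesgue. (v x)\<^sup>2)" unfolding set_int_eq by (intro integral_nonneg_AE) simp
    then show ?thesis unfolding norm_restrict_int by (intro real_le_rsqrt) simp
  qed
  finally show "\<bar>field_functional D f v\<bar> \<le> nrm2 f * sqrt ((LINT x:D|lebesgue. (v x)\<^sup>2) + (LINT x:D|lebesgue. (norm (g x))\<^sup>2))"
    by (simp add: mult_right_mono mult.commute)
qed

text \<open>L2 densities as functionals; they give weak L2 convergence of the values, the input of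
  \<open>rellich\<close>.\<close>

definition val_functional :: "(real^'n) set \<Rightarrow> (real^'n \<Rightarrow> real) \<Rightarrow> (real^'n \<Rightarrow> real) \<Rightarrow> real" where
  "val_functional D f v = (LINT x|lebesgue. (ind D x *\<^sub>R v x) * f x)"

lemma val_functional_Hminus1:
  assumes D: "open D" and f: "L2 f"
  shows "val_functional D f \<in> Hminus1 D"
  unfolding Hminus1_def
proof (intro CollectI conjI allI impI exI[of _ "nrm2 f"])
  fix v w a b assume "v \<in> H10 D" "w \<in> H10 D"
  then obtain g h where gh: "H10_grad D v g" "H10_grad D w h" unfolding H10_def by blast
  note i = L2_mult_integrable_real[OF W_L2(1)[OF H10_grad_W[OF gh(1) D]] f] L2_mult_integrable_real[OF W_L2(1)[OF H10_grad_W[OF gh(2) D]] f]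
  have "val_functional D f (\<lambda>x. a * v x + b * w x) = (LINT x|lebesgue. a * ((ind D x *\<^sub>R v x) * f x) + b * ((ind D x *\<^sub>R w x) * f x))"
    unfolding val_functional_def by (simp add: algebra_simps)
  also have "\<dots> = a * val_functional D f v + b * val_functional D f w"
    unfolding val_functional_def using i by simp
  finally show "val_functional D f (\<lambda>x. a * v x + b * w x) = a * val_functional D f v + b * val_functional D f w" .
next
  fix v g assume h: "H10_grad D v g"
  have "\<bar>val_functional D f v\<bar> \<le> nrm2 (res D v) * nrm2 f"
    unfolding val_functional_def using CS_inner[OF W_L2(1)[OF H10_grad_W[OF h D]] f] by simp
  also have "nrm2 (res D v) \<le> sqrt ((LINT x:D|lebesgue. (v x)\<^sup>2) + (LINT x:D|lebesgue. (norm (g x))\<^sup>2))"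
  proof -
    have "0 \<le> (LINT x:D|lebesgue. (norm (g x))\<^sup>2)" unfolding set_int_eq by (intro integral_nonneg_AE) simp
    then show ?thesis using norm_restrict_int[of D v] by (intro real_le_rsqrt) simp
  qed
  finally show "\<bar>val_functional D f v\<bar> \<le> nrm2 f * sqrt ((LINT x:D|lebesgue. (v x)\<^sup>2) + (LINT x:D|lebesgue. (norm (g x))\<^sup>2))"
    by (simp add: mult_right_mono mult.commute)
qed

lemma val_functional_W:
  assumes w: "W D v g" and D: "open D" and f: "L2 f"
  shows "val_functional D f v = (LINT x|lebesgue. v x * f x)"
  unfolding val_functional_def
proof (rule integral_cong_AE)
  note L = W_L2(1)[OF w] W_L2(1)[OF W_restrict[OF w D]]
  show "AE x in lebesgue. (ind D x *\<^sub>R v x) * f x = v x * f x"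
    using W_zero_outside[OF w D] by eventually_elim (auto simp: indicator_def)
  show "(\<lambda>x. (ind D x *\<^sub>R v x) * f x) \<in> LM"
    by (rule borel_measurable_times[OF L2_meas[OF L(2)] L2_meas[OF f]])
  show "(\<lambda>x. v x * f x) \<in> LM"
    by (rule borel_measurable_times[OF L2_meas[OF L(1)] L2_meas[OF f]])
qed

lemma int_D_aF:
  assumes A: "A \<in> Msym \<alpha> \<beta> D" and D: "open D" and g: "W D u g" and h: "H10_grad D v h" and ab: "0 < \<alpha>" "\<alpha> \<le> \<beta>"
  shows "(LINT x:D|lebesgue. (A x *v g x) \<bullet> h x) = aF (cut_coef \<alpha> \<beta> D A) g (res D h)"
  unfolding set_int_eq aF_def
proof (rule integral_cong_AE)
  note L = W_L2(2)[OF g] W_L2(2)[OF H10_grad_W[OF h D]]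
  have m: "(res D A) \<in> LM"
    using A unfolding Msym_def by (simp add: set_borel_measurable_def)
  have e: "ind D x *\<^sub>R ((A x *v g x) \<bullet> h x) = ((ind D x *\<^sub>R A x) *v g x) \<bullet> (ind D x *\<^sub>R h x)" for x
    by (simp add: indicator_def)
  show "(res D (\<lambda>x. (A x *v g x) \<bullet> h x)) \<in> LM"
    unfolding e by (intro borel_measurable_inner mult_vec_measurable m L2_meas L)
  show "(\<lambda>x. (cut_coef \<alpha> \<beta> D A x *v g x) \<bullet> (ind D x *\<^sub>R h x)) \<in> LM"
    by (intro borel_measurable_inner L2_meas L ell_L2(1)[OF cut_coef_ell[OF A D ab]])
  show "AE x in lebesgue. ind D x *\<^sub>R ((A x *v g x) \<bullet> h x) = (cut_coef \<alpha> \<beta> D A x *v g x) \<bullet> (ind D x *\<^sub>R h x)"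
    using cut_coef_AE[OF A] by eventually_elim (auto simp: indicator_def)
qed

lemma is_sol_W:
  assumes D: "bounded D" "open D" and ab: "0 < \<alpha>" "\<alpha> \<le> \<beta>" and A: "A \<in> Msym \<alpha> \<beta> D"
    and F: "F \<in> Hminus1 D" and w: "W D u g" and eq: "\<And>v h. W D v h \<Longrightarrow> aF (cut_coef \<alpha> \<beta> D A) g h = F v"
  shows "is_sol D A F u"
  unfolding is_sol_def
proof (intro exI[of _ g] conjI allI impI)
  show "H10_grad D u g" by (rule W_H10_grad[OF w D(2)])
  fix v h assume h: "H10_grad D v h"
  have "F v = F (res D v)"
    by (rule Hminus1_cong[OF F D]) (use h in \<open>auto simp: H10_def\<close>)
  then show "(LINT x:D|lebesgue. (A x *v g x) \<bullet> h x) = F v"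
    using int_D_aF[OF A D(2) w h ab] eq[OF H10_grad_W[OF h D(2)]] by simp
qed

lemma W_is_sol:
  assumes D: "bounded D" "open D" and ab: "0 < \<alpha>" "\<alpha> \<le> \<beta>" and A: "A \<in> Msym \<alpha> \<beta> D"
    and F: "F \<in> Hminus1 D" and s: "is_sol D A F u"
  shows "\<exists>g. W D (res D u) g \<and> (\<forall>v h. W D v h \<longrightarrow> aF (cut_coef \<alpha> \<beta> D A) g h = F v)"
proof -
  obtain g where g: "H10_grad D u g" "\<forall>v h. H10_grad D v h \<longrightarrow> (LINT x:D|lebesgue. (A x *v g x) \<bullet> h x) = F v"
    using s unfolding is_sol_def by blast
  let ?g = "res D g"
  have w: "W D (res D u) ?g" by (rule H10_grad_W[OF g(1) D(2)])
  note E = cut_coef_ell[OF A D(2) ab]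
  have "aF (cut_coef \<alpha> \<beta> D A) ?g h = F v" if wv: "W D v h" for v h
  proof -
    note Lh = W_L2(2)[OF wv] W_L2(2)[OF W_restrict[OF wv D(2)]]
    have hv: "H10_grad D v h" by (rule W_H10_grad[OF wv D(2)])
    have "F v = (LINT x:D|lebesgue. (A x *v g x) \<bullet> h x)" using g(2) hv by simp
    also have "\<dots> = (LINT x:D|lebesgue. (A x *v ?g x) \<bullet> h x)"
      unfolding set_int_eq by (intro Bochner_Integration.integral_cong refl) (simp add: indicator_def)
    also have "\<dots> = aF (cut_coef \<alpha> \<beta> D A) ?g (res D h)"
      by (rule int_D_aF[OF A D(2) w hv ab])
    also have "\<dots> = aF (cut_coef \<alpha> \<beta> D A) ?g h"
      unfolding aF_def
    proof (rule integral_cong_AE)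
      show "AE x in lebesgue. (cut_coef \<alpha> \<beta> D A x *v ?g x) \<bullet> (ind D x *\<^sub>R h x) = (cut_coef \<alpha> \<beta> D A x *v ?g x) \<bullet> h x"
        by (intro AE_I2) (simp add: indicator_def)
    qed (intro borel_measurable_inner L2_meas Lh ell_L2(1)[OF E] W_L2(2)[OF w])+
    finally show ?thesis by simp
  qed
  then show ?thesis using w by blast
qed

text \<open>The consequence of G-convergence from which correctors are built: for each test function
  w, the right-hand side -div(B0 grad w) is chosen so that the limit problem is solved by w
  itself.\<close>

definition Gconv :: "real \<Rightarrow> real \<Rightarrow> (real^'n) set \<Rightarrow> (nat \<Rightarrow> real^'n \<Rightarrow> real^'n^'n) \<Rightarrow> (real^'n \<Rightarrow> real^'n^'n) \<Rightarrow> bool" where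
  "Gconv \<alpha> \<beta> D B B0 \<longleftrightarrow> (\<forall>k. ell \<alpha> \<beta> D (B k)) \<and> ell \<alpha> \<beta> D B0 \<and>
    (\<forall>w. Cc_inf D w \<longrightarrow> (\<exists>v g. (\<forall>k. W D (v k) (g k)) \<and> (\<forall>k y h. W D y h \<longrightarrow> aF (B k) (g k) h = aF B0 (grad w) h)
      \<and> (\<forall>F\<in>Hminus1 D. (\<lambda>k. F (v k)) \<longlonglongrightarrow> F w)))"

text \<open>\<open>G_conv\<close> only speaks about given solutions, so their existence for each k
  is supplied by \<open>lax_milgram\<close>; the right-hand side becomes an element of
  \<open>Hminus1\<close> through \<open>field_functional\<close>.\<close>

lemma G_conv_Gconv:
  assumes D: "bounded D" "open D" and ab: "0 < \<alpha>" "\<alpha> \<le> \<beta>" and G: "G_conv \<alpha> \<beta> D B B0"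
  shows "Gconv \<alpha> \<beta> D (\<lambda>k. cut_coef \<alpha> \<beta> D (B k)) (cut_coef \<alpha> \<beta> D B0)"
proof -
  have B: "B k \<in> Msym \<alpha> \<beta> D" and B0: "B0 \<in> Msym \<alpha> \<beta> D" for k using G by (simp_all add: G_conv_def)
  have conv: "weak_conv_H10 D us u" if "F \<in> Hminus1 D" "\<forall>k. is_sol D (B k) F (us k)" "is_sol D B0 F u" for F us u
    using G that unfolding G_conv_def by blast
  note E = cut_coef_ell[OF B D(2) ab] and E0 = cut_coef_ell[OF B0 D(2) ab]
  show ?thesis unfolding Gconv_def
  proof (intro conjI allI impI E E0)
    fix w assume w: "Cc_inf D w"
    let ?f = "\<lambda>x. cut_coef \<alpha> \<beta> D B0 x *v grad w x"
    let ?F = "field_functional D ?f"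
    have Lf: "L2 ?f" by (rule ell_L2(1)[OF E0 Cc_inf_L2(2)[OF w]])
    have FH: "?F \<in> Hminus1 D" by (rule field_functional_Hminus1[OF D(2) Lf])
    have FW: "?F y = aF (cut_coef \<alpha> \<beta> D B0) (grad w) h" if "W D y h" for y h
      unfolding field_functional_W[OF that D(2) Lf] aF_def by (simp add: inner_commute)
    have "\<exists>v g. W D v g \<and> (\<forall>y h. W D y h \<longrightarrow> aF (cut_coef \<alpha> \<beta> D (B k)) g h = aF (cut_coef \<alpha> \<beta> D B0) (grad w) h)" for k
    proof (rule lax_milgram[OF D E ab(1), where F="\<lambda>y h. aF (cut_coef \<alpha> \<beta> D B0) (grad w) h"])
      show "\<bar>aF (cut_coef \<alpha> \<beta> D B0) (grad w) g\<bar> \<le> (\<beta> * nrm2 (grad w)) * nrm2 g" if "W D u g" for u g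
        by (rule aF_bound[OF E0 Cc_inf_L2(2)[OF w] W_L2(2)[OF that]])
      show "aF (cut_coef \<alpha> \<beta> D B0) (grad w) (\<lambda>x. a *\<^sub>R g x + b *\<^sub>R h x) = a * aF (cut_coef \<alpha> \<beta> D B0) (grad w) g + b * aF (cut_coef \<alpha> \<beta> D B0) (grad w) h"
        if "W D u g" "W D v h" for u g v h a b
        by (rule aF_lin2[OF E0 W_L2(2)[OF that(1)] W_L2(2)[OF that(2)] Cc_inf_L2(2)[OF w]])
    qed
    then have "\<forall>k. \<exists>p. W D (fst p) (snd p) \<and> (\<forall>y h. W D y h \<longrightarrow> aF (cut_coef \<alpha> \<beta> D (B k)) (snd p) h = aF (cut_coef \<alpha> \<beta> D B0) (grad w) h)"
      by (metis fst_conv snd_conv)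
    then obtain p where p: "\<forall>k. W D (fst (p k)) (snd (p k)) \<and> (\<forall>y h. W D y h \<longrightarrow> aF (cut_coef \<alpha> \<beta> D (B k)) (snd (p k)) h = aF (cut_coef \<alpha> \<beta> D B0) (grad w) h)"
      by (elim choice[elim_format] exE)
    have "is_sol D (B k) ?F (fst (p k))" for k
      by (rule is_sol_W[OF D ab B FH]) (use p FW in auto)
    moreover have "is_sol D B0 ?F w"
      by (rule is_sol_W[OF D ab B0 FH W_Cc[OF w]]) (use FW in auto)
    ultimately have "weak_conv_H10 D (\<lambda>k. fst (p k)) w" by (intro conv[OF FH]) auto
    then show "\<exists>v g. (\<forall>k. W D (v k) (g k)) \<and> (\<forall>k y h. W D y h \<longrightarrow> aF (cut_coef \<alpha> \<beta> D (B k)) (g k) h = aF (cut_coef \<alpha> \<beta> D B0) (grad w) h)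
      \<and> (\<forall>F\<in>Hminus1 D. (\<lambda>k. F (v k)) \<longlonglongrightarrow> F w)"
      using p unfolding weak_conv_H10_def
      by (intro exI[of _ "\<lambda>k. fst (p k)"] exI[of _ "\<lambda>k. snd (p k)"]) simp
  qed
qed

section \<open>Correctors\<close>

text \<open>Tartar's correctors with every mode of convergence that is used later: strong in L2 for
  the values, weak in L2 for the gradients, and against functionals.\<close>

definition corr :: "(real^'n) set \<Rightarrow> (nat \<Rightarrow> real^'n \<Rightarrow> real^'n^'n) \<Rightarrow> (real^'n \<Rightarrow> real^'n^'n) \<Rightarrow> (real^'n \<Rightarrow> real)
    \<Rightarrow> (nat \<Rightarrow> real^'n \<Rightarrow> real) \<Rightarrow> (nat \<Rightarrow> real^'n \<Rightarrow> real^'n) \<Rightarrow> bool" where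
  "corr D B B0 w v g \<longleftrightarrow> (\<forall>k. W D (v k) (g k)) \<and> (\<forall>k y h. W D y h \<longrightarrow> aF (B k) (g k) h = aF B0 (grad w) h)
    \<and> (\<lambda>k. nrm2 (\<lambda>x. v k x - w x)) \<longlonglongrightarrow> 0
    \<and> (\<forall>f. L2 f \<longrightarrow> (\<lambda>k. LINT x|lebesgue. g k x \<bullet> f x) \<longlonglongrightarrow> (LINT x|lebesgue. grad w x \<bullet> f x))
    \<and> (\<forall>F\<in>Hminus1 D. (\<lambda>k. F (v k)) \<longlonglongrightarrow> F w)"

lemma corrD:
  assumes "corr D B B0 w v g"
  shows "W D (v k) (g k)" "W D y h \<Longrightarrow> aF (B k) (g k) h = aF B0 (grad w) h"
    "(\<lambda>k. nrm2 (\<lambda>x. v k x - w x)) \<longlonglongrightarrow> 0"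
    "L2 f \<Longrightarrow> (\<lambda>k. LINT x|lebesgue. g k x \<bullet> f x) \<longlonglongrightarrow> (LINT x|lebesgue. grad w x \<bullet> f x)"
    "F \<in> Hminus1 D \<Longrightarrow> (\<lambda>k. F (v k)) \<longlonglongrightarrow> F w"
  using assms unfolding corr_def by blast+

lemma corr_bound_gen:
  assumes D: "open D" and a: "0 < \<alpha>" and B: "ell \<alpha> \<beta> D B" and B0: "ell \<alpha> \<beta> D B0" and G: "L2 G" and w: "W D v g"
    and eq: "aF B g g = aF B0 G g"
  shows "nrm2 g \<le> \<beta> / \<alpha> * nrm2 G"
proof -
  have "\<alpha> * (nrm2 g)\<^sup>2 \<le> aF B0 G g" using aF_coercive[OF B w D] eq by simp
  also have "\<dots> \<le> \<beta> * nrm2 G * nrm2 g" using aF_bound[OF B0 G W_L2(2)[OF w]] by linarith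
  finally have "nrm2 g * (\<alpha> * nrm2 g) \<le> nrm2 g * (\<beta> * nrm2 G)" by (simp add: power2_eq_square mult_ac)
  then have "\<alpha> * nrm2 g \<le> \<beta> * nrm2 G"
    using ell_beta_nonneg[OF B] nrm2_nonneg[of g] by (cases "nrm2 g = 0") (simp_all add: mult_le_cancel_left)
  then show ?thesis using a by (simp add: field_simps)
qed

lemma Gconv_corr:
  assumes D: "bounded D" "open D" and a: "0 < \<alpha>" and G: "Gconv \<alpha> \<beta> D B B0" and w: "Cc_inf D w"
  shows "\<exists>v g. corr D B B0 w v g"
proof -
  have B: "ell \<alpha> \<beta> D (B k)" and B0: "ell \<alpha> \<beta> D B0" for k using G unfolding Gconv_def by blast+
  have "\<exists>v g. (\<forall>k. W D (v k) (g k)) \<and> (\<forall>k y h. W D y h \<longrightarrow> aF (B k) (g k) h = aF B0 (grad w) h)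
      \<and> (\<forall>F\<in>Hminus1 D. (\<lambda>k. F (v k)) \<longlonglongrightarrow> F w)"
    using G w unfolding Gconv_def by blast
  then obtain v g where v: "\<forall>k. W D (v k) (g k)" "\<forall>k y h. W D y h \<longrightarrow> aF (B k) (g k) h = aF B0 (grad w) h"
    "\<forall>F\<in>Hminus1 D. (\<lambda>k. F (v k)) \<longlonglongrightarrow> F w" by (elim exE conjE)
  have vW: "W D (v k) (g k)" for k using v(1) by blast
  note ww = W_Cc[OF w] and Lw = Cc_inf_L2[OF w]
  have bd: "nrm2 (g k) \<le> \<beta> / \<alpha> * nrm2 (grad w)" for k
    by (rule corr_bound_gen[OF D(2) a B B0 Lw(2) vW]) (use v(2) vW in blast)
  have gw: "(\<lambda>k. LINT x|lebesgue. g k x \<bullet> f x) \<longlonglongrightarrow> (LINT x|lebesgue. grad w x \<bullet> f x)" if f: "L2 f" for f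
    using v(3)[rule_format, OF field_functional_Hminus1[OF D(2) f]]
    unfolding field_functional_W[OF vW D(2) f] field_functional_W[OF ww D(2) f] .
  have vw: "(\<lambda>k. LINT x|lebesgue. v k x * f x) \<longlonglongrightarrow> (LINT x|lebesgue. w x * f x)" if f: "L2 f" for f
    using v(3)[rule_format, OF val_functional_Hminus1[OF D(2) f]]
    unfolding val_functional_W[OF vW D(2) f] val_functional_W[OF ww D(2) f] .
  have "(\<lambda>k. nrm2 (\<lambda>x. v k x - w x)) \<longlonglongrightarrow> 0"
  proof (rule rellich[OF D W_diff[OF vW ww]])
    show "nrm2 (\<lambda>x. g k x - grad w x) \<le> \<beta> / \<alpha> * nrm2 (grad w) + nrm2 (grad w)" for k
      using nrm2_triangle[OF W_L2(2)[OF vW] L2_minus[OF Lw(2)], of k] bd[of k] nrm2_minus[of "grad w"] by simp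
    fix f assume f: "L2 (f :: real^'a \<Rightarrow> real)"
    have "(LINT x|lebesgue. (v k x - w x) * f x) = (LINT x|lebesgue. v k x * f x) - (LINT x|lebesgue. w x * f x)" for k
      using L2_mult_integrable_real[OF W_L2(1)[OF vW] f] L2_mult_integrable_real[OF Lw(1) f] by (simp add: left_diff_distrib)
    then show "(\<lambda>k. LINT x|lebesgue. (v k x - w x) * f x) \<longlonglongrightarrow> 0" using LIM_zero[OF vw[OF f]] by simp
  qed
  then have "corr D B B0 w v g" unfolding corr_def using v gw by blast
  then show ?thesis by blast
qed

lemma Cc_scale_L2:
  fixes h :: "real^'n \<Rightarrow> 'b::euclidean_space"
  assumes "Cc_inf D' \<psi>" "L2 h" shows "L2 (\<lambda>x. \<psi> x *\<^sub>R h x)"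
proof -
  obtain C where C: "C \<ge> 0 \<and> (\<forall>x. \<bar>\<psi> x\<bar> \<le> C \<and> norm (grad \<psi> x) \<le> C)" using Cc_inf_bounded[OF assms(1)] by (elim exE)
  show ?thesis by (rule L2_bdd_mult(1)[OF assms(2) smooth_lebesgue(1)[OF Cc_infD(1)[OF assms(1)]], of C]) (use C in blast)
qed

lemma aF_scale_move:
  assumes "ell \<alpha> \<beta> D A"
  shows "aF A g (\<lambda>x. \<psi> x *\<^sub>R h x) = aF A h (\<lambda>x. \<psi> x *\<^sub>R g x)"
  unfolding aF_def using symmetric_inner[OF ell_D(2)[OF assms]]
  by (intro Bochner_Integration.integral_cong refl) (simp add: inner_commute)

text \<open>Test the equation with \<psi> times y. Terms containing the gradient of \<psi> carry the
  factor y, which tends to 0 strongly, and what remains on the right pairs a fixed field with the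
  weakly null h.\<close>

lemma div_curl:
  assumes D: "bounded D" "open D" and B: "\<And>k. ell \<alpha> \<beta> D (B k)" and B0: "ell \<alpha> \<beta> D B0" and w: "Cc_inf D w"
    and g: "\<And>k. L2 (g k)" "\<And>k. nrm2 (g k) \<le> M" "\<And>k y h. W D y h \<Longrightarrow> aF (B k) (g k) h = aF B0 (grad w) h"
    and y: "\<And>k. W D (y k) (h k)" "(\<lambda>k. nrm2 (y k)) \<longlonglongrightarrow> 0"
    and h: "\<And>f. L2 f \<Longrightarrow> (\<lambda>k. LINT x|lebesgue. h k x \<bullet> f x) \<longlonglongrightarrow> 0"
    and \<psi>: "Cc_inf D \<psi>"
  shows "(\<lambda>k. aF (B k) (g k) (\<lambda>x. \<psi> x *\<^sub>R h k x)) \<longlonglongrightarrow> 0"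
proof -
  note Lh = W_L2[OF y(1)]
  obtain C where C: "C \<ge> 0 \<and> (\<forall>x. \<bar>\<psi> x\<bar> \<le> C \<and> norm (grad \<psi> x) \<le> C)" using Cc_inf_bounded[OF \<psi>] by (elim exE)
  have m: "grad \<psi> \<in> LM" by (rule smooth_lebesgue(2)[OF Cc_infD(1)[OF \<psi>]])
  have yL: "L2 (\<lambda>x. y k x *\<^sub>R grad \<psi> x)" for k by (rule L2_bdd_mult_vec(1)[OF Lh(1) m, of C]) (use C in blast)
  have yn: "nrm2 (\<lambda>x. y k x *\<^sub>R grad \<psi> x) \<le> C * nrm2 (y k)" for k by (rule L2_bdd_mult_vec(2)[OF Lh(1) m]) (use C in blast)
  have hL: "L2 (\<lambda>x. \<psi> x *\<^sub>R h k x)" for k by (rule Cc_scale_L2[OF \<psi> Lh(2)])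
  note Lw = Cc_inf_L2(2)[OF w]
  have b0: "0 \<le> \<beta>" by (rule ell_beta_nonneg[OF B0])
  have yz: "(\<lambda>k. C * nrm2 (y k)) \<longlonglongrightarrow> 0" by (rule tendsto_mult_right_zero[OF y(2)])
  have e: "aF (B k) (g k) (\<lambda>x. \<psi> x *\<^sub>R h k x) = aF B0 (grad w) (\<lambda>x. \<psi> x *\<^sub>R h k x) + aF B0 (grad w) (\<lambda>x. y k x *\<^sub>R grad \<psi> x) - aF (B k) (g k) (\<lambda>x. y k x *\<^sub>R grad \<psi> x)" for k
  proof -
    have "aF (B k) (g k) (\<lambda>x. 1 *\<^sub>R (\<psi> x *\<^sub>R h k x) + 1 *\<^sub>R (y k x *\<^sub>R grad \<psi> x)) = aF B0 (grad w) (\<lambda>x. 1 *\<^sub>R (\<psi> x *\<^sub>R h k x) + 1 *\<^sub>R (y k x *\<^sub>R grad \<psi> x))"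
      using g(3)[OF W_mult_Cc[OF y(1) \<psi>], of k] by simp
    then show ?thesis
      unfolding aF_lin2[OF B hL yL g(1)] aF_lin2[OF B0 hL yL Lw] by simp
  qed
  have t1: "(\<lambda>k. aF B0 (grad w) (\<lambda>x. \<psi> x *\<^sub>R h k x)) \<longlonglongrightarrow> 0"
  proof -
    have "L2 (\<lambda>x. \<psi> x *\<^sub>R (B0 x *v grad w x))" by (rule Cc_scale_L2[OF \<psi> ell_L2(1)[OF B0 Lw]])
    from h[OF this] show ?thesis unfolding aF_def by (simp add: inner_commute)
  qed
  have t2: "(\<lambda>k. aF B0 (grad w) (\<lambda>x. y k x *\<^sub>R grad \<psi> x)) \<longlonglongrightarrow> 0"
  proof (rule Lim_null_comparison)
    show "(\<lambda>k. \<beta> * nrm2 (grad w) * (C * nrm2 (y k))) \<longlonglongrightarrow> 0" by (rule tendsto_mult_right_zero[OF yz])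
    show "\<forall>\<^sub>F k in sequentially. norm (aF B0 (grad w) (\<lambda>x. y k x *\<^sub>R grad \<psi> x)) \<le> \<beta> * nrm2 (grad w) * (C * nrm2 (y k))"
    proof (intro always_eventually allI)
      fix k
      have "\<bar>aF B0 (grad w) (\<lambda>x. y k x *\<^sub>R grad \<psi> x)\<bar> \<le> \<beta> * nrm2 (grad w) * nrm2 (\<lambda>x. y k x *\<^sub>R grad \<psi> x)" by (rule aF_bound[OF B0 Lw yL])
      also have "\<dots> \<le> \<beta> * nrm2 (grad w) * (C * nrm2 (y k))" by (intro mult_left_mono yn mult_nonneg_nonneg b0) simp
      finally show "norm (aF B0 (grad w) (\<lambda>x. y k x *\<^sub>R grad \<psi> x)) \<le> \<beta> * nrm2 (grad w) * (C * nrm2 (y k))" by simp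
    qed
  qed
  have t3: "(\<lambda>k. aF (B k) (g k) (\<lambda>x. y k x *\<^sub>R grad \<psi> x)) \<longlonglongrightarrow> 0"
  proof (rule Lim_null_comparison)
    show "(\<lambda>k. \<beta> * M * (C * nrm2 (y k))) \<longlonglongrightarrow> 0" by (rule tendsto_mult_right_zero[OF yz])
    show "\<forall>\<^sub>F k in sequentially. norm (aF (B k) (g k) (\<lambda>x. y k x *\<^sub>R grad \<psi> x)) \<le> \<beta> * M * (C * nrm2 (y k))"
    proof (intro always_eventually allI)
      fix k
      have "\<bar>aF (B k) (g k) (\<lambda>x. y k x *\<^sub>R grad \<psi> x)\<bar> \<le> \<beta> * nrm2 (g k) * nrm2 (\<lambda>x. y k x *\<^sub>R grad \<psi> x)" by (rule aF_bound[OF B g(1) yL])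
      also have "\<dots> \<le> \<beta> * M * (C * nrm2 (y k))"
        using order_trans[OF nrm2_nonneg g(2)] by (intro mult_mono mult_left_mono yn g(2) mult_nonneg_nonneg b0) auto
      finally show "norm (aF (B k) (g k) (\<lambda>x. y k x *\<^sub>R grad \<psi> x)) \<le> \<beta> * M * (C * nrm2 (y k))" by simp
    qed
  qed
  show ?thesis unfolding e using tendsto_diff[OF tendsto_add[OF t1 t2] t3] by simp
qed

lemma corr_bound:
  assumes D: "open D" and a: "0 < \<alpha>" and B: "\<And>k. ell \<alpha> \<beta> D (B k)" and B0: "ell \<alpha> \<beta> D B0" and w: "Cc_inf D w" and c: "corr D B B0 w v g"
  shows "nrm2 (g k) \<le> \<beta> / \<alpha> * nrm2 (grad w)"
  by (rule corr_bound_gen[OF D a B B0 Cc_inf_L2(2)[OF w] corrD(1)[OF c] corrD(2)[OF c corrD(1)[OF c]]])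

lemma corr_weak_diff:
  assumes c: "corr D B B0 w v g" and w: "Cc_inf D w" and f: "L2 f"
  shows "(\<lambda>k. LINT x|lebesgue. (g k x - grad w x) \<bullet> f x) \<longlonglongrightarrow> 0"
proof -
  have "(LINT x|lebesgue. (g k x - grad w x) \<bullet> f x) = (LINT x|lebesgue. g k x \<bullet> f x) - (LINT x|lebesgue. grad w x \<bullet> f x)" for k
    using L2_inner_integrable[OF W_L2(2)[OF corrD(1)[OF c]] f] L2_inner_integrable[OF Cc_inf_L2(2)[OF w] f] by (simp add: inner_diff_left)
  then show ?thesis using LIM_zero[OF corrD(4)[OF c f]] by simp
qed

text \<open>\<open>div_curl\<close> for \<open>v' k - w'\<close>. The second corrector may belong to
  another coefficient sequence, because it enters only through its convergence and not through its
  equation.\<close>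

lemma corr_div_curl:
  assumes D: "bounded D" "open D" and a: "0 < \<alpha>" and B: "\<And>k. ell \<alpha> \<beta> D (B k)" and B0: "ell \<alpha> \<beta> D B0"
    and w: "Cc_inf D w" and c: "corr D B B0 w v g" and w': "Cc_inf D w'" and c': "corr D B' B0' w' v' g'" and \<psi>: "Cc_inf D \<psi>"
  shows "(\<lambda>k. aF (B k) (g k) (\<lambda>x. \<psi> x *\<^sub>R g' k x) - aF (B k) (g k) (\<lambda>x. \<psi> x *\<^sub>R grad w' x)) \<longlonglongrightarrow> 0"
proof -
  have "(\<lambda>k. aF (B k) (g k) (\<lambda>x. \<psi> x *\<^sub>R (g' k x - grad w' x))) \<longlonglongrightarrow> 0"
    by (rule div_curl[OF D B B0 w W_L2(2)[OF corrD(1)[OF c]] corr_bound[OF D(2) a B B0 w c] corrD(2)[OF c]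
          W_diff[OF corrD(1)[OF c'] W_Cc[OF w']] corrD(3)[OF c'] corr_weak_diff[OF c' w'] \<psi>])
  moreover have "aF (B k) (g k) (\<lambda>x. \<psi> x *\<^sub>R (g' k x - grad w' x)) = aF (B k) (g k) (\<lambda>x. \<psi> x *\<^sub>R g' k x) - aF (B k) (g k) (\<lambda>x. \<psi> x *\<^sub>R grad w' x)" for k
    using aF_diff2[OF B Cc_scale_L2[OF \<psi> W_L2(2)[OF corrD(1)[OF c']]] Cc_scale_L2[OF \<psi> Cc_inf_L2(2)[OF w']] W_L2(2)[OF corrD(1)[OF c]], of k k k]
    by (simp add: scaleR_diff_right)
  ultimately show ?thesis by simp
qed

text \<open>The form T below is asymptotically symmetric in its last two arguments (div-curl) and
  exactly antisymmetric under exchange of the first and the last one (the equation tested with a product);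
  a trilinear form with both symmetries vanishes. This yields convergence of the fluxes.\<close>

lemma flux_smooth:
  assumes D: "bounded D" "open D" and al: "0 < \<alpha>" and B: "\<And>k. ell \<alpha> \<beta> D (B k)" and B0: "ell \<alpha> \<beta> D B0"
    and a: "Cc_inf D a" "corr D B B0 a va ga" and b: "Cc_inf D b" "corr D B B0 b vb gb" and c: "Cc_inf D c" "corr D B B0 c vc gc"
  shows "(\<lambda>k. aF (B k) (gb k) (\<lambda>x. a x *\<^sub>R grad c x)) \<longlonglongrightarrow> aF B0 (grad b) (\<lambda>x. a x *\<^sub>R grad c x)"
proof -
  define T where "T g q p r k = aF (B k) (g k) (\<lambda>x. p x *\<^sub>R grad r x) - aF B0 (grad q) (\<lambda>x. p x *\<^sub>R grad r x)"
    for g :: "nat \<Rightarrow> real^'a \<Rightarrow> real^'a" and q p r :: "real^'a \<Rightarrow> real" and k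
  have sym: "(\<lambda>k. T g q p r k - T g' r p q k) \<longlonglongrightarrow> 0"
    if p: "Cc_inf D p" and q: "Cc_inf D q" "corr D B B0 q v g" and r: "Cc_inf D r" "corr D B B0 r v' g'" for p q r v g v' g'
  proof -
    have 1: "(\<lambda>k. aF (B k) (g k) (\<lambda>x. p x *\<^sub>R g' k x) - aF (B k) (g k) (\<lambda>x. p x *\<^sub>R grad r x)) \<longlonglongrightarrow> 0"
      by (rule corr_div_curl[OF D al B B0 q r p])
    have 2: "(\<lambda>k. aF (B k) (g' k) (\<lambda>x. p x *\<^sub>R g k x) - aF (B k) (g' k) (\<lambda>x. p x *\<^sub>R grad q x)) \<longlonglongrightarrow> 0"
      by (rule corr_div_curl[OF D al B B0 r q p])
    have e: "T g q p r k - T g' r p q k =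
       (aF (B k) (g' k) (\<lambda>x. p x *\<^sub>R g k x) - aF (B k) (g' k) (\<lambda>x. p x *\<^sub>R grad q x)) - (aF (B k) (g k) (\<lambda>x. p x *\<^sub>R g' k x) - aF (B k) (g k) (\<lambda>x. p x *\<^sub>R grad r x))" for k
      using aF_scale_move[OF B, of k "g k" p "g' k"] aF_scale_move[OF B0, of "grad q" p "grad r"] unfolding T_def by simp
    show ?thesis unfolding e using tendsto_diff[OF 2 1] by simp
  qed
  have anti: "T g q p r k = - T g q r p k"
    if p: "Cc_inf D p" and q: "Cc_inf D q" "corr D B B0 q v g" and r: "Cc_inf D r" for p q r v g k
  proof -
    have w: "W D (\<lambda>x. p x * r x) (\<lambda>x. p x *\<^sub>R grad r x + r x *\<^sub>R grad p x)" by (rule W_mult_Cc[OF W_Cc[OF r] p])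
    have L: "L2 (\<lambda>x. p x *\<^sub>R grad r x)" "L2 (\<lambda>x. r x *\<^sub>R grad p x)"
      by (rule Cc_scale_L2[OF p Cc_inf_L2(2)[OF r]], rule Cc_scale_L2[OF r Cc_inf_L2(2)[OF p]])
    have "aF (B k) (g k) (\<lambda>x. 1 *\<^sub>R (p x *\<^sub>R grad r x) + 1 *\<^sub>R (r x *\<^sub>R grad p x)) = aF B0 (grad q) (\<lambda>x. 1 *\<^sub>R (p x *\<^sub>R grad r x) + 1 *\<^sub>R (r x *\<^sub>R grad p x))"
      using corrD(2)[OF q(2) w] by simp
    then show ?thesis
      unfolding aF_lin2[OF B L W_L2(2)[OF corrD(1)[OF q(2)]]] aF_lin2[OF B0 L Cc_inf_L2(2)[OF q(1)]] T_def by simp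
  qed
  have s1: "(\<lambda>k. T gb b a c k - T gc c a b k) \<longlonglongrightarrow> 0" by (rule sym[OF a(1) b c])
  have s2: "(\<lambda>k. T gc c b a k - T ga a b c k) \<longlonglongrightarrow> 0" by (rule sym[OF b(1) c a])
  have s3: "(\<lambda>k. T ga a c b k - T gb b c a k) \<longlonglongrightarrow> 0" by (rule sym[OF c(1) a b])
  \<comment> \<open>After the antisymmetry relations, the third and sixth term double the first, and
    the remaining mixed terms cancel in pairs.\<close>
  have e: "T gb b a c k = ((T gb b a c k - T gc c a b k) - (T gc c b a k - T ga a b c k) + (T ga a c b k - T gb b c a k)) / 2" for k
    using anti[OF a(1) c b(1), of k] anti[OF b(1) a c(1), of k] anti[OF c(1) b a(1), of k] by simp
  have "(\<lambda>k. ((T gb b a c k - T gc c a b k) - (T gc c b a k - T ga a b c k) + (T ga a c b k - T gb b c a k)) / 2) \<longlonglongrightarrow> (0 - 0 + 0) / 2"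
    by (intro tendsto_intros s1 s2 s3) simp
  then have "(\<lambda>k. T gb b a c k) \<longlonglongrightarrow> 0" unfolding e[symmetric] by simp
  then show ?thesis unfolding T_def by (simp add: LIM_zero_iff)
qed

text \<open>Limits of quadratic expressions in two weakly convergent sequences. That the correctors
  may come from different coefficient sequences is what makes two G-limits comparable.\<close>

lemma flux_limit:
  assumes D: "bounded D" "open D" and al: "0 < \<alpha>" and G: "Gconv \<alpha> \<beta> D B B0"
    and \<psi>: "Cc_inf D \<psi>" and w: "Cc_inf D w" and c: "corr D B B0 w v g" and w': "Cc_inf D w'" and c': "corr D B' B0' w' v' g'"
  shows "(\<lambda>k. aF (B k) (g k) (\<lambda>x. \<psi> x *\<^sub>R g' k x)) \<longlonglongrightarrow> aF B0 (grad w) (\<lambda>x. \<psi> x *\<^sub>R grad w' x)"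
proof -
  have B: "ell \<alpha> \<beta> D (B k)" and B0: "ell \<alpha> \<beta> D B0" for k using G unfolding Gconv_def by blast+
  \<comment> \<open>\<open>flux_smooth\<close> needs correctors of \<open>B\<close> itself for all
    three functions, so new ones are taken for \<psi> and w'.\<close>
  obtain va ga where a: "corr D B B0 \<psi> va ga" using Gconv_corr[OF D al G \<psi>] by (elim exE)
  obtain vc gc where cc: "corr D B B0 w' vc gc" using Gconv_corr[OF D al G w'] by (elim exE)
  have 1: "(\<lambda>k. aF (B k) (g k) (\<lambda>x. \<psi> x *\<^sub>R grad w' x)) \<longlonglongrightarrow> aF B0 (grad w) (\<lambda>x. \<psi> x *\<^sub>R grad w' x)"
    by (rule flux_smooth[OF D al B B0 \<psi> a w c w' cc])
  have 2: "(\<lambda>k. aF (B k) (g k) (\<lambda>x. \<psi> x *\<^sub>R g' k x) - aF (B k) (g k) (\<lambda>x. \<psi> x *\<^sub>R grad w' x)) \<longlonglongrightarrow> 0"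
    by (rule corr_div_curl[OF D al B B0 w c w' c' \<psi>])
  show ?thesis using tendsto_add[OF 2 1] by simp
qed

text \<open>The equation tested with the corrector itself makes the energy linear in the gradient,
  so weak convergence is enough.\<close>

lemma energy_limit:
  assumes D: "bounded D" "open D" and al: "0 < \<alpha>" and G: "Gconv \<alpha> \<beta> D B B0" and w: "Cc_inf D w" and c: "corr D B B0 w v g"
  shows "(\<lambda>k. aF (B k) (g k) (g k)) \<longlonglongrightarrow> aF B0 (grad w) (grad w)"
proof -
  have B0: "ell \<alpha> \<beta> D B0" for k using G unfolding Gconv_def by blast
  have "aF (B k) (g k) (g k) = (LINT x|lebesgue. g k x \<bullet> (B0 x *v grad w x))" for k
    using corrD(2)[OF c corrD(1)[OF c], of k k] by (simp add: aF_def inner_commute)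
  moreover have "(\<lambda>k. LINT x|lebesgue. g k x \<bullet> (B0 x *v grad w x)) \<longlonglongrightarrow> (LINT x|lebesgue. grad w x \<bullet> (B0 x *v grad w x))"
    by (rule corrD(4)[OF c ell_L2(1)[OF B0 Cc_inf_L2(2)[OF w]]])
  ultimately show ?thesis by (simp add: aF_def inner_commute)
qed

text \<open>As \<psi> is 1 where the gradient of w does not vanish, the total and the localised
  energy have the same limit, and coercivity turns their difference into a bound for the corrector
  gradient. This covers the strip near the boundary, where interior estimates give nothing.\<close>

lemma energy_tail:
  assumes D: "bounded D" "open D" and al: "0 < \<alpha>" and G: "Gconv \<alpha> \<beta> D B B0" and w: "Cc_inf D w" and c: "corr D B B0 w v g"
    and \<psi>: "Cc_inf D \<psi>" "\<And>x. 0 \<le> \<psi> x \<and> \<psi> x \<le> 1" "\<And>x. grad w x \<noteq> 0 \<Longrightarrow> \<psi> x = 1"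
  shows "(\<lambda>k. LINT x|lebesgue. (1 - \<psi> x) * (norm (g k x))\<^sup>2) \<longlonglongrightarrow> 0"
proof -
  have B: "ell \<alpha> \<beta> D (B k)" and B0: "ell \<alpha> \<beta> D B0" for k using G unfolding Gconv_def by blast+
  note Lg = W_L2(2)[OF corrD(1)[OF c]]
  have Lp: "L2 (\<lambda>x. \<psi> x *\<^sub>R g k x)" for k by (rule Cc_scale_L2[OF \<psi>(1) Lg])
  have 1: "(\<lambda>k. aF (B k) (g k) (g k) - aF (B k) (g k) (\<lambda>x. \<psi> x *\<^sub>R g k x)) \<longlonglongrightarrow> aF B0 (grad w) (grad w) - aF B0 (grad w) (\<lambda>x. \<psi> x *\<^sub>R grad w x)"
    by (intro tendsto_diff energy_limit[OF D al G w c] flux_limit[OF D al G \<psi>(1) w c w c])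
  have "(\<lambda>x. \<psi> x *\<^sub>R grad w x) = grad w" using \<psi>(3) by (intro ext) (case_tac "grad w x = 0"; simp)
  with 1 have 2: "(\<lambda>k. aF (B k) (g k) (g k) - aF (B k) (g k) (\<lambda>x. \<psi> x *\<^sub>R g k x)) \<longlonglongrightarrow> 0" by simp
  have le: "\<alpha> * (LINT x|lebesgue. (1 - \<psi> x) * (norm (g k x))\<^sup>2) \<le> aF (B k) (g k) (g k) - aF (B k) (g k) (\<lambda>x. \<psi> x *\<^sub>R g k x)" for k
  proof -
    have i: "integrable lebesgue (\<lambda>x. (1 - \<psi> x) * (norm (g k x))\<^sup>2)"
    proof (rule Bochner_Integration.integrable_bound[OF L2_int[OF Lg]])
      show "(\<lambda>x. (1 - \<psi> x) * (norm (g k x))\<^sup>2) \<in> LM"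
        using L2_meas[OF Lg] smooth_lebesgue(1)[OF Cc_infD(1)[OF \<psi>(1)]]
        by (intro borel_measurable_times borel_measurable_diff borel_measurable_power borel_measurable_norm) auto
      show "AE x in lebesgue. norm ((1 - \<psi> x) * (norm (g k x))\<^sup>2) \<le> norm ((norm (g k x))\<^sup>2)"
      proof (rule AE_I2)
        fix x
        have "\<bar>1 - \<psi> x\<bar> * (norm (g k x))\<^sup>2 \<le> 1 * (norm (g k x))\<^sup>2" using \<psi>(2)[of x] by (intro mult_right_mono) auto
        then show "norm ((1 - \<psi> x) * (norm (g k x))\<^sup>2) \<le> norm ((norm (g k x))\<^sup>2)" by (simp add: abs_mult)
      qed
    qed
    have "\<alpha> * (LINT x|lebesgue. (1 - \<psi> x) * (norm (g k x))\<^sup>2) = (LINT x|lebesgue. \<alpha> * ((1 - \<psi> x) * (norm (g k x))\<^sup>2))" by simp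
    also have "\<dots> \<le> (LINT x|lebesgue. (B k x *v g k x) \<bullet> (g k x - \<psi> x *\<^sub>R g k x))"
    proof (rule integral_mono_AE)
      show "integrable lebesgue (\<lambda>x. (B k x *v g k x) \<bullet> (g k x - \<psi> x *\<^sub>R g k x))"
        by (rule L2_inner_integrable[OF ell_L2(1)[OF B Lg] L2_diff[OF Lg Lp]])
      show "AE x in lebesgue. \<alpha> * ((1 - \<psi> x) * (norm (g k x))\<^sup>2) \<le> (B k x *v g k x) \<bullet> (g k x - \<psi> x *\<^sub>R g k x)"
        using ell_D(5)[OF B[of k]] W_zero_outside[OF corrD(1)[OF c] D(2), of k]
      proof eventually_elim
        case (elim x)
        show ?case
        proof (cases "x \<in> D")
          case True
          then have "\<alpha> * (norm (g k x))\<^sup>2 \<le> (B k x *v g k x) \<bullet> g k x" using elim by blast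
          then have "(1 - \<psi> x) * (\<alpha> * (norm (g k x))\<^sup>2) \<le> (1 - \<psi> x) * ((B k x *v g k x) \<bullet> g k x)"
            using \<psi>(2)[of x] by (intro mult_left_mono) auto
          also have "\<dots> = (B k x *v g k x) \<bullet> (g k x - \<psi> x *\<^sub>R g k x)" by (simp add: inner_diff_right algebra_simps)
          finally show ?thesis by (simp add: mult_ac)
        qed (use elim in simp)
      qed
    qed (use i in simp)
    also have "\<dots> = aF (B k) (g k) (g k) - aF (B k) (g k) (\<lambda>x. \<psi> x *\<^sub>R g k x)"
      using aF_diff2[OF B Lg Lp Lg, of k k k k] by (simp add: aF_def)
    finally show ?thesis .
  qed
  have "(\<lambda>k. \<alpha> * (LINT x|lebesgue. (1 - \<psi> x) * (norm (g k x))\<^sup>2)) \<longlonglongrightarrow> 0"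
  proof (rule tendsto_0_le[OF 2 _ le])
    show "0 \<le> \<alpha> * (LINT x|lebesgue. (1 - \<psi> x) * (norm (g k x))\<^sup>2)" for k
      using al \<psi>(2) by (intro mult_nonneg_nonneg integral_nonneg_AE) auto
  qed
  from tendsto_mult_right_zero[OF this, of "1 / \<alpha>"] show ?thesis using al by simp
qed

section \<open>Averages over balls\<close>

lemma emeasure_ball_lebesgue:
  fixes x :: "'a::euclidean_space"
  assumes "0 \<le> r"
  shows "emeasure lebesgue (ball x r) = ennreal (measure lborel (ball 0 1 :: 'a set) * r ^ DIM('a))"
proof -
  have "emeasure lborel (ball x r) = ennreal (measure lborel (ball x r))"
    using emeasure_lborel_ball_finite[of x r] by (simp add: emeasure_eq_ennreal_measure)
  then show ?thesis using content_ball_conv_unit_ball[OF assms, of x] by (simp add: mult.commute)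
qed

lemma null_set_nn_integral_mono:
  fixes f :: "'a \<Rightarrow> ennreal"
  assumes "N - S \<in> null_sets M"
  shows "(\<integral>\<^sup>+x\<in>N. f x \<partial>M) \<le> (\<integral>\<^sup>+x\<in>S. f x \<partial>M)"
proof (rule nn_integral_mono_AE)
  show "AE x in M. f x * ind N x \<le> f x * ind S x"
    using AE_not_in[OF assms] by eventually_elim (auto simp: indicator_def)
qed

text \<open>Vitali's covering theorem inside an open set slightly larger than N: disjoint good balls
  cover N up to a null set, and summing their bounds gives c times the measure of the open set. The
  tolerance e / (c + 1) makes the excess at most e.\<close>

lemma density_vitali:
  fixes h :: "'a::euclidean_space \<Rightarrow> ennreal" and c :: real
  assumes h[measurable]: "h \<in> LM" and N: "N \<in> sets lebesgue" and c: "0 \<le> c"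
    and cov: "\<And>x d. x \<in> N \<Longrightarrow> 0 < d \<Longrightarrow> \<exists>r. 0 < r \<and> r < d \<and> (\<integral>\<^sup>+y\<in>ball x r. h y \<partial>lebesgue) \<le> ennreal c * emeasure lebesgue (ball x r)"
  shows "(\<integral>\<^sup>+y\<in>N. h y \<partial>lebesgue) \<le> ennreal c * emeasure lebesgue N"
proof (rule ennreal_le_epsilon)
  fix e :: real assume e: "0 < e"
  have e': "0 < e / (c + 1)" using e c by simp
  obtain U where U: "open U" "N \<subseteq> U" "U - N \<in> lmeasurable" "emeasure lebesgue (U - N) < ennreal (e / (c + 1))"
    using sets_lebesgue_outer_open[OF N e'] by metis
  define K where "K = {p :: 'a \<times> real. 0 < snd p \<and> ball (fst p) (snd p) \<subseteq> U \<and>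
    (\<integral>\<^sup>+y\<in>ball (fst p) (snd p). h y \<partial>lebesgue) \<le> ennreal c * emeasure lebesgue (ball (fst p) (snd p))}"
  have S: "\<exists>i. i \<in> K \<and> x \<in> ball (fst i) (snd i) \<and> snd i < d" if x: "x \<in> N" and d: "0 < d" for x d
  proof -
    have "x \<in> U" using x U(2) by blast
    then obtain e1 where e1: "e1 > 0" "ball x e1 \<subseteq> U" using U(1) openE by metis
    have "0 < min d e1" using d e1 by simp
    from cov[OF x this] obtain r where r: "0 < r" "r < min d e1"
      "(\<integral>\<^sup>+y\<in>ball x r. h y \<partial>lebesgue) \<le> ennreal c * emeasure lebesgue (ball x r)" by (elim exE conjE)
    have "ball x r \<subseteq> U" using r(2) e1(2) by (auto simp: subset_iff)
    then have "(x, r) \<in> K" using r unfolding K_def by simp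
    then show ?thesis using r by (intro exI[of _ "(x, r)"]) simp
  qed
  obtain C where C: "countable C" "C \<subseteq> K"
     "pairwise (\<lambda>i j. disjnt (ball (fst i) (snd i)) (ball (fst j) (snd j))) C"
     "negligible (N - (\<Union>i \<in> C. ball (fst i) (snd i)))"
    by (rule Vitali_covering_theorem_balls[of N K fst snd]) (rule S)
  let ?X = "\<lambda>i :: 'a \<times> real. ball (fst i) (snd i)"
  let ?W = "\<Union>i\<in>C. ?X i"
  have disj: "disjoint_family_on ?X C"
    using C(3) unfolding disjoint_family_on_def pairwise_def disjnt_def by blast
  have Wm: "?W \<in> sets lebesgue" by (intro borel_sets_lebesgue borel_open) auto
  have "N - ?W \<in> null_sets lebesgue" using C(4) negligible_iff_null_sets by blast
  then have "(\<integral>\<^sup>+y\<in>N. h y \<partial>lebesgue) \<le> (\<integral>\<^sup>+y\<in>?W. h y \<partial>lebesgue)" by (rule null_set_nn_integral_mono)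
  also have "\<dots> = emeasure (density lebesgue h) ?W" using Wm by (simp add: emeasure_density)
  also have "\<dots> = (\<integral>\<^sup>+i. emeasure (density lebesgue h) (?X i) \<partial>count_space C)"
    by (rule emeasure_UN_countable[OF _ C(1) disj]) simp
  also have "\<dots> \<le> (\<integral>\<^sup>+i. ennreal c * emeasure lebesgue (?X i) \<partial>count_space C)"
  proof (rule nn_integral_mono)
    fix i assume "i \<in> space (count_space C)"
    then have "i \<in> K" using C(2) by auto
    then have "(\<integral>\<^sup>+y\<in>?X i. h y \<partial>lebesgue) \<le> ennreal c * emeasure lebesgue (?X i)" unfolding K_def by blast
    then show "emeasure (density lebesgue h) (?X i) \<le> ennreal c * emeasure lebesgue (?X i)"
      by (subst emeasure_density) simp_all
  qed
  also have "\<dots> = ennreal c * (\<integral>\<^sup>+i. emeasure lebesgue (?X i) \<partial>count_space C)" by (rule nn_integral_cmult) simp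
  also have "(\<integral>\<^sup>+i. emeasure lebesgue (?X i) \<partial>count_space C) = emeasure lebesgue ?W"
    by (rule emeasure_UN_countable[symmetric, OF _ C(1) disj]) simp
  also have "\<dots> \<le> emeasure lebesgue U"
    using C(2) U(1) by (intro emeasure_mono) (auto simp: K_def)
  also have "emeasure lebesgue U \<le> emeasure lebesgue N + emeasure lebesgue (U - N)"
  proof -
    have "U = N \<union> (U - N)" using U(2) by blast
    then show ?thesis using emeasure_subadditive[OF N, of "U - N"] U(3) by (metis fmeasurableD)
  qed
  also have "\<dots> \<le> emeasure lebesgue N + ennreal (e / (c + 1))" using U(4) by (intro add_left_mono) simp
  finally have "(\<integral>\<^sup>+y\<in>N. h y \<partial>lebesgue) \<le> ennreal c * emeasure lebesgue N + ennreal c * ennreal (e / (c + 1))"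
    by (simp add: distrib_left mult_left_mono)
  also have "ennreal c * ennreal (e / (c + 1)) = ennreal (c * (e / (c + 1)))" by (rule ennreal_mult[symmetric, OF c less_imp_le[OF e']])
  also have "\<dots> \<le> ennreal e" using c e by (intro ennreal_leI) (simp add: field_simps)
  finally show "(\<integral>\<^sup>+y\<in>N. h y \<partial>lebesgue) \<le> ennreal c * emeasure lebesgue N + ennreal e"
    by (simp add: add_left_mono)
qed

text \<open>Tonelli's theorem for a Borel representative of h, since the Lebesgue sigma-algebra does
  not go along with products.\<close>

lemma ball_average_measurable:
  fixes h :: "'a::euclidean_space \<Rightarrow> real"
  assumes "h \<in> LM"
  shows "(\<lambda>x. \<integral>\<^sup>+y\<in>ball x r. ennreal (h y) \<partial>lebesgue) \<in> borel_measurable borel"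
proof -
  obtain g where g[measurable]: "g \<in> borel_measurable lborel" and ae: "AE x in lborel. h x = g x"
    using completion_ex_borel_measurable_real[OF assms] by blast
  have e: "(\<integral>\<^sup>+y\<in>ball x r. ennreal (h y) \<partial>lebesgue) = (\<integral>\<^sup>+y. ennreal (g y) * ind {y. dist x y < r} y \<partial>lborel)" for x
  proof -
    have "(\<integral>\<^sup>+y\<in>ball x r. ennreal (h y) \<partial>lebesgue) = (\<integral>\<^sup>+y\<in>ball x r. ennreal (h y) \<partial>lborel)" by (rule nn_integral_completion)
    also have "\<dots> = (\<integral>\<^sup>+y. ennreal (g y) * ind {y. dist x y < r} y \<partial>lborel)"
    proof (rule nn_integral_cong_AE)
      show "AE y in lborel. ennreal (h y) * ind (ball x r) y = ennreal (g y) * ind {y. dist x y < r} y"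
        using ae by eventually_elim (simp add: indicator_def)
    qed
    finally show ?thesis .
  qed
  have "(\<lambda>(x, y). ennreal (g y) * ind {y. dist x y < r} y) = (\<lambda>p::'a\<times>'a. ennreal (g (snd p)) * ind {p. dist (fst p) (snd p) < r} p)"
    by (auto simp: indicator_def)
  moreover have "{p::'a\<times>'a. dist (fst p) (snd p) < r} \<in> sets (borel \<Otimes>\<^sub>M borel)"
    unfolding borel_prod by (intro borel_open open_Collect_less continuous_intros)
  ultimately have "(\<lambda>(x, y). ennreal (g y) * ind {y. dist x y < r} y) \<in> borel_measurable (borel \<Otimes>\<^sub>M (lborel :: 'a measure))"
    by (simp add: measurable_cong_sets[OF sets_pair_measure_cong[OF refl sets_lborel] refl])
  then show ?thesis unfolding e by (rule lborel.borel_measurable_nn_integral)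
qed

text \<open>A one-sided differentiation theorem. Where h exceeds c although all small balls have
  averages at most c, \<open>density_vitali\<close> bounds the integral of h by c times the measure,
  so this set is null. The quantifier over c is inside, so one null set serves all levels.\<close>

lemma AE_average_le:
  fixes h :: "'a::euclidean_space \<Rightarrow> real"
  assumes h: "h \<in> LM"
  shows "AE x in lebesgue. \<forall>c\<ge>0. (\<exists>d>0. \<forall>r. 0 < r \<and> r < d \<longrightarrow> (\<integral>\<^sup>+y\<in>ball x r. ennreal (h y) \<partial>lebesgue) \<le> ennreal c * emeasure lebesgue (ball x r)) \<longrightarrow> h x \<le> c"
proof -
  let ?A = "\<lambda>x r. \<integral>\<^sup>+y\<in>ball x r. ennreal (h y) \<partial>lebesgue"
  define T where "T = {r::real. r \<in> \<rat> \<and> 0 < r}"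
  have cT: "countable T" unfolding T_def by (rule countable_subset[OF _ countable_rat]) auto
  \<comment> \<open>Rational radii keep the set measurable, the ball \<open>cball 0 (real m)\<close>
    gives it finite measure, and 1 / (m + 1) discretises the radius up to which the averages are
    small.\<close>
  define Nc where "Nc c m = {x. c < h x} \<inter> cball 0 (real m) \<inter> (\<Inter>r\<in>{r\<in>T. r < 1 / real (Suc m)}. {x. ?A x r \<le> ennreal c * emeasure lebesgue (ball x r)})" for c :: real and m
  have hm: "{x. c < h x} \<in> sets lebesgue" for c
    using h unfolding borel_measurable_iff_greater by simp
  have Nm: "Nc c m \<in> sets lebesgue" for c m
  proof -
    have "{x. ?A x r \<le> ennreal c * emeasure lebesgue (ball x r)} \<in> sets lebesgue" if "r \<in> T" for r
    proof -
      have [measurable]: "(\<lambda>x. ?A x r) \<in> borel_measurable borel" by (rule ball_average_measurable[OF h])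
      have r0: "0 \<le> r" using that by (simp add: T_def)
      have "{x. ?A x r \<le> ennreal c * ennreal (measure lborel (ball 0 1 :: 'a set) * r ^ DIM('a))} \<in> sets borel" by measurable
      then show ?thesis unfolding emeasure_ball_lebesgue[OF r0] by simp
    qed
    moreover have "{r\<in>T. r < 1 / real (Suc m)} \<noteq> {}"
    proof -
      have "(0::real) < 1 / real (Suc m)" by simp
      then obtain q :: rat where "0 < real_of_rat q" "real_of_rat q < 1 / real (Suc m)"
        using of_rat_dense by blast
      then have "real_of_rat q \<in> {r\<in>T. r < 1 / real (Suc m)}" unfolding T_def by simp
      then show ?thesis by blast
    qed
    moreover have "countable {r\<in>T. r < 1 / real (Suc m)}" using cT by (rule countable_subset[rotated]) auto
    ultimately have "(\<Inter>r\<in>{r\<in>T. r < 1 / real (Suc m)}. {x. ?A x r \<le> ennreal c * emeasure lebesgue (ball x r)}) \<in> sets lebesgue"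
      by (intro sets.countable_INT'') auto
    then show ?thesis unfolding Nc_def by (intro sets.Int hm) auto
  qed
  have null: "Nc c m \<in> null_sets lebesgue" if c: "0 \<le> c" for c m
  proof -
    have le: "(\<integral>\<^sup>+y\<in>Nc c m. ennreal (h y) \<partial>lebesgue) \<le> ennreal c * emeasure lebesgue (Nc c m)"
    proof (rule density_vitali[OF _ Nm c])
      show "(\<lambda>y. ennreal (h y)) \<in> LM" using h by measurable
      fix x d assume x: "x \<in> Nc c m" and d: "0 < (d::real)"
      have "0 < min d (1 / real (Suc m))" using d by simp
      then obtain q :: rat where q: "0 < real_of_rat q" "of_rat q < min d (1 / real (Suc m))"
        using of_rat_dense by blast
      then have "of_rat q \<in> {r\<in>T. r < 1 / real (Suc m)}" unfolding T_def by simp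
      then have "?A x (of_rat q) \<le> ennreal c * emeasure lebesgue (ball x (of_rat q))" using x unfolding Nc_def by blast
      then show "\<exists>r. 0 < r \<and> r < d \<and> ?A x r \<le> ennreal c * emeasure lebesgue (ball x r)" using q by (intro exI[of _ "of_rat q"]) simp
    qed
    have fin: "emeasure lebesgue (Nc c m) < \<infinity>"
    proof -
      have "emeasure lebesgue (Nc c m) \<le> emeasure lebesgue (cball 0 (real m) :: 'a set)"
        by (intro emeasure_mono) (auto simp: Nc_def)
      also have "\<dots> < \<infinity>" using emeasure_lborel_cball_finite[of "0::'a" "real m"] by simp
      finally show ?thesis .
    qed
    have split: "(\<integral>\<^sup>+y\<in>Nc c m. ennreal (h y) \<partial>lebesgue) = (\<integral>\<^sup>+y. ennreal ((h y - c) * ind (Nc c m) y) \<partial>lebesgue) + ennreal c * emeasure lebesgue (Nc c m)"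
    proof -
      have mm: "(\<lambda>y. ennreal ((h y - c) * ind (Nc c m) y)) \<in> LM"
        using h Nm by measurable
      have "(\<integral>\<^sup>+y\<in>Nc c m. ennreal (h y) \<partial>lebesgue) = (\<integral>\<^sup>+y. ennreal ((h y - c) * ind (Nc c m) y) + ennreal c * ind (Nc c m) y \<partial>lebesgue)"
      proof (rule nn_integral_cong)
        fix y
        show "ennreal (h y) * ind (Nc c m) y = ennreal ((h y - c) * ind (Nc c m) y) + ennreal c * ind (Nc c m) y"
        proof (cases "y \<in> Nc c m")
          case True
          then have "c < h y" unfolding Nc_def by blast
          then show ?thesis using True c by (simp add: ennreal_plus[symmetric] del: ennreal_plus)
        qed simp
      qed
      also have "\<dots> = (\<integral>\<^sup>+y. ennreal ((h y - c) * ind (Nc c m) y) \<partial>lebesgue) + (\<integral>\<^sup>+y. ennreal c * ind (Nc c m) y \<partial>lebesgue)"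
        by (rule nn_integral_add[OF mm]) (use Nm in measurable)
      finally show ?thesis using Nm by (simp add: nn_integral_cmult_indicator)
    qed
    have cf: "ennreal c * emeasure lebesgue (Nc c m) < \<infinity>" using fin by (simp add: ennreal_mult_less_top)
    have "(\<integral>\<^sup>+y. ennreal ((h y - c) * ind (Nc c m) y) \<partial>lebesgue) = 0"
    proof -
      let ?X = "\<integral>\<^sup>+y. ennreal ((h y - c) * ind (Nc c m) y) \<partial>lebesgue" and ?Y = "ennreal c * emeasure lebesgue (Nc c m)"
      have "?X + ?Y \<le> ?Y" using le unfolding split .
      then have "?Y + ?X = ?Y + 0" by (intro antisym) (simp_all add: add.commute)
      then show ?thesis using cf unfolding ennreal_add_left_cancel by auto
    qed
    moreover have "(\<lambda>y. ennreal ((h y - c) * ind (Nc c m) y)) \<in> LM" using h Nm by measurable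
    ultimately have "AE y in lebesgue. ennreal ((h y - c) * ind (Nc c m) y) = 0"
      using nn_integral_0_iff_AE by blast
    then have "AE y in lebesgue. y \<notin> Nc c m"
    proof eventually_elim
      case (elim y)
      show ?case
      proof
        assume y: "y \<in> Nc c m"
        then have "c < h y" unfolding Nc_def by blast
        then show False using elim y by (simp add: ennreal_eq_0_iff)
      qed
    qed
    then show ?thesis using AE_iff_null_sets[OF Nm] by blast
  qed
  have "AE x in lebesgue. \<forall>q\<in>{q::rat. 0 \<le> q}. \<forall>m. x \<notin> Nc (of_rat q) m"
  proof (rule AE_ball_countable')
    show "AE x in lebesgue. \<forall>m. x \<notin> Nc (of_rat q) m" if "q \<in> {q::rat. 0 \<le> q}" for q
      unfolding AE_all_countable using that by (intro allI AE_not_in null) simp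
  qed simp
  then show ?thesis
  proof eventually_elim
    case (elim x)
    show ?case
    proof (intro allI impI)
      fix c :: real assume c: "0 \<le> c" and "\<exists>d>0. \<forall>r. 0 < r \<and> r < d \<longrightarrow> ?A x r \<le> ennreal c * emeasure lebesgue (ball x r)"
      then obtain d where d: "d > 0" "\<And>r. 0 < r \<Longrightarrow> r < d \<Longrightarrow> ?A x r \<le> ennreal c * emeasure lebesgue (ball x r)" by blast
      show "h x \<le> c"
      proof (rule ccontr)
        assume "\<not> h x \<le> c"
        \<comment> \<open>A rational level strictly between c and \<open>h x\<close> reduces
          uncountably many levels to countably many null sets.\<close>
        then obtain q :: rat where q: "c < of_rat q" "of_rat q < h x" using of_rat_dense[of c "h x"] by auto
        have q0: "0 \<le> q" using c q(1) by (metis less_imp_le order_trans zero_le_of_rat_iff)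
        obtain m1 :: nat where m1: "norm x \<le> real m1" using real_arch_simple by blast
        obtain m2 :: nat where m2: "1 / d \<le> real m2" using real_arch_simple by blast
        define m where "m = max m1 m2"
        have "1 / d < real (Suc m)" using m2 by (simp add: m_def)
        then have md: "1 / real (Suc m) < d" using d(1) by (simp add: field_simps)
        have "x \<in> Nc (of_rat q) m" unfolding Nc_def
        proof (intro IntI INT_I)
          show "x \<in> {x. of_rat q < h x}" using q by simp
          show "x \<in> cball 0 (real m)" using m1 by (simp add: m_def)
          fix r assume "r \<in> {r \<in> T. r < 1 / real (Suc m)}"
          then have "0 < r" "r < d" using md by (auto simp: T_def)
          then have "?A x r \<le> ennreal c * emeasure lebesgue (ball x r)" by (rule d(2))
          also have "\<dots> \<le> ennreal (of_rat q) * emeasure lebesgue (ball x r)" using q by (intro mult_right_mono ennreal_leI) auto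
          finally show "x \<in> {x. ?A x r \<le> ennreal (of_rat q) * emeasure lebesgue (ball x r)}" by simp
        qed
        then show False using elim q0 by blast
      qed
    qed
  qed
qed

section \<open>Gehring's estimate from a reverse Hoelder inequality\<close>

lemma dyadic_sum_le:
  fixes t y :: real
  assumes "0 < t" "0 \<le> y"
  shows "(\<Sum>m\<le>N. 2 ^ m * t * ind {s. s < y} (2 ^ m * t)) \<le> 2 * y"
proof (induction N)
  case 0
  then show ?case using assms by (auto simp: indicator_def)
next
  case (Suc N)
  show ?case
  proof (cases "2 ^ Suc N * t < y")
    case True
    have "(\<Sum>m\<le>Suc N. 2 ^ m * t * ind {s. s < y} (2 ^ m * t)) \<le> (\<Sum>m\<le>Suc N. 2 ^ m * t)"
      using assms by (intro sum_mono) (auto simp: indicator_def)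
    also have "\<dots> = (2 ^ Suc (Suc N) - 1) * t"
    proof -
      have "(\<Sum>m\<le>k. 2 ^ m * t) = (2 ^ Suc k - 1) * t" for k by (induction k) (simp_all add: algebra_simps)
      then show ?thesis by blast
    qed
    also have "\<dots> \<le> 2 * (2 ^ Suc N * t)" using assms by (simp add: algebra_simps)
    also have "\<dots> \<le> 2 * y" by (rule mult_left_mono[OF less_imp_le[OF True]]) simp
    finally show ?thesis .
  next
    case False
    then show ?thesis using Suc by simp
  qed
qed

text \<open>Along the radii r0 24^m, take the last one before the density first falls to the
  critical level. The factor 24 is chosen to exceed the enlargement 5 * 4 needed for the Vitali
  cover in \<open>gehring\<close>.\<close>

lemma stopping_radius:
  fixes a :: "real \<Rightarrow> real" and c \<rho> r0 :: real and n :: nat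
  assumes r0: "0 < r0" and a0: "a r0 > c * r0 ^ n" and big: "\<And>s. \<rho> \<le> s \<Longrightarrow> a s \<le> c * s ^ n"
  shows "\<exists>r. 0 < r \<and> r < \<rho> \<and> a r > c * r ^ n \<and> a (24 * r) \<le> c * (24 * r) ^ n"
proof -
  let ?P = "\<lambda>m. a (r0 * 24 ^ m) \<le> c * (r0 * 24 ^ m) ^ n"
  obtain m0 where "\<rho> / r0 < 24 ^ m0" using real_arch_pow[of 24 "\<rho> / r0"] by auto
  then have "\<rho> \<le> r0 * 24 ^ m0" using r0 by (simp add: field_simps)
  then have ex: "?P m0" by (rule big)
  define m where "m = (LEAST m. ?P m)"
  have Pm: "?P m" unfolding m_def using ex by (rule LeastI)
  have "m \<noteq> 0" using Pm a0 by (intro notI) simp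
  then obtain k where k: "m = Suc k" using not0_implies_Suc by blast
  have nk: "\<not> ?P k" using not_less_Least[of k ?P] k unfolding m_def[symmetric] by simp
  let ?r = "r0 * 24 ^ k"
  have "?r < \<rho>" using nk big[of ?r] by linarith
  moreover have "a (24 * ?r) \<le> c * (24 * ?r) ^ n" using Pm unfolding k by (simp add: mult_ac)
  moreover have "a ?r > c * ?r ^ n" using nk by simp
  ultimately show ?thesis using r0 by (intro exI[of _ ?r]) simp
qed

text \<open>The stopping-time estimate for the super-level sets is summed over dyadic levels,
  so no absorption is needed and the super-level sets on the right may live on the larger ball.\<close>

lemma gehring:
  fixes f :: "'a::euclidean_space \<Rightarrow> real" and x0 :: 'a and R \<kappa> \<Lambda> :: real
  assumes L: "L2 f" and f0: "\<And>x. 0 \<le> f x" and out: "\<And>x. x \<notin> ball x0 R \<Longrightarrow> f x = 0" and R: "0 < R"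
    and \<Lambda>: "0 < \<Lambda>" and \<kappa>: "0 \<le> \<kappa>" "\<kappa> * 24 ^ DIM('a) \<le> 1 / 2"
    and RH: "\<And>x r. 0 < r \<Longrightarrow> ball x (4 * r) \<subseteq> ball x0 R \<Longrightarrow>
      (LINT y|lebesgue. ind (ball x r) y * (f y)\<^sup>2) \<le> \<kappa> * (LINT y|lebesgue. ind (ball x (4 * r)) y * (f y)\<^sup>2)
        + \<Lambda> / r ^ DIM('a) * (LINT y|lebesgue. ind (ball x (4 * r)) y * f y)\<^sup>2"
    and E: "E \<in> sets lebesgue" "E \<subseteq> ball x0 (R / 2)"
  shows "(LINT y|lebesgue. ind E y * (f y)\<^sup>2)
    \<le> (16 * measure lborel (ball 0 1 :: 'a set) * 96 ^ DIM('a) * \<Lambda> / real (Suc N)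
       + 4 ^ N * measure lebesgue E / (measure lborel (ball 0 1 :: 'a set) * (R / 48) ^ DIM('a))) * (LINT y|lebesgue. (f y)\<^sup>2)"
proof -
  let ?n = "DIM('a)"
  define \<omega> where "\<omega> = measure lborel (ball 0 1 :: 'a set)"
  have \<omega>: "0 < \<omega>" unfolding \<omega>_def by (rule content_ball_pos) simp
  \<comment> \<open>For a centre in \<open>ball x0 (R / 2)\<close> and r below \<rho>, even the ball
    of radius 24 r stays in \<open>ball x0 R\<close>.\<close>
  define \<rho> where "\<rho> = R / 48"
  have \<rho>: "0 < \<rho>" using R by (simp add: \<rho>_def)
  define I2 where "I2 S = (LINT y|lebesgue. ind S y * (f y)\<^sup>2)" for S
  define I1 where "I1 S = (LINT y|lebesgue. ind S y * f y)" for S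
  define S0 where "S0 = (LINT y|lebesgue. (f y)\<^sup>2)"
  have fm[measurable]: "f \<in> LM" by (rule L2_meas[OF L])
  have i2: "integrable lebesgue (\<lambda>y. (f y)\<^sup>2)" using L2_int[OF L] by simp
  have i2S: "integrable lebesgue (\<lambda>y. ind S y * (f y)\<^sup>2)" if "S \<in> sets lebesgue" for S
    using integrable_mult_indicator[OF that i2] by simp
  have i1: "integrable lebesgue f"
  proof -
    have "L2 (\<lambda>x. ind (ball x0 R) x *\<^sub>R (1::real))" by (rule L2_indicator) auto
    then have "integrable lebesgue (\<lambda>x. f x * (ind (ball x0 R) x *\<^sub>R (1::real)))" by (rule L2_mult_integrable_real[OF L])
    moreover have "f x * (ind (ball x0 R) x *\<^sub>R (1::real)) = f x" for x using out[of x] by (cases "x \<in> ball x0 R") simp_all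
    ultimately show ?thesis by (simp only:)
  qed
  have i1S: "integrable lebesgue (\<lambda>y. ind S y * f y)" if "S \<in> sets lebesgue" for S
    using integrable_mult_indicator[OF that i1] by simp
  have ballm: "ball x r \<in> sets lebesgue" for x :: 'a and r by (intro borel_sets_lebesgue borel_open) auto
  have I2n: "(\<integral>\<^sup>+y\<in>S. ennreal ((f y)\<^sup>2) \<partial>lebesgue) = ennreal (I2 S)" if "S \<in> sets lebesgue" for S
  proof -
    have "(\<integral>\<^sup>+y\<in>S. ennreal ((f y)\<^sup>2) \<partial>lebesgue) = (\<integral>\<^sup>+y. ennreal (ind S y * (f y)\<^sup>2) \<partial>lebesgue)"
      by (intro nn_integral_cong) (simp add: indicator_def)
    then show ?thesis unfolding I2_def using nn_integral_eq_integral[OF i2S[OF that]] by simp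
  qed
  have I2mono: "I2 S \<le> I2 S'" if "S \<in> sets lebesgue" "S' \<in> sets lebesgue" "S \<subseteq> S'" for S S'
    unfolding I2_def using that by (intro integral_mono i2S) (auto simp: indicator_def)
  have I2S0: "I2 S \<le> S0" if "S \<in> sets lebesgue" for S
    unfolding I2_def S0_def using that by (intro integral_mono i2S i2) (auto simp: indicator_def)
  have I20: "0 \<le> I2 S" for S unfolding I2_def by (intro integral_nonneg_AE) simp
  have S00: "0 \<le> S0" unfolding S0_def by (intro integral_nonneg_AE) simp
  let ?C = "16 * \<omega> * 96 ^ ?n * \<Lambda>"
  have "I2 E \<le> (?C / real (Suc N) + 4 ^ N * measure lebesgue E / (\<omega> * \<rho> ^ ?n)) * S0"
  proof (cases "S0 = 0")
    case True
    then show ?thesis using I2S0[OF E(1)] I20[of E] by simp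
  next
    case False
    then have S0p: "0 < S0" using S00 by simp
    \<comment> \<open>The square of \<open>t0\<close> is the mean that the whole mass
      \<open>S0\<close> would have on a ball of radius \<rho>. Above this level, balls of radius at
      least \<rho> are never critical, so stopping occurs below \<rho>.\<close>
    define t0 where "t0 = sqrt (S0 / (\<omega> * \<rho> ^ ?n))"
    have t0: "0 < t0" unfolding t0_def using S0p \<omega> \<rho> by simp
    have t0sq: "t0\<^sup>2 = S0 / (\<omega> * \<rho> ^ ?n)" unfolding t0_def using S0p \<omega> \<rho> by simp
    \<comment> \<open>The three constants are dictated by \<open>key\<close>: on the ball of radius
      4 r around a stopped point f has integral at least \<gamma> t r^n, values below c t account
      for at most half of it, and \<Gamma> converts the other half into the bound for the mass on
      the ball of radius 24 r.\<close>
    define \<gamma> where "\<gamma> = sqrt (\<omega> / (2 * \<Lambda>))"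
    have \<gamma>: "0 < \<gamma>" unfolding \<gamma>_def using \<omega> \<Lambda> by simp
    have \<gamma>sq: "\<gamma>\<^sup>2 = \<omega> / (2 * \<Lambda>)" unfolding \<gamma>_def using \<omega> \<Lambda> by simp
    define c where "c = \<gamma> / (2 * \<omega> * 4 ^ ?n)"
    have c: "0 < c" unfolding c_def using \<gamma> \<omega> by simp
    define \<Gamma> where "\<Gamma> = 2 * \<omega> * 24 ^ ?n / \<gamma>"
    have \<Gamma>: "0 < \<Gamma>" unfolding \<Gamma>_def using \<gamma> \<omega> by simp
    define Q where "Q x \<longleftrightarrow> (\<forall>b\<ge>0. (\<exists>d>0. \<forall>r. 0 < r \<and> r < d \<longrightarrow> (\<integral>\<^sup>+y\<in>ball x r. ennreal ((f y)\<^sup>2) \<partial>lebesgue) \<le> ennreal b * emeasure lebesgue (ball x r)) \<longrightarrow> (f x)\<^sup>2 \<le> b)" for x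
    have "AE x in lebesgue. Q x"
      unfolding Q_def by (rule AE_average_le) measurable
    then obtain Z where Z1: "Z \<in> null_sets lebesgue" "{x \<in> space lebesgue. \<not> Q x} \<subseteq> Z"
      unfolding eventually_ae_filter by blast
    have Z2: "Q x" if "x \<notin> Z" for x using Z1(2) that by auto
    define St where "St t = {x \<in> ball x0 (R / 2). t < f x}" for t
    have Stm: "St t \<in> sets lebesgue" for t
    proof -
      have "{x. t < f x} \<in> sets lebesgue" using fm unfolding borel_measurable_iff_greater by simp
      then have "ball x0 (R / 2) \<inter> {x. t < f x} \<in> sets lebesgue" by (intro sets.Int ballm)
      moreover have "St t = ball x0 (R / 2) \<inter> {x. t < f x}" by (auto simp: St_def)
      ultimately show ?thesis by (simp only:)
    qed
    define ft where "ft t x = f x * ind {y. c * t < f y} x" for t x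
    have ftm: "ft t \<in> LM" for t
    proof -
      have "{y. c * t < f y} \<in> sets lebesgue" using fm unfolding borel_measurable_iff_greater by simp
      then show ?thesis unfolding ft_def by (intro borel_measurable_times fm borel_measurable_indicator)
    qed
    have ft0: "0 \<le> ft t x" for t x unfolding ft_def using f0 by simp
    have fti: "integrable lebesgue (ft t)" for t
      by (rule Bochner_Integration.integrable_bound[OF i1 ftm]) (use f0 in \<open>auto simp: ft_def indicator_def\<close>)
    have ftiS: "integrable lebesgue (\<lambda>y. ind S y * ft t y)" if "S \<in> sets lebesgue" for S t
      using integrable_mult_indicator[OF that fti] by simp
    define J where "J t S = (LINT y|lebesgue. ind S y * ft t y)" for t S
    have Jn: "(\<integral>\<^sup>+y\<in>S. ennreal (ft t y) \<partial>lebesgue) = ennreal (J t S)" if "S \<in> sets lebesgue" for S t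
    proof -
      have "(\<integral>\<^sup>+y\<in>S. ennreal (ft t y) \<partial>lebesgue) = (\<integral>\<^sup>+y. ennreal (ind S y * ft t y) \<partial>lebesgue)"
        by (intro nn_integral_cong) (simp add: indicator_def)
      then show ?thesis unfolding J_def using nn_integral_eq_integral[OF ftiS[OF that]] ft0 by simp
    qed
    have level: "I2 (St t) \<le> t * \<Gamma> * (LINT y|lebesgue. ft t y)" if t: "t0 \<le> t" for t
    proof -
      have tp: "0 < t" using t t0 by linarith
      define S where "S = St t - Z"
      have stop: "\<exists>r. 0 < r \<and> r < \<rho> \<and> I2 (ball x r) > t\<^sup>2 * \<omega> * r ^ ?n \<and> I2 (ball x (24 * r)) \<le> t\<^sup>2 * \<omega> * (24 * r) ^ ?n" if x: "x \<in> S" for x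
      proof -
        \<comment> \<open>Off the null set, a value above t forces some ball around x to have mean
          of f^2 above t^2, which starts the stopping argument.\<close>
        have fx: "t < f x" "x \<notin> Z" using x by (auto simp: S_def St_def)
        have "\<not> (f x)\<^sup>2 \<le> t\<^sup>2" using fx tp by (simp add: abs_le_square_iff[symmetric])
        then have "\<not> (\<exists>d>0. \<forall>r. 0 < r \<and> r < d \<longrightarrow> (\<integral>\<^sup>+y\<in>ball x r. ennreal ((f y)\<^sup>2) \<partial>lebesgue) \<le> ennreal (t\<^sup>2) * emeasure lebesgue (ball x r))"
          using Z2[OF fx(2), unfolded Q_def, THEN spec[of _ "t\<^sup>2"]] zero_le_power2[of t] by blast
        then obtain r0 where r0: "0 < r0" "\<not> (\<integral>\<^sup>+y\<in>ball x r0. ennreal ((f y)\<^sup>2) \<partial>lebesgue) \<le> ennreal (t\<^sup>2) * emeasure lebesgue (ball x r0)"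
          using \<rho> by blast
        have "ennreal (t\<^sup>2) * emeasure lebesgue (ball x r0) = ennreal (t\<^sup>2 * \<omega> * r0 ^ ?n)"
          unfolding emeasure_ball_lebesgue[OF less_imp_le[OF r0(1)]] \<omega>_def using r0(1) by (simp add: ennreal_mult mult.assoc)
        then have a0: "I2 (ball x r0) > t\<^sup>2 * \<omega> * r0 ^ ?n"
          using r0(2) I2n[OF ballm] by (simp add: not_le ennreal_less_iff \<omega> less_imp_le r0(1))
        show ?thesis
        proof (rule stopping_radius[of r0 "t\<^sup>2 * \<omega>" ?n "\<lambda>r. I2 (ball x r)" \<rho>, OF r0(1) a0])
          fix s assume s: "\<rho> \<le> s"
          have "I2 (ball x s) \<le> S0" by (rule I2S0[OF ballm])
          also have "\<dots> = t0\<^sup>2 * \<omega> * \<rho> ^ ?n" unfolding t0sq using \<omega> \<rho> by simp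
          also have "\<dots> \<le> t\<^sup>2 * \<omega> * s ^ ?n" using t t0 s \<rho> \<omega> by (intro mult_mono power_mono mult_nonneg_nonneg) auto
          finally show "I2 (ball x s) \<le> t\<^sup>2 * \<omega> * s ^ ?n" .
        qed
      qed
      then obtain r where r: "\<forall>x\<in>S. 0 < r x \<and> r x < \<rho> \<and> I2 (ball x (r x)) > t\<^sup>2 * \<omega> * r x ^ ?n \<and> I2 (ball x (24 * r x)) \<le> t\<^sup>2 * \<omega> * (24 * r x) ^ ?n"
        by metis
      have key: "I2 (ball x (24 * r x)) \<le> t * \<Gamma> * J t (ball x (4 * r x))" if x: "x \<in> S" for x
      proof -
        let ?r = "r x"
        have rr: "0 < ?r" "?r < \<rho>" "I2 (ball x ?r) > t\<^sup>2 * \<omega> * ?r ^ ?n" "I2 (ball x (24 * ?r)) \<le> t\<^sup>2 * \<omega> * (24 * ?r) ^ ?n" using r x by blast+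
        define q where "q = ?r ^ ?n"
        have q: "0 < q" unfolding q_def using rr by simp
        have xb: "dist x0 x < R / 2" using x by (simp add: S_def St_def)
        have sub: "ball x (4 * ?r) \<subseteq> ball x0 R"
        proof
          fix z assume "z \<in> ball x (4 * ?r)"
          then have "dist x z < 4 * ?r" by simp
          moreover have "4 * ?r < R / 12" using rr(2) by (simp add: \<rho>_def)
          ultimately show "z \<in> ball x0 R" using xb dist_triangle[of x0 z x] R by simp
        qed
        let ?b = "ball x (4 * ?r)"
        \<comment> \<open>The stopping rule at factor 24 bounds the mass on the ball of radius 4 r
          by 24^n times the critical one, so the \<kappa> term is at most half of the lower bound on
          the ball of radius r and only the L1 term is left to compensate.\<close>
        have "I2 ?b \<le> I2 (ball x (24 * ?r))" using rr(1) by (intro I2mono ballm) (auto simp: subset_iff)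
        also have "\<dots> \<le> t\<^sup>2 * \<omega> * 24 ^ ?n * q" using rr(4) by (simp add: power_mult_distrib q_def mult.assoc)
        finally have b1: "\<kappa> * I2 ?b \<le> \<kappa> * (t\<^sup>2 * \<omega> * 24 ^ ?n * q)" using \<kappa> by (intro mult_left_mono) auto
        also have "\<dots> = (\<kappa> * 24 ^ ?n) * (t\<^sup>2 * \<omega> * q)" by simp
        also have "\<dots> \<le> 1 / 2 * (t\<^sup>2 * \<omega> * q)" using \<kappa> \<omega> q by (intro mult_right_mono) auto
        finally have b2: "\<kappa> * I2 ?b \<le> 1 / 2 * (t\<^sup>2 * \<omega> * q)" .
        have "t\<^sup>2 * \<omega> * q < \<kappa> * I2 ?b + \<Lambda> / q * (I1 ?b)\<^sup>2"
          using RH[OF rr(1) sub] rr(3) unfolding I2_def[symmetric] I1_def[symmetric] q_def by linarith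
        then have "1 / 2 * (t\<^sup>2 * \<omega> * q) \<le> \<Lambda> / q * (I1 ?b)\<^sup>2" using b2 by linarith
        then have "t\<^sup>2 * \<omega> * q * q \<le> 2 * \<Lambda> * (I1 ?b)\<^sup>2" using q by (simp add: field_simps)
        then have "t\<^sup>2 * \<omega> * q * q / (2 * \<Lambda>) \<le> 2 * \<Lambda> * (I1 ?b)\<^sup>2 / (2 * \<Lambda>)" using \<Lambda> by (intro divide_right_mono) simp_all
        moreover have "(\<gamma> * t * q)\<^sup>2 = t\<^sup>2 * \<omega> * q * q / (2 * \<Lambda>)"
          unfolding power_mult_distrib \<gamma>sq by (simp add: power2_eq_square)
        ultimately have "(\<gamma> * t * q)\<^sup>2 \<le> (I1 ?b)\<^sup>2" using \<Lambda> by simp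
        moreover have "0 \<le> I1 ?b" unfolding I1_def using f0 by (intro integral_nonneg_AE) simp
        ultimately have g1: "\<gamma> * t * q \<le> I1 ?b" by (rule power2_le_imp_le)
        have "I1 ?b \<le> (LINT y|lebesgue. ind ?b y * ft t y + c * t * ind ?b y)"
          unfolding I1_def
        proof (rule integral_mono)
          show "integrable lebesgue (\<lambda>y. ind ?b y * ft t y + c * t * ind ?b y)"
            by (intro Bochner_Integration.integrable_add ftiS ballm integrable_mult_right integrable_real_indicator) (use emeasure_ball_lebesgue[of "4 * ?r" x] rr(1) in simp)
          show "ind ?b y * f y \<le> ind ?b y * ft t y + c * t * ind ?b y" for y
            using c tp by (simp add: ft_def indicator_def)
        qed (rule i1S[OF ballm])
        also have "\<dots> = J t ?b + c * t * measure lebesgue ?b"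
        proof -
          have ib: "integrable lebesgue (\<lambda>y. ind ?b y :: real)"
            using emeasure_ball_lebesgue[of "4 * ?r" x] rr(1) by (intro integrable_real_indicator ballm) simp
          show ?thesis using ftiS[OF ballm, of x "4 * ?r" t] ib ballm by (simp add: J_def)
        qed
        also have "measure lebesgue ?b = \<omega> * 4 ^ ?n * q"
          using emeasure_ball_lebesgue[of "4 * ?r" x] rr(1) by (simp add: measure_def \<omega>_def q_def power_mult_distrib)
        also have "c * t * (\<omega> * 4 ^ ?n * q) = \<gamma> * t * q / 2" unfolding c_def using \<omega> by simp
        finally have "\<gamma> * t * q / 2 \<le> J t ?b" using g1 by linarith
        then have "t * \<Gamma> * (\<gamma> * t * q / 2) \<le> t * \<Gamma> * J t ?b" using tp \<Gamma> by (intro mult_left_mono) auto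
        moreover have "t * \<Gamma> * (\<gamma> * t * q / 2) = t\<^sup>2 * \<omega> * (24 * ?r) ^ ?n"
          unfolding \<Gamma>_def q_def using \<gamma> by (simp add: power_mult_distrib power2_eq_square)
        ultimately show ?thesis using rr(4) by linarith
      qed
      \<comment> \<open>Vitali's lemma: disjoint balls of radius 4 r whose fivefold enlargements, of
        radius 20 r, cover \<open>S\<close> and lie inside the balls of radius 24 r.\<close>
      obtain C where C: "countable C" "C \<subseteq> S" "pairwise (\<lambda>i j. disjnt (cball i (4 * r i)) (cball j (4 * r j))) C"
        "S \<subseteq> (\<Union>i\<in>C. cball i (5 * (4 * r i)))"
      proof (rule Vitali_covering_lemma_cballs[where S=S and K=S and a="\<lambda>x. x" and r="\<lambda>x. 4 * r x" and B="4 * \<rho>"])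
        show "S \<subseteq> (\<Union>i\<in>S. cball i (4 * r i))" using r by (force simp: less_imp_le)
        show "0 < 4 * r i \<and> 4 * r i \<le> 4 * \<rho>" if "i \<in> S" for i using r that by (simp add: less_imp_le)
      qed
      let ?X = "\<lambda>i. ball i (24 * r i)" and ?Y = "\<lambda>i. ball i (4 * r i)"
      have disj: "disjoint_family_on ?Y C"
        using C(3) unfolding disjoint_family_on_def pairwise_def disjnt_def by (meson ball_subset_cball disjoint_iff subsetD)
      have cov: "\<exists>i\<in>C. x \<in> ?X i" if "x \<in> S" for x
      proof -
        obtain i where i: "i \<in> C" "dist i x \<le> 5 * (4 * r i)" using C(4) \<open>x \<in> S\<close> by auto
        moreover have "0 < r i" using r C(2) i(1) by blast
        ultimately show ?thesis by (intro bexI[of _ i]) auto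
      qed
      have "St t - S \<in> null_sets lebesgue" by (rule completion.complete2[OF _ Z1(1)]) (auto simp: S_def)
      then have "ennreal (I2 (St t)) \<le> (\<integral>\<^sup>+y\<in>S. ennreal ((f y)\<^sup>2) \<partial>lebesgue)"
        unfolding I2n[OF Stm, symmetric] by (rule null_set_nn_integral_mono)
      also have "\<dots> \<le> (\<integral>\<^sup>+y. (\<integral>\<^sup>+i. ennreal ((f y)\<^sup>2) * ind (?X i) y \<partial>count_space C) \<partial>lebesgue)"
      proof (rule nn_integral_mono)
        fix y
        show "ennreal ((f y)\<^sup>2) * ind S y \<le> (\<integral>\<^sup>+i. ennreal ((f y)\<^sup>2) * ind (?X i) y \<partial>count_space C)"
        proof (cases "y \<in> S")
          case True
          then obtain i where i: "i \<in> C" "y \<in> ?X i" using cov by blast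
          then show ?thesis using nn_integral_ge_point[OF i(1), of "\<lambda>i. ennreal ((f y)\<^sup>2) * ind (?X i) y"] True by simp
        qed simp
      qed
      also have "\<dots> = (\<integral>\<^sup>+i. (\<integral>\<^sup>+y\<in>?X i. ennreal ((f y)\<^sup>2) \<partial>lebesgue) \<partial>count_space C)"
        by (rule nn_integral_count_space_nn_integral[OF C(1)]) (use ballm in measurable)
      also have "\<dots> \<le> (\<integral>\<^sup>+i. ennreal (t * \<Gamma>) * (\<integral>\<^sup>+y\<in>?Y i. ennreal (ft t y) \<partial>lebesgue) \<partial>count_space C)"
      proof (rule nn_integral_mono)
        fix i assume "i \<in> space (count_space C)"
        then have "i \<in> S" using C(2) by auto
        from key[OF this] have "ennreal (I2 (?X i)) \<le> ennreal (t * \<Gamma> * J t (?Y i))" by (rule ennreal_leI)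
        also have "\<dots> = ennreal (t * \<Gamma>) * ennreal (J t (?Y i))" using tp \<Gamma> by (intro ennreal_mult') simp
        finally show "(\<integral>\<^sup>+y\<in>?X i. ennreal ((f y)\<^sup>2) \<partial>lebesgue) \<le> ennreal (t * \<Gamma>) * (\<integral>\<^sup>+y\<in>?Y i. ennreal (ft t y) \<partial>lebesgue)"
          unfolding I2n[OF ballm] Jn[OF ballm] .
      qed
      also have "\<dots> = ennreal (t * \<Gamma>) * (\<integral>\<^sup>+i. (\<integral>\<^sup>+y\<in>?Y i. ennreal (ft t y) \<partial>lebesgue) \<partial>count_space C)"
        by (rule nn_integral_cmult) simp
      also have "(\<integral>\<^sup>+i. (\<integral>\<^sup>+y\<in>?Y i. ennreal (ft t y) \<partial>lebesgue) \<partial>count_space C) \<le> (\<integral>\<^sup>+y. ennreal (ft t y) \<partial>lebesgue)"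
      proof -
        have m: "(\<lambda>y. ennreal (ft t y)) \<in> LM" using ftm by measurable
        have "(\<integral>\<^sup>+i. (\<integral>\<^sup>+y\<in>?Y i. ennreal (ft t y) \<partial>lebesgue) \<partial>count_space C) = (\<integral>\<^sup>+i. emeasure (density lebesgue (\<lambda>y. ennreal (ft t y))) (?Y i) \<partial>count_space C)"
          by (intro nn_integral_cong) (simp add: emeasure_density m)
        also have "\<dots> = emeasure (density lebesgue (\<lambda>y. ennreal (ft t y))) (\<Union>i\<in>C. ?Y i)"
          by (rule emeasure_UN_countable[symmetric, OF _ C(1) disj]) simp
        also have "\<dots> = (\<integral>\<^sup>+y\<in>(\<Union>i\<in>C. ?Y i). ennreal (ft t y) \<partial>lebesgue)"
          by (rule emeasure_density[OF m]) (intro borel_sets_lebesgue borel_open, auto)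
        also have "\<dots> \<le> (\<integral>\<^sup>+y. ennreal (ft t y) \<partial>lebesgue)" by (intro nn_integral_mono) (simp add: indicator_def)
        finally show ?thesis .
      qed
      also have "(\<integral>\<^sup>+y. ennreal (ft t y) \<partial>lebesgue) = ennreal (LINT y|lebesgue. ft t y)"
        by (rule nn_integral_eq_integral[OF fti]) (simp add: ft0)
      finally have "ennreal (I2 (St t)) \<le> ennreal (t * \<Gamma>) * ennreal (LINT y|lebesgue. ft t y)"
        by (simp add: mult_left_mono)
      also have "\<dots> = ennreal (t * \<Gamma> * (LINT y|lebesgue. ft t y))" using tp \<Gamma> by (intro ennreal_mult'[symmetric]) simp
      finally have fin: "ennreal (I2 (St t)) \<le> ennreal (t * \<Gamma> * (LINT y|lebesgue. ft t y))" .
      have "0 \<le> (LINT y|lebesgue. ft t y)" by (rule integral_nonneg_AE) (simp add: ft0)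
      then have "0 \<le> t * \<Gamma> * (LINT y|lebesgue. ft t y)" using tp \<Gamma> by simp
      from iffD1[OF ennreal_le_iff[OF this] fin] show ?thesis .
    qed
    define tt where "tt m = 2 ^ m * t0" for m :: nat
    have ttp: "t0 \<le> tt m" for m unfolding tt_def using t0 mult_right_mono[of 1 "2 ^ m" t0] by simp
    have mono: "I2 (St (tt N)) \<le> I2 (St (tt m))" if "m \<le> N" for m
    proof (intro I2mono Stm)
      have "tt m \<le> tt N" unfolding tt_def using that t0 by (intro mult_right_mono power_increasing) auto
      then show "St (tt N) \<subseteq> St (tt m)" by (auto simp: St_def)
    qed
    \<comment> \<open>The top level set is contained in all lower ones, so its mass is counted N + 1
      times. On the right, the dyadic thresholds below \<open>f y / c\<close> sum to at most twice
      \<open>f y / c\<close>, which leaves a fixed multiple of \<open>S0\<close>; hence the gain 1 /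
      (N + 1).\<close>
    have "real (Suc N) * I2 (St (tt N)) = (\<Sum>m\<le>N. I2 (St (tt N)))" by simp
    also have "\<dots> \<le> (\<Sum>m\<le>N. I2 (St (tt m)))" by (intro sum_mono mono) simp
    also have "\<dots> \<le> (\<Sum>m\<le>N. tt m * \<Gamma> * (LINT y|lebesgue. ft (tt m) y))" by (intro sum_mono level ttp)
    also have "\<dots> = \<Gamma> * (LINT y|lebesgue. (\<Sum>m\<le>N. tt m * ft (tt m) y))"
    proof -
      have "(LINT y|lebesgue. (\<Sum>m\<le>N. tt m * ft (tt m) y)) = (\<Sum>m\<le>N. (LINT y|lebesgue. tt m * ft (tt m) y))"
        by (rule Bochner_Integration.integral_sum) (intro integrable_mult_right fti)
      then show ?thesis by (simp add: sum_distrib_left mult_ac)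
    qed
    also have "\<dots> \<le> \<Gamma> * (LINT y|lebesgue. 2 / c * (f y)\<^sup>2)"
    proof (intro mult_left_mono integral_mono)
      show "integrable lebesgue (\<lambda>y. \<Sum>m\<le>N. tt m * ft (tt m) y)"
        by (intro Bochner_Integration.integrable_sum integrable_mult_right fti)
      fix y
      have "(\<Sum>m\<le>N. tt m * ft (tt m) y) = f y * (\<Sum>m\<le>N. 2 ^ m * t0 * ind {s. s < f y / c} (2 ^ m * t0))"
        unfolding ft_def tt_def sum_distrib_left using c
        by (intro sum.cong refl) (simp add: indicator_def field_simps)
      also have "\<dots> \<le> f y * (2 * (f y / c))"
        using f0[of y] c t0 by (intro mult_left_mono dyadic_sum_le) auto
      also have "\<dots> = 2 / c * (f y)\<^sup>2" by (simp add: power2_eq_square)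
      finally show "(\<Sum>m\<le>N. tt m * ft (tt m) y) \<le> 2 / c * (f y)\<^sup>2" .
    qed (use i2 \<Gamma> in auto)
    also have "\<dots> = (\<Gamma> * 2 / c) * S0" by (simp add: S0_def)
    also have "\<Gamma> * 2 / c = ?C"
    proof -
      have "\<Gamma> * 2 / c = 8 * \<omega>\<^sup>2 * (24 ^ ?n * 4 ^ ?n) / \<gamma>\<^sup>2" unfolding \<Gamma>_def c_def using \<gamma> \<omega> by (simp add: field_simps power2_eq_square)
      also have "24 ^ ?n * 4 ^ ?n = (96::real) ^ ?n" by (simp add: power_mult_distrib[symmetric])
      also have "8 * \<omega>\<^sup>2 * 96 ^ ?n / \<gamma>\<^sup>2 = ?C" unfolding \<gamma>sq using \<omega> \<Lambda> by (simp add: field_simps power2_eq_square)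
      finally show ?thesis .
    qed
    finally have N1: "I2 (St (tt N)) \<le> ?C / real (Suc N) * S0" by (simp add: field_simps)
    have Efin: "emeasure lebesgue E < \<infinity>"
    proof -
      have "emeasure lebesgue E \<le> emeasure lebesgue (ball x0 (R / 2))" by (intro emeasure_mono E ballm)
      then show ?thesis using emeasure_ball_lebesgue[of "R / 2" x0] R by (auto simp: less_top[symmetric] top_unique)
    qed
    have iE: "integrable lebesgue (\<lambda>y. ind E y :: real)" by (rule integrable_real_indicator[OF E(1) Efin])
    \<comment> \<open>Split E at the top level \<open>tt N\<close>: above it the previous bound
      applies, below it f^2 is at most the square of \<open>tt N\<close>.\<close>
    have "I2 E \<le> (LINT y|lebesgue. ind (St (tt N)) y * (f y)\<^sup>2 + (tt N)\<^sup>2 * ind E y)"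
      unfolding I2_def
    proof (rule integral_mono)
      show "integrable lebesgue (\<lambda>y. ind (St (tt N)) y * (f y)\<^sup>2 + (tt N)\<^sup>2 * ind E y)"
        by (intro Bochner_Integration.integrable_add i2S Stm integrable_mult_right iE)
      fix y
      show "ind E y * (f y)\<^sup>2 \<le> ind (St (tt N)) y * (f y)\<^sup>2 + (tt N)\<^sup>2 * ind E y"
      proof (cases "y \<in> E \<and> \<not> tt N < f y")
        case True
        then have "(f y)\<^sup>2 \<le> (tt N)\<^sup>2" using f0[of y] by (intro power_mono) auto
        then show ?thesis using True by (simp add: indicator_def)
      next
        case False
        then show ?thesis using E(2) by (auto simp: indicator_def St_def)
      qed
    qed (rule i2S[OF E(1)])
    also have "\<dots> = I2 (St (tt N)) + (tt N)\<^sup>2 * measure lebesgue E"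
      using i2S[OF Stm] iE E(1) by (simp add: I2_def)
    also have "(tt N)\<^sup>2 = 4 ^ N * (S0 / (\<omega> * \<rho> ^ ?n))"
      unfolding tt_def power_mult_distrib t0sq by (simp add: power_mult[symmetric] mult.commute[of N 2]) (simp add: power_mult)
    finally have fin: "I2 E \<le> I2 (St (tt N)) + 4 ^ N * (S0 / (\<omega> * \<rho> ^ ?n)) * measure lebesgue E" .
    have e: "4 ^ N * measure lebesgue E / (\<omega> * \<rho> ^ ?n) * S0 = 4 ^ N * (S0 / (\<omega> * \<rho> ^ ?n)) * measure lebesgue E" by simp
    show ?thesis unfolding distrib_right e using N1 fin by linarith
  qed
  then show ?thesis unfolding I2_def S0_def \<omega>_def \<rho>_def .
qed

section \<open>Equiintegrability of gradients\<close>

text \<open>Each of the two terms containing p gives up a quarter of a p^2; half of the left-hand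
  side remains, which explains the doubled constants.\<close>

lemma young_bound:
  fixes p q s a b :: real
  assumes a: "0 < a" and h: "a * p\<^sup>2 \<le> 2 * b * (p * q) + s * p + 2 * (s * q)"
  shows "p\<^sup>2 \<le> (8 * b\<^sup>2 / a\<^sup>2 + 2) * q\<^sup>2 + 4 / a\<^sup>2 * s\<^sup>2"
proof -
  have 1: "0 \<le> (p / 2 - 2 * b / a * q)\<^sup>2" and 2: "0 \<le> (p / 2 - s / a)\<^sup>2" and 3: "0 \<le> (s / a - q)\<^sup>2" by simp_all
  have e1: "2 * b * (p * q) = a * (p\<^sup>2 / 4 + 4 * b\<^sup>2 / a\<^sup>2 * q\<^sup>2 - (p / 2 - 2 * b / a * q)\<^sup>2)"
    using a by (simp add: power2_eq_square field_simps)
  have e2: "s * p = a * (p\<^sup>2 / 4 + s\<^sup>2 / a\<^sup>2 - (p / 2 - s / a)\<^sup>2)"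
    using a by (simp add: power2_eq_square field_simps)
  have e3: "2 * (s * q) = a * (s\<^sup>2 / a\<^sup>2 + q\<^sup>2 - (s / a - q)\<^sup>2)"
    using a by (simp add: power2_eq_square field_simps)
  have "a * p\<^sup>2 \<le> a * (p\<^sup>2 / 4 + 4 * b\<^sup>2 / a\<^sup>2 * q\<^sup>2 - (p / 2 - 2 * b / a * q)\<^sup>2 + (p\<^sup>2 / 4 + s\<^sup>2 / a\<^sup>2 - (p / 2 - s / a)\<^sup>2) + (s\<^sup>2 / a\<^sup>2 + q\<^sup>2 - (s / a - q)\<^sup>2))"
    using h unfolding e1 e2 e3 distrib_left .
  then have "p\<^sup>2 \<le> p\<^sup>2 / 4 + 4 * b\<^sup>2 / a\<^sup>2 * q\<^sup>2 - (p / 2 - 2 * b / a * q)\<^sup>2 + (p\<^sup>2 / 4 + s\<^sup>2 / a\<^sup>2 - (p / 2 - s / a)\<^sup>2) + (s\<^sup>2 / a\<^sup>2 + q\<^sup>2 - (s / a - q)\<^sup>2)"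
    using a by (simp only: mult_le_cancel_left_pos)
  moreover have "4 * b\<^sup>2 / a\<^sup>2 * q\<^sup>2 = b\<^sup>2 / a\<^sup>2 * q\<^sup>2 * 4" by simp
  moreover have "(8 * b\<^sup>2 / a\<^sup>2 + 2) * q\<^sup>2 = b\<^sup>2 / a\<^sup>2 * q\<^sup>2 * 8 + q\<^sup>2 * 2" by (simp add: distrib_right)
  moreover have "4 / a\<^sup>2 * s\<^sup>2 = s\<^sup>2 / a\<^sup>2 * 4" by simp
  ultimately show ?thesis using 1 2 3 by argo
qed

lemma ball_restrict_const: "L2 (\<lambda>x. ind (ball (x0::'a::euclidean_space) r) x *\<^sub>R (c::'b::euclidean_space))"
  by (rule L2_indicator) auto

lemma ball_lebesgue[simp]: "ball (x::'a::euclidean_space) r \<in> sets lebesgue"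
  by (intro borel_sets_lebesgue borel_open) auto

text \<open>The equation is tested with \<psi>^2 (v - c) for a cutoff \<psi>. In terms of p, q and s
  below it becomes a quadratic inequality between norms, to which \<open>young_bound\<close>
  applies; c is free and will be a mean value.\<close>

lemma caccioppoli:
  fixes v :: "real^'n \<Rightarrow> real" and x0 :: "real^'n"
  assumes D: "open D" and B: "ell \<alpha> \<beta> D B" and a: "0 < \<alpha>" and w: "W D v g" and G: "L2 G"
    and eq: "\<And>y h. W D y h \<Longrightarrow> aF B g h = (LINT x|lebesgue. G x \<bullet> h x)"
    and r: "0 < r" and sub: "ball x0 (2 * r) \<subseteq> D" and Cb: "\<And>y. norm (grad (bump x0 r) y) \<le> Cb / r"
  shows "(nrm2 (res (ball x0 r) g))\<^sup>2
    \<le> (8 * \<beta>\<^sup>2 / \<alpha>\<^sup>2 + 2) * (Cb / r * nrm2 (res (ball x0 (2 * r)) (\<lambda>x. v x - c)))\<^sup>2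
      + 4 / \<alpha>\<^sup>2 * (nrm2 (res (ball x0 (2 * r)) G))\<^sup>2"
proof -
  let ?\<psi> = "bump x0 r" and ?B = "ball x0 (2 * r)"
  note bp = bump_props[OF r]
  have \<psi>: "Cc_inf D ?\<psi>" by (rule Cc_inf_bump[OF r sub])
  have \<psi>B: "Cc_inf ?B ?\<psi>" by (rule Cc_inf_bump[OF r order_refl])
  have \<psi>2: "Cc_inf D (\<lambda>x. ?\<psi> x * ?\<psi> x)" by (rule Cc_inf_mult(1)[OF \<psi> smooth_bump])
  note L = W_L2[OF w]
  have \<psi>m: "?\<psi> \<in> LM" "grad ?\<psi> \<in> LM" by (rule smooth_lebesgue[OF smooth_bump])+
  have \<psi>1: "\<bar>?\<psi> x\<bar> \<le> 1" for x using bp(1,2)[of x0 x] by simp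
  have Lv: "L2 (\<lambda>x. ind ?B x *\<^sub>R (v x - c))"
    using L2_diff[OF nrm2_restrict_le(1)[OF L(1) ball_lebesgue] ball_restrict_const[of x0 "2 * r" c]] by (simp add: right_diff_distrib)
  define p where "p x = ?\<psi> x *\<^sub>R g x" for x
  define q where "q x = (ind ?B x *\<^sub>R (v x - c)) *\<^sub>R grad ?\<psi> x" for x
  define s where "s x = ?\<psi> x *\<^sub>R G x" for x
  have Lp: "L2 p" unfolding p_def by (rule L2_bdd_mult(1)[OF L(2) \<psi>m(1) \<psi>1])
  have Ls: "L2 s" unfolding s_def by (rule L2_bdd_mult(1)[OF G \<psi>m(1) \<psi>1])
  have Lq: "L2 q" unfolding q_def by (rule L2_bdd_mult_vec(1)[OF Lv \<psi>m(2) Cb])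
  have nq: "nrm2 q \<le> Cb / r * nrm2 (\<lambda>x. ind ?B x *\<^sub>R (v x - c))" unfolding q_def by (rule L2_bdd_mult_vec(2)[OF Lv \<psi>m(2) Cb])
  have qe: "q x = (v x - c) *\<^sub>R grad ?\<psi> x" for x
    using Cc_inf_zero_off[OF \<psi>B, of x] by (cases "x \<in> ?B") (simp_all add: q_def)
  have LP: "L2 (\<lambda>x. ?\<psi> x *\<^sub>R p x)" by (rule L2_bdd_mult(1)[OF Lp \<psi>m(1) \<psi>1])
  have LQ: "L2 (\<lambda>x. ?\<psi> x *\<^sub>R q x)" by (rule L2_bdd_mult(1)[OF Lq \<psi>m(1) \<psi>1])
  \<comment> \<open>Constants do not belong to \<open>W D\<close>, so c is subtracted after
    multiplication by the squared cutoff.\<close>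
  let ?y = "\<lambda>x. ?\<psi> x * ?\<psi> x * v x - c * (?\<psi> x * ?\<psi> x)"
  let ?h = "\<lambda>x. 1 *\<^sub>R (?\<psi> x *\<^sub>R p x) + 2 *\<^sub>R (?\<psi> x *\<^sub>R q x)"
  have wy: "W D ?y ?h"
  proof -
    have g2: "grad (\<lambda>x. ?\<psi> x * ?\<psi> x) x = 2 *\<^sub>R (?\<psi> x *\<^sub>R grad ?\<psi> x)" for x
      unfolding grad_mult[OF smooth_bump smooth_bump] by (rule scaleR_2[symmetric])
    have "W D ?y (\<lambda>x. ((?\<psi> x * ?\<psi> x) *\<^sub>R g x + v x *\<^sub>R grad (\<lambda>x. ?\<psi> x * ?\<psi> x) x) - c *\<^sub>R grad (\<lambda>x. ?\<psi> x * ?\<psi> x) x)"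
      by (rule W_diff[OF W_mult_Cc[OF w \<psi>2] W_scale[OF W_Cc[OF \<psi>2]]])
    moreover have "((?\<psi> x * ?\<psi> x) *\<^sub>R g x + v x *\<^sub>R grad (\<lambda>x. ?\<psi> x * ?\<psi> x) x) - c *\<^sub>R grad (\<lambda>x. ?\<psi> x * ?\<psi> x) x = ?h x" for x
      unfolding g2 qe p_def by (simp add: algebra_simps)
    ultimately show ?thesis by simp
  qed
  have lhs: "aF B g ?h = aF B p p + 2 * aF B p q"
  proof -
    have "aF B g ?h = 1 * aF B g (\<lambda>x. ?\<psi> x *\<^sub>R p x) + 2 * aF B g (\<lambda>x. ?\<psi> x *\<^sub>R q x)" by (rule aF_lin2[OF B LP LQ L(2)])
    moreover have "aF B g (\<lambda>x. ?\<psi> x *\<^sub>R p x) = aF B p p" unfolding p_def by (rule aF_scale_move[OF B])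
    moreover have "aF B g (\<lambda>x. ?\<psi> x *\<^sub>R q x) = aF B p q"
      using aF_scale_move[OF B, of g ?\<psi> q] aF_sym[OF B, of q p] unfolding p_def by simp
    ultimately show ?thesis by simp
  qed
  have rhs: "(LINT x|lebesgue. G x \<bullet> ?h x) = (LINT x|lebesgue. s x \<bullet> p x) + 2 * (LINT x|lebesgue. s x \<bullet> q x)"
  proof -
    have "(LINT x|lebesgue. G x \<bullet> ?h x) = (LINT x|lebesgue. s x \<bullet> p x + 2 * (s x \<bullet> q x))"
      unfolding s_def by (simp add: inner_add_right mult.assoc)
    then show ?thesis using L2_inner_integrable[OF Ls Lp] L2_inner_integrable[OF Ls Lq] by simp
  qed
  have "\<alpha> * (nrm2 p)\<^sup>2 \<le> aF B p p"
  proof -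
    have "W D (\<lambda>x. ?\<psi> x * v x) (\<lambda>x. ?\<psi> x *\<^sub>R g x + v x *\<^sub>R grad ?\<psi> x)" by (rule W_mult_Cc[OF w \<psi>])
    have "\<alpha> * (nrm2 p)\<^sup>2 = (LINT x|lebesgue. \<alpha> * (norm (p x))\<^sup>2)" by (simp add: nrm2_sq)
    also have "\<dots> \<le> (LINT x|lebesgue. (B x *v p x) \<bullet> p x)"
    proof (rule integral_mono_AE)
      show "AE x in lebesgue. \<alpha> * (norm (p x))\<^sup>2 \<le> (B x *v p x) \<bullet> p x"
        using ell_D(5)[OF B]
      proof eventually_elim
        case (elim x)
        show ?case
        proof (cases "x \<in> D")
          case True
          then show ?thesis using elim by blast
        next
          case False
          then have "p x = 0" using Cc_inf_zero_off[OF \<psi>] by (simp add: p_def)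
          then show ?thesis by simp
        qed
      qed
    qed (use L2_int[OF Lp] L2_inner_integrable[OF ell_L2(1)[OF B Lp] Lp] in auto)
    finally show ?thesis by (simp add: aF_def)
  qed
  also have "aF B p p = (LINT x|lebesgue. s x \<bullet> p x) + 2 * (LINT x|lebesgue. s x \<bullet> q x) - 2 * aF B p q"
    using eq[OF wy] unfolding lhs rhs by linarith
  also have "\<dots> \<le> nrm2 s * nrm2 p + 2 * (nrm2 s * nrm2 q) + 2 * (\<beta> * nrm2 p * nrm2 q)"
    using CS_inner[OF Ls Lp] CS_inner[OF Ls Lq] aF_bound[OF B Lp Lq] by linarith
  finally have "\<alpha> * (nrm2 p)\<^sup>2 \<le> 2 * \<beta> * (nrm2 p * nrm2 q) + nrm2 s * nrm2 p + 2 * (nrm2 s * nrm2 q)"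
    by (simp add: mult_ac)
  from young_bound[OF a this]
  have main: "(nrm2 p)\<^sup>2 \<le> (8 * \<beta>\<^sup>2 / \<alpha>\<^sup>2 + 2) * (nrm2 q)\<^sup>2 + 4 / \<alpha>\<^sup>2 * (nrm2 s)\<^sup>2" .
  have "nrm2 (res (ball x0 r) g) \<le> 1 * nrm2 p"
  proof (rule L2_mono(2)[OF _ Lp])
    show "(res (ball x0 r) g) \<in> LM" by (intro L2_meas nrm2_restrict_le(1) L) simp
    show "AE x in lebesgue. norm (ind (ball x0 r) x *\<^sub>R g x) \<le> 1 * norm (p x)"
      using bp(3)[of _ x0] by (intro AE_I2) (simp add: p_def indicator_def dist_norm norm_minus_commute)
  qed simp
  then have "(nrm2 (res (ball x0 r) g))\<^sup>2 \<le> (nrm2 p)\<^sup>2" by (intro power_mono) simp_all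
  moreover have "(nrm2 q)\<^sup>2 \<le> (Cb / r * nrm2 (\<lambda>x. ind ?B x *\<^sub>R (v x - c)))\<^sup>2" using nq by (intro power_mono) simp_all
  moreover have "nrm2 s \<le> 1 * nrm2 (\<lambda>x. ind ?B x *\<^sub>R G x)"
  proof (rule L2_mono(2)[OF L2_meas[OF Ls] nrm2_restrict_le(1)[OF G ball_lebesgue]])
    show "AE x in lebesgue. norm (s x) \<le> 1 * norm (ind ?B x *\<^sub>R G x)"
    proof (rule AE_I2)
      fix x
      show "norm (s x) \<le> 1 * norm (ind ?B x *\<^sub>R G x)"
        using Cc_inf_zero_off[OF \<psi>B, of x] mult_right_mono[OF \<psi>1[of x] norm_ge_zero[of "G x"]]
        by (cases "x \<in> ?B") (simp_all add: s_def)
    qed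
  qed simp
  then have "(nrm2 s)\<^sup>2 \<le> (nrm2 (\<lambda>x. ind ?B x *\<^sub>R G x))\<^sup>2" by (intro power_mono) simp_all
  ultimately show ?thesis
  proof -
    assume 1: "(nrm2 (res (ball x0 r) g))\<^sup>2 \<le> (nrm2 p)\<^sup>2"
      and 2: "(nrm2 q)\<^sup>2 \<le> (Cb / r * nrm2 (\<lambda>x. ind ?B x *\<^sub>R (v x - c)))\<^sup>2"
      and 3: "(nrm2 s)\<^sup>2 \<le> (nrm2 (\<lambda>x. ind ?B x *\<^sub>R G x))\<^sup>2"
    have "(8 * \<beta>\<^sup>2 / \<alpha>\<^sup>2 + 2) * (nrm2 q)\<^sup>2 \<le> (8 * \<beta>\<^sup>2 / \<alpha>\<^sup>2 + 2) * (Cb / r * nrm2 (\<lambda>x. ind ?B x *\<^sub>R (v x - c)))\<^sup>2"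
      using 2 by (intro mult_left_mono) simp_all
    moreover have "4 / \<alpha>\<^sup>2 * (nrm2 s)\<^sup>2 \<le> 4 / \<alpha>\<^sup>2 * (nrm2 (\<lambda>x. ind ?B x *\<^sub>R G x))\<^sup>2"
      using 3 by (intro mult_left_mono) simp_all
    ultimately show ?thesis using 1 main by linarith
  qed
qed

lemma measure_ball_lebesgue:
  "0 \<le> r \<Longrightarrow> measure lebesgue (ball (x::'a::euclidean_space) r) = measure lborel (ball 0 1 :: 'a set) * r ^ DIM('a)"
  using emeasure_ball_lebesgue[of r x] by (simp add: measure_def)

lemma nrm2_restrict_sq: "(nrm2 (res S f))\<^sup>2 = (LINT x|lebesgue. ind S x * (norm (f x))\<^sup>2)"
  unfolding nrm2_sq by (intro Bochner_Integration.integral_cong refl) (simp add: indicator_def)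

text \<open>A solution with right-hand side -div G, where G is bounded on one ball only. The domain,
  the coefficient and the solution remain variable in the estimates below, so their constants depend
  on \<alpha>, \<beta>, the dimension and the prescribed accuracy alone.\<close>

definition local_sol :: "real \<Rightarrow> real \<Rightarrow> (real^'n) set \<Rightarrow> (real^'n \<Rightarrow> real^'n^'n) \<Rightarrow> (real^'n \<Rightarrow> real) \<Rightarrow> (real^'n \<Rightarrow> real^'n)
    \<Rightarrow> real^'n \<Rightarrow> real \<Rightarrow> real \<Rightarrow> bool" where
  "local_sol \<alpha> \<beta> D B v g x0 R M \<longleftrightarrow> open D \<and> ell \<alpha> \<beta> D B \<and> W D v g \<and> 0 < R \<and> ball x0 R \<subseteq> D \<and> 0 \<le> M \<and>
    (\<exists>G. L2 G \<and> (\<forall>y h. W D y h \<longrightarrow> aF B g h = (LINT x|lebesgue. G x \<bullet> h x)) \<and> (AE x in lebesgue. x \<in> ball x0 R \<longrightarrow> norm (G x) \<le> M))"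

text \<open>\<open>caccioppoli\<close> followed by \<open>local_poincare\<close> gives a reverse
  Hoelder inequality with small \<kappa>, and \<open>gehring\<close> applies. For small mass on E,
  first N is taken large and then the measure of E small.\<close>

lemma equiintegrability:
  assumes ab: "0 < \<alpha>" "\<alpha> \<le> \<beta>"
  shows "\<exists>C>0. \<forall>D B v (g::real^'n \<Rightarrow> real^'n) x0 R M E N. local_sol \<alpha> \<beta> D B v g x0 R M \<longrightarrow> E \<in> sets lebesgue \<longrightarrow> E \<subseteq> ball x0 (R / 2) \<longrightarrow>
     (nrm2 (res E g))\<^sup>2 \<le> C * (1 / real (Suc N) + 4 ^ N * measure lebesgue E / R ^ CARD('n))
        * ((nrm2 (res (ball x0 R) g))\<^sup>2 + M\<^sup>2 * R ^ CARD('n))"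
proof -
  let ?n = "CARD('n)"
  define \<omega> where "\<omega> = measure lborel (ball 0 1 :: (real^'n) set)"
  have \<omega>: "0 < \<omega>" unfolding \<omega>_def by (rule content_ball_pos) simp
  obtain Cb where Cb: "Cb > 0 \<and> (\<forall>(x::real^'n) r y. r > 0 \<longrightarrow> norm (grad (bump x r) y) \<le> Cb / r)" using grad_bump_bound by (elim exE)
  define K1 where "K1 = (8 * \<beta>\<^sup>2 / \<alpha>\<^sup>2 + 2) * Cb\<^sup>2"
  define K2 where "K2 = 4 / \<alpha>\<^sup>2"
  have K1: "0 \<le> K1" unfolding K1_def by (intro mult_nonneg_nonneg add_nonneg_nonneg) simp_all
  have K2: "0 \<le> K2" unfolding K2_def by simp
  \<comment> \<open>This makes \<kappa> 24^n equal to K1 / (2 (K1 + 1)), hence at most 1/2 as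
    \<open>gehring\<close> requires.\<close>
  define \<delta> where "\<delta> = sqrt (1 / (16 * 48 ^ ?n * (K1 + 1)))"
  have \<delta>sq: "\<delta>\<^sup>2 = 1 / (16 * 48 ^ ?n * (K1 + 1))" unfolding \<delta>_def using K1 by simp
  have \<delta>0: "0 < \<delta>" unfolding \<delta>_def using K1 by simp
  have \<delta>1: "\<delta> \<le> 1"
  proof -
    have "1 \<le> (48::real) ^ ?n" by simp
    then have "1 \<le> 16 * (48::real) ^ ?n" by linarith
    then have "1 * 1 \<le> (16 * 48 ^ ?n) * (K1 + 1)" using K1 by (intro mult_mono) simp_all
    then have "1 / (16 * 48 ^ ?n * (K1 + 1)) \<le> 1" using divide_le_eq_1_pos[of "16 * 48 ^ ?n * (K1 + 1)" 1] by linarith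
    then show ?thesis unfolding \<delta>_def by simp
  qed
  define \<kappa> where "\<kappa> = 8 * 2 ^ ?n * K1 * \<delta>\<^sup>2"
  have \<kappa>0: "0 \<le> \<kappa>" unfolding \<kappa>_def using K1 by simp
  have \<kappa>1: "\<kappa> * 24 ^ ?n \<le> 1 / 2"
  proof -
    have "2 ^ ?n * 24 ^ ?n = (48::real) ^ ?n" by (simp add: power_mult_distrib[symmetric])
    then have "\<kappa> * 24 ^ ?n = 8 * 48 ^ ?n * K1 * \<delta>\<^sup>2" unfolding \<kappa>_def by (simp add: mult_ac)
    also have "\<dots> = K1 / (2 * (K1 + 1))"
    proof -
      have "8 * Q * K1 * (1 / (16 * Q * (K1 + 1))) = K1 / (2 * (K1 + 1))" if "0 < Q" for Q :: real
        using that K1 by (simp add: divide_simps)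
      from this[of "48 ^ ?n"] show ?thesis unfolding \<delta>sq by (metis zero_less_numeral zero_less_power)
    qed
    also have "\<dots> \<le> 1 / 2" using K1 by (simp add: field_simps)
    finally show ?thesis .
  qed
  define P where "P = (real ?n / \<delta>) ^ ?n * (2 ^ ?n * 4)\<^sup>2"
  have P: "0 \<le> P" unfolding P_def using \<delta>0 by simp
  \<comment> \<open>The total factor of the squared L1 norm: the contribution of
    \<open>local_poincare\<close>, and those of M, which \<open>MJ\<close> expresses by the same
    quantity.\<close>
  define \<Lambda> where "\<Lambda> = 8 * K1 * P + (2 * K2 * 2 ^ ?n + 2) / \<omega>"
  have \<Lambda>: "0 < \<Lambda>" unfolding \<Lambda>_def using K1 K2 P \<omega> by (intro add_nonneg_pos divide_pos_pos) auto
  define C1 where "C1 = 16 * \<omega> * 96 ^ ?n * \<Lambda> + 48 ^ ?n / \<omega>"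
  define C where "C = C1 * (2 + 2 * \<omega>)"
  have C1: "0 < C1" unfolding C1_def using \<omega> \<Lambda> by (intro add_pos_pos mult_pos_pos divide_pos_pos) auto
  have C: "0 < C" unfolding C_def using C1 \<omega> by simp
  show ?thesis
  proof (intro exI[of _ C] conjI C allI impI)
    fix D B v and g :: "real^'n \<Rightarrow> real^'n" and x0 R M E N
    assume sol: "local_sol \<alpha> \<beta> D B v g x0 R M" and E: "E \<in> sets lebesgue" "E \<subseteq> ball x0 (R / 2)"
    then have D: "open D" and B: "ell \<alpha> \<beta> D B" and w: "W D v g" and R: "0 < R" and sub: "ball x0 R \<subseteq> D" and M: "0 \<le> M"
      unfolding local_sol_def by simp_all
    obtain G where G: "L2 G" and eq: "\<forall>y h. W D y h \<longrightarrow> aF B g h = (LINT x|lebesgue. G x \<bullet> h x)"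
      and GM: "AE x in lebesgue. x \<in> ball x0 R \<longrightarrow> norm (G x) \<le> M" using sol unfolding local_sol_def by blast
    note L = W_L2[OF w]
    \<comment> \<open>Adding M to the norm of the gradient absorbs the right-hand side, so that the
      reverse Hoelder inequality is homogeneous in f.\<close>
    define f where "f x = ind (ball x0 R) x * (norm (g x) + M)" for x
    have Lf: "L2 f"
      using L2_add[OF nrm2_restrict_le(1)[OF L2_norm[OF L(2)] ball_lebesgue[of x0 R]] ball_restrict_const[of x0 R M]]
      unfolding f_def by (simp add: distrib_left)
    have f0: "0 \<le> f x" for x unfolding f_def using M by simp
    have ge: "ind S x * (norm (g x))\<^sup>2 \<le> ind S x * (f x)\<^sup>2" if "S \<subseteq> ball x0 R" for S x
    proof (cases "x \<in> S")
      case True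
      then have "x \<in> ball x0 R" using that by blast
      then have "f x = norm (g x) + M" by (simp add: f_def)
      then have "(norm (g x))\<^sup>2 \<le> (f x)\<^sup>2" using M by (intro power_mono) auto
      then show ?thesis using True by simp
    qed simp
    have if2: "integrable lebesgue (\<lambda>x. ind S x * (f x)\<^sup>2)" if "S \<in> sets lebesgue" for S
      using integrable_mult_indicator[OF that L2_int[OF Lf]] by simp
    have ig2: "integrable lebesgue (\<lambda>x. ind S x * (norm (g x))\<^sup>2)" if "S \<in> sets lebesgue" for S
      using integrable_mult_indicator[OF that L2_int[OF L(2)]] by simp
    have iball: "integrable lebesgue (\<lambda>y. ind (ball x r) y :: real)" if "0 < r" for x :: "real^'n" and r
      using emeasure_ball_lebesgue[of r x] that by (intro integrable_real_indicator) simp_all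
    have mball: "measure lebesgue (ball x r) = \<omega> * r ^ ?n" if "0 < r" for x :: "real^'n" and r
      using measure_ball_lebesgue[of r x] that by (simp add: \<omega>_def)
    have RH: "(LINT y|lebesgue. ind (ball x r) y * (f y)\<^sup>2) \<le> \<kappa> * (LINT y|lebesgue. ind (ball x (4 * r)) y * (f y)\<^sup>2)
        + \<Lambda> / r ^ ?n * (LINT y|lebesgue. ind (ball x (4 * r)) y * f y)\<^sup>2"
      if r: "0 < r" and s4: "ball x (4 * r) \<subseteq> ball x0 R" for x r
    proof -
      let ?B = "\<lambda>s. ball x s"
      have s2: "?B (2 * r) \<subseteq> ?B (4 * r)" and s1: "?B r \<subseteq> ?B (4 * r)" using r by (auto simp: subset_iff)
      \<comment> \<open>The mean over the ball of radius 4 r: \<open>caccioppoli\<close> goes from r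
        to 2 r and \<open>local_poincare\<close> from 2 r to 4 r.\<close>
      define c where "c = (LINT y|lebesgue. ind (ball x (2 * (2 * r))) y * v y) / measure lborel (ball x (2 * (2 * r)))"
      define N4 where "N4 = (nrm2 (res (?B (4 * r)) g))\<^sup>2"
      define I4 where "I4 = (LINT y|lebesgue. ind (?B (4 * r)) y * norm (g y))"
      define F4 where "F4 = (LINT y|lebesgue. ind (?B (4 * r)) y * (f y)\<^sup>2)"
      define J4 where "J4 = (LINT y|lebesgue. ind (?B (4 * r)) y * f y)"
      define q where "q = r ^ ?n"
      have q: "0 < q" unfolding q_def using r by simp
      have cac: "(nrm2 (res (?B r) g))\<^sup>2
        \<le> (8 * \<beta>\<^sup>2 / \<alpha>\<^sup>2 + 2) * (Cb / r * nrm2 (res (?B (2 * r)) (\<lambda>y. v y - c)))\<^sup>2 + K2 * (nrm2 (res (?B (2 * r)) G))\<^sup>2"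
        unfolding K2_def
        by (rule caccioppoli[OF D B ab(1) w G _ r]) (use eq s2 s4 sub Cb r in auto)
      have poi: "(nrm2 (res (?B (2 * r)) (\<lambda>y. v y - c)))\<^sup>2 \<le> \<delta>\<^sup>2 * (2 * r)\<^sup>2 * 2 ^ ?n * N4 + P * ((2 * r)\<^sup>2 / (2 * r) ^ ?n) * I4\<^sup>2"
        using local_poincare(1)[OF w, of "2 * r" \<delta> x] r \<delta>0 \<delta>1 unfolding c_def N4_def I4_def P_def by simp
      have "(8 * \<beta>\<^sup>2 / \<alpha>\<^sup>2 + 2) * (Cb / r * nrm2 (res (?B (2 * r)) (\<lambda>y. v y - c)))\<^sup>2
        = K1 / r\<^sup>2 * (nrm2 (res (?B (2 * r)) (\<lambda>y. v y - c)))\<^sup>2"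
        unfolding K1_def by (simp add: power_mult_distrib power_divide)
      also have "\<dots> \<le> K1 / r\<^sup>2 * (\<delta>\<^sup>2 * (2 * r)\<^sup>2 * 2 ^ ?n * N4 + P * ((2 * r)\<^sup>2 / (2 * r) ^ ?n) * I4\<^sup>2)"
        using poi K1 by (intro mult_left_mono) simp_all
      also have "\<dots> = 4 * 2 ^ ?n * K1 * \<delta>\<^sup>2 * N4 + 4 * K1 * P / 2 ^ ?n / q * I4\<^sup>2"
        using r by (simp add: q_def power_mult_distrib field_simps)
      also have "4 * K1 * P / 2 ^ ?n / q * I4\<^sup>2 \<le> 4 * K1 * P / q * I4\<^sup>2"
      proof -
        have "4 * K1 * P / 2 ^ ?n \<le> 4 * K1 * P / 1" using K1 P by (intro divide_left_mono) auto
        then show ?thesis using q by (intro mult_right_mono divide_right_mono) auto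
      qed
      finally have t1: "(8 * \<beta>\<^sup>2 / \<alpha>\<^sup>2 + 2) * (Cb / r * nrm2 (res (?B (2 * r)) (\<lambda>y. v y - c)))\<^sup>2
        \<le> 4 * 2 ^ ?n * K1 * \<delta>\<^sup>2 * N4 + 4 * K1 * P / q * I4\<^sup>2" by simp
      have t2: "(nrm2 (res (?B (2 * r)) G))\<^sup>2 \<le> M\<^sup>2 * (\<omega> * 2 ^ ?n * q)"
      proof -
        have "(nrm2 (res (?B (2 * r)) G))\<^sup>2 = (LINT y|lebesgue. ind (?B (2 * r)) y * (norm (G y))\<^sup>2)" by (rule nrm2_restrict_sq)
        also have "\<dots> \<le> (LINT y|lebesgue. M\<^sup>2 * ind (?B (2 * r)) y)"
        proof (rule integral_mono_AE)
          show "integrable lebesgue (\<lambda>y. ind (?B (2 * r)) y * (norm (G y))\<^sup>2)"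
            using integrable_mult_indicator[OF ball_lebesgue L2_int[OF G], of x "2 * r"] by simp
          show "integrable lebesgue (\<lambda>y. M\<^sup>2 * ind (?B (2 * r)) y)" using iball[of "2 * r" x] r by simp
          show "AE y in lebesgue. ind (?B (2 * r)) y * (norm (G y))\<^sup>2 \<le> M\<^sup>2 * ind (?B (2 * r)) y"
            using GM
          proof eventually_elim
            case (elim y)
            show ?case
            proof (cases "y \<in> ?B (2 * r)")
              case True
              then have "norm (G y) \<le> M" using elim s2 s4 by blast
              then have "(norm (G y))\<^sup>2 \<le> M\<^sup>2" by (intro power_mono) simp_all
              then show ?thesis using True by simp
            qed simp
          qed
        qed
        also have "\<dots> = M\<^sup>2 * (\<omega> * 2 ^ ?n * q)" using mball[of "2 * r" x] r by (simp add: q_def power_mult_distrib)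
        finally show ?thesis .
      qed
      have N4F: "N4 \<le> F4" unfolding N4_def F4_def nrm2_restrict_sq by (intro integral_mono ig2 if2 ge s4) simp_all
      have intf: "integrable lebesgue (\<lambda>y. ind (?B (4 * r)) y * f y)"
        using L2_mult_integrable_real[OF ball_restrict_const[of x "4 * r" "1::real"] Lf] by simp
      have intg: "integrable lebesgue (\<lambda>y. ind (?B (4 * r)) y * norm (g y))"
        using L2_mult_integrable_real[OF ball_restrict_const[of x "4 * r" "1::real"] L2_norm[OF L(2)]] by simp
      have fe: "ind (?B (4 * r)) y * f y = ind (?B (4 * r)) y * norm (g y) + M * ind (?B (4 * r)) y" for y
      proof (cases "y \<in> ?B (4 * r)")
        case True
        then have "y \<in> ball x0 R" using s4 by blast
        then show ?thesis using True by (simp add: f_def)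
      qed simp
      have Je: "J4 = I4 + M * (\<omega> * 4 ^ ?n * q)"
        unfolding J4_def I4_def fe using intg iball[of "4 * r" x] mball[of "4 * r" x] r by (simp add: q_def power_mult_distrib)
      have I40: "0 \<le> I4" unfolding I4_def by (intro integral_nonneg_AE) simp
      have IJ: "I4\<^sup>2 \<le> J4\<^sup>2" using Je I40 M \<omega> q by (intro power_mono) simp_all
      have MJ: "M\<^sup>2 * \<omega> * q \<le> 1 / \<omega> / q * J4\<^sup>2"
      proof -
        have "M * (\<omega> * q) \<le> M * (\<omega> * 4 ^ ?n * q)" using M \<omega> q by (intro mult_left_mono mult_right_mono) simp_all
        then have "M * (\<omega> * q) \<le> J4" using Je I40 by linarith
        then have "(M * (\<omega> * q))\<^sup>2 \<le> J4\<^sup>2" using M \<omega> q by (intro power_mono) simp_all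
        then have "1 / \<omega> / q * (M * (\<omega> * q))\<^sup>2 \<le> 1 / \<omega> / q * J4\<^sup>2" using \<omega> q by (intro mult_left_mono) simp_all
        moreover have "1 / \<omega> / q * (M * (\<omega> * q))\<^sup>2 = M\<^sup>2 * \<omega> * q" using \<omega> q by (simp add: power2_eq_square)
        ultimately show ?thesis by simp
      qed
      have "(LINT y|lebesgue. ind (?B r) y * (f y)\<^sup>2) \<le> (LINT y|lebesgue. 2 * (ind (?B r) y * (norm (g y))\<^sup>2) + 2 * M\<^sup>2 * ind (?B r) y)"
      proof (rule integral_mono)
        show "integrable lebesgue (\<lambda>y. 2 * (ind (?B r) y * (norm (g y))\<^sup>2) + 2 * M\<^sup>2 * ind (?B r) y)"
          by (intro Bochner_Integration.integrable_add integrable_mult_right ig2 iball r) simp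
        fix y
        show "ind (?B r) y * (f y)\<^sup>2 \<le> 2 * (ind (?B r) y * (norm (g y))\<^sup>2) + 2 * M\<^sup>2 * ind (?B r) y"
        proof (cases "y \<in> ?B r")
          case True
          then have "y \<in> ball x0 R" using s1 s4 by blast
          then have "f y = norm (g y) + M" by (simp add: f_def)
          then have "(f y)\<^sup>2 \<le> 2 * (norm (g y))\<^sup>2 + 2 * M\<^sup>2" using norm_add_sq_le[of "norm (g y)" M] M by simp
          then show ?thesis using True by simp
        qed simp
      qed (simp add: if2)
      also have "\<dots> = 2 * (nrm2 (res (?B r) g))\<^sup>2 + 2 * M\<^sup>2 * (\<omega> * q)"
        unfolding nrm2_restrict_sq using ig2[of "?B r"] iball[OF r, of x] mball[OF r, of x] by (simp add: q_def)
      finally have F1: "(LINT y|lebesgue. ind (?B r) y * (f y)\<^sup>2) \<le> 2 * (nrm2 (res (?B r) g))\<^sup>2 + 2 * M\<^sup>2 * (\<omega> * q)" .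
      have K2t: "K2 * (nrm2 (res (?B (2 * r)) G))\<^sup>2 \<le> K2 * (M\<^sup>2 * (\<omega> * 2 ^ ?n * q))" by (rule mult_left_mono[OF t2 K2])
      have F2: "(nrm2 (res (?B r) g))\<^sup>2 \<le> 4 * 2 ^ ?n * K1 * \<delta>\<^sup>2 * N4 + 4 * K1 * P / q * I4\<^sup>2 + K2 * (M\<^sup>2 * (\<omega> * 2 ^ ?n * q))"
        using cac t1 K2t by linarith
      have "4 * 2 ^ ?n * K1 * \<delta>\<^sup>2 * N4 \<le> 4 * 2 ^ ?n * K1 * \<delta>\<^sup>2 * F4" using N4F K1 by (intro mult_left_mono) simp_all
      moreover have "4 * K1 * P / q * I4\<^sup>2 \<le> 4 * K1 * P / q * J4\<^sup>2" using IJ K1 P q by (intro mult_left_mono) simp_all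
      moreover have "2 * (4 * 2 ^ ?n * K1 * \<delta>\<^sup>2 * F4) = \<kappa> * F4" by (simp add: \<kappa>_def)
      moreover have "(2 * K2 * 2 ^ ?n + 2) * (M\<^sup>2 * \<omega> * q) \<le> (2 * K2 * 2 ^ ?n + 2) * (1 / \<omega> / q * J4\<^sup>2)"
        using MJ K2 by (intro mult_left_mono) simp_all
      moreover have "(2 * K2 * 2 ^ ?n + 2) * (M\<^sup>2 * \<omega> * q) = 2 * (K2 * (M\<^sup>2 * (\<omega> * 2 ^ ?n * q))) + 2 * M\<^sup>2 * (\<omega> * q)"
        by (simp add: distrib_right)
      moreover have "\<Lambda> / q * J4\<^sup>2 = 2 * (4 * K1 * P / q * J4\<^sup>2) + (2 * K2 * 2 ^ ?n + 2) * (1 / \<omega> / q * J4\<^sup>2)"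
        unfolding \<Lambda>_def by (simp add: add_divide_distrib distrib_right)
      ultimately have "(LINT y|lebesgue. ind (?B r) y * (f y)\<^sup>2) \<le> \<kappa> * F4 + \<Lambda> / q * J4\<^sup>2"
        using F1 F2 by linarith
      then show ?thesis unfolding F4_def J4_def q_def .
    qed
    let ?F = "LINT y|lebesgue. (f y)\<^sup>2"
    have F0: "0 \<le> ?F" by (intro integral_nonneg_AE) simp
    have ge1: "(LINT y|lebesgue. ind E y * (f y)\<^sup>2) \<le> (16 * \<omega> * 96 ^ ?n * \<Lambda> / real (Suc N) + 4 ^ N * measure lebesgue E / (\<omega> * (R / 48) ^ ?n)) * ?F"
      using gehring[OF Lf f0 _ R \<Lambda> \<kappa>0 _ _ E, of N] \<kappa>1 RH unfolding \<omega>_def by (simp add: f_def)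
    have EB: "E \<subseteq> ball x0 R" using E(2) R by (auto simp: subset_iff)
    have "(nrm2 (res E g))\<^sup>2 \<le> (LINT y|lebesgue. ind E y * (f y)\<^sup>2)"
      unfolding nrm2_restrict_sq by (intro integral_mono ig2 if2 ge EB E(1))
    also note ge1
    also have "(16 * \<omega> * 96 ^ ?n * \<Lambda> / real (Suc N) + 4 ^ N * measure lebesgue E / (\<omega> * (R / 48) ^ ?n)) * ?F
      \<le> (C1 * (1 / real (Suc N) + 4 ^ N * measure lebesgue E / R ^ ?n)) * ?F"
    proof (rule mult_right_mono[OF _ F0])
      have a1: "16 * \<omega> * 96 ^ ?n * \<Lambda> / real (Suc N) \<le> C1 / real (Suc N)" unfolding C1_def using \<omega> by (intro divide_right_mono) simp_all
      have "4 ^ N * measure lebesgue E / (\<omega> * (R / 48) ^ ?n) = 48 ^ ?n / \<omega> * (4 ^ N * measure lebesgue E / R ^ ?n)"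
        by (simp add: power_divide)
      also have "\<dots> \<le> C1 * (4 ^ N * measure lebesgue E / R ^ ?n)"
        unfolding C1_def using \<omega> \<Lambda> R by (intro mult_right_mono) simp_all
      finally show "16 * \<omega> * 96 ^ ?n * \<Lambda> / real (Suc N) + 4 ^ N * measure lebesgue E / (\<omega> * (R / 48) ^ ?n)
        \<le> C1 * (1 / real (Suc N) + 4 ^ N * measure lebesgue E / R ^ ?n)" using a1 by (simp add: distrib_left)
    qed
    also have "\<dots> \<le> (C1 * (1 / real (Suc N) + 4 ^ N * measure lebesgue E / R ^ ?n)) * ((2 + 2 * \<omega>) * ((nrm2 (res (ball x0 R) g))\<^sup>2 + M\<^sup>2 * R ^ ?n))"
    proof (rule mult_left_mono)
      have "?F \<le> (LINT y|lebesgue. 2 * (ind (ball x0 R) y * (norm (g y))\<^sup>2) + 2 * M\<^sup>2 * ind (ball x0 R) y)"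
      proof (rule integral_mono)
        show "integrable lebesgue (\<lambda>y. 2 * (ind (ball x0 R) y * (norm (g y))\<^sup>2) + 2 * M\<^sup>2 * ind (ball x0 R) y)"
          by (intro Bochner_Integration.integrable_add integrable_mult_right ig2 iball R) simp
        show "(f y)\<^sup>2 \<le> 2 * (ind (ball x0 R) y * (norm (g y))\<^sup>2) + 2 * M\<^sup>2 * ind (ball x0 R) y" for y
          using norm_add_sq_le[of "norm (g y)" M] M by (cases "y \<in> ball x0 R") (simp_all add: f_def)
      qed (use L2_int[OF Lf] in simp)
      also have "\<dots> = 2 * (nrm2 (res (ball x0 R) g))\<^sup>2 + 2 * M\<^sup>2 * (\<omega> * R ^ ?n)"
        unfolding nrm2_restrict_sq using ig2[of "ball x0 R"] iball[OF R, of x0] mball[OF R, of x0] by simp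
      also have "\<dots> \<le> (2 + 2 * \<omega>) * ((nrm2 (res (ball x0 R) g))\<^sup>2 + M\<^sup>2 * R ^ ?n)"
        using \<omega> R by (simp add: distrib_left distrib_right mult_ac)
      finally show "?F \<le> (2 + 2 * \<omega>) * ((nrm2 (res (ball x0 R) g))\<^sup>2 + M\<^sup>2 * R ^ ?n)" .
      show "0 \<le> C1 * (1 / real (Suc N) + 4 ^ N * measure lebesgue E / R ^ ?n)" using C1 R by simp
    qed
    finally show "(nrm2 (res E g))\<^sup>2 \<le> C * (1 / real (Suc N) + 4 ^ N * measure lebesgue E / R ^ CARD('n))
        * ((nrm2 (res (ball x0 R) g))\<^sup>2 + M\<^sup>2 * R ^ CARD('n))"
      unfolding C_def by (simp add: mult_ac)
  qed
qed

section \<open>Comparison of G-limits\<close>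

lemma norm_matrix_vector_le: "norm ((M::real^'n^'m) *v x) \<le> norm M * norm x"
proof -
  have "norm (M *v x) = L2_set (\<lambda>i. norm ((M *v x) $ i)) UNIV" by (simp add: norm_vec_def)
  also have "\<dots> \<le> L2_set (\<lambda>i. norm (M $ i) * norm x) UNIV"
  proof (rule L2_set_mono)
    show "norm ((M *v x) $ i) \<le> norm (M $ i) * norm x" for i
      using Cauchy_Schwarz_ineq2[of "M $ i" x] by (simp add: matrix_vector_mul_component)
  qed simp
  also have "\<dots> = norm M * norm x" by (simp add: norm_vec_def L2_set_left_distrib)
  finally show ?thesis .
qed

lemma norm_matrix_entries_le:
  fixes M :: "real^'n^'m"
  assumes e: "\<And>i j. \<bar>M $ i $ j\<bar> \<le> b"
  shows "norm M \<le> real CARD('m) * (real CARD('n) * b)"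
proof -
  have "norm M \<le> (\<Sum>i\<in>UNIV. norm (M $ i))"
    unfolding norm_vec_def[of M] by (rule L2_set_le_sum) simp
  also have "\<dots> \<le> (\<Sum>i\<in>(UNIV::'m set). real CARD('n) * b)"
  proof (rule sum_mono)
    fix i
    have "norm (M $ i) \<le> (\<Sum>j\<in>UNIV. \<bar>M $ i $ j\<bar>)" by (rule norm_le_l1_cart)
    also have "\<dots> \<le> (\<Sum>j\<in>(UNIV::'n set). b)" by (intro sum_mono e)
    finally show "norm (M $ i) \<le> real CARD('n) * b" by simp
  qed
  finally show ?thesis by simp
qed

lemma norm_matrix_le:
  fixes M :: "real^'n^'n"
  assumes "\<And>\<xi>. norm (M *v \<xi>) \<le> b * norm \<xi>"
  shows "norm M \<le> real CARD('n) * (real CARD('n) * b)"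
proof (rule norm_matrix_entries_le)
  show "\<bar>M $ i $ j\<bar> \<le> b" for i j
    using component_le_norm_cart[of "M *v axis j 1" i] assms[of "axis j 1"] by (simp add: matrix_vector_mult_basis column_def)
qed

lemma ell_diff_bounds:
  fixes D :: "(real^'n) set"
  assumes "ell \<alpha> \<beta> D B" "ell \<alpha> \<beta> D B'"
  shows "norm ((B x - B' x) *v \<xi>) \<le> 2 * \<beta> * norm \<xi>" "norm (B x - B' x) \<le> real CARD('n) * (real CARD('n) * (2 * \<beta>))"
    "(\<lambda>x. norm (B x - B' x)) \<in> LM"
proof -
  show *: "norm ((B x - B' x) *v \<xi>) \<le> 2 * \<beta> * norm \<xi>" for \<xi>
    using norm_triangle_ineq4[of "B x *v \<xi>" "B' x *v \<xi>"] ell_D(3)[OF assms(1), of x \<xi>] ell_D(3)[OF assms(2), of x \<xi>]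
    by (simp add: matrix_vector_mult_diff_rdistrib)
  show "norm (B x - B' x) \<le> real CARD('n) * (real CARD('n) * (2 * \<beta>))" by (rule norm_matrix_le[OF *])
  show "(\<lambda>x. norm (B x - B' x)) \<in> LM"
    using ell_D(1)[OF assms(1)] ell_D(1)[OF assms(2)] by simp
qed

lemma ell_diff_L2:
  fixes D :: "(real^'n) set"
  assumes "ell \<alpha> \<beta> D B" "ell \<alpha> \<beta> D B'" "L2 g"
  shows "L2 (\<lambda>x. (B x - B' x) *v g x)" "nrm2 (\<lambda>x. (B x - B' x) *v g x) \<le> 2 * \<beta> * nrm2 g"
proof -
  have m: "(\<lambda>x. (B x - B' x) *v g x) \<in> LM"
    using mult_vec_measurable[of "\<lambda>x. B x - B' x" g] ell_D(1)[OF assms(1)] ell_D(1)[OF assms(2)] L2_meas[OF assms(3)] by simp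
  have "0 \<le> 2 * \<beta>" using ell_beta_nonneg[OF assms(1)] by simp
  then show "L2 (\<lambda>x. (B x - B' x) *v g x)" "nrm2 (\<lambda>x. (B x - B' x) *v g x) \<le> 2 * \<beta> * nrm2 g"
    using L2_mono[OF m assms(3), of "2 * \<beta>"] ell_diff_bounds(1)[OF assms(1,2)] by simp_all
qed

lemma ell_diff_integrable:
  fixes D :: "(real^'n) set"
  assumes "ell \<alpha> \<beta> D B" "ell \<alpha> \<beta> D B'" "S \<in> sets lebesgue" "bounded S"
  shows "integrable lebesgue (\<lambda>y. ind S y * norm (B y - B' y))"
proof (rule finite_measure_support_integrable[OF _ _ assms(4)])
  show "(\<lambda>y. ind S y * norm (B y - B' y)) \<in> LM"
    using assms(3) ell_diff_bounds(3)[OF assms(1,2)] by (intro borel_measurable_times) simp_all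
  show "norm (ind S y * norm (B y - B' y)) \<le> real CARD('n) * (real CARD('n) * (2 * \<beta>))" for y
    using ell_diff_bounds(2)[OF assms(1,2), of y] order_trans[OF norm_ge_zero ell_diff_bounds(2)[OF assms(1,2), of y]]
    by (cases "y \<in> S") simp_all
qed simp

text \<open>Split the ball at the level t of the norm of \<open>B' x - B x\<close>. Below t the
  product is small by itself. The set above t has small measure by Chebyshev's inequality, the
  coefficients are bounded there, and equiintegrability makes the gradient small on it.\<close>

lemma small_product:
  assumes ab: "0 < \<alpha>" "\<alpha> \<le> \<beta>" and e: "0 < \<epsilon>"
  shows "\<exists>\<delta>>0. \<forall>D B B' v (g::real^'n \<Rightarrow> real^'n) x0 R M. local_sol \<alpha> \<beta> D B v g x0 (2 * R) M \<longrightarrow> ell \<alpha> \<beta> D B' \<longrightarrow>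
     (LINT y|lebesgue. ind (ball x0 R) y * norm (B' y - B y)) \<le> \<delta> * R ^ CARD('n) \<longrightarrow>
     (nrm2 (res (ball x0 R) (\<lambda>x. (B' x - B x) *v g x)))\<^sup>2 \<le> \<epsilon> * ((nrm2 g)\<^sup>2 + M\<^sup>2 * R ^ CARD('n))"
proof -
  let ?n = "CARD('n)"
  have b: "0 < \<beta>" using ab by simp
  obtain C where C: "0 < C \<and> (\<forall>D B v (g::real^'n \<Rightarrow> real^'n) x0 R M E N. local_sol \<alpha> \<beta> D B v g x0 R M \<longrightarrow> E \<in> sets lebesgue \<longrightarrow> E \<subseteq> ball x0 (R / 2) \<longrightarrow>
     (nrm2 (res E g))\<^sup>2 \<le> C * (1 / real (Suc N) + 4 ^ N * measure lebesgue E / R ^ CARD('n))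
        * ((nrm2 (res (ball x0 R) g))\<^sup>2 + M\<^sup>2 * R ^ CARD('n)))"
    using equiintegrability[OF ab, where 'n='n] by (elim exE)
  \<comment> \<open>Solves 4 \<beta>^2 C q 2^n = \<epsilon> / 2, the share of the set where the
    coefficients differ much.\<close>
  define q where "q = \<epsilon> / (8 * \<beta>\<^sup>2 * C * 2 ^ ?n)"
  have q: "0 < q" unfolding q_def using e b C by simp
  obtain N where N: "1 / real (Suc N) < q / 2" using q reals_Archimedean[of "q / 2"] by (auto simp: inverse_eq_divide)
  define t where "t = sqrt (\<epsilon> / 2)"
  have t: "0 < t" "t\<^sup>2 = \<epsilon> / 2" unfolding t_def using e by simp_all
  \<comment> \<open>By Chebyshev the set above level t has measure at most \<delta> R^n / t; this
    \<delta> brings the measure term of \<open>equiintegrability\<close>, taken for radius 2 R, down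
    to q / 2.\<close>
  define \<delta> where "\<delta> = t * (q / 2 * 2 ^ ?n / 4 ^ N)"
  have \<delta>: "0 < \<delta>" unfolding \<delta>_def using t q by simp
  show ?thesis
  proof (intro exI[of _ \<delta>] conjI \<delta> allI impI)
    fix D B B' v and g :: "real^'n \<Rightarrow> real^'n" and x0 R M
    assume sol: "local_sol \<alpha> \<beta> D B v g x0 (2 * R) M" and B': "ell \<alpha> \<beta> D B'"
      and sm: "(LINT y|lebesgue. ind (ball x0 R) y * norm (B' y - B y)) \<le> \<delta> * R ^ CARD('n)"
    then have B: "ell \<alpha> \<beta> D B" and w: "W D v g" and R: "0 < R" unfolding local_sol_def by simp_all
    note L = W_L2(2)[OF w]
    define E where "E = ball x0 R \<inter> {y. t < norm (B' y - B y)}"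
    have mE: "E \<in> sets lebesgue"
    proof -
      have "{y \<in> space lebesgue. t < norm (B' y - B y)} \<in> sets lebesgue"
        using ell_diff_bounds(3)[OF B' B] by (intro borel_measurable_less borel_measurable_const)
      then show ?thesis unfolding E_def by (intro sets.Int ball_lebesgue) simp
    qed
    have Eb: "bounded E" unfolding E_def by (rule bounded_subset[OF bounded_ball]) blast
    have meas: "t * measure lebesgue E \<le> \<delta> * R ^ ?n"
    proof -
      have fin: "emeasure lebesgue E < \<infinity>"
      proof -
        have "emeasure lebesgue E \<le> emeasure lebesgue (ball x0 R)" unfolding E_def by (rule emeasure_mono) auto
        also have "\<dots> < \<infinity>" using emeasure_ball_lebesgue[of R x0] R by simp
        finally show ?thesis .
      qed
      have "t * measure lebesgue E = (LINT y|lebesgue. t * ind E y)" using mE by simp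
      also have "\<dots> \<le> (LINT y|lebesgue. ind (ball x0 R) y * norm (B' y - B y))"
      proof (rule integral_mono)
        show "integrable lebesgue (\<lambda>y. t * ind E y)" using integrable_real_indicator[OF mE fin] by simp
        show "integrable lebesgue (\<lambda>y. ind (ball x0 R) y * norm (B' y - B y))"
          by (rule ell_diff_integrable[OF B' B ball_lebesgue bounded_ball])
        show "t * ind E y \<le> ind (ball x0 R) y * norm (B' y - B y)" for y
          by (cases "y \<in> E") (simp_all add: E_def)
      qed
      finally show ?thesis using sm by linarith
    qed
    have mq: "4 ^ N * measure lebesgue E / (2 * R) ^ ?n \<le> q / 2"
    proof -
      have "t * measure lebesgue E \<le> t * (q / 2 * 2 ^ ?n / 4 ^ N * R ^ ?n)" using meas unfolding \<delta>_def by (simp add: mult_ac)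
      then have "measure lebesgue E \<le> q / 2 * 2 ^ ?n / 4 ^ N * R ^ ?n" using t by (simp only: mult_le_cancel_left_pos)
      then have "4 ^ N * measure lebesgue E \<le> 4 ^ N * (q / 2 * 2 ^ ?n / 4 ^ N * R ^ ?n)" by (rule mult_left_mono) simp
      also have "\<dots> = q / 2 * (2 * R) ^ ?n" by (simp add: power_mult_distrib)
      finally show ?thesis using R by (simp add: divide_simps)
    qed
    have X0: "(nrm2 (res (ball x0 (2 * R)) g))\<^sup>2 \<le> (nrm2 g)\<^sup>2"
      using nrm2_restrict_le(2)[OF L ball_lebesgue] by (rule power_mono) simp
    have "(nrm2 (res E g))\<^sup>2 \<le> C * (1 / real (Suc N) + 4 ^ N * measure lebesgue E / (2 * R) ^ ?n)
        * ((nrm2 (res (ball x0 (2 * R)) g))\<^sup>2 + M\<^sup>2 * (2 * R) ^ ?n)"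
      by (rule C[THEN conjunct2, rule_format, OF sol mE]) (simp add: E_def)
    also have "\<dots> \<le> (C * q) * (2 ^ ?n * ((nrm2 g)\<^sup>2 + M\<^sup>2 * R ^ ?n))"
    proof (rule mult_mono)
      show "C * (1 / real (Suc N) + 4 ^ N * measure lebesgue E / (2 * R) ^ ?n) \<le> C * q"
        using mq N C by (intro mult_left_mono) linarith+
      have "1 * (nrm2 g)\<^sup>2 \<le> 2 ^ ?n * (nrm2 g)\<^sup>2" by (rule mult_right_mono) simp_all
      then show "(nrm2 (res (ball x0 (2 * R)) g))\<^sup>2 + M\<^sup>2 * (2 * R) ^ ?n \<le> 2 ^ ?n * ((nrm2 g)\<^sup>2 + M\<^sup>2 * R ^ ?n)"
        using X0 mult.left_commute[of "M\<^sup>2" "2 ^ ?n" "R ^ ?n"] unfolding distrib_left power_mult_distrib by linarith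
      show "0 \<le> C * q" using C q by simp
      show "0 \<le> (nrm2 (res (ball x0 (2 * R)) g))\<^sup>2 + M\<^sup>2 * (2 * R) ^ ?n" using R by simp
    qed
    finally have E1: "4 * \<beta>\<^sup>2 * (nrm2 (res E g))\<^sup>2 \<le> 4 * \<beta>\<^sup>2 * ((C * q) * (2 ^ ?n * ((nrm2 g)\<^sup>2 + M\<^sup>2 * R ^ ?n)))"
      by (rule mult_left_mono) simp
    have E2: "4 * \<beta>\<^sup>2 * ((C * q) * (2 ^ ?n * ((nrm2 g)\<^sup>2 + M\<^sup>2 * R ^ ?n))) = \<epsilon> / 2 * ((nrm2 g)\<^sup>2 + M\<^sup>2 * R ^ ?n)"
    proof -
      have "4 * \<beta>\<^sup>2 * ((C * q) * (2 ^ ?n * X)) = \<epsilon> / 2 * X" for X unfolding q_def using C b by (simp add: field_simps)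
      then show ?thesis .
    qed
    have "(nrm2 (res (ball x0 R) (\<lambda>x. (B' x - B x) *v g x)))\<^sup>2
      \<le> (LINT x|lebesgue. 4 * \<beta>\<^sup>2 * (ind E x * (norm (g x))\<^sup>2) + t\<^sup>2 * (norm (g x))\<^sup>2)"
      unfolding nrm2_restrict_sq
    proof (rule integral_mono)
      show "integrable lebesgue (\<lambda>x. ind (ball x0 R) x * (norm ((B' x - B x) *v g x))\<^sup>2)"
        using integrable_mult_indicator[OF ball_lebesgue L2_int[OF ell_diff_L2(1)[OF B' B L]], of x0 R] by simp
      show "integrable lebesgue (\<lambda>x. 4 * \<beta>\<^sup>2 * (ind E x * (norm (g x))\<^sup>2) + t\<^sup>2 * (norm (g x))\<^sup>2)"
        using integrable_mult_indicator[OF mE L2_int[OF L]] L2_int[OF L] by simp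
      fix x
      show "ind (ball x0 R) x * (norm ((B' x - B x) *v g x))\<^sup>2 \<le> 4 * \<beta>\<^sup>2 * (ind E x * (norm (g x))\<^sup>2) + t\<^sup>2 * (norm (g x))\<^sup>2"
      proof (cases "x \<in> ball x0 R")
        case True
        show ?thesis
        proof (cases "x \<in> E")
          case E: True
          have "(norm ((B' x - B x) *v g x))\<^sup>2 \<le> (2 * \<beta> * norm (g x))\<^sup>2" by (intro power_mono ell_diff_bounds(1)[OF B' B]) simp
          then show ?thesis using True E by (simp add: power_mult_distrib add_increasing2)
        next
          case False
          then have "norm (B' x - B x) \<le> t" using True by (simp add: E_def)
          then have "norm (B' x - B x) * norm (g x) \<le> t * norm (g x)" by (rule mult_right_mono) simp
          then have "norm ((B' x - B x) *v g x) \<le> t * norm (g x)" using norm_matrix_vector_le[of "B' x - B x" "g x"] by linarith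
          then have "(norm ((B' x - B x) *v g x))\<^sup>2 \<le> (t * norm (g x))\<^sup>2" by (intro power_mono) simp_all
          then show ?thesis using True False by (simp add: power_mult_distrib)
        qed
      qed simp
    qed
    also have "\<dots> = 4 * \<beta>\<^sup>2 * (nrm2 (res E g))\<^sup>2 + \<epsilon> / 2 * (nrm2 g)\<^sup>2"
      unfolding nrm2_restrict_sq nrm2_sq[of g] t(2) using integrable_mult_indicator[OF mE L2_int[OF L]] L2_int[OF L] by simp
    also have "\<dots> \<le> \<epsilon> / 2 * ((nrm2 g)\<^sup>2 + M\<^sup>2 * R ^ ?n) + \<epsilon> / 2 * ((nrm2 g)\<^sup>2 + M\<^sup>2 * R ^ ?n)"
    proof (rule add_mono)
      show "4 * \<beta>\<^sup>2 * (nrm2 (res E g))\<^sup>2 \<le> \<epsilon> / 2 * ((nrm2 g)\<^sup>2 + M\<^sup>2 * R ^ ?n)" using E1 unfolding E2 .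
      show "\<epsilon> / 2 * (nrm2 g)\<^sup>2 \<le> \<epsilon> / 2 * ((nrm2 g)\<^sup>2 + M\<^sup>2 * R ^ ?n)" using e R by (intro mult_left_mono) simp_all
    qed
    finally show "(nrm2 (res (ball x0 R) (\<lambda>x. (B' x - B x) *v g x)))\<^sup>2 \<le> \<epsilon> * ((nrm2 g)\<^sup>2 + M\<^sup>2 * R ^ CARD('n))"
      by (simp add: mult.assoc)
  qed
qed

text \<open>A bump times the linear function with slope a that vanishes at the centre: its size, at
  most 2 r times the norm of a, compensates the 1 / r in the gradient of the bump, so the energy
  scales like r^n.\<close>

lemma cut_linear_function:
  "\<exists>K\<ge>0. \<forall>(x0::real^'n) r a D. 0 < r \<longrightarrow> ball x0 (2 * r) \<subseteq> D \<longrightarrow>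
     (\<exists>w. Cc_inf D w \<and> (\<forall>x\<in>ball x0 r. grad w x = a) \<and> (nrm2 (grad w))\<^sup>2 \<le> K * (norm a)\<^sup>2 * r ^ CARD('n))"
proof -
  let ?n = "CARD('n)"
  obtain Cb where Cb: "Cb > 0 \<and> (\<forall>(x::real^'n) r y. r > 0 \<longrightarrow> norm (grad (bump x r) y) \<le> Cb / r)" using grad_bump_bound by (elim exE)
  define \<omega> where "\<omega> = measure lborel (ball 0 1 :: (real^'n) set)"
  have \<omega>: "0 \<le> \<omega>" unfolding \<omega>_def by simp
  show ?thesis
  proof (intro exI[of _ "(1 + 2 * Cb)\<^sup>2 * (\<omega> * 2 ^ ?n)"] conjI allI impI)
    show "0 \<le> (1 + 2 * Cb)\<^sup>2 * (\<omega> * 2 ^ ?n)" using \<omega> by simp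
    fix x0 :: "real^'n" and r a D assume r: "0 < r" and sub: "ball x0 (2 * r) \<subseteq> D"
    define l where "l x = (\<Sum>i\<in>UNIV. a $ i * x $ i) - a \<bullet> x0" for x :: "real^'n"
    have le: "l x = a \<bullet> (x - x0)" for x unfolding l_def by (simp add: inner_vec_def sum_subtractf right_diff_distrib)
    have sl: "smooth_fun l" unfolding l_def by (intro smooth_diff smooth_sum smooth_mult smooth_const smooth_coord)
    have gl: "grad l x = a" for x unfolding le[abs_def] by (rule gradI) (auto intro!: derivative_eq_intros)
    define w where "w x = bump x0 r x * l x" for x
    have w1: "Cc_inf (ball x0 (2 * r)) w" unfolding w_def by (rule Cc_inf_mult(1)[OF Cc_inf_bump[OF r order_refl] sl])
    have gw: "grad w x = bump x0 r x *\<^sub>R a + l x *\<^sub>R grad (bump x0 r) x" for x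
      unfolding w_def grad_mult[OF smooth_bump sl] gl ..
    have g1: "grad w x = a" if x: "x \<in> ball x0 r" for x
    proof -
      have b1: "bump x0 r y = 1" if "y \<in> ball x0 r" for y using bump_props(3)[OF r, of y x0] that by (simp add: dist_norm norm_minus_commute)
      have "grad (\<lambda>y. bump x0 r y - 1) x = 0" by (rule grad_zero_open[OF open_ball x]) (simp add: b1)
      then have "grad (bump x0 r) x = 0" using grad_diff[OF smooth_bump smooth_const[of 1], of x0 r x] by (simp add: grad_const)
      then show ?thesis unfolding gw b1[OF x] by simp
    qed
    have gb: "norm (grad w x) \<le> (1 + 2 * Cb) * norm a" if x: "x \<in> ball x0 (2 * r)" for x
    proof -
      have "norm (grad w x) \<le> \<bar>bump x0 r x\<bar> * norm a + \<bar>l x\<bar> * norm (grad (bump x0 r) x)"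
        unfolding gw using norm_triangle_ineq[of "bump x0 r x *\<^sub>R a" "l x *\<^sub>R grad (bump x0 r) x"] by simp
      moreover have "\<bar>bump x0 r x\<bar> * norm a \<le> 1 * norm a"
        using bump_props(1,2)[OF r, of x0 x] by (intro mult_right_mono) simp_all
      moreover have "\<bar>l x\<bar> * norm (grad (bump x0 r) x) \<le> (norm a * (2 * r)) * (Cb / r)"
      proof (rule mult_mono)
        have "\<bar>l x\<bar> \<le> norm a * norm (x - x0)" unfolding le by (rule Cauchy_Schwarz_ineq2)
        also have "\<dots> \<le> norm a * (2 * r)" using x by (intro mult_left_mono) (simp_all add: dist_norm norm_minus_commute)
        finally show "\<bar>l x\<bar> \<le> norm a * (2 * r)" .
      qed (use Cb r in simp_all)
      moreover have "(norm a * (2 * r)) * (Cb / r) = 2 * Cb * norm a" using r by simp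
      ultimately show ?thesis by (simp add: distrib_right)
    qed
    show "\<exists>w. Cc_inf D w \<and> (\<forall>x\<in>ball x0 r. grad w x = a) \<and> (nrm2 (grad w))\<^sup>2 \<le> (1 + 2 * Cb)\<^sup>2 * (\<omega> * 2 ^ ?n) * (norm a)\<^sup>2 * r ^ ?n"
    proof (intro exI[of _ w] conjI ballI g1 Cc_inf_mono[OF w1 sub])
      have "(nrm2 (grad w))\<^sup>2 \<le> (LINT x|lebesgue. ((1 + 2 * Cb) * norm a)\<^sup>2 * ind (ball x0 (2 * r)) x)"
        unfolding nrm2_sq
      proof (rule integral_mono[OF L2_int[OF Cc_inf_L2(2)[OF w1]]])
        show "integrable lebesgue (\<lambda>x. ((1 + 2 * Cb) * norm a)\<^sup>2 * ind (ball x0 (2 * r)) x)"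
          using emeasure_ball_lebesgue[of "2 * r" x0] r by (intro integrable_mult_right integrable_real_indicator) simp_all
        show "(norm (grad w x))\<^sup>2 \<le> ((1 + 2 * Cb) * norm a)\<^sup>2 * ind (ball x0 (2 * r)) x" for x
        proof (cases "x \<in> ball x0 (2 * r)")
          case True
          then show ?thesis using power_mono[OF gb[OF True], of 2] by simp
        next
          case False
          then show ?thesis using Cc_inf_zero_off[OF w1 False] by simp
        qed
      qed
      also have "\<dots> = ((1 + 2 * Cb) * norm a)\<^sup>2 * (\<omega> * (2 * r) ^ ?n)"
        using measure_ball_lebesgue[of "2 * r" x0] r by (simp add: \<omega>_def)
      finally show "(nrm2 (grad w))\<^sup>2 \<le> (1 + 2 * Cb)\<^sup>2 * (\<omega> * 2 ^ ?n) * (norm a)\<^sup>2 * r ^ ?n"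
        by (simp only: power_mult_distrib mult_ac)
    qed
  qed
qed

text \<open>Normalised by r^n instead of the volume of the ball, as in the hypothesis of the
  theorem.\<close>

definition l1_close :: "(nat \<Rightarrow> real^'n \<Rightarrow> real^'n^'n) \<Rightarrow> (nat \<Rightarrow> real^'n \<Rightarrow> real^'n^'n) \<Rightarrow> real \<Rightarrow> real^'n \<Rightarrow> real \<Rightarrow> bool" where
  "l1_close A B \<delta> x r \<longleftrightarrow> (\<forall>\<^sub>F k in sequentially. (LINT y|lebesgue. ind (ball x r) y * norm (A k y - B k y)) \<le> \<delta> * r ^ CARD('n))"

text \<open>A corrector solves its equation with the field \<open>B0 x *v grad w x\<close>, which is
  bounded wherever the gradient of w is, whatever k.\<close>

lemma corr_local_sol:
  assumes D: "open D" and b: "0 \<le> \<beta>" and G: "Gconv \<alpha> \<beta> D B B0" and w: "Cc_inf D w" and c: "corr D B B0 w v g"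
    and R: "0 < R" "ball x0 R \<subseteq> D" and m: "0 \<le> m" "\<And>x. x \<in> ball x0 R \<Longrightarrow> norm (grad w x) \<le> m"
  shows "local_sol \<alpha> \<beta> D (B k) (v k) (g k) x0 R (\<beta> * m)"
proof -
  have ell: "ell \<alpha> \<beta> D (B k)" "ell \<alpha> \<beta> D B0" using G unfolding Gconv_def by simp_all
  have "norm (B0 x *v grad w x) \<le> \<beta> * m" if "x \<in> ball x0 R" for x
    using ell_D(3)[OF ell(2), of x "grad w x"] mult_left_mono[OF m(2)[OF that] b] by linarith
  moreover have "aF (B k) (g k) h = (LINT x|lebesgue. (B0 x *v grad w x) \<bullet> h x)" if "W D y h" for y h
    using corrD(2)[OF c that, of k] unfolding aF_def .
  ultimately show ?thesis
    unfolding local_sol_def using ell_L2(1)[OF ell(2) Cc_inf_L2(2)[OF w]] D ell(1) corrD(1)[OF c] R m(1) b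
    by (intro conjI exI[of _ "\<lambda>x. B0 x *v grad w x"] AE_I2) simp_all
qed

text \<open>\<open>flux_limit\<close> identifies the limit of \<open>T k\<close>, and
  \<open>small_product\<close> bounds \<open>T k\<close> for large k. Both corrector energies are at
  most a constant times R^n, so \<delta> does not depend on R. The one-sided bound is enough because
  the two sequences can be exchanged.\<close>

lemma limit_difference_weak:
  fixes D :: "(real^'n) set"
  assumes D: "bounded D" "open D" and ab: "0 < \<alpha>" "\<alpha> \<le> \<beta>" and e: "0 < \<epsilon>"
  shows "\<exists>\<delta>>0. \<forall>B B0 B' B0' x0 R a b \<psi>. Gconv \<alpha> \<beta> D B B0 \<longrightarrow> Gconv \<alpha> \<beta> D B' B0' \<longrightarrow> 0 < R \<longrightarrow> ball x0 (4 * R) \<subseteq> D \<longrightarrow>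
     l1_close B' B \<delta> x0 R \<longrightarrow> norm a = 1 \<longrightarrow> norm b = 1 \<longrightarrow> Cc_inf (ball x0 R) \<psi> \<longrightarrow> (\<forall>x. 0 \<le> \<psi> x \<and> \<psi> x \<le> 1) \<longrightarrow>
     (LINT x|lebesgue. \<psi> x * (((B0' x - B0 x) *v a) \<bullet> b)) \<le> \<epsilon> * R ^ CARD('n)"
proof -
  let ?n = "CARD('n)"
  have b0: "0 < \<beta>" using ab by simp
  obtain K where K: "0 \<le> K \<and> (\<forall>(x0::real^'n) r a D. 0 < r \<longrightarrow> ball x0 (2 * r) \<subseteq> D \<longrightarrow>
     (\<exists>w. Cc_inf D w \<and> (\<forall>x\<in>ball x0 r. grad w x = a) \<and> (nrm2 (grad w))\<^sup>2 \<le> K * (norm a)\<^sup>2 * r ^ CARD('n)))"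
    using cut_linear_function[where 'n='n] by (elim exE)
  define S where "S = (\<beta> / \<alpha>)\<^sup>2 * (K * 2 ^ ?n)"
  have S: "0 \<le> S" unfolding S_def using K by simp
  \<comment> \<open>Makes the product of the two norms at most \<epsilon> R^n; the summand 1 keeps
    the denominator positive.\<close>
  define \<epsilon>' where "\<epsilon>' = \<epsilon>\<^sup>2 / ((S + \<beta>\<^sup>2) * (S + 1))"
  have e': "0 < \<epsilon>'" unfolding \<epsilon>'_def using e S b0 by (intro divide_pos_pos mult_pos_pos add_nonneg_pos) simp_all
  obtain \<delta> where \<delta>: "0 < \<delta> \<and> (\<forall>D B B' v (g::real^'n \<Rightarrow> real^'n) x0 R M. local_sol \<alpha> \<beta> D B v g x0 (2 * R) M \<longrightarrow> ell \<alpha> \<beta> D B' \<longrightarrow>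
     (LINT y|lebesgue. ind (ball x0 R) y * norm (B' y - B y)) \<le> \<delta> * R ^ CARD('n) \<longrightarrow>
     (nrm2 (res (ball x0 R) (\<lambda>x. (B' x - B x) *v g x)))\<^sup>2 \<le> \<epsilon>' * ((nrm2 g)\<^sup>2 + M\<^sup>2 * R ^ CARD('n)))"
    using small_product[OF ab e', where 'n='n] by (elim exE)
  show ?thesis
  proof (intro exI[of _ \<delta>] conjI allI impI)
    show "0 < \<delta>" using \<delta> by simp
    fix B B0 B' B0' x0 R and a b :: "real^'n" and \<psi>
    assume G: "Gconv \<alpha> \<beta> D B B0" and G': "Gconv \<alpha> \<beta> D B' B0'" and R: "0 < R" and sub: "ball x0 (4 * R) \<subseteq> D"
      and sm: "l1_close B' B \<delta> x0 R" and a: "norm a = 1" and b: "norm b = 1"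
      and \<psi>: "Cc_inf (ball x0 R) \<psi>" and \<psi>1: "\<forall>x. 0 \<le> \<psi> x \<and> \<psi> x \<le> 1"
    have ell: "ell \<alpha> \<beta> D (B k)" "ell \<alpha> \<beta> D (B' k)" "ell \<alpha> \<beta> D B0" "ell \<alpha> \<beta> D B0'" for k using G G' unfolding Gconv_def by simp_all
    have sub2: "ball x0 (2 * R) \<subseteq> D" "ball x0 R \<subseteq> D" using sub R by (auto simp: subset_iff)
    have R2: "0 < 2 * R" and sub4: "ball x0 (2 * (2 * R)) \<subseteq> D" using R sub by simp_all
    have \<psi>D: "Cc_inf D \<psi>" by (rule Cc_inf_mono[OF \<psi> sub2(2)])
    note Kx = K[THEN conjunct2, rule_format, OF R2 sub4]
    obtain w where w: "Cc_inf D w \<and> (\<forall>x\<in>ball x0 (2 * R). grad w x = a) \<and> (nrm2 (grad w))\<^sup>2 \<le> K * (norm a)\<^sup>2 * (2 * R) ^ ?n" using Kx[of a] by (elim exE)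
    obtain w' where w': "Cc_inf D w' \<and> (\<forall>x\<in>ball x0 (2 * R). grad w' x = b) \<and> (nrm2 (grad w'))\<^sup>2 \<le> K * (norm b)\<^sup>2 * (2 * R) ^ ?n" using Kx[of b] by (elim exE)
    have wC: "Cc_inf D w" "Cc_inf D w'" using w w' by simp_all
    obtain v g where c: "corr D B B0 w v g" using Gconv_corr[OF D ab(1) G wC(1)] by (elim exE)
    obtain v' g' where c': "corr D B' B0' w' v' g'" using Gconv_corr[OF D ab(1) G' wC(2)] by (elim exE)
    have L: "L2 (g k)" "L2 (g' k)" for k using W_L2(2)[OF corrD(1)[OF c]] W_L2(2)[OF corrD(1)[OF c']] by simp_all
    have en: "(nrm2 (g k))\<^sup>2 \<le> S * R ^ ?n" for k
    proof -
      have "(nrm2 (g k))\<^sup>2 \<le> (\<beta> / \<alpha> * nrm2 (grad w))\<^sup>2" by (intro power_mono corr_bound[OF D(2) ab(1) ell(1) ell(3) wC(1) c]) simp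
      also have "\<dots> \<le> (\<beta> / \<alpha>)\<^sup>2 * (K * (norm a)\<^sup>2 * (2 * R) ^ ?n)" using w by (simp only: power_mult_distrib) (intro mult_left_mono, simp_all)
      finally show ?thesis unfolding S_def a by (simp add: power_mult_distrib mult_ac)
    qed
    have en': "(nrm2 (g' k))\<^sup>2 \<le> S * R ^ ?n" for k
    proof -
      have "(nrm2 (g' k))\<^sup>2 \<le> (\<beta> / \<alpha> * nrm2 (grad w'))\<^sup>2" by (intro power_mono corr_bound[OF D(2) ab(1) ell(2) ell(4) wC(2) c']) simp
      also have "\<dots> \<le> (\<beta> / \<alpha>)\<^sup>2 * (K * (norm b)\<^sup>2 * (2 * R) ^ ?n)" using w' by (simp only: power_mult_distrib) (intro mult_left_mono, simp_all)
      finally show ?thesis unfolding S_def b by (simp add: power_mult_distrib mult_ac)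
    qed
    define T where "T k = (LINT x|lebesgue. (\<psi> x *\<^sub>R ((B' k x - B k x) *v g k x)) \<bullet> g' k x)" for k
    have L\<psi>: "L2 (\<lambda>x. \<psi> x *\<^sub>R g' k x)" "L2 (\<lambda>x. \<psi> x *\<^sub>R ((B' k x - B k x) *v g k x))" for k
      by (rule Cc_scale_L2[OF \<psi> L(2)], rule Cc_scale_L2[OF \<psi> ell_diff_L2(1)[OF ell(2,1) L(1)]])
    \<comment> \<open>Symmetry of \<open>B' k\<close> lets each corrector be multiplied by its own
      coefficient, the only combination for which its equation gives information.\<close>
    have Te: "T k = aF (B' k) (g' k) (\<lambda>x. \<psi> x *\<^sub>R g k x) - aF (B k) (g k) (\<lambda>x. \<psi> x *\<^sub>R g' k x)" for k
    proof -
      have "T k = (LINT x|lebesgue. (B' k x *v g k x) \<bullet> (\<psi> x *\<^sub>R g' k x) - (B k x *v g k x) \<bullet> (\<psi> x *\<^sub>R g' k x))"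
        unfolding T_def by (simp add: matrix_vector_mult_diff_rdistrib inner_diff_left right_diff_distrib)
      also have "\<dots> = aF (B' k) (g k) (\<lambda>x. \<psi> x *\<^sub>R g' k x) - aF (B k) (g k) (\<lambda>x. \<psi> x *\<^sub>R g' k x)"
        unfolding aF_def
        by (rule Bochner_Integration.integral_diff[OF L2_inner_integrable[OF ell_L2(1)[OF ell(2) L(1)] L\<psi>(1)] L2_inner_integrable[OF ell_L2(1)[OF ell(1) L(1)] L\<psi>(1)]])
      finally show ?thesis using aF_scale_move[OF ell(2), of k "g k" \<psi> "g' k"] by simp
    qed
    have gradC: "L2 (\<lambda>x. \<psi> x *\<^sub>R grad w x)" "L2 (\<lambda>x. \<psi> x *\<^sub>R grad w' x)"
      by (rule Cc_scale_L2[OF \<psi> Cc_inf_L2(2)[OF wC(1)]], rule Cc_scale_L2[OF \<psi> Cc_inf_L2(2)[OF wC(2)]])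
    have lim: "T \<longlonglongrightarrow> (LINT x|lebesgue. \<psi> x * (((B0' x - B0 x) *v a) \<bullet> b))"
    proof -
      have "T \<longlonglongrightarrow> aF B0' (grad w') (\<lambda>x. \<psi> x *\<^sub>R grad w x) - aF B0 (grad w) (\<lambda>x. \<psi> x *\<^sub>R grad w' x)"
        unfolding Te[abs_def]
        by (rule tendsto_diff[OF flux_limit[OF D ab(1) G' \<psi>D wC(2) c' wC(1) c] flux_limit[OF D ab(1) G \<psi>D wC(1) c wC(2) c']])
      also have "aF B0' (grad w') (\<lambda>x. \<psi> x *\<^sub>R grad w x) - aF B0 (grad w) (\<lambda>x. \<psi> x *\<^sub>R grad w' x)
        = (LINT x|lebesgue. (B0' x *v grad w' x) \<bullet> (\<psi> x *\<^sub>R grad w x) - (B0 x *v grad w x) \<bullet> (\<psi> x *\<^sub>R grad w' x))"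
        unfolding aF_def
        by (rule Bochner_Integration.integral_diff[OF L2_inner_integrable[OF ell_L2(1)[OF ell(4) Cc_inf_L2(2)[OF wC(2)]] gradC(1)]
          L2_inner_integrable[OF ell_L2(1)[OF ell(3) Cc_inf_L2(2)[OF wC(1)]] gradC(2)], symmetric])
      also have "\<dots> = (LINT x|lebesgue. \<psi> x * (((B0' x - B0 x) *v a) \<bullet> b))"
      proof (intro Bochner_Integration.integral_cong refl)
        fix x
        show "(B0' x *v grad w' x) \<bullet> (\<psi> x *\<^sub>R grad w x) - (B0 x *v grad w x) \<bullet> (\<psi> x *\<^sub>R grad w' x) = \<psi> x * (((B0' x - B0 x) *v a) \<bullet> b)"
        proof (cases "x \<in> ball x0 R")
          case True
          then have "x \<in> ball x0 (2 * R)" using R by simp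
          then have "grad w x = a" "grad w' x = b" using w w' by blast+
          then show ?thesis using symmetric_inner[OF ell_D(2)[OF ell(4), of x], of b a]
            by (simp add: matrix_vector_mult_diff_rdistrib inner_diff_left right_diff_distrib)
        next
          case False
          then show ?thesis using Cc_inf_zero_off[OF \<psi> False] by simp
        qed
      qed
      finally show ?thesis .
    qed
    have bd: "T k \<le> \<epsilon> * R ^ ?n" if k: "(LINT y|lebesgue. ind (ball x0 R) y * norm (B' k y - B k y)) \<le> \<delta> * R ^ ?n" for k
    proof -
      define X where "X = nrm2 (res (ball x0 R) (\<lambda>x. (B' k x - B k x) *v g k x))"
      have LX: "L2 (res (ball x0 R) (\<lambda>x. (B' k x - B k x) *v g k x))"
        by (rule nrm2_restrict_le(1)[OF ell_diff_L2(1)[OF ell(2,1) L(1)] ball_lebesgue])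
      have "norm (grad w x) \<le> 1" if "x \<in> ball x0 (2 * R)" for x using w a that by simp
      from corr_local_sol[OF D(2) less_imp_le[OF b0] G wC(1) c R2 sub2(1) _ this, of k]
      have sol: "local_sol \<alpha> \<beta> D (B k) (v k) (g k) x0 (2 * R) \<beta>" by simp
      have "X\<^sup>2 \<le> \<epsilon>' * ((nrm2 (g k))\<^sup>2 + \<beta>\<^sup>2 * R ^ ?n)"
        unfolding X_def by (rule \<delta>[THEN conjunct2, rule_format, OF sol ell(2) k])
      also have "\<dots> \<le> \<epsilon>' * (S * R ^ ?n + \<beta>\<^sup>2 * R ^ ?n)" using en e' by (intro mult_left_mono add_right_mono) simp_all
      finally have X2: "X\<^sup>2 \<le> \<epsilon>' * ((S + \<beta>\<^sup>2) * R ^ ?n)" by (simp add: distrib_right)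
      have "(X * nrm2 (g' k))\<^sup>2 = X\<^sup>2 * (nrm2 (g' k))\<^sup>2" by (rule power_mult_distrib)
      also have "\<dots> \<le> (\<epsilon>' * ((S + \<beta>\<^sup>2) * R ^ ?n)) * (S * R ^ ?n)"
        using X2 en'[of k] e' S R by (intro mult_mono) simp_all
      also have "\<dots> \<le> (\<epsilon>' * ((S + \<beta>\<^sup>2) * R ^ ?n)) * ((S + 1) * R ^ ?n)"
        using e' S R by (intro mult_left_mono mult_right_mono) simp_all
      also have "\<dots> = (\<epsilon> * R ^ ?n)\<^sup>2"
      proof -
        have "0 < (S + \<beta>\<^sup>2) * (S + 1)" using S b0 by (intro mult_pos_pos add_nonneg_pos) simp_all
        moreover have "\<epsilon>\<^sup>2 / y * y = \<epsilon>\<^sup>2" if "0 < y" for y using that by simp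
        ultimately have "\<epsilon>' * ((S + \<beta>\<^sup>2) * (S + 1)) = \<epsilon>\<^sup>2" unfolding \<epsilon>'_def by blast
        moreover have "(\<epsilon>' * ((S + \<beta>\<^sup>2) * R ^ ?n)) * ((S + 1) * R ^ ?n) = \<epsilon>' * ((S + \<beta>\<^sup>2) * (S + 1)) * (R ^ ?n)\<^sup>2"
          by (simp add: power2_eq_square mult_ac)
        ultimately show ?thesis by (simp add: power_mult_distrib)
      qed
      finally have XY: "X * nrm2 (g' k) \<le> \<epsilon> * R ^ ?n" by (rule power2_le_imp_le) (use e R in simp)
      have "T k \<le> nrm2 (\<lambda>x. \<psi> x *\<^sub>R ((B' k x - B k x) *v g k x)) * nrm2 (g' k)"
        using abs_le_D1[OF CS_inner[OF L\<psi>(2)[of k] L(2)[of k]]] unfolding T_def .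
      also have "\<dots> \<le> X * nrm2 (g' k)"
      proof (rule mult_right_mono)
        have "nrm2 (\<lambda>x. \<psi> x *\<^sub>R ((B' k x - B k x) *v g k x)) \<le> 1 * X" unfolding X_def
        proof (rule L2_mono(2)[OF L2_meas[OF L\<psi>(2)] LX])
          show "AE x in lebesgue. norm (\<psi> x *\<^sub>R ((B' k x - B k x) *v g k x)) \<le> 1 * norm (ind (ball x0 R) x *\<^sub>R ((B' k x - B k x) *v g k x))"
          proof (rule AE_I2)
            fix x
            have "0 \<le> \<psi> x" "\<psi> x \<le> 1" using \<psi>1 by simp_all
            then show "norm (\<psi> x *\<^sub>R ((B' k x - B k x) *v g k x)) \<le> 1 * norm (ind (ball x0 R) x *\<^sub>R ((B' k x - B k x) *v g k x))"
              using Cc_inf_zero_off[OF \<psi>, of x] mult_right_mono[of "\<psi> x" 1 "norm ((B' k x - B k x) *v g k x)"]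
              by (cases "x \<in> ball x0 R") simp_all
          qed
        qed simp
        then show "nrm2 (\<lambda>x. \<psi> x *\<^sub>R ((B' k x - B k x) *v g k x)) \<le> X" by simp
      qed simp
      finally show ?thesis using XY by linarith
    qed
    show "(LINT x|lebesgue. \<psi> x * (((B0' x - B0 x) *v a) \<bullet> b)) \<le> \<epsilon> * R ^ ?n"
      using sm bd unfolding l1_close_def by (intro tendsto_upperbound[OF lim]) (auto elim: eventually_mono)
  qed
qed


text \<open>Differentiation of integrals applied to the previous lemma. The cutoff \<psi> there is
  smooth whereas averages are over balls, so two concentric balls of almost equal radius are
  compared.\<close>

lemma limit_difference_pointwise:
  fixes D :: "(real^'n) set"
  assumes D: "bounded D" "open D" and ab: "0 < \<alpha>" "\<alpha> \<le> \<beta>" and e: "0 < \<epsilon>"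
  shows "\<exists>\<delta>>0. \<forall>B B0 B' B0' a b. Gconv \<alpha> \<beta> D B B0 \<longrightarrow> Gconv \<alpha> \<beta> D B' B0' \<longrightarrow> norm a = 1 \<longrightarrow> norm b = 1 \<longrightarrow>
     (AE x in lebesgue. x \<in> D \<longrightarrow> (\<forall>\<^sub>F r in at_right 0. l1_close B' B \<delta> x r) \<longrightarrow> ((B0' x - B0 x) *v a) \<bullet> b \<le> \<epsilon>)"
proof -
  let ?n = "CARD('n)"
  have b0: "0 < \<beta>" using ab by simp
  define \<omega> where "\<omega> = measure lborel (ball 0 1 :: (real^'n) set)"
  have \<omega>: "0 < \<omega>" unfolding \<omega>_def by (rule content_ball_pos) simp
  have e2: "0 < \<epsilon> * \<omega> / 2" using e \<omega> by simp
  obtain \<delta> where \<delta>: "0 < \<delta> \<and> (\<forall>B B0 B' B0' x0 R a b \<psi>. Gconv \<alpha> \<beta> D B B0 \<longrightarrow> Gconv \<alpha> \<beta> D B' B0' \<longrightarrow> 0 < R \<longrightarrow> ball x0 (4 * R) \<subseteq> D \<longrightarrow>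
     l1_close B' B \<delta> x0 R \<longrightarrow> norm a = 1 \<longrightarrow> norm b = 1 \<longrightarrow> Cc_inf (ball x0 R) \<psi> \<longrightarrow> (\<forall>x. 0 \<le> \<psi> x \<and> \<psi> x \<le> 1) \<longrightarrow>
     (LINT x|lebesgue. \<psi> x * (((B0' x - B0 x) *v a) \<bullet> b)) \<le> \<epsilon> * \<omega> / 2 * R ^ CARD('n))"
    using limit_difference_weak[OF D ab e2] by (elim exE)
  \<comment> \<open>Solves (2 \<beta> + \<epsilon>) n \<tau> = \<epsilon> / 2; by Bernoulli's
    inequality, shrinking the radius by the factor 1 - \<tau> then costs at most \<epsilon> /
    2.\<close>
  define \<tau> where "\<tau> = \<epsilon> / (2 * real ?n * (2 * \<beta> + \<epsilon>))"
  have be: "0 < 2 * \<beta> + \<epsilon>" using b0 e by simp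
  have n1: "1 \<le> real ?n" by (simp add: Suc_le_eq)
  have \<tau>n: "(2 * \<beta> + \<epsilon>) * (real ?n * \<tau>) = \<epsilon> / 2"
  proof -
    have "y * (real ?n * (\<epsilon> / (2 * real ?n * y))) = \<epsilon> / 2" if "0 < y" for y using that by simp
    then show ?thesis unfolding \<tau>_def using be by blast
  qed
  have \<tau>: "0 < \<tau>" unfolding \<tau>_def using e be by simp
  have \<tau>1: "\<tau> < 1"
  proof (rule ccontr)
    assume "\<not> \<tau> < 1"
    then have "(2 * \<beta> + \<epsilon>) * (1 * 1) \<le> (2 * \<beta> + \<epsilon>) * (real ?n * \<tau>)" using be n1 by (intro mult_left_mono mult_mono) simp_all
    then show False using \<tau>n b0 e by simp
  qed
  define s where "s = 1 - \<tau>"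
  have s: "0 < s" "s < 1" unfolding s_def using \<tau> \<tau>1 by simp_all
  have sn: "2 * \<beta> + \<epsilon> / 2 \<le> (2 * \<beta> + \<epsilon>) * s ^ ?n"
  proof -
    have "(2 * \<beta> + \<epsilon>) * (1 - real ?n * \<tau>) \<le> (2 * \<beta> + \<epsilon>) * s ^ ?n"
      unfolding s_def using Bernoulli_inequality[of "- \<tau>" ?n] \<tau>1 be by (intro mult_left_mono) simp_all
    then show ?thesis using \<tau>n by (simp add: right_diff_distrib)
  qed
  show ?thesis
  proof (intro exI[of _ \<delta>] conjI allI impI)
    show "0 < \<delta>" using \<delta> by simp
    fix B B0 B' B0' and a b :: "real^'n"
    assume G: "Gconv \<alpha> \<beta> D B B0" and G': "Gconv \<alpha> \<beta> D B' B0'"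
      and a: "norm a = 1" and b: "norm b = 1"
    have ell: "ell \<alpha> \<beta> D B0" "ell \<alpha> \<beta> D B0'" using G G' unfolding Gconv_def by simp_all
    define f where "f x = ((B0' x - B0 x) *v a) \<bullet> b" for x
    have fb: "\<bar>f x\<bar> \<le> 2 * \<beta>" for x
      using Cauchy_Schwarz_ineq2[of "(B0' x - B0 x) *v a" b] ell_diff_bounds(1)[OF ell(2,1), of x a] a b unfolding f_def by simp
    have fm: "f \<in> LM"
    proof -
      have "(\<lambda>x. (B0' x - B0 x) *v a) \<in> LM"
        using mult_vec_measurable[of "\<lambda>x. B0' x - B0 x" "\<lambda>x. a"] ell_D(1)[OF ell(1)] ell_D(1)[OF ell(2)] by simp
      then show ?thesis unfolding f_def by (intro borel_measurable_inner borel_measurable_const)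
    qed
    \<comment> \<open>The shift by 2 \<beta> makes the function nonnegative, so that its integral
      over a ball is at most its integral against \<psi>.\<close>
    define h where "h x = 2 * \<beta> + f x" for x
    have hm: "h \<in> LM" unfolding h_def using fm by simp
    have h0: "0 \<le> h x" for x using fb[of x] unfolding h_def by linarith
    show "AE x in lebesgue. x \<in> D \<longrightarrow> (\<forall>\<^sub>F r in at_right 0. l1_close B' B \<delta> x r) \<longrightarrow> ((B0' x - B0 x) *v a) \<bullet> b \<le> \<epsilon>"
      using AE_average_le[OF hm]
    proof eventually_elim
      case (elim x)
      show ?case
      proof (intro impI)
        assume x: "x \<in> D" and sm: "\<forall>\<^sub>F r in at_right 0. l1_close B' B \<delta> x r"
        obtain d where d: "0 < d \<and> (\<forall>R>0. R < d \<longrightarrow> l1_close B' B \<delta> x R)" using sm unfolding eventually_at_right_field by blast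
        obtain d' where d': "0 < d'" "ball x d' \<subseteq> D" using D(2) x open_contains_ball by blast
        have "h x \<le> 2 * \<beta> + \<epsilon>"
        proof (rule elim[rule_format])
          show "0 \<le> 2 * \<beta> + \<epsilon>" using b0 e by simp
          show "\<exists>d>0. \<forall>r. 0 < r \<and> r < d \<longrightarrow> (\<integral>\<^sup>+y\<in>ball x r. ennreal (h y) \<partial>lebesgue) \<le> ennreal (2 * \<beta> + \<epsilon>) * emeasure lebesgue (ball x r)"
          proof (rule exI[of _ "s * min d (d' / 4)"], intro conjI allI impI)
            show "0 < s * min d (d' / 4)" using d d' s by simp
            fix r' assume r': "0 < r' \<and> r' < s * min d (d' / 4)"
            \<comment> \<open>\<psi> is 1 on the ball of radius r' = s r and supported in that of
              radius r, where the weak estimate is available.\<close>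
            define r where "r = r' / s"
            have rr: "r' = s * r" unfolding r_def using s by simp
            have "s * r < s * min d (d' / 4)" using r' unfolding rr by simp
            then have "r < min d (d' / 4)" using s(1) by (simp only: mult_less_cancel_left_pos)
            moreover have "0 < r" unfolding r_def using r' s by simp
            ultimately have r: "0 < r" "r < d" "4 * r < d'" by simp_all
            have sub: "ball x (4 * r) \<subseteq> D" using d'(2) r(3) by (auto simp: subset_iff)
            have "r' < r" unfolding rr using r(1) s by simp
            then have "cball x r' \<subseteq> ball x r" by (auto simp: subset_iff)
            from smooth_urysohn[OF compact_cball open_ball this] obtain \<psi>
              where \<psi>: "Cc_inf (ball x r) \<psi> \<and> (\<forall>x. 0 \<le> \<psi> x \<and> \<psi> x \<le> 1) \<and> (\<forall>x\<in>cball x r'. \<psi> x = 1)" by (elim exE)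
            have \<psi>C: "Cc_inf (ball x r) \<psi>" and \<psi>01: "0 \<le> \<psi> y" "\<psi> y \<le> 1" for y using \<psi> by simp_all
            have main: "(LINT y|lebesgue. \<psi> y * f y) \<le> \<epsilon> * \<omega> / 2 * r ^ ?n"
              unfolding f_def by (rule \<delta>[THEN conjunct2, rule_format, OF G G' r(1) sub _ a b \<psi>C]) (use r d \<psi>01 in simp_all)
            have i\<psi>: "integrable lebesgue (\<lambda>y. \<psi> y * f y)"
            proof (rule finite_measure_support_integrable[where C="2 * \<beta>" and S="ball x r"])
              show "(\<lambda>y. \<psi> y * f y) \<in> LM"
                using smooth_lebesgue(1)[OF Cc_infD(1)[OF \<psi>C]] fm by (rule borel_measurable_times)
              show "norm (\<psi> y * f y) \<le> 2 * \<beta>" for y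
                using mult_mono[of "\<psi> y" 1 "\<bar>f y\<bar>" "2 * \<beta>"] \<psi>01[of y] fb[of y] by (simp add: abs_mult)
            qed (use Cc_inf_zero_off[OF \<psi>C] in simp_all)
            note i\<psi>1 = Cc_inf_integrable(1)[OF \<psi>C]
            have e\<psi>: "\<psi> y * h y = 2 * \<beta> * \<psi> y + \<psi> y * f y" for y unfolding h_def by (simp add: distrib_left)
            have "(LINT y|lebesgue. \<psi> y) \<le> (LINT y|lebesgue. ind (ball x r) y)"
            proof (rule integral_mono[OF i\<psi>1])
              show "integrable lebesgue (\<lambda>y. ind (ball x r) y :: real)"
                using emeasure_ball_lebesgue[of r x] r by (intro integrable_real_indicator) simp_all
              show "\<psi> y \<le> ind (ball x r) y" for y
                using Cc_inf_zero_off[OF \<psi>C, of y] \<psi>01[of y] by (cases "y \<in> ball x r") simp_all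
            qed
            then have \<psi>\<omega>: "(LINT y|lebesgue. \<psi> y) \<le> \<omega> * r ^ ?n" using measure_ball_lebesgue[of r x] r(1) by (simp add: \<omega>_def)
            have "(\<integral>\<^sup>+y\<in>ball x r'. ennreal (h y) \<partial>lebesgue) \<le> (\<integral>\<^sup>+y. ennreal (\<psi> y * h y) \<partial>lebesgue)"
            proof (rule nn_integral_mono)
              show "ennreal (h y) * ind (ball x r') y \<le> ennreal (\<psi> y * h y)" for y
                using \<psi> h0[of y] by (cases "y \<in> ball x r'") simp_all
            qed
            also have "\<dots> = ennreal (LINT y|lebesgue. \<psi> y * h y)"
            proof (rule nn_integral_eq_integral)
              show "integrable lebesgue (\<lambda>y. \<psi> y * h y)" unfolding e\<psi> using i\<psi> i\<psi>1 by simp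
              show "AE y in lebesgue. 0 \<le> \<psi> y * h y" using h0 \<psi>01 by simp
            qed
            also have "(LINT y|lebesgue. \<psi> y * h y) = 2 * \<beta> * (LINT y|lebesgue. \<psi> y) + (LINT y|lebesgue. \<psi> y * f y)"
              unfolding e\<psi> using i\<psi> i\<psi>1 by simp
            also have "ennreal \<dots> \<le> ennreal ((2 * \<beta> + \<epsilon>) * (\<omega> * r' ^ ?n))"
            proof (rule ennreal_leI)
              have "2 * \<beta> * (LINT y|lebesgue. \<psi> y) + (LINT y|lebesgue. \<psi> y * f y) \<le> 2 * \<beta> * (\<omega> * r ^ ?n) + \<epsilon> * \<omega> / 2 * r ^ ?n"
                using \<psi>\<omega> main b0 by (intro add_mono mult_left_mono) simp_all
              also have "\<dots> = (2 * \<beta> + \<epsilon> / 2) * (\<omega> * r ^ ?n)" by (simp add: distrib_right)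
              also have "\<dots> \<le> ((2 * \<beta> + \<epsilon>) * s ^ ?n) * (\<omega> * r ^ ?n)" using sn \<omega> r(1) by (intro mult_right_mono) simp_all
              also have "\<dots> = (2 * \<beta> + \<epsilon>) * (\<omega> * r' ^ ?n)" unfolding rr by (simp add: power_mult_distrib mult_ac)
              finally show "2 * \<beta> * (LINT y|lebesgue. \<psi> y) + (LINT y|lebesgue. \<psi> y * f y) \<le> (2 * \<beta> + \<epsilon>) * (\<omega> * r' ^ ?n)" .
            qed
            also have "\<dots> = ennreal (2 * \<beta> + \<epsilon>) * emeasure lebesgue (ball x r')"
              using emeasure_ball_lebesgue[of r' x] r' be \<omega> by (simp add: \<omega>_def ennreal_mult)
            finally show "(\<integral>\<^sup>+y\<in>ball x r'. ennreal (h y) \<partial>lebesgue) \<le> ennreal (2 * \<beta> + \<epsilon>) * emeasure lebesgue (ball x r')" .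
          qed
        qed
        then show "((B0' x - B0 x) *v a) \<bullet> b \<le> \<epsilon>" unfolding h_def f_def by simp
      qed
    qed
  qed
qed

section \<open>Passage to the limit\<close>

text \<open>Tonelli: each y is counted by the centres within distance r, a set whose measure is that
  of a ball of radius r.\<close>

lemma nn_integral_ball_averages:
  fixes h :: "'a::euclidean_space \<Rightarrow> real"
  assumes h: "h \<in> LM" and r: "0 \<le> r"
  shows "(\<integral>\<^sup>+x. (\<integral>\<^sup>+y\<in>ball x r. ennreal (h y) \<partial>lebesgue) \<partial>lebesgue)
    = ennreal (measure lborel (ball 0 1 :: 'a set) * r ^ DIM('a)) * (\<integral>\<^sup>+y. ennreal (h y) \<partial>lebesgue)"
proof -
  obtain g where g[measurable]: "g \<in> borel_measurable lborel" and ae: "AE x in lborel. h x = g x"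
    using completion_ex_borel_measurable_real[OF h] by blast
  have gb[measurable]: "g \<in> borel_measurable borel" using g by simp
  have e: "(\<integral>\<^sup>+y\<in>ball x r. ennreal (h y) \<partial>lebesgue) = (\<integral>\<^sup>+y. ennreal (g y) * ind (ball x r) y \<partial>lborel)" for x
  proof -
    have "AE y in lborel. ennreal (h y) * ind (ball x r) y = ennreal (g y) * ind (ball x r) y" using ae by eventually_elim simp
    then show ?thesis unfolding nn_integral_completion by (rule nn_integral_cong_AE)
  qed
  have m: "(\<lambda>p. ennreal (g (snd p)) * ind {p. dist (fst p) (snd p) < r} p) \<in> borel_measurable (lborel \<Otimes>\<^sub>M (lborel::'a measure))"
  proof -
    have "{p::'a\<times>'a. dist (fst p) (snd p) < r} \<in> sets (borel \<Otimes>\<^sub>M borel)"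
      unfolding borel_prod by (intro borel_open open_Collect_less continuous_intros)
    then have "(\<lambda>p. ennreal (g (snd p)) * ind {p. dist (fst p) (snd p) < r} p) \<in> borel_measurable (borel \<Otimes>\<^sub>M (borel::'a measure))" by measurable
    then show ?thesis by (simp add: measurable_cong_sets[OF sets_pair_measure_cong[OF sets_lborel sets_lborel] refl])
  qed
  have "(\<integral>\<^sup>+x. (\<integral>\<^sup>+y\<in>ball x r. ennreal (h y) \<partial>lebesgue) \<partial>lebesgue)
    = (\<integral>\<^sup>+x. (\<integral>\<^sup>+y. (\<lambda>x y. ennreal (g y) * ind {p. dist (fst p) (snd p) < r} (x, y)) x y \<partial>lborel) \<partial>lborel)"
    unfolding e unfolding nn_integral_completion by (intro nn_integral_cong) (simp add: indicator_def)
  also have "\<dots> = (\<integral>\<^sup>+y. (\<integral>\<^sup>+x. (\<lambda>x y. ennreal (g y) * ind {p. dist (fst p) (snd p) < r} (x, y)) x y \<partial>lborel) \<partial>lborel)"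
    by (rule lborel_pair.Fubini'[symmetric]) (use m in \<open>simp add: case_prod_beta'\<close>)
  also have "\<dots> = (\<integral>\<^sup>+y. ennreal (measure lborel (ball 0 1 :: 'a set) * r ^ DIM('a)) * ennreal (g y) \<partial>lborel)"
  proof (rule nn_integral_cong)
    fix y :: 'a
    have "(\<integral>\<^sup>+x. (\<lambda>x y. ennreal (g y) * ind {p. dist (fst p) (snd p) < r} (x, y)) x y \<partial>lborel) = (\<integral>\<^sup>+x. ennreal (g y) * ind (ball y r) x \<partial>lborel)"
      by (intro nn_integral_cong) (simp add: indicator_def dist_commute)
    also have "\<dots> = ennreal (g y) * emeasure lborel (ball y r)" by (rule nn_integral_cmult_indicator) simp
    also have "emeasure lborel (ball y r) = emeasure lebesgue (ball y r)" by simp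
    also have "\<dots> = ennreal (measure lborel (ball 0 1 :: 'a set) * r ^ DIM('a))" by (rule emeasure_ball_lebesgue[OF r])
    finally show "(\<integral>\<^sup>+x. (\<lambda>x y. ennreal (g y) * ind {p. dist (fst p) (snd p) < r} (x, y)) x y \<partial>lborel)
      = ennreal (measure lborel (ball 0 1 :: 'a set) * r ^ DIM('a)) * ennreal (g y)" by (simp add: mult.commute)
  qed
  also have "\<dots> = ennreal (measure lborel (ball 0 1 :: 'a set) * r ^ DIM('a)) * (\<integral>\<^sup>+y. ennreal (g y) \<partial>lborel)"
    by (rule nn_integral_cmult) simp
  also have "(\<integral>\<^sup>+y. ennreal (g y) \<partial>lborel) = (\<integral>\<^sup>+y. ennreal (h y) \<partial>lebesgue)"
  proof -
    have "AE y in lborel. ennreal (g y) = ennreal (h y)" using ae by eventually_elim simp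
    then show ?thesis unfolding nn_integral_completion by (rule nn_integral_cong_AE)
  qed
  finally show ?thesis .
qed

text \<open>After division by the volume, averaging over centres preserves the integral of
  \<open>f j k\<close> over K, so the integral can be written with ball averages of any radius. The
  reverse Fatou lemma then moves the upper limits in k, in the radius and in j inside, one after the
  other, and the pointwise hypothesis finishes.\<close>

lemma local_to_compact_L1:
  fixes f :: "nat \<Rightarrow> nat \<Rightarrow> real^'n \<Rightarrow> real"
  assumes f: "\<And>j k. f j k \<in> LM" "\<And>j k x. 0 \<le> f j k x" "\<And>j k x. f j k x \<le> C"
    and K: "compact K" "K \<subseteq> D"
    and H: "AE x in lebesgue. x \<in> D \<longrightarrow> (\<forall>\<delta>>0. \<forall>\<^sub>F j in sequentially. \<forall>\<^sub>F r in at_right 0. \<forall>\<^sub>F k in sequentially.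
      (LINT y|lebesgue. ind (ball x r) y * f j k y) \<le> \<delta> * r ^ CARD('n))"
    and e: "0 < \<eta>"
  shows "\<forall>\<^sub>F j in sequentially. \<forall>\<^sub>F k in sequentially. (LINT y|lebesgue. ind K y * f j k y) \<le> \<eta>"
proof -
  define \<omega> where "\<omega> = measure lborel (ball 0 1 :: (real^'n) set)"
  have \<omega>: "0 < \<omega>" unfolding \<omega>_def by (rule content_ball_pos) simp
  define \<rho> where "\<rho> m = 1 / real (Suc m)" for m
  have \<rho>: "0 < \<rho> m" "\<rho> m \<le> 1" for m unfolding \<rho>_def by simp_all
  have \<rho>0: "\<rho> \<longlonglongrightarrow> 0" unfolding \<rho>_def by (rule LIMSEQ_Suc[OF lim_1_over_n])
  have \<rho>f: "filterlim \<rho> (at_right 0) sequentially" using \<rho>0 \<rho>(1) by (intro filterlim_at_withinI always_eventually) (auto intro: less_imp_neq[symmetric])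
  define c where "c m = \<omega> * \<rho> m ^ CARD('n)" for m
  have c: "0 < c m" for m unfolding c_def using \<omega> \<rho>(1)[of m] by simp
  have KL: "K \<in> sets lebesgue" using K(1) by (intro borel_sets_lebesgue borel_compact)
  have Kb: "bounded K" by (rule compact_imp_bounded[OF K(1)])
  define F where "F j k y = ind K y * f j k y" for j k y
  have Fm: "F j k \<in> LM" for j k unfolding F_def using f(1) KL by (intro borel_measurable_times borel_measurable_indicator)
  have F0: "0 \<le> F j k y" for j k y unfolding F_def using f(2) by simp
  have C0: "0 \<le> C" using order_trans[OF f(2) f(3)] .
  have FC: "F j k y \<le> C" for j k y unfolding F_def using f(3) C0 by (cases "y \<in> K") simp_all
  have Fi: "integrable lebesgue (F j k)" for j k
    by (rule finite_measure_support_integrable[OF Fm _ Kb]) (use F0 FC in \<open>simp_all add: F_def\<close>)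
  have FI: "(\<integral>\<^sup>+y. ennreal (F j k y) \<partial>lebesgue) = ennreal (LINT y|lebesgue. F j k y)" for j k
    by (rule nn_integral_eq_integral[OF Fi]) (simp add: F0)
  define a where "a j m k x = (\<integral>\<^sup>+y\<in>ball x (\<rho> m). ennreal (F j k y) \<partial>lebesgue) / ennreal (c m)" for j m k x
  have avm: "(\<lambda>x. \<integral>\<^sup>+y\<in>ball x (\<rho> m). ennreal (F j k y) \<partial>lebesgue) \<in> LM" for j m k
    by (rule measurable_completion) (use ball_average_measurable[OF Fm] in simp)
  have am: "a j m k \<in> LM" for j m k
    using avm[of j k m] unfolding a_def by simp
  have aF: "(\<integral>\<^sup>+x. a j m k x \<partial>lebesgue) = (\<integral>\<^sup>+y. ennreal (F j k y) \<partial>lebesgue)" for j m k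
  proof -
    have "(\<integral>\<^sup>+x. a j m k x \<partial>lebesgue) = (\<integral>\<^sup>+x. (\<integral>\<^sup>+y\<in>ball x (\<rho> m). ennreal (F j k y) \<partial>lebesgue) \<partial>lebesgue) / ennreal (c m)"
      unfolding a_def by (rule nn_integral_divide[OF avm])
    also have "\<dots> = ennreal (c m) * (\<integral>\<^sup>+y. ennreal (F j k y) \<partial>lebesgue) / ennreal (c m)"
      using nn_integral_ball_averages[OF Fm[of j k], of "\<rho> m"] \<rho>(1)[of m] unfolding c_def \<omega>_def by simp
    also have "\<dots> = (\<integral>\<^sup>+y. ennreal (F j k y) \<partial>lebesgue)"
      using c[of m] by (simp add: FI ennreal_mult''[symmetric] divide_ennreal integral_nonneg_AE F0)
    finally show ?thesis .
  qed
  have aeq: "a j m k x = ennreal ((LINT y|lebesgue. ind (ball x (\<rho> m)) y * F j k y) / c m)" for j m k x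
  proof -
    have "(\<integral>\<^sup>+y\<in>ball x (\<rho> m). ennreal (F j k y) \<partial>lebesgue) = (\<integral>\<^sup>+y. ennreal (ind (ball x (\<rho> m)) y * F j k y) \<partial>lebesgue)"
      by (intro nn_integral_cong) (simp add: indicator_def)
    also have "\<dots> = ennreal (LINT y|lebesgue. ind (ball x (\<rho> m)) y * F j k y)"
      using integrable_mult_indicator[OF ball_lebesgue Fi[of j k], of x "\<rho> m"] by (intro nn_integral_eq_integral) (simp_all add: F0)
    finally show ?thesis unfolding a_def using c[of m] by (simp add: divide_ennreal integral_nonneg_AE F0)
  qed
  obtain s where s: "\<And>y. y \<in> K \<Longrightarrow> norm y \<le> s" using Kb unfolding bounded_iff by blast
  \<comment> \<open>A common majorant for the three uses of Fatou's lemma: the radii are at most 1,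
    so averages of functions supported in K vanish outside the ball of radius s + 1.\<close>
  define w where "w x = ennreal C * ind (ball (0::real^'n) (s + 1)) x" for x
  have wm: "w \<in> LM" unfolding w_def by (intro borel_measurable_times_ennreal borel_measurable_const borel_measurable_indicator ball_lebesgue)
  have wI: "(\<integral>\<^sup>+x. w x \<partial>lebesgue) < \<infinity>"
  proof -
    have "(\<integral>\<^sup>+x. w x \<partial>lebesgue) = ennreal C * emeasure lebesgue (ball (0::real^'n) (s + 1))"
      unfolding w_def by (rule nn_integral_cmult_indicator) simp
    also have "\<dots> < \<infinity>" using emeasure_lborel_ball_finite[of "0::real^'n" "s + 1"] by (simp add: ennreal_mult_less_top)
    finally show ?thesis .
  qed
  have aw: "a j m k x \<le> w x" for j m k x
  proof (cases "x \<in> ball 0 (s + 1)")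
    case True
    have "(LINT y|lebesgue. ind (ball x (\<rho> m)) y * F j k y) \<le> (LINT y|lebesgue. C * ind (ball x (\<rho> m)) y)"
    proof (rule integral_mono)
      show "integrable lebesgue (\<lambda>y. ind (ball x (\<rho> m)) y * F j k y)"
        using integrable_mult_indicator[OF ball_lebesgue Fi[of j k], of x "\<rho> m"] by simp
      show "integrable lebesgue (\<lambda>y. C * ind (ball x (\<rho> m)) y)"
        using emeasure_ball_lebesgue[of "\<rho> m" x] \<rho>(1)[of m] by (intro integrable_mult_right integrable_real_indicator) simp_all
      show "ind (ball x (\<rho> m)) y * F j k y \<le> C * ind (ball x (\<rho> m)) y" for y using FC[of j k y] by (cases "y \<in> ball x (\<rho> m)") simp_all
    qed
    also have "\<dots> = C * c m" using measure_ball_lebesgue[of "\<rho> m" x] \<rho>(1)[of m] by (simp add: c_def \<omega>_def)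
    finally have "(LINT y|lebesgue. ind (ball x (\<rho> m)) y * F j k y) / c m \<le> C" using c[of m] by (simp add: pos_divide_le_eq)
    then show ?thesis unfolding aeq w_def using True by (simp add: ennreal_leI)
  next
    case False
    have z: "ind (ball x (\<rho> m)) y * F j k y = 0" for y
    proof (cases "y \<in> K")
      case True
      then have "dist x y \<ge> 1" using s[OF True] False norm_triangle_ineq2[of x y] by (simp add: dist_norm)
      then have "y \<notin> ball x (\<rho> m)" using \<rho>(2)[of m] by simp
      then show ?thesis by simp
    qed (simp add: F_def)
    show ?thesis unfolding aeq z by simp
  qed
  define L where "L j m x = limsup (\<lambda>k. a j m k x)" for j m x
  define Q where "Q j x = limsup (\<lambda>m. L j m x)" for j x
  have Lm: "L j m \<in> LM" for j m unfolding L_def using am by (rule borel_measurable_limsup)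
  have Qm: "Q j \<in> LM" for j unfolding Q_def using Lm by (rule borel_measurable_limsup)
  have Lw: "L j m x \<le> w x" for j m x unfolding L_def by (rule Limsup_bounded) (simp add: aw)
  have Qw: "Q j x \<le> w x" for j x unfolding Q_def by (rule Limsup_bounded) (simp add: Lw)
  have X: "limsup (\<lambda>k. \<integral>\<^sup>+y. ennreal (F j k y) \<partial>lebesgue) \<le> (\<integral>\<^sup>+x. Q j x \<partial>lebesgue)" for j
  proof -
    \<comment> \<open>The left-hand side does not depend on m, so the upper limit in m may be taken
      on the right alone.\<close>
    have 1: "limsup (\<lambda>k. \<integral>\<^sup>+y. ennreal (F j k y) \<partial>lebesgue) \<le> (\<integral>\<^sup>+x. L j m x \<partial>lebesgue)" for m
      using nn_integral_limsup[of "a j m" lebesgue w, OF am wm _ wI] aw unfolding aF L_def by simp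
    have "limsup (\<lambda>k. \<integral>\<^sup>+y. ennreal (F j k y) \<partial>lebesgue) = limsup (\<lambda>m::nat. limsup (\<lambda>k. \<integral>\<^sup>+y. ennreal (F j k y) \<partial>lebesgue))"
      by (rule Limsup_const[symmetric]) simp
    also have "\<dots> \<le> limsup (\<lambda>m. \<integral>\<^sup>+x. L j m x \<partial>lebesgue)" by (rule Limsup_mono) (simp add: 1)
    also have "\<dots> \<le> (\<integral>\<^sup>+x. Q j x \<partial>lebesgue)" unfolding Q_def by (rule nn_integral_limsup[OF Lm wm _ wI]) (simp add: Lw)
    finally show ?thesis .
  qed
  have Q0: "AE x in lebesgue. limsup (\<lambda>j. Q j x) = 0"
    using H
  proof eventually_elim
    case (elim x)
    show ?case
    proof (cases "x \<in> D")
      case True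
      have "limsup (\<lambda>j. Q j x) \<le> 0 + ennreal t" if t: "0 < t" for t
      proof -
        have "0 < t * \<omega>" using t \<omega> by simp
        from elim[THEN mp, OF True, THEN spec, THEN mp, OF this]
        have "\<forall>\<^sub>F j in sequentially. Q j x \<le> ennreal t"
        proof eventually_elim
          case (elim j)
          from eventually_compose_filterlim[OF elim \<rho>f]
          have "\<forall>\<^sub>F m in sequentially. L j m x \<le> ennreal t"
          proof eventually_elim
            case (elim m)
            then have "\<forall>\<^sub>F k in sequentially. a j m k x \<le> ennreal t"
            proof eventually_elim
              case (elim k)
              have "(LINT y|lebesgue. ind (ball x (\<rho> m)) y * F j k y) \<le> (LINT y|lebesgue. ind (ball x (\<rho> m)) y * f j k y)"
              proof (rule integral_mono)
                show "integrable lebesgue (\<lambda>y. ind (ball x (\<rho> m)) y * F j k y)"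
                  using integrable_mult_indicator[OF ball_lebesgue Fi[of j k], of x "\<rho> m"] by simp
                show "integrable lebesgue (\<lambda>y. ind (ball x (\<rho> m)) y * f j k y)"
                proof (rule finite_measure_support_integrable[OF _ _ bounded_ball[of x "\<rho> m"]])
                  show "(\<lambda>y. ind (ball x (\<rho> m)) y * f j k y) \<in> LM"
                    using f(1) by (intro borel_measurable_times borel_measurable_indicator ball_lebesgue)
                  show "norm (ind (ball x (\<rho> m)) y * f j k y) \<le> C" for y using f(2,3)[of j k y] C0 by (cases "y \<in> ball x (\<rho> m)") simp_all
                qed simp
                show "ind (ball x (\<rho> m)) y * F j k y \<le> ind (ball x (\<rho> m)) y * f j k y" for y
                  using f(2)[of j k y] unfolding F_def by (cases "y \<in> K") simp_all
              qed
              also have "\<dots> \<le> t * c m" using elim unfolding c_def by (simp add: mult.assoc)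
              finally have "(LINT y|lebesgue. ind (ball x (\<rho> m)) y * F j k y) / c m \<le> t" using c[of m] by (simp add: pos_divide_le_eq)
              then show ?case unfolding aeq by (rule ennreal_leI)
            qed
            then show ?case unfolding L_def by (rule Limsup_bounded)
          qed
          then show ?case unfolding Q_def by (rule Limsup_bounded)
        qed
        then show ?thesis unfolding add_0 by (rule Limsup_bounded)
      qed
      then have "limsup (\<lambda>j. Q j x) \<le> 0" by (rule ennreal_le_epsilon)
      then show ?thesis by simp
    next
      case False
      \<comment> \<open>The hypothesis says nothing off D, but such points have positive distance
        from K, so averages over small balls vanish.\<close>
      then have "x \<in> - K" "open (- K)" using K compact_imp_closed[OF K(1)] by auto
      then obtain d where d: "0 < d" "ball x d \<subseteq> - K" using open_contains_ball by blast
      have "L j m x \<le> 0" if m: "\<rho> m < d" for j m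
      proof -
        have z: "ind (ball x (\<rho> m)) y * F j k y = 0" for k y
          using d(2) m unfolding F_def by (cases "y \<in> K"; cases "y \<in> ball x (\<rho> m)") (auto simp: subset_iff)
        have "a j m k x = 0" for k unfolding aeq z by simp
        then show ?thesis unfolding L_def by (intro Limsup_bounded) simp
      qed
      then have "Q j x \<le> 0" for j unfolding Q_def using order_tendstoD(2)[OF \<rho>0 d(1)] by (intro Limsup_bounded) (auto elim: eventually_mono)
      then have "limsup (\<lambda>j. Q j x) \<le> 0" by (intro Limsup_bounded) simp
      then show ?thesis by simp
    qed
  qed
  have "limsup (\<lambda>j. \<integral>\<^sup>+x. Q j x \<partial>lebesgue) \<le> (\<integral>\<^sup>+x. limsup (\<lambda>j. Q j x) \<partial>lebesgue)"
    by (rule nn_integral_limsup[OF Qm wm _ wI]) (simp add: Qw)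
  also have "\<dots> = nn_integral lebesgue (\<lambda>x::real^'n. 0)" by (rule nn_integral_cong_AE[OF Q0])
  also have "\<dots> < ennreal \<eta>" using e by simp
  finally have "\<forall>\<^sub>F j in sequentially. (\<integral>\<^sup>+x. Q j x \<partial>lebesgue) < ennreal \<eta>" by (rule Limsup_lessD)
  then show ?thesis
  proof eventually_elim
    case (elim j)
    have "\<forall>\<^sub>F k in sequentially. (\<integral>\<^sup>+y. ennreal (F j k y) \<partial>lebesgue) < ennreal \<eta>" by (rule Limsup_lessD[OF le_less_trans[OF X elim]])
    then show ?case
    proof eventually_elim
      case (elim k)
      then show ?case using e unfolding FI F_def[symmetric] by (simp add: ennreal_less_iff integral_nonneg_AE F0)
    qed
  qed
qed

lemma coefficient_change:
  fixes D :: "(real^'n) set"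
  assumes B: "ell \<alpha> \<beta> D B" "ell \<alpha> \<beta> D B'" and g: "L2 g" "L2 h"
  shows "\<bar>aF B g h - aF B' g h\<bar> \<le> nrm2 (\<lambda>x. (B x - B' x) *v g x) * nrm2 h"
proof -
  have "aF B g h - aF B' g h = (LINT x|lebesgue. ((B x - B' x) *v g x) \<bullet> h x)"
    unfolding aF_def matrix_vector_mult_diff_rdistrib inner_diff_left
    by (rule Bochner_Integration.integral_diff[OF L2_inner_integrable[OF ell_L2(1)[OF B(1) g(1)] g(2)] L2_inner_integrable[OF ell_L2(1)[OF B(2) g(1)] g(2)], symmetric])
  then show ?thesis using CS_inner[OF ell_diff_L2(1)[OF B g(1)] g(2)] by simp
qed

lemma finite_ball_cover:
  fixes K D :: "(real^'n) set"
  assumes "compact K" "open D" "K \<subseteq> D"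
  shows "\<exists>X r. finite X \<and> (\<forall>x. 0 < r x) \<and> (\<forall>x\<in>X. ball x (2 * r x) \<subseteq> D) \<and> K \<subseteq> (\<Union>x\<in>X. ball x (r x))"
proof -
  have "\<forall>x. \<exists>r>0. x \<in> K \<longrightarrow> ball x (2 * r) \<subseteq> D"
  proof
    fix x
    show "\<exists>r>0. x \<in> K \<longrightarrow> ball x (2 * r) \<subseteq> D"
    proof (cases "x \<in> K")
      case True
      then obtain d where "0 < d" "ball x d \<subseteq> D" using assms open_contains_ball by blast
      then show ?thesis by (intro exI[of _ "d / 2"]) simp
    qed (intro exI[of _ 1], simp)
  qed
  then obtain r where r: "\<And>x. 0 < r x" "\<And>x. x \<in> K \<Longrightarrow> ball x (2 * r x) \<subseteq> D" by metis
  have "K \<subseteq> (\<Union>x\<in>K. ball x (r x))" using r(1) by force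
  then obtain X where X: "X \<subseteq> K" "finite X" "K \<subseteq> (\<Union>x\<in>X. ball x (r x))"
    using compactE_image[OF assms(1), of K "\<lambda>x. ball x (r x)"] by auto
  show ?thesis by (intro exI[of _ X] exI[of _ r]) (use X r in blast)
qed

text \<open>On the support of a cutoff that is 1 on the support of w, finitely many balls reduce the
  claim to \<open>small_product\<close>. Elsewhere the coefficients are merely bounded, and
  \<open>energy_tail\<close> makes the corrector gradient small.\<close>

lemma corrector_product_small:
  fixes D :: "(real^'n) set"
  assumes D: "bounded D" "open D" and ab: "0 < \<alpha>" "\<alpha> \<le> \<beta>" and A: "\<And>k. ell \<alpha> \<beta> D (A k)"
    and G: "\<And>j. Gconv \<alpha> \<beta> D (B j) (C j)"
    and L1: "\<And>K \<eta>. compact K \<Longrightarrow> K \<subseteq> D \<Longrightarrow> 0 < \<eta> \<Longrightarrow>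
      \<forall>\<^sub>F j in sequentially. \<forall>\<^sub>F k in sequentially. (LINT y|lebesgue. ind K y * norm (A k y - B j k y)) \<le> \<eta>"
    and w: "Cc_inf D w" and c: "\<And>j. corr D (B j) (C j) w (v j) (g j)" and e: "0 < \<eta>"
  shows "\<forall>\<^sub>F j in sequentially. \<forall>\<^sub>F k in sequentially. (nrm2 (\<lambda>x. (A k x - B j k x) *v g j k x))\<^sup>2 \<le> \<eta>"
proof -
  let ?n = "CARD('n)"
  have b0: "0 < \<beta>" using ab by simp
  have B: "ell \<alpha> \<beta> D (B j k)" and C: "ell \<alpha> \<beta> D (C j)" for j k using G unfolding Gconv_def by blast+
  have L: "L2 (g j k)" for j k by (rule W_L2(2)[OF corrD(1)[OF c]])
  obtain K0 where K0: "compact K0 \<and> K0 \<subseteq> D \<and> (\<forall>x. x \<notin> K0 \<longrightarrow> w x = 0) \<and> (\<forall>x. x \<notin> K0 \<longrightarrow> grad w x = 0)"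
    using Cc_inf_support[OF w] by (elim exE)
  obtain \<psi> where \<psi>: "Cc_inf D \<psi> \<and> (\<forall>x. 0 \<le> \<psi> x \<and> \<psi> x \<le> 1) \<and> (\<forall>x\<in>K0. \<psi> x = 1)"
    using smooth_urysohn[OF K0[THEN conjunct1] D(2) K0[THEN conjunct2, THEN conjunct1]] by (elim exE)
  have \<psi>C: "Cc_inf D \<psi>" using \<psi> by simp
  obtain K1 where K1: "compact K1 \<and> K1 \<subseteq> D \<and> (\<forall>x. x \<notin> K1 \<longrightarrow> \<psi> x = 0) \<and> (\<forall>x. x \<notin> K1 \<longrightarrow> grad \<psi> x = 0)"
    using Cc_inf_support[OF \<psi>C] by (elim exE)
  obtain X r where X: "finite X \<and> (\<forall>x. 0 < r x) \<and> (\<forall>x\<in>X. ball x (2 * r x) \<subseteq> D) \<and> K1 \<subseteq> (\<Union>x\<in>X. ball x (r x))"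
    using finite_ball_cover[OF K1[THEN conjunct1] D(2) K1[THEN conjunct2, THEN conjunct1]] by (elim exE)
  have fX: "finite X" and r: "0 < r x" for x using X by simp_all
  define K where "K = (\<Union>x\<in>X. cball x (r x))"
  have Kc: "compact K" unfolding K_def using fX by (intro compact_UN) simp_all
  have KD: "K \<subseteq> D"
  proof -
    have "cball x (r x) \<subseteq> D" if "x \<in> X" for x
    proof -
      have "cball x (r x) \<subseteq> ball x (2 * r x)" using r[of x] by (auto simp: subset_iff)
      then show ?thesis using X that by blast
    qed
    then show ?thesis unfolding K_def by blast
  qed
  define P where "P = \<beta> / \<alpha> * nrm2 (grad w)"
  have gP: "(nrm2 (g j k))\<^sup>2 \<le> P\<^sup>2" for j k
    unfolding P_def by (intro power_mono corr_bound[OF D(2) ab(1) B C w c]) simp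
  obtain Cw where Cw: "Cw \<ge> 0 \<and> (\<forall>x. \<bar>w x\<bar> \<le> Cw \<and> norm (grad w x) \<le> Cw)" using Cc_inf_bounded[OF w] by (elim exE)
  define M where "M = \<beta> * Cw"
  define S where "S = (\<Sum>x\<in>X. P\<^sup>2 + M\<^sup>2 * r x ^ ?n)"
  have S: "0 \<le> S" unfolding S_def using r by (intro sum_nonneg) (simp add: less_imp_le)
  \<comment> \<open>The ball estimates add up to at most \<epsilon> S, half of the allowed error;
    the other half goes to the tail.\<close>
  define \<epsilon> where "\<epsilon> = \<eta> / (2 * (S + 1))"
  have \<epsilon>: "0 < \<epsilon>" unfolding \<epsilon>_def using e S by simp
  have \<epsilon>S: "\<epsilon> * S \<le> \<eta> / 2"
  proof -
    have "\<epsilon> * S \<le> \<epsilon> * (S + 1)" using \<epsilon> by simp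
    also have "\<dots> = \<eta> / 2" unfolding \<epsilon>_def using S by (simp add: divide_simps)
    finally show ?thesis .
  qed
  obtain \<delta> where \<delta>: "0 < \<delta> \<and> (\<forall>D B B' v (g::real^'n \<Rightarrow> real^'n) x0 R M. local_sol \<alpha> \<beta> D B v g x0 (2 * R) M \<longrightarrow> ell \<alpha> \<beta> D B' \<longrightarrow>
     (LINT y|lebesgue. ind (ball x0 R) y * norm (B' y - B y)) \<le> \<delta> * R ^ CARD('n) \<longrightarrow>
     (nrm2 (res (ball x0 R) (\<lambda>x. (B' x - B x) *v g x)))\<^sup>2 \<le> \<epsilon> * ((nrm2 g)\<^sup>2 + M\<^sup>2 * R ^ CARD('n)))"
    using small_product[OF ab \<epsilon>, where 'n='n] by (elim exE)
  \<comment> \<open>L1 smallness on the union of the balls has to serve every ball of the cover; the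
    inserted 1 handles an empty cover.\<close>
  define \<eta>1 where "\<eta>1 = Min (insert 1 ((\<lambda>x. \<delta> * r x ^ ?n) ` X))"
  have \<eta>1: "0 < \<eta>1" "\<And>x. x \<in> X \<Longrightarrow> \<eta>1 \<le> \<delta> * r x ^ ?n"
    unfolding \<eta>1_def using fX \<delta> r by simp_all
  from L1[OF Kc KD \<eta>1(1)] show ?thesis
  proof eventually_elim
    case (elim j)
    have t: "(\<lambda>k. LINT x|lebesgue. (1 - \<psi> x) * (norm (g j k x))\<^sup>2) \<longlonglongrightarrow> 0"
      by (rule energy_tail[OF D ab(1) G w c \<psi>C]) (use \<psi> K0 in blast)+
    have "0 < \<eta> / (8 * \<beta>\<^sup>2)" using e b0 by simp
    from elim order_tendstoD(2)[OF t this] show ?case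
    proof eventually_elim
      case k: (elim k)
      let ?h = "\<lambda>x. (A k x - B j k x) *v g j k x"
      have Lh: "L2 ?h" by (rule ell_diff_L2(1)[OF A B L])
      have loc: "(nrm2 (\<lambda>y. ind (ball x (r x)) y *\<^sub>R ?h y))\<^sup>2 \<le> \<epsilon> * (P\<^sup>2 + M\<^sup>2 * r x ^ ?n)" if x: "x \<in> X" for x
      proof -
        have sub: "ball x (2 * r x) \<subseteq> D" using X x by blast
        have sm: "(LINT y|lebesgue. ind (ball x (r x)) y * norm (A k y - B j k y)) \<le> \<delta> * r x ^ ?n"
        proof -
          have "ball x (r x) \<subseteq> K" unfolding K_def using x ball_subset_cball by blast
          then have "(LINT y|lebesgue. ind (ball x (r x)) y * norm (A k y - B j k y)) \<le> (LINT y|lebesgue. ind K y * norm (A k y - B j k y))"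
            using compact_imp_bounded[OF Kc] Kc
            by (intro integral_mono ell_diff_integrable[OF A B] ball_lebesgue bounded_ball borel_sets_lebesgue borel_compact mult_right_mono)
              (auto simp: indicator_def)
          then show ?thesis using k(1) \<eta>1(2)[OF x] by linarith
        qed
        have "(nrm2 (\<lambda>y. ind (ball x (r x)) y *\<^sub>R ?h y))\<^sup>2 \<le> \<epsilon> * ((nrm2 (g j k))\<^sup>2 + M\<^sup>2 * r x ^ ?n)"
          by (rule \<delta>[THEN conjunct2, rule_format, OF _ A sm], unfold M_def, rule corr_local_sol[OF D(2) less_imp_le[OF b0] G w c _ sub])
            (use r Cw in simp_all)
        also have "\<dots> \<le> \<epsilon> * (P\<^sup>2 + M\<^sup>2 * r x ^ ?n)" using gP \<epsilon> by (intro mult_left_mono add_right_mono) simp_all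
        finally show ?thesis .
      qed
      have i1: "integrable lebesgue (\<lambda>y. (1 - \<psi> y) * (norm (g j k y))\<^sup>2)"
      proof (rule Bochner_Integration.integrable_bound[OF L2_int[OF L]])
        show "(\<lambda>y. (1 - \<psi> y) * (norm (g j k y))\<^sup>2) \<in> LM"
          using smooth_lebesgue(1)[OF Cc_infD(1)[OF \<psi>C]] L2_meas[OF L, of j k] by simp
        show "AE y in lebesgue. norm ((1 - \<psi> y) * (norm (g j k y))\<^sup>2) \<le> norm ((norm (g j k y))\<^sup>2)"
          using \<psi> mult_right_mono[of "1 - \<psi> _" 1 "(norm _)\<^sup>2"] by (intro AE_I2) (simp add: abs_mult)
      qed
      have i2: "integrable lebesgue (\<lambda>y. ind (ball x (r x)) y * (norm (?h y))\<^sup>2)" for x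
        using integrable_mult_indicator[OF ball_lebesgue L2_int[OF Lh], of x "r x"] by simp
      have "(nrm2 ?h)\<^sup>2 \<le> (LINT y|lebesgue. 4 * \<beta>\<^sup>2 * ((1 - \<psi> y) * (norm (g j k y))\<^sup>2) + (\<Sum>x\<in>X. ind (ball x (r x)) y * (norm (?h y))\<^sup>2))"
        unfolding nrm2_sq
      proof (rule integral_mono[OF L2_int[OF Lh]])
        show "integrable lebesgue (\<lambda>y. 4 * \<beta>\<^sup>2 * ((1 - \<psi> y) * (norm (g j k y))\<^sup>2) + (\<Sum>x\<in>X. ind (ball x (r x)) y * (norm (?h y))\<^sup>2))"
          by (intro Bochner_Integration.integrable_add integrable_mult_right Bochner_Integration.integrable_sum i1 i2)
        fix y
        have s0: "0 \<le> (\<Sum>x\<in>X. ind (ball x (r x)) y * (norm (?h y))\<^sup>2)" by (intro sum_nonneg) simp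
        have p0: "0 \<le> 4 * \<beta>\<^sup>2 * ((1 - \<psi> y) * (norm (g j k y))\<^sup>2)" using \<psi> by simp
        show "(norm (?h y))\<^sup>2 \<le> 4 * \<beta>\<^sup>2 * ((1 - \<psi> y) * (norm (g j k y))\<^sup>2) + (\<Sum>x\<in>X. ind (ball x (r x)) y * (norm (?h y))\<^sup>2)"
        proof (cases "y \<in> K1")
          case True
          then obtain x where x: "x \<in> X" "y \<in> ball x (r x)" using X by blast
          have "ind (ball x (r x)) y * (norm (?h y))\<^sup>2 \<le> (\<Sum>x\<in>X. ind (ball x (r x)) y * (norm (?h y))\<^sup>2)"
            by (rule member_le_sum[OF x(1) _ fX]) simp
          moreover have "ind (ball x (r x)) y = (1::real)" using x(2) by simp
          ultimately have "(norm (?h y))\<^sup>2 \<le> (\<Sum>x\<in>X. ind (ball x (r x)) y * (norm (?h y))\<^sup>2)" by (simp only: mult_1)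
          then show ?thesis using p0 by linarith
        next
          case False
          \<comment> \<open>Outside the support of \<psi> the weight 1 - \<psi> is 1, so the tail
            term alone dominates.\<close>
          then have "\<psi> y = 0" using K1 by blast
          moreover have "(norm (?h y))\<^sup>2 \<le> (2 * \<beta> * norm (g j k y))\<^sup>2" by (intro power_mono ell_diff_bounds(1)[OF A B]) simp
          ultimately show ?thesis using s0 by (simp add: power_mult_distrib)
        qed
      qed
      also have "\<dots> = 4 * \<beta>\<^sup>2 * (LINT y|lebesgue. (1 - \<psi> y) * (norm (g j k y))\<^sup>2) + (\<Sum>x\<in>X. (nrm2 (\<lambda>y. ind (ball x (r x)) y *\<^sub>R ?h y))\<^sup>2)"
        unfolding nrm2_restrict_sq using i1 i2 by (simp add: Bochner_Integration.integral_add Bochner_Integration.integral_sum)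
      also have "\<dots> \<le> 4 * \<beta>\<^sup>2 * (\<eta> / (8 * \<beta>\<^sup>2)) + (\<Sum>x\<in>X. \<epsilon> * (P\<^sup>2 + M\<^sup>2 * r x ^ ?n))"
        using k(2) by (intro add_mono mult_left_mono sum_mono loc) simp_all
      also have "\<dots> = \<eta> / 2 + \<epsilon> * S" unfolding S_def using b0 by (simp add: sum_distrib_left)
      finally show ?case using \<epsilon>S by linarith
    qed
  qed
qed

lemma pointwise_coefficient_limit:
  fixes D :: "(real^'n) set"
  assumes C: "\<And>j. ell \<alpha> \<beta> D (C j)" and C0: "ell \<alpha> \<beta> D C0"
    and conv: "AE x in lebesgue. x \<in> D \<longrightarrow> (\<lambda>j. C j x) \<longlonglongrightarrow> C0 x" and f: "L2 f" "\<And>x. x \<notin> D \<Longrightarrow> f x = 0"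
  shows "(\<lambda>j. nrm2 (\<lambda>x. (C0 x - C j x) *v f x)) \<longlonglongrightarrow> 0"
proof -
  have "(\<lambda>j. LINT x|lebesgue. (norm ((C0 x - C j x) *v f x))\<^sup>2) \<longlonglongrightarrow> (LINT x::real^'n|lebesgue. (0::real))"
  proof (rule integral_dominated_convergence)
    show "integrable lebesgue (\<lambda>x. (2 * \<beta>)\<^sup>2 * (norm (f x))\<^sup>2)" using L2_int[OF f(1)] by simp
    show "(\<lambda>x. (norm ((C0 x - C j x) *v f x))\<^sup>2) \<in> LM" for j
      using L2_meas[OF ell_diff_L2(1)[OF C0 C f(1)], of j] by simp
    show "AE x in lebesgue. norm ((norm ((C0 x - C j x) *v f x))\<^sup>2) \<le> (2 * \<beta>)\<^sup>2 * (norm (f x))\<^sup>2" for j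
    proof (rule AE_I2)
      fix x
      have "(norm ((C0 x - C j x) *v f x))\<^sup>2 \<le> (2 * \<beta> * norm (f x))\<^sup>2" by (intro power_mono ell_diff_bounds(1)[OF C0 C]) simp
      then show "norm ((norm ((C0 x - C j x) *v f x))\<^sup>2) \<le> (2 * \<beta>)\<^sup>2 * (norm (f x))\<^sup>2" by (simp add: power_mult_distrib)
    qed
    show "AE x in lebesgue. (\<lambda>j. (norm ((C0 x - C j x) *v f x))\<^sup>2) \<longlonglongrightarrow> 0"
      using conv
    proof eventually_elim
      case (elim x)
      show ?case
      proof (cases "x \<in> D")
        case True
        then have c: "(\<lambda>j. C0 x - C j x) \<longlonglongrightarrow> C0 x - C0 x" using elim by (intro tendsto_diff tendsto_const) (rule mp)
        have "(\<lambda>j. norm (C0 x - C j x) * norm (f x)) \<longlonglongrightarrow> 0" using tendsto_mult_right[OF tendsto_norm[OF c], of "norm (f x)"] by simp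
        then have "(\<lambda>j. norm ((C0 x - C j x) *v f x)) \<longlonglongrightarrow> 0"
          by (rule tendsto_0_le) (rule norm_ge_zero, rule norm_matrix_vector_le)
        then show ?thesis using tendsto_power[of _ 0 sequentially 2] by simp
      next
        case False
        then show ?thesis using f(2) by simp
      qed
    qed
  qed simp
  then have "(\<lambda>j. sqrt (LINT x|lebesgue. (norm ((C0 x - C j x) *v f x))\<^sup>2)) \<longlonglongrightarrow> sqrt 0" by (intro tendsto_real_sqrt) simp
  then show ?thesis unfolding nrm2_def by simp
qed

lemma Hminus1_W_bound:
  assumes F: "F \<in> Hminus1 D" and D: "bounded D" "open D"
  shows "\<exists>C\<ge>0. \<forall>v h. W D v h \<longrightarrow> \<bar>F v\<bar> \<le> C * nrm2 h"
proof -
  obtain C where C: "0 \<le> C \<and> (\<forall>v g. H10_grad D v g \<longrightarrow> \<bar>F v\<bar> \<le> C * nrm2 (res D g))"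
    using Hminus1_bound[OF F D] by (elim exE)
  have "\<bar>F v\<bar> \<le> C * nrm2 h" if w: "W D v h" for v h
  proof -
    have "\<bar>F v\<bar> \<le> C * nrm2 (res D h)" using C W_H10_grad[OF w D(2)] by blast
    also have "\<dots> \<le> C * nrm2 h"
      using C nrm2_restrict_le(2)[OF W_L2(2)[OF w] borel_sets_lebesgue[OF borel_open[OF D(2)]]] by (intro mult_left_mono) simp_all
    finally show ?thesis .
  qed
  then show ?thesis using C by blast
qed

lemma W_H10: "W D v h \<Longrightarrow> open D \<Longrightarrow> v \<in> H10 D"
  unfolding H10_def using W_H10_grad by blast

lemma Hminus1_W_diff:
  assumes F: "F \<in> Hminus1 D" and D: "open D" and w: "W D v h" "W D v' h'"
  shows "F (\<lambda>x. v x - v' x) = F v - F v'"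
  using Hminus1_lin[OF F W_H10[OF w(1) D] W_H10[OF w(2) D], of 1 "-1"] by simp

text \<open>For a test function \<phi>, replace C0 by \<open>C j\<close>, use the corrector equation
  to pass to \<open>B j k\<close>, and replace \<open>B j k\<close> by \<open>A k\<close>. By
  symmetry the result is the equation for \<open>u k\<close> tested with the corrector, that is F at
  the corrector, which tends to \<open>F \<phi>\<close>. The weak limit of the gradients
  \<open>g k\<close> need not be known beforehand.\<close>

lemma solutions_converge:
  fixes D :: "(real^'n) set"
  assumes D: "bounded D" "open D" and ab: "0 < \<alpha>" "\<alpha> \<le> \<beta>" and A: "\<And>k. ell \<alpha> \<beta> D (A k)"
    and G: "\<And>j. Gconv \<alpha> \<beta> D (B j) (C j)" and C0: "ell \<alpha> \<beta> D C0"
    and conv: "AE x in lebesgue. x \<in> D \<longrightarrow> (\<lambda>j. C j x) \<longlonglongrightarrow> C0 x"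
    and L1: "\<And>K \<eta>. compact K \<Longrightarrow> K \<subseteq> D \<Longrightarrow> 0 < \<eta> \<Longrightarrow>
      \<forall>\<^sub>F j in sequentially. \<forall>\<^sub>F k in sequentially. (LINT y|lebesgue. ind K y * norm (A k y - B j k y)) \<le> \<eta>"
    and F: "F \<in> Hminus1 D" and u: "\<And>k. W D (u k) (g k)" "\<And>k v h. W D v h \<Longrightarrow> aF (A k) (g k) h = F v"
    and u0: "W D u0 g0" "\<And>v h. W D v h \<Longrightarrow> aF C0 g0 h = F v" and \<Phi>: "\<Phi> \<in> Hminus1 D"
  shows "(\<lambda>k. \<Phi> (u k)) \<longlonglongrightarrow> \<Phi> u0"
proof -
  have b0: "0 < \<beta>" using ab by simp
  have B: "ell \<alpha> \<beta> D (B j k)" and C: "ell \<alpha> \<beta> D (C j)" for j k using G unfolding Gconv_def by blast+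
  obtain c where c: "0 \<le> c \<and> (\<forall>v h. W D v h \<longrightarrow> \<bar>F v\<bar> \<le> c * nrm2 h)" using Hminus1_W_bound[OF F D] by (elim exE)
  have Lg: "L2 (g k)" for k by (rule W_L2(2)[OF u(1)])
  define P where "P = c / \<alpha>"
  have P0: "0 \<le> P" unfolding P_def using c ab by simp
  have P: "nrm2 (g k) \<le> P" for k
  proof (cases "nrm2 (g k) = 0")
    case False
    then have p: "0 < nrm2 (g k)" using nrm2_nonneg[of "g k"] by linarith
    have "\<alpha> * (nrm2 (g k))\<^sup>2 \<le> aF (A k) (g k) (g k)" by (rule aF_coercive[OF A u(1) D(2)])
    also have "\<dots> = F (u k)" by (rule u(2)[OF u(1)])
    also have "\<dots> \<le> c * nrm2 (g k)" using c u(1)[of k] abs_le_D1 by blast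
    finally have "(\<alpha> * nrm2 (g k)) * nrm2 (g k) \<le> c * nrm2 (g k)" by (simp add: power2_eq_square mult.assoc)
    then have "\<alpha> * nrm2 (g k) \<le> c" using p by (simp only: mult_le_cancel_right_pos)
    then show ?thesis unfolding P_def using ab by (simp add: pos_le_divide_eq mult.commute)
  qed (use P0 in simp)
  have smooth: "(\<lambda>k. aF C0 (grad \<phi>) (g k)) \<longlonglongrightarrow> F \<phi>" if \<phi>: "Cc_inf D \<phi>" for \<phi>
  proof (rule LIMSEQ_I)
    fix r :: real assume r: "0 < r"
    note LG = Cc_inf_L2(2)[OF \<phi>]
    have "\<exists>v \<gamma>. corr D (B j) (C j) \<phi> v \<gamma>" for j by (rule Gconv_corr[OF D ab(1) G \<phi>])
    then obtain v \<gamma> where cor: "\<And>j. corr D (B j) (C j) \<phi> (v j) (\<gamma> j)" by metis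
    \<comment> \<open>Two coefficient errors are each at most q P, hence at most r / 3; the
      convergence of F along the correctors takes the last third.\<close>
    define q where "q = r / (3 * (P + 1))"
    have q: "0 < q" unfolding q_def using r P0 by simp
    have qP: "q * P \<le> r / 3"
    proof -
      have "q * P \<le> q * (P + 1)" using q by simp
      also have "\<dots> = r / 3" unfolding q_def using P0 by (simp add: divide_simps)
      finally show ?thesis .
    qed
    have q2: "0 < q\<^sup>2" using q by simp
    have "(\<lambda>j. nrm2 (\<lambda>x. (C0 x - C j x) *v grad \<phi> x)) \<longlonglongrightarrow> 0"
      by (rule pointwise_coefficient_limit[OF C C0 conv LG]) (use Cc_inf_zero_off[OF \<phi>] in simp)
    \<comment> \<open>First one j is fixed for which both coefficient errors are small; only then
      does k grow, with a threshold depending on this j.\<close>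
    from eventually_conj[OF corrector_product_small[OF D ab A G L1 \<phi> cor q2] order_tendstoD(2)[OF this q]]
    obtain j where ev: "\<forall>\<^sub>F k in sequentially. (nrm2 (\<lambda>x. (A k x - B j k x) *v \<gamma> j k x))\<^sup>2 \<le> q\<^sup>2"
      and jq: "nrm2 (\<lambda>x. (C0 x - C j x) *v grad \<phi> x) < q" using eventually_happens[of _ sequentially] by auto
    obtain N where N: "\<And>k. N \<le> k \<Longrightarrow> (nrm2 (\<lambda>x. (A k x - B j k x) *v \<gamma> j k x))\<^sup>2 \<le> q\<^sup>2" using ev unfolding eventually_sequentially by blast
    have r3: "0 < r / 3" using r by simp
    obtain N' where N': "\<And>k. N' \<le> k \<Longrightarrow> norm (F (v j k) - F \<phi>) < r / 3"
      using LIMSEQ_D[OF corrD(5)[OF cor F, of j] r3] by blast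
    have "norm (aF C0 (grad \<phi>) (g k) - F \<phi>) < r" if k: "max N N' \<le> k" for k
    proof -
      have L\<gamma>: "L2 (\<gamma> j k)" by (rule W_L2(2)[OF corrD(1)[OF cor]])
      have "nrm2 (\<lambda>x. (A k x - B j k x) *v \<gamma> j k x) \<le> q" by (rule power2_le_imp_le[OF N]) (use k q in simp_all)
      then have "nrm2 (\<lambda>x. (A k x - B j k x) *v \<gamma> j k x) * nrm2 (g k) \<le> q * P" using P q by (intro mult_mono) simp_all
      then have 1: "\<bar>aF (A k) (\<gamma> j k) (g k) - aF (B j k) (\<gamma> j k) (g k)\<bar> \<le> q * P"
        using coefficient_change[OF A[of k] B[of j k] L\<gamma> Lg[of k]] by linarith
      have "nrm2 (\<lambda>x. (C0 x - C j x) *v grad \<phi> x) * nrm2 (g k) \<le> q * P" using P q jq by (intro mult_mono) simp_all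
      then have 2: "\<bar>aF C0 (grad \<phi>) (g k) - aF (C j) (grad \<phi>) (g k)\<bar> \<le> q * P"
        using coefficient_change[OF C0 C[of j] LG Lg[of k]] by linarith
      have 3: "aF (C j) (grad \<phi>) (g k) = aF (B j k) (\<gamma> j k) (g k)" by (rule corrD(2)[OF cor u(1), symmetric])
      have 4: "F (v j k) = aF (A k) (\<gamma> j k) (g k)"
        using u(2)[OF corrD(1)[OF cor], of k j k] aF_sym[OF A, of k "g k" "\<gamma> j k"] by simp
      have 5: "\<bar>F (v j k) - F \<phi>\<bar> < r / 3" using N'[of k] k by simp
      show ?thesis using 1 2 5 qP unfolding 3 4[symmetric] real_norm_def abs_le_iff abs_less_iff by linarith
    qed
    then show "\<exists>no. \<forall>k\<ge>no. norm (aF C0 (grad \<phi>) (g k) - F \<phi>) < r" by blast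
  qed
  obtain c' where c': "0 \<le> c' \<and> (\<forall>v h. W D v h \<longrightarrow> \<bar>\<Phi> v\<bar> \<le> c' * nrm2 h)" using Hminus1_W_bound[OF \<Phi> D] by (elim exE)
  \<comment> \<open>The dual problem: z represents \<Phi>, so \<open>\<Phi> (u k)\<close> is
    \<open>aF C0 z (g k)\<close> and \<open>\<Phi> u0\<close> is \<open>F v\<close>. Approximating z
    by gradients of test functions reduces the claim to \<open>smooth\<close>.\<close>
  have "\<exists>v z. W D v z \<and> (\<forall>y h. W D y h \<longrightarrow> aF C0 z h = \<Phi> y)"
    by (rule lax_milgram[where F="\<lambda>v g. \<Phi> v", OF D C0 ab(1)]) (use c' Hminus1_lin[OF \<Phi> W_H10 W_H10] D in blast)+
  then obtain v z where v: "W D v z \<and> (\<forall>y h. W D y h \<longrightarrow> aF C0 z h = \<Phi> y)" by (elim exE)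
  have vW: "W D v z" and vz: "\<And>y h. W D y h \<Longrightarrow> aF C0 z h = \<Phi> y" using v by blast+
  have lim: "\<Phi> u0 = F v" using vz[OF u0(1)] u0(2)[OF vW] aF_sym[OF C0, of z g0] by simp
  show ?thesis
  proof (rule LIMSEQ_I)
    fix r :: real assume r: "0 < r"
    \<comment> \<open>The approximation error enters once through the form, with factor \<beta> P,
      and once through F, with factor c.\<close>
    define e where "e = r / (3 * (\<beta> * P + c + 1))"
    have d0: "0 < \<beta> * P + c + 1" using b0 P0 c by (intro add_nonneg_pos add_nonneg_nonneg) simp_all
    have e: "0 < e" unfolding e_def using r d0 by simp
    have ed: "e * (\<beta> * P + c + 1) = r / 3" unfolding e_def using d0 by (simp add: divide_simps)
    obtain \<phi> where \<phi>: "Cc_inf D \<phi> \<and> nrm2 (\<lambda>x. \<phi> x - v x) < e \<and> nrm2 (\<lambda>x. grad \<phi> x - z x) < e" using W_approx[OF vW e] by (elim exE)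
    have \<phi>C: "Cc_inf D \<phi>" using \<phi> by simp
    have r3: "0 < r / 3" using r by simp
    obtain N where N: "\<And>k. N \<le> k \<Longrightarrow> norm (aF C0 (grad \<phi>) (g k) - F \<phi>) < r / 3" using LIMSEQ_D[OF smooth[OF \<phi>C] r3] by blast
    have "\<bar>F \<phi> - F v\<bar> \<le> c * nrm2 (\<lambda>x. grad \<phi> x - z x)"
      using c[THEN conjunct2, rule_format, OF W_diff[OF W_Cc[OF \<phi>C] vW]] unfolding Hminus1_W_diff[OF F D(2) W_Cc[OF \<phi>C] vW] .
    also have "\<dots> \<le> c * e" using c \<phi> by (intro mult_left_mono) simp_all
    finally have 1: "\<bar>F \<phi> - F v\<bar> \<le> c * e" .
    have "norm (\<Phi> (u k) - \<Phi> u0) < r" if k: "N \<le> k" for k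
    proof -
      have "\<bar>aF C0 (grad \<phi>) (g k) - aF C0 z (g k)\<bar> = \<bar>aF C0 (\<lambda>x. grad \<phi> x - z x) (g k)\<bar>"
        using aF_diff[OF C0 Cc_inf_L2(2)[OF \<phi>C] W_L2(2)[OF vW] Lg, of k] by simp
      also have "\<dots> \<le> \<beta> * nrm2 (\<lambda>x. grad \<phi> x - z x) * nrm2 (g k)"
        by (rule aF_bound[OF C0 L2_diff[OF Cc_inf_L2(2)[OF \<phi>C] W_L2(2)[OF vW]] Lg])
      also have "\<dots> \<le> \<beta> * e * P" using P[of k] P0 \<phi> b0 e by (intro mult_mono mult_left_mono) simp_all
      finally have 2: "\<bar>aF C0 (grad \<phi>) (g k) - aF C0 z (g k)\<bar> \<le> \<beta> * e * P" .
      have 3: "aF C0 z (g k) = \<Phi> (u k)" by (rule vz[OF u(1)])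
      have 4: "\<bar>aF C0 (grad \<phi>) (g k) - F \<phi>\<bar> < r / 3" using N[OF k] by simp
      have 5: "\<beta> * e * P + c * e < r"
      proof -
        have "e * (\<beta> * P + c + 1) = \<beta> * e * P + c * e + e" by (simp add: distrib_left mult_ac)
        then show ?thesis using ed e r by linarith
      qed
      have 6: "\<beta> * e * P + c * e \<le> r / 3"
      proof -
        have "e * (\<beta> * P + c + 1) = \<beta> * e * P + c * e + e" by (simp add: distrib_left mult_ac)
        then show ?thesis using ed e by linarith
      qed
      show ?thesis using 1 2 4 6 r unfolding lim 3 real_norm_def abs_le_iff abs_less_iff by linarith
    qed
    then show "\<exists>no. \<forall>k\<ge>no. norm (\<Phi> (u k) - \<Phi> u0) < r" by blast
  qed
qed

section \<open>The Cauchy property of the limits and the proof of the theorem\<close>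

lemma l1_close_trans:
  fixes D :: "(real^'n) set"
  assumes ell: "\<And>k. ell \<alpha> \<beta> D (A k)" "\<And>k. ell \<alpha> \<beta> D (B k)" "\<And>k. ell \<alpha> \<beta> D (B' k)"
    and c: "l1_close A B (\<delta> / 2) x r" "l1_close A B' (\<delta> / 2) x r"
  shows "l1_close B B' \<delta> x r"
  using c unfolding l1_close_def
proof eventually_elim
  case (elim k)
  note i = ell_diff_integrable[OF ell(2,3) ball_lebesgue bounded_ball] ell_diff_integrable[OF ell(1,2) ball_lebesgue bounded_ball] ell_diff_integrable[OF ell(1,3) ball_lebesgue bounded_ball]
  have "(LINT y|lebesgue. ind (ball x r) y * norm (B k y - B' k y))
    \<le> (LINT y|lebesgue. ind (ball x r) y * norm (A k y - B k y) + ind (ball x r) y * norm (A k y - B' k y))"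
  proof (rule integral_mono)
    fix y
    have "norm (B k y - B' k y) \<le> norm (A k y - B k y) + norm (A k y - B' k y)"
      using norm_triangle_ineq4[of "A k y - B' k y" "A k y - B k y"] by (simp add: add.commute)
    then show "ind (ball x r) y * norm (B k y - B' k y) \<le> ind (ball x r) y * norm (A k y - B k y) + ind (ball x r) y * norm (A k y - B' k y)"
      by (cases "y \<in> ball x r") simp_all
  qed (intro Bochner_Integration.integrable_add i)+
  also have "\<dots> = (LINT y|lebesgue. ind (ball x r) y * norm (A k y - B k y)) + (LINT y|lebesgue. ind (ball x r) y * norm (A k y - B' k y))"
    by (intro Bochner_Integration.integral_add i)
  also have "\<dots> \<le> \<delta> / 2 * r ^ CARD('n) + \<delta> / 2 * r ^ CARD('n)" using elim by (intro add_mono)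
  finally show ?case by (simp add: mult.assoc)
qed

text \<open>For large i and j both sequences are close to \<open>A\<close> on small balls, hence to
  each other, and \<open>limit_difference_pointwise\<close> bounds the entries of the difference of
  the limits.\<close>

lemma limits_Cauchy:
  fixes D :: "(real^'n) set"
  assumes D: "bounded D" "open D" and ab: "0 < \<alpha>" "\<alpha> \<le> \<beta>" and A: "\<And>k. ell \<alpha> \<beta> D (A k)"
    and G: "\<And>j. Gconv \<alpha> \<beta> D (B j) (C j)"
    and H: "AE x in lebesgue. x \<in> D \<longrightarrow> (\<forall>\<delta>>0. \<forall>\<^sub>F j in sequentially. \<forall>\<^sub>F r in at_right 0. l1_close A (B j) \<delta> x r)"
  shows "AE x in lebesgue. x \<in> D \<longrightarrow> Cauchy (\<lambda>j. C j x)"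
proof -
  let ?n = "real CARD('n)"
  have B: "ell \<alpha> \<beta> D (B j k)" for j k using G unfolding Gconv_def by blast
  let ?P = "\<lambda>m \<delta>. 0 < \<delta> \<and> (\<forall>B B0 B' B0' a b. Gconv \<alpha> \<beta> D B B0 \<longrightarrow> Gconv \<alpha> \<beta> D B' B0' \<longrightarrow> norm a = 1 \<longrightarrow> norm b = 1 \<longrightarrow>
     (AE x in lebesgue. x \<in> D \<longrightarrow> (\<forall>\<^sub>F r in at_right 0. l1_close B' B \<delta> x r) \<longrightarrow> ((B0' x - B0 x) *v a) \<bullet> b \<le> 1 / real (Suc m)))"
  have "\<forall>m. \<exists>\<delta>. ?P m \<delta>" by (rule allI, rule limit_difference_pointwise[OF D ab]) simp
  from choice[OF this] obtain \<delta> where \<delta>: "\<forall>m. ?P m (\<delta> m)" by (elim exE)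
  \<comment> \<open>Accuracy, indices and pairs of basis vectors range over countable sets, so one
    null set covers them all.\<close>
  have all: "AE x in lebesgue. \<forall>m i j p q. x \<in> D \<longrightarrow> (\<forall>\<^sub>F r in at_right 0. l1_close (B i) (B j) (\<delta> m) x r) \<longrightarrow>
      ((C i x - C j x) *v axis p 1) \<bullet> axis q 1 \<le> 1 / real (Suc m)"
    unfolding AE_all_countable by (intro allI \<delta>[THEN spec, THEN conjunct2, THEN spec, THEN spec, THEN spec, THEN spec, THEN spec, THEN spec, THEN mp, THEN mp, THEN mp, THEN mp] G) simp_all
  from all H show ?thesis
  proof eventually_elim
    case (elim x)
    show ?case
    proof
      assume x: "x \<in> D"
      show "Cauchy (\<lambda>j. C j x)"
      proof (rule metric_CauchyI)
        fix e :: real assume e: "0 < e"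
        then have "0 < e / (?n * ?n)" by simp
        then obtain m where m: "1 / real (Suc m) < e / (?n * ?n)" using reals_Archimedean[of "e / (?n * ?n)"] by (auto simp: inverse_eq_divide)
        have "0 < \<delta> m / 2" using \<delta>[THEN spec[of _ m]] by simp
        from elim(2)[THEN mp, OF x, THEN spec, THEN mp, OF this] obtain J
          where J: "\<And>j. J \<le> j \<Longrightarrow> \<forall>\<^sub>F r in at_right 0. l1_close A (B j) (\<delta> m / 2) x r" unfolding eventually_sequentially by blast
        have QQ: "\<forall>\<^sub>F r in at_right 0. l1_close (B i) (B j) (\<delta> m) x r" if "J \<le> i" "J \<le> j" for i j
          using J[OF that(1)] J[OF that(2)] by eventually_elim (rule l1_close_trans[OF A B B])
        have "dist (C i x) (C j x) < e" if ij: "J \<le> i" "J \<le> j" for i j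
        proof -
          \<comment> \<open>A one-sided bound; exchanging i and j turns it into a bound for the
            absolute value.\<close>
          have ent: "(C i x - C j x) $ q $ p \<le> 1 / real (Suc m)" if "J \<le> i" "J \<le> j" for i j p q
            using elim(1)[rule_format, OF x QQ[OF that]] by (simp add: matrix_vector_mult_basis column_def inner_axis)
          have "\<bar>(C i x - C j x) $ q $ p\<bar> \<le> 1 / real (Suc m)" for p q
            using ent[OF ij, of q p] ent[OF ij(2,1), of q p] by (simp add: abs_le_iff)
          then have "norm (C i x - C j x) \<le> ?n * (?n * (1 / real (Suc m)))" by (rule norm_matrix_entries_le)
          also have "\<dots> < ?n * (?n * (e / (?n * ?n)))" using m by (intro mult_strict_left_mono) simp_all
          finally show ?thesis by (simp add: dist_norm)
        qed
        then show "\<exists>M. \<forall>i\<ge>M. \<forall>j\<ge>M. dist (C i x) (C j x) < e" by blast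
      qed
    qed
  qed
qed

text \<open>An upper limit below \<delta> gives an eventual bound, so the iterated limit becomes
  nested eventualities in the same order; positivity of the radius allows multiplying by its
  power.\<close>

lemma iterated_Limsup_small:
  fixes f :: "nat \<Rightarrow> nat \<Rightarrow> real \<Rightarrow> real"
  assumes lim: "(\<lambda>j. Limsup (at_right 0) (\<lambda>\<rho>::real. limsup (\<lambda>k. ereal (1 / \<rho> ^ n * f j k \<rho>)))) \<longlonglongrightarrow> 0" and d: "0 < \<delta>"
  shows "\<forall>\<^sub>F j in sequentially. \<forall>\<^sub>F r in at_right 0. \<forall>\<^sub>F k in sequentially. f j k r \<le> \<delta> * r ^ n"
proof -
  have "(0::ereal) < ereal \<delta>" using d by simp
  from order_tendstoD(2)[OF lim this] show ?thesis
  proof eventually_elim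
    case (elim j)
    from Limsup_lessD[OF elim] eventually_at_right_less[of 0] show ?case
    proof eventually_elim
      case r: (elim r)
      from Limsup_lessD[OF r(1)] show ?case
      proof eventually_elim
        case (elim k)
        then show ?case using r(2) by (simp add: pos_divide_less_eq)
      qed
    qed
  qed
qed

lemma cut_coef_ball_integral:
  fixes D :: "(real^'n) set"
  assumes A: "A \<in> Msym \<alpha> \<beta> D" "B \<in> Msym \<alpha> \<beta> D" and D: "open D" and ab: "0 < \<alpha>" "\<alpha> \<le> \<beta>" and sub: "ball x r \<subseteq> D"
  shows "(LINT y|lebesgue. ind (ball x r) y * norm (cut_coef \<alpha> \<beta> D A y - cut_coef \<alpha> \<beta> D B y))
    = (LINT y:ball x r|lebesgue. norm (A y - B y))"
  unfolding set_int_eq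
proof (rule Bochner_Integration.integral_cong_AE)
  show "(\<lambda>y. ind (ball x r) y * norm (cut_coef \<alpha> \<beta> D A y - cut_coef \<alpha> \<beta> D B y)) \<in> LM"
    by (intro borel_measurable_times borel_measurable_indicator ball_lebesgue ell_diff_bounds(3)[OF cut_coef_ell[OF A(1) D ab] cut_coef_ell[OF A(2) D ab]])
  have "(res D A) \<in> LM" "(res D B) \<in> LM"
    using A unfolding Msym_def set_borel_measurable_def by simp_all
  then have d: "(\<lambda>y. ind D y *\<^sub>R A y - ind D y *\<^sub>R B y) \<in> LM" by (rule borel_measurable_diff)
  have m: "(\<lambda>y. ind (ball x r) y *\<^sub>R norm (ind D y *\<^sub>R A y - ind D y *\<^sub>R B y)) \<in> LM"
    by (intro borel_measurable_scaleR borel_measurable_indicator ball_lebesgue measurable_compose[OF d borel_measurable_norm])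
  have e: "ind (ball x r) y *\<^sub>R norm (ind D y *\<^sub>R A y - ind D y *\<^sub>R B y) = ind (ball x r) y *\<^sub>R norm (A y - B y)" for y
  proof (cases "y \<in> ball x r")
    case True
    then have "y \<in> D" using sub by blast
    then show ?thesis by simp
  qed simp
  show "(\<lambda>y. ind (ball x r) y *\<^sub>R norm (A y - B y)) \<in> LM" using m unfolding e .
  show "AE y in lebesgue. ind (ball x r) y * norm (cut_coef \<alpha> \<beta> D A y - cut_coef \<alpha> \<beta> D B y) = ind (ball x r) y *\<^sub>R norm (A y - B y)"
    using cut_coef_AE[OF A(1)] cut_coef_AE[OF A(2)]
  proof eventually_elim
    case (elim y)
    show ?case
    proof (cases "y \<in> ball x r")
      case True
      then have "y \<in> D" using sub by blast
      then show ?thesis using elim by simp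
    qed simp
  qed
qed

theorem theorem7p3:
  fixes D :: "(real^'n) set" and \<alpha> \<beta> :: real
    and A :: "nat \<Rightarrow> real^'n \<Rightarrow> real^'n^'n"
    and B :: "nat \<Rightarrow> nat \<Rightarrow> real^'n \<Rightarrow> real^'n^'n"
    and Binf :: "nat \<Rightarrow> real^'n \<Rightarrow> real^'n^'n"
  assumes "bounded D" and "open D" and "0 < \<alpha>" and "\<alpha> \<le> \<beta>"
    and "\<And>k. A k \<in> Msym \<alpha> \<beta> D"
    and "\<And>j k. B j k \<in> Msym \<alpha> \<beta> D"
    and "AE x\<in>D in lebesgue.
          (\<lambda>j. Limsup (at_right 0) (\<lambda>\<rho>::real.
              limsup (\<lambda>k. ereal ((1 / \<rho> ^ CARD('n)) *
                 (\<integral>y\<in>ball x \<rho>. norm (A k y - B j k y) \<partial>lebesgue)))))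
           \<longlonglongrightarrow> 0"
    and "\<And>j. G_conv \<alpha> \<beta> D (B j) (Binf j)"
  shows "\<exists>B0. (AE x\<in>D in lebesgue. (\<lambda>j. Binf j x) \<longlonglongrightarrow> B0 x) \<and> G_conv \<alpha> \<beta> D A B0"
proof -
  note D = assms(1,2) and ab = assms(3,4) and Am = assms(5) and Bm = assms(6)
  let ?cut = "cut_coef \<alpha> \<beta> D"
  have Cm: "Binf j \<in> Msym \<alpha> \<beta> D" for j using assms(8)[of j] unfolding G_conv_def by simp
  have A: "ell \<alpha> \<beta> D (?cut (A k))" for k by (rule cut_coef_ell[OF Am D(2) ab])
  have B: "ell \<alpha> \<beta> D (?cut (B j k))" for j k by (rule cut_coef_ell[OF Bm D(2) ab])
  have C: "ell \<alpha> \<beta> D (?cut (Binf j))" for j by (rule cut_coef_ell[OF Cm D(2) ab])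
  have G: "Gconv \<alpha> \<beta> D (\<lambda>k. ?cut (B j k)) (?cut (Binf j))" for j by (rule G_conv_Gconv[OF D ab assms(8)])
  have H: "AE x in lebesgue. x \<in> D \<longrightarrow> (\<forall>\<delta>>0. \<forall>\<^sub>F j in sequentially. \<forall>\<^sub>F r in at_right 0. l1_close (\<lambda>k. ?cut (A k)) (\<lambda>k. ?cut (B j k)) \<delta> x r)"
    using assms(7)
  proof eventually_elim
    case (elim x)
    show ?case
    proof (intro impI allI)
      fix \<delta> :: real assume x: "x \<in> D" and \<delta>: "0 < \<delta>"
      \<comment> \<open>For radii below d the ball lies in D, where the modified coefficients agree
        with the given ones almost everywhere.\<close>
      obtain d where d: "0 < d" "ball x d \<subseteq> D" using D(2) x open_contains_ball by blast
      from iterated_Limsup_small[OF elim[THEN mp, OF x] \<delta>]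
      show "\<forall>\<^sub>F j in sequentially. \<forall>\<^sub>F r in at_right 0. l1_close (\<lambda>k. ?cut (A k)) (\<lambda>k. ?cut (B j k)) \<delta> x r"
      proof eventually_elim
        case (elim j)
        from elim eventually_at_right_real[OF d(1)] show ?case
        proof eventually_elim
          case (elim r)
          have "ball x r \<subseteq> D" using elim(2) d(2) by (auto simp: subset_iff)
          from elim(1) cut_coef_ball_integral[OF Am Bm D(2) ab this] show ?case unfolding l1_close_def by simp
        qed
      qed
    qed
  qed
  have Cau: "AE x in lebesgue. x \<in> D \<longrightarrow> Cauchy (\<lambda>j. ?cut (Binf j) x)" by (rule limits_Cauchy[OF D ab A G H])
  \<comment> \<open>\<open>Msym\<close> demands symmetry at every point of D, not merely almost
    everywhere; limits of the modified coefficients and the default value 0 are both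
    symmetric.\<close>
  define B0 where "B0 x = (if Cauchy (\<lambda>j. ?cut (Binf j) x) then lim (\<lambda>j. ?cut (Binf j) x) else 0)" for x
  have lim: "(\<lambda>j. ?cut (Binf j) x) \<longlonglongrightarrow> B0 x" if "Cauchy (\<lambda>j. ?cut (Binf j) x)" for x
    using that Cauchy_convergent[OF that] unfolding B0_def by (simp add: convergent_LIMSEQ_iff)
  have conv: "AE x in lebesgue. x \<in> D \<longrightarrow> (\<lambda>j. ?cut (Binf j) x) \<longlonglongrightarrow> B0 x"
    using Cau by eventually_elim (use lim in blast)
  have cutC: "AE x in lebesgue. \<forall>j. x \<in> D \<longrightarrow> ?cut (Binf j) x = Binf j x"
    unfolding AE_all_countable using cut_coef_AE[OF Cm] by blast
  have convB: "AE x in lebesgue. x \<in> D \<longrightarrow> (\<lambda>j. Binf j x) \<longlonglongrightarrow> B0 x"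
    using conv cutC by eventually_elim simp
  have B0m: "B0 \<in> Msym \<alpha> \<beta> D"
    unfolding Msym_def
  proof (intro CollectI conjI ballI)
    have m: "?cut (Binf j) \<in> LM" for j by (rule ell_D(1)[OF C])
    have "{x \<in> space lebesgue. Cauchy (\<lambda>j. ?cut (Binf j) x)} \<in> sets lebesgue" by (rule sets_Collect_Cauchy[OF m])
    then have "B0 \<in> LM"
      unfolding B0_def by (intro measurable_If borel_measurable_lim_metric m borel_measurable_const)
    then show "set_borel_measurable lebesgue D B0"
      unfolding set_borel_measurable_def using D(2) by (intro borel_measurable_scaleR borel_measurable_indicator borel_sets_lebesgue borel_open)
    show "transpose (B0 x) = B0 x" for x
    proof (cases "Cauchy (\<lambda>j. ?cut (Binf j) x)")
      case True
      have "B0 x $ p $ q = B0 x $ q $ p" for p q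
      proof (rule LIMSEQ_unique)
        show "(\<lambda>j. ?cut (Binf j) x $ p $ q) \<longlonglongrightarrow> B0 x $ p $ q" by (intro tendsto_vec_nth lim True)
        have "?cut (Binf j) x $ p $ q = ?cut (Binf j) x $ q $ p" for j
          using arg_cong[OF ell_D(2)[OF C[of j], of x], of "\<lambda>M. M $ q $ p"] by (simp add: transpose_def)
        then show "(\<lambda>j. ?cut (Binf j) x $ p $ q) \<longlonglongrightarrow> B0 x $ q $ p" using tendsto_vec_nth[OF tendsto_vec_nth[OF lim[OF True], of q], of p] by simp
      qed
      then show ?thesis by (simp add: transpose_def vec_eq_iff)
    qed (simp add: B0_def transpose_def vec_eq_iff)
    have "AE x in lebesgue. \<forall>j. x \<in> D \<longrightarrow> (\<forall>\<xi>. \<alpha> * (norm \<xi>)\<^sup>2 \<le> (Binf j x *v \<xi>) \<bullet> \<xi> \<and> (Binf j x *v \<xi>) \<bullet> \<xi> \<le> \<beta> * (norm \<xi>)\<^sup>2)"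
      unfolding AE_all_countable using Cm unfolding Msym_def by blast
    then show "AE x\<in>D in lebesgue. \<forall>\<xi>. \<alpha> * (norm \<xi>)\<^sup>2 \<le> (B0 x *v \<xi>) \<bullet> \<xi> \<and> (B0 x *v \<xi>) \<bullet> \<xi> \<le> \<beta> * (norm \<xi>)\<^sup>2"
      using convB
    proof eventually_elim
      case (elim x)
      show ?case
      proof (intro impI allI)
        fix \<xi> assume x: "x \<in> D"
        have "(\<lambda>j. Binf j x *v \<xi>) \<longlonglongrightarrow> B0 x *v \<xi>"
        proof (rule vec_tendstoI)
          fix p
          show "(\<lambda>j. (Binf j x *v \<xi>) $ p) \<longlonglongrightarrow> (B0 x *v \<xi>) $ p"
            unfolding matrix_vector_mul_component
            by (intro tendsto_inner tendsto_const tendsto_vec_nth elim(2)[THEN mp, OF x])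
        qed
        then have l: "(\<lambda>j. (Binf j x *v \<xi>) \<bullet> \<xi>) \<longlonglongrightarrow> (B0 x *v \<xi>) \<bullet> \<xi>" by (intro tendsto_inner tendsto_const)
        show "\<alpha> * (norm \<xi>)\<^sup>2 \<le> (B0 x *v \<xi>) \<bullet> \<xi> \<and> (B0 x *v \<xi>) \<bullet> \<xi> \<le> \<beta> * (norm \<xi>)\<^sup>2"
          using LIMSEQ_le_const[OF l, of "\<alpha> * (norm \<xi>)\<^sup>2"] LIMSEQ_le_const2[OF l, of "\<beta> * (norm \<xi>)\<^sup>2"] elim(1) x by blast
      qed
    qed
  qed
  have C0: "ell \<alpha> \<beta> D (?cut B0)" by (rule cut_coef_ell[OF B0m D(2) ab])
  have conv0: "AE x in lebesgue. x \<in> D \<longrightarrow> (\<lambda>j. ?cut (Binf j) x) \<longlonglongrightarrow> ?cut B0 x"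
    using conv cut_coef_AE[OF B0m] by eventually_elim simp
  have L1: "\<forall>\<^sub>F j in sequentially. \<forall>\<^sub>F k in sequentially. (LINT y|lebesgue. ind K y * norm (?cut (A k) y - ?cut (B j k) y)) \<le> \<eta>"
    if "compact K" "K \<subseteq> D" "0 < \<eta>" for K \<eta>
    by (rule local_to_compact_L1[OF ell_diff_bounds(3)[OF A B] norm_ge_zero ell_diff_bounds(2)[OF A B] that(1,2) H[unfolded l1_close_def] that(3)])
  have "G_conv \<alpha> \<beta> D A B0"
    unfolding G_conv_def
  proof (intro conjI allI ballI impI Am B0m)
    fix F us u assume F: "F \<in> Hminus1 D" and us: "\<forall>k. is_sol D (A k) F (us k)" and u: "is_sol D B0 F u"
    have "\<forall>k. \<exists>g. W D (res D (us k)) g \<and> (\<forall>v h. W D v h \<longrightarrow> aF (?cut (A k)) g h = F v)"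
      by (intro allI W_is_sol[OF D ab Am F] us[THEN spec])
    from choice[OF this] obtain g where g: "\<forall>k. W D (res D (us k)) (g k) \<and> (\<forall>v h. W D v h \<longrightarrow> aF (?cut (A k)) (g k) h = F v)" by (elim exE)
    obtain g0 where g0: "W D (res D u) g0 \<and> (\<forall>v h. W D v h \<longrightarrow> aF (?cut B0) g0 h = F v)"
      using W_is_sol[OF D ab B0m F u] by (elim exE)
    have usH: "us k \<in> H10 D" for k using us unfolding is_sol_def H10_def by blast
    have uH: "u \<in> H10 D" using u unfolding is_sol_def H10_def by blast
    show "weak_conv_H10 D us u"
      unfolding weak_conv_H10_def
    proof (intro conjI allI ballI usH uH)
      fix \<Phi> assume \<Phi>: "\<Phi> \<in> Hminus1 D"
      \<comment> \<open>Membership in \<open>W D\<close> concerns functions that vanish off D, so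
        the solutions are first restricted; functionals do not notice, by
        \<open>Hminus1_cong\<close>.\<close>
      have "(\<lambda>k. \<Phi> (res D (us k))) \<longlonglongrightarrow> \<Phi> (res D u)"
        by (rule solutions_converge[OF D ab A G C0 conv0 L1 F g[THEN spec, THEN conjunct1] _ g0[THEN conjunct1] _ \<Phi>])
          (assumption | use g g0 in blast)+
      moreover have "\<Phi> (us k) = \<Phi> (res D (us k))" for k by (rule Hminus1_cong[OF \<Phi> D usH]) simp
      moreover have "\<Phi> u = \<Phi> (res D u)" by (rule Hminus1_cong[OF \<Phi> D uH]) simp
      ultimately show "(\<lambda>k. \<Phi> (us k)) \<longlonglongrightarrow> \<Phi> u" by simp
    qed
  qed
  with convB show ?thesis by blast
qed

end
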